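(* Let $N\ge1$, $T>0$, $Q_T=\mathbb{R}^N\times(0,T]$, $\bar Q_T=\mathbb{R}^N\times[0,T]$, $\sigma\in(1,2)$. Let $a:\mathbb{R}^N\times\mathbb{R}^N\to\mathbb{R}$ be uniformly continuous, $H\in C(\mathbb{R}^N\times\mathbb{R}^N\times\mathbb{R}^N)$, and $K^\sigma:\mathbb{R}^N\to\mathbb{R}$ nonnegative and measurable. Assume: (1) there is $a_0>0$ with $a_0\le a(x,y)\le a_0^{-1}$ for all $x,y$; the function $\bar k(z):=K^\sigma(z)|z|^{N+\sigma}$ is bounded on $\mathbb{R}^N$, continuous at the origin, and $\bar k(0)=C_{N,\sigma}>0$; (2) $|H(\cdot,\cdot,0)|_\infty<+\infty$, $|a|_\infty<+\infty$, and $a(x,\cdot)$, $H(x,\cdot,p)$ are $\mathbb{Z}^N$-periodic for all $x,p\in\mathbb{R}^N$; (3) there exist $b_0,C_0>0$, $m>1$ such that $\mu H(x,y,\mu^{-1}p)-H(x,y,p)\ge(1-\mu)(b_0|p|^m-C_0)$ for all $\mu\in(0,1)$ and all $x,y,p\in\mathbb{R}^N$; (4) there is a modulus of continuity $\omega$ such that for all $R>0$, all $x,x',y,y'\in\mathbb{R}^N$ and all $p,p'\in\mathbb{R}^N$ with $|p|,|p'|\le R$, $$|H(x,y,p)-H(x',y',p')|\le\omega(|x-x'|+|y-y'|)(1+R^m)+\omega(|p-p'|)(1+R^{m-1}).$$ Let $u_0$ be bounded and uniformly continuous on $\mathbb{R}^N$, and for $\epsilon>0$ let $u^\epsilon$ be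 the unique bounded continuous viscosity solution of $$u^\epsilon_t-a\left(x,\tfrac x\epsilon\right)\mathcal{I}(u^\epsilon,x)+H\left(x,\tfrac x\epsilon,Du^\epsilon\right)=0\ \text{ in }Q_T,\qquad u^\epsilon(x,0)=u_0(x),\ x\in\mathbb{R}^N.$$ Let $$\bar H(x,p,l)=-A(x)\,l+A(x)\int_{\mathbb{T}^N}\frac{H(x,y,p)}{a(x,y)}\,dy,\qquad A(x)=1\Big/\left(\int_{\mathbb{T}^N}\frac{1}{a(x,y)}\,dy\right),$$ which is the constant $c$ for which the cell problem $-a(x,y)l+a(x,y)(-\Delta)^{\sigma/2}\psi(y)+H(x,y,p)=c$, $y\in\mathbb{T}^N$, is solvable. Then, as $\epsilon\to0$, the family $u^\epsilon$ converges locally uniformly in $\bar Q_T$ to the unique viscosity solution $u$ of the effective problem $$u_t+\bar H(x,Du,\mathcal{I}(u,x))=0\ \text{ in }Q_T$$ satisfying $u(x,0)=u_0(x)$, $x\in\mathbb{R}^N$.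
   Context: A modulus of continuity is a nondecreasing function $\omega:[0,\infty)\to[0,\infty)$ with $\omega(t)\to\omega(0)=0$ as $t\to0^+$. $\mathbb{T}^N=\mathbb{R}^N/\mathbb{Z}^N$; functions on $\mathbb{T}^N$ are identified with $\mathbb{Z}^N$-periodic functions. $B_\delta$ is the ball of radius $\delta$ centered at $0$, $B_\delta(x)$ the ball centered at $x$, $B=B_1$. The nonlocal operator, acting in space at fixed time, is $$\mathcal{I}(u,x)=\int_{\mathbb{R}^N}[u(x+z)-u(x)-\mathbf 1_B(z)\langle Du(x),z\rangle]K^\sigma(z)\,dz,$$ and $(-\Delta)^{\sigma/2}u(x)=-C_{N,\sigma}\int_{\mathbb{R}^N}[u(x+z)-u(x)-\mathbf 1_B(z)\langle Du(x),z\rangle]|z|^{-(N+\sigma)}dz$, where $C_{N,\sigma}>0$ is the standard normalizing constant (Fourier symbol $|\xi|^\sigma$). It is known that under the stated hypotheses $u^\epsilon$ exists and is unique. Viscosity solutions. For $\delta\in(0,1)$, $\phi\in C^2$, bounded $u$ and $p\in\mathbb{R}^N$ set $\mathcal{I}[B_\delta](\phi,x)=\int_{B_\delta}[\phi(x+z,t)-\phi(x,t)-\langle D\phi(x,t),z\rangle]K^\sigma(z)dz$ and $\mathcal{I}[B_\delta^c](u,p,x)=\int_{B_\delta^c}[u(x+z,t)-u(x,t)-\mathbf 1_B(z)\langle p,z\rangle]K^\sigma(z)dz$. For $u_t+F(x,Du,\mathcal{I}(u,x))=0$ in $Q_T$, with $F$ continuous and nonincreasing in its last variable, a bounded upper semicontinuous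 (resp. lower semicontinuous) $u$ is a viscosity subsolution (resp. supersolution) if for every $(x,t)\in\mathbb{R}^N\times(0,T]$ and every $\phi\in C^2(\mathbb{R}^N\times(0,T])$ such that $(x,t)$ is a maximum (resp. minimum) point of $u-\phi$ in $B_\delta(x)\times(t-\delta,t+\delta)$ (intersected with $Q_T$) for a small $\delta>0$, one has $$\phi_t(x,t)+F\big(x,D\phi(x,t),\mathcal{I}[B_\delta](\phi,x)+\mathcal{I}[B_\delta^c](u,D\phi(x,t),x)\big)\le0\quad(\text{resp. }\ge0).$$ A bounded continuous function (on $\bar Q_T$, for the Cauchy problem) is a viscosity solution if it is both a sub- and a supersolution. The $\epsilon$-problem corresponds to $F(x,p,l)=-a(x,x/\epsilon)l+H(x,x/\epsilon,p)$, the effective one to $F=\bar H$. *)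

theory Defs
  imports "HOL-Analysis.Analysis"
begin

section \<open>Moduli of continuity and periodicity\<close>

definition modulus_of_continuity :: "(real \<Rightarrow> real) \<Rightarrow> bool" where
  "modulus_of_continuity \<omega> \<longleftrightarrow>
     mono_on {0..} \<omega> \<and> (\<forall>t\<ge>0. 0 \<le> \<omega> t) \<and> \<omega> 0 = 0 \<and> (\<omega> \<longlongrightarrow> 0) (at_right 0)"

definition ZN_periodic :: "(real ^ 'n \<Rightarrow> 'b) \<Rightarrow> bool" where
  "ZN_periodic f \<longleftrightarrow> (\<forall>y k. (\<forall>i. k $ i \<in> \<int>) \<longrightarrow> f (y + k) = f y)"

text \<open>Functions on the torus are periodic functions on the whole space, so the integral over the
  torus is the one over the unit cube.\<close>

definition torus_integral :: "(real ^ 'n \<Rightarrow> real) \<Rightarrow> real" where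
  "torus_integral f = (LINT y:cbox 0 1|lebesgue. f y)"

section \<open>Nonlocal operators\<close>

text \<open>The constant for which the fractional Laplacian of order \<open>\<sigma>\<close> has Fourier symbol
  \<open>|\<xi>|^\<sigma>\<close>: applied to \<open>exp (i \<langle>\<xi>, x\<rangle>)\<close>, the operator with constant \<open>C\<close> has symbol
  \<open>C \<integral> (1 - cos \<langle>\<xi>, z\<rangle>) / |z|^(N+\<sigma>) dz\<close>, which is \<open>|\<xi>|^\<sigma>\<close> times its value at any unit vector.
  By rotation invariance the choice of the coordinate below is immaterial.\<close>

definition frac_const :: "'n::finite itself \<Rightarrow> real \<Rightarrow> real" where
  "frac_const TYPE('n) \<sigma> =
     1 / (LINT z|lebesgue. (1 - cos ((z :: real ^ 'n) $ (SOME i. True))) / norm z powr (real CARD('n) + \<sigma>))"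

text \<open>The fractional Laplacian of order \<open>\<sigma>\<close> is minus the nonlocal operator with this kernel.\<close>

definition frac_kernel :: "real \<Rightarrow> real ^ 'n \<Rightarrow> real" where
  "frac_kernel \<sigma> z = frac_const TYPE('n) \<sigma> / norm z powr (real CARD('n) + \<sigma>)"

text \<open>Taken literally, the following function vanishes at the origin; its value there is to be
  understood as its limit along \<open>z \<noteq> 0\<close>.\<close>

definition kbar :: "real \<Rightarrow> (real ^ 'n \<Rightarrow> real) \<Rightarrow> real ^ 'n \<Rightarrow> real" where
  "kbar \<sigma> K z = K z * norm z powr (real CARD('n) + \<sigma>)"

definition grad :: "(real ^ 'n \<Rightarrow> real) \<Rightarrow> real ^ 'n \<Rightarrow> real ^ 'n" where
  "grad f x = (THE p. GDERIV f x :> p)"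

definition nonlocal_inner ::
  "(real ^ 'n \<Rightarrow> real) \<Rightarrow> real \<Rightarrow> (real ^ 'n \<Rightarrow> real) \<Rightarrow> real ^ 'n \<Rightarrow> real" where
  "nonlocal_inner K \<delta> \<phi> x =
     (LINT z:ball 0 \<delta>|lebesgue. (\<phi> (x + z) - \<phi> x - grad \<phi> x \<bullet> z) * K z)"

definition nonlocal_outer ::
  "(real ^ 'n \<Rightarrow> real) \<Rightarrow> real \<Rightarrow> (real ^ 'n \<Rightarrow> real) \<Rightarrow> real ^ 'n \<Rightarrow> real ^ 'n \<Rightarrow> real" where
  "nonlocal_outer K \<delta> u p x =
     (LINT z:- ball 0 \<delta>|lebesgue. (u (x + z) - u x - indicator (ball 0 1) z * (p \<bullet> z)) * K z)"

section \<open>Regularity\<close>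

text \<open>Derivatives are taken within the set, so they are one-sided at boundary points.\<close>

definition C2_on :: "'e::real_normed_vector set \<Rightarrow> ('e \<Rightarrow> real) \<Rightarrow> bool" where
  "C2_on S \<phi> \<longleftrightarrow>
     (\<exists>(D :: 'e \<Rightarrow> ('e \<Rightarrow>\<^sub>L real)) (D2 :: 'e \<Rightarrow> ('e \<Rightarrow>\<^sub>L ('e \<Rightarrow>\<^sub>L real))).
        (\<forall>q\<in>S. (\<phi> has_derivative blinfun_apply (D q)) (at q within S) \<and>
               (D has_derivative blinfun_apply (D2 q)) (at q within S)) \<and>
        continuous_on S D2)"

definition usc_on :: "'e::topological_space set \<Rightarrow> ('e \<Rightarrow> real) \<Rightarrow> bool" where
  "usc_on S u \<longleftrightarrow> (\<forall>q\<in>S. \<forall>c. u q < c \<longrightarrow> (\<forall>\<^sub>F r in at q within S. u r < c))"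

definition lsc_on :: "'e::topological_space set \<Rightarrow> ('e \<Rightarrow> real) \<Rightarrow> bool" where
  "lsc_on S u \<longleftrightarrow> (\<forall>q\<in>S. \<forall>c. c < u q \<longrightarrow> (\<forall>\<^sub>F r in at q within S. c < u r))"

section \<open>Viscosity solutions of the Cauchy problem\<close>

definition QT :: "real \<Rightarrow> ((real ^ 'n) \<times> real) set" where
  "QT T = UNIV \<times> {0<..T}"

definition QT_bar :: "real \<Rightarrow> ((real ^ 'n) \<times> real) set" where
  "QT_bar T = UNIV \<times> {0..T}"

text \<open>The left-hand side of the viscosity inequality at \<open>(x, t)\<close> for the equation
  \<open>u\<^sub>t + F(x, Du, I(u, x)) = 0\<close>, the operator \<open>I\<close> having kernel \<open>K\<close>. The time derivative is
  one-sided at \<open>t = T\<close>.\<close>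

definition visc_lhs ::
  "real \<Rightarrow> (real ^ 'n \<Rightarrow> real) \<Rightarrow> (real ^ 'n \<Rightarrow> real ^ 'n \<Rightarrow> real \<Rightarrow> real) \<Rightarrow> ((real ^ 'n) \<times> real \<Rightarrow> real) \<Rightarrow>
   ((real ^ 'n) \<times> real \<Rightarrow> real) \<Rightarrow> real \<Rightarrow> real ^ 'n \<Rightarrow> real \<Rightarrow> real" where
  "visc_lhs T K F u \<phi> \<delta> x t =
     (let p = grad (\<lambda>y. \<phi> (y, t)) x in
      vector_derivative (\<lambda>s. \<phi> (x, s)) (at t within {0<..T}) +
      F x p (nonlocal_inner K \<delta> (\<lambda>y. \<phi> (y, t)) x + nonlocal_outer K \<delta> (\<lambda>y. u (y, t)) p x))"

definition visc_subsol ::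
  "real \<Rightarrow> (real ^ 'n \<Rightarrow> real) \<Rightarrow> (real ^ 'n \<Rightarrow> real ^ 'n \<Rightarrow> real \<Rightarrow> real) \<Rightarrow> ((real ^ 'n) \<times> real \<Rightarrow> real) \<Rightarrow> bool" where
  "visc_subsol T K F u \<longleftrightarrow>
     bounded (u ` QT T) \<and> usc_on (QT T) u \<and>
     (\<forall>x. \<forall>t\<in>{0<..T}. \<forall>\<phi> \<delta>.
        C2_on (QT T) \<phi> \<and> 0 < \<delta> \<and> \<delta> < 1 \<and>
        (\<forall>q \<in> (ball x \<delta> \<times> {t - \<delta><..<t + \<delta>}) \<inter> QT T. u q - \<phi> q \<le> u (x, t) - \<phi> (x, t))
        \<longrightarrow> visc_lhs T K F u \<phi> \<delta> x t \<le> 0)"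

definition visc_supersol ::
  "real \<Rightarrow> (real ^ 'n \<Rightarrow> real) \<Rightarrow> (real ^ 'n \<Rightarrow> real ^ 'n \<Rightarrow> real \<Rightarrow> real) \<Rightarrow> ((real ^ 'n) \<times> real \<Rightarrow> real) \<Rightarrow> bool" where
  "visc_supersol T K F u \<longleftrightarrow>
     bounded (u ` QT T) \<and> lsc_on (QT T) u \<and>
     (\<forall>x. \<forall>t\<in>{0<..T}. \<forall>\<phi> \<delta>.
        C2_on (QT T) \<phi> \<and> 0 < \<delta> \<and> \<delta> < 1 \<and>
        (\<forall>q \<in> (ball x \<delta> \<times> {t - \<delta><..<t + \<delta>}) \<inter> QT T. u (x, t) - \<phi> (x, t) \<le> u q - \<phi> q)
        \<longrightarrow> 0 \<le> visc_lhs T K F u \<phi> \<delta> x t)"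

definition cauchy_visc_sol ::
  "real \<Rightarrow> (real ^ 'n \<Rightarrow> real) \<Rightarrow> (real ^ 'n \<Rightarrow> real ^ 'n \<Rightarrow> real \<Rightarrow> real) \<Rightarrow> (real ^ 'n \<Rightarrow> real) \<Rightarrow>
   ((real ^ 'n) \<times> real \<Rightarrow> real) \<Rightarrow> bool" where
  "cauchy_visc_sol T K F u0 u \<longleftrightarrow>
     bounded (u ` QT_bar T) \<and> continuous_on (QT_bar T) u \<and>
     visc_subsol T K F u \<and> visc_supersol T K F u \<and> (\<forall>x. u (x, 0) = u0 x)"

section \<open>The cell problem and the effective Hamiltonian\<close>

text \<open>Viscosity solutions of the stationary equation \<open>F(y, D\<psi>, I(\<psi>, y)) = 0\<close> on the whole space.\<close>

definition stat_lhs ::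
  "(real ^ 'n \<Rightarrow> real) \<Rightarrow> (real ^ 'n \<Rightarrow> real ^ 'n \<Rightarrow> real \<Rightarrow> real) \<Rightarrow> (real ^ 'n \<Rightarrow> real) \<Rightarrow>
   (real ^ 'n \<Rightarrow> real) \<Rightarrow> real \<Rightarrow> real ^ 'n \<Rightarrow> real" where
  "stat_lhs K F \<psi> \<phi> \<delta> y =
     F y (grad \<phi> y) (nonlocal_inner K \<delta> \<phi> y + nonlocal_outer K \<delta> \<psi> (grad \<phi> y) y)"

definition stat_visc_sol ::
  "(real ^ 'n \<Rightarrow> real) \<Rightarrow> (real ^ 'n \<Rightarrow> real ^ 'n \<Rightarrow> real \<Rightarrow> real) \<Rightarrow> (real ^ 'n \<Rightarrow> real) \<Rightarrow> bool" where
  "stat_visc_sol K F \<psi> \<longleftrightarrow>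
     bounded (range \<psi>) \<and> continuous_on UNIV \<psi> \<and>
     (\<forall>y \<phi> \<delta>. C2_on UNIV \<phi> \<and> 0 < \<delta> \<and> \<delta> < 1 \<longrightarrow>
        ((\<forall>z\<in>ball y \<delta>. \<psi> z - \<phi> z \<le> \<psi> y - \<phi> y) \<longrightarrow> stat_lhs K F \<psi> \<phi> \<delta> y \<le> 0) \<and>
        ((\<forall>z\<in>ball y \<delta>. \<psi> y - \<phi> y \<le> \<psi> z - \<phi> z) \<longrightarrow> 0 \<le> stat_lhs K F \<psi> \<phi> \<delta> y))"

text \<open>Solvability of \<open>- a(x,y) l + a(x,y) (-\<Delta>)^(\<sigma>/2) \<psi>(y) + H(x,y,p) = c\<close> on the torus, for frozen
  \<open>x\<close>, \<open>p\<close>, \<open>l\<close>. The last argument \<open>j\<close> below stands for \<open>- (-\<Delta>)^(\<sigma>/2) \<psi>(y)\<close>.\<close>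

definition cell_solvable ::
  "real \<Rightarrow> (real ^ 'n \<Rightarrow> real ^ 'n \<Rightarrow> real) \<Rightarrow> (real ^ 'n \<Rightarrow> real ^ 'n \<Rightarrow> real ^ 'n \<Rightarrow> real) \<Rightarrow>
   real ^ 'n \<Rightarrow> real ^ 'n \<Rightarrow> real \<Rightarrow> real \<Rightarrow> bool" where
  "cell_solvable \<sigma> a H x p l c \<longleftrightarrow>
     (\<exists>\<psi>. ZN_periodic \<psi> \<and>
          stat_visc_sol (frac_kernel \<sigma>) (\<lambda>y _ j. - a x y * l + a x y * (- j) + H x y p - c) \<psi>)"

definition eff_coeff :: "(real ^ 'n \<Rightarrow> real ^ 'n \<Rightarrow> real) \<Rightarrow> real ^ 'n \<Rightarrow> real" where
  "eff_coeff a x = 1 / torus_integral (\<lambda>y. 1 / a x y)"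

definition eff_H ::
  "(real ^ 'n \<Rightarrow> real ^ 'n \<Rightarrow> real) \<Rightarrow> (real ^ 'n \<Rightarrow> real ^ 'n \<Rightarrow> real ^ 'n \<Rightarrow> real) \<Rightarrow>
   real ^ 'n \<Rightarrow> real ^ 'n \<Rightarrow> real \<Rightarrow> real" where
  "eff_H a H x p l =
     - eff_coeff a x * l + eff_coeff a x * torus_integral (\<lambda>y. H x y p / a x y)"

end

theory Submission
  imports Defs "HOL-Real_Asymp.Real_Asymp"
begin

text \<open>
  The cell problem is linear in the corrector, so averaging it against \<open>1 / a(x, \<cdot>)\<close> gives the
  formula for the effective Hamiltonian. For trigonometric polynomials the fractional Laplacian is
  inverted mode by mode; by density this yields smooth correctors that solve the cell problem up to
  a small error, and exact viscosity correctors as their uniform limits.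

  The half-relaxed limits of the family \<open>u\<^sub>\<epsilon>\<close> are compared with the effective equation by adding
  \<open>\<epsilon>^\<sigma> \<psi>(x/\<epsilon>)\<close> to the test function, where \<open>\<psi>\<close> is such an approximate corrector. Since \<open>\<sigma> > 1\<close>
  this changes the gradient only by \<open>O(\<epsilon>^(\<sigma>-1))\<close>, while the nonlocal term converges to
  the fractional Laplacian of \<open>\<psi>\<close>, because after rescaling only the value of the kernel density at
  the origin matters. Barriers uniform in \<open>\<epsilon>\<close> fix the initial data of the relaxed limits.

  For the effective equation, divided by the coefficient in front of the nonlocal term, comparison
  is proved by doubling variables with \<open>\<mu> u\<close> in place of \<open>u\<close>: the gain \<open>(1 - \<mu>) b |p|^m\<close> from the
  coercivity condition dominates the oscillation in \<open>x\<close>. Applied to the relaxed limits it shows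
  that they coincide, which is locally uniform convergence. The lower limit is
  reduced to the upper one by the reflection \<open>u \<mapsto> -u\<close>.
\<close>

section \<open>Levy integrals\<close>

text \<open>The main obstacle is the x-dependence of the coefficient A in front of the nonlocal
  term. When variables are doubled, the two nonlocal terms have no bound of their own; only their
  sum is bounded above, so a factor A(x) - A(y) on one of them could not be controlled. Since 1/A is
  the torus mean b of 1/a, multiplying by b makes this coefficient one. The price is b(x) in front
  of the time slope, which is at most T/\<eta> with \<eta> the doubling parameter in time; fixing
  \<eta> before the spatial parameter makes (b(x) - b(y)) times the slope small.

  A second obstacle is that exact correctors are only known to be continuous viscosity solutions and
  cannot be added to a test function. Approximate smooth ones carry the passage to the limit; exact
  ones serve the characterisation of the constant c. Its uniqueness comes from touching an exact
  corrector by a smooth solution, since a viscosity inequality cannot simply be integrated.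

  All integrals are controlled by the weight min(|z|, |z|^2). Its linear growth lets the gradient be
  subtracted on all of space, which makes the scaling of the corrector exact.\<close>

definition wt :: "'a::real_normed_vector \<Rightarrow> real" where
  "wt z = min (norm z) ((norm z)\<^sup>2)"

lemma wt_nonneg [simp]: "0 \<le> wt z"
  by (simp add: wt_def)

lemma wt_zero [simp]: "wt 0 = 0"
  by (simp add: wt_def)

lemma wt_less_1: "norm z \<le> 1 \<Longrightarrow> wt z = (norm z)\<^sup>2"
  using mult_left_le[of "norm z" "norm z"] by (simp add: wt_def power2_eq_square min_def)

lemma wt_ge_1: "1 \<le> norm z \<Longrightarrow> wt z = norm z"
  using mult_left_mono[of 1 "norm z" "norm z"] by (simp add: wt_def power2_eq_square min_def)

lemma wt_le_norm: "wt z \<le> norm z"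
  by (simp add: wt_def)

lemma wt_le_norm2: "wt z \<le> (norm z)\<^sup>2"
  by (simp add: wt_def)

lemma continuous_wt: "continuous_on UNIV (wt :: 'a::real_normed_vector \<Rightarrow> real)"
  unfolding wt_def by (intro continuous_intros)

lemma wt_measurable [measurable]: "(wt :: 'a::euclidean_space \<Rightarrow> real) \<in> borel_measurable borel"
  by (rule borel_measurable_continuous_onI) (rule continuous_wt)

lemma lebesgue_measurable_borel:
  "f \<in> borel_measurable borel \<Longrightarrow> f \<in> borel_measurable (lebesgue :: 'a::euclidean_space measure)"
  by (intro measurable_completion) simp

lemma wt_outside:
  assumes "0 < \<delta>" "\<delta> < 1" "\<delta> \<le> norm z"
  shows "\<delta>\<^sup>2 \<le> wt z"
proof (cases "norm z \<le> 1")
  case True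
  then show ?thesis using assms by (simp add: wt_less_1 power_mono)
next
  case False
  then have "\<delta>\<^sup>2 \<le> 1" using assms by (simp add: power_le_one)
  then show ?thesis using False by (simp add: wt_ge_1)
qed

section \<open>Integrability of the weight by dyadic decomposition\<close>

lemma ennreal_suminf_ge: "f k \<le> (\<Sum>n. f n)" for f :: "nat \<Rightarrow> ennreal"
  using sum_le_suminf[of f "{k}"] by simp

text \<open>The function lies below the series of c_k times the indicator of A_k, whose integral is
  the sum in the last hypothesis. The sets may overlap, so balls can stand in for dyadic shells and
  the volume formula applies directly.\<close>

lemma integrable_dyadic:
  fixes f :: "'a::euclidean_space \<Rightarrow> real"
  assumes f: "f \<in> borel_measurable lebesgue" "\<And>z. 0 \<le> f z"
    and A: "\<And>k. A k \<in> lmeasurable" and c: "\<And>k. 0 \<le> c k"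
    and bd: "\<And>z. f z \<noteq> 0 \<Longrightarrow> \<exists>k::nat. z \<in> A k \<and> f z \<le> c k"
    and sm: "summable (\<lambda>k. c k * measure lebesgue (A k))"
  shows "integrable lebesgue f"
proof (rule integrableI_nonneg)
  show "f \<in> borel_measurable lebesgue" by fact
  show "AE x in lebesgue. 0 \<le> f x" using f by simp
  have Am: "A k \<in> sets lebesgue" for k using A[of k] by (simp add: fmeasurable_def)
  have "ennreal (f z) \<le> (\<Sum>k. ennreal (c k) * indicator (A k) z)" for z
  proof (cases "f z = 0")
    case False
    then obtain k where k: "z \<in> A k" "f z \<le> c k" using bd by blast
    have "ennreal (f z) \<le> ennreal (c k) * indicator (A k) z"
      using k by (simp add: ennreal_leI)
    also have "\<dots> \<le> (\<Sum>k. ennreal (c k) * indicator (A k) z)"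
      by (rule ennreal_suminf_ge)
    finally show ?thesis .
  qed simp
  then have "(\<integral>\<^sup>+z. ennreal (f z) \<partial>lebesgue) \<le> (\<integral>\<^sup>+z. (\<Sum>k. ennreal (c k) * indicator (A k) z) \<partial>lebesgue)"
    by (intro nn_integral_mono) simp
  also have "\<dots> = (\<Sum>k. \<integral>\<^sup>+z. ennreal (c k) * indicator (A k) z \<partial>lebesgue)"
    using Am by (intro nn_integral_suminf) auto
  also have "\<dots> = (\<Sum>k. ennreal (c k * measure lebesgue (A k)))"
  proof (rule suminf_cong)
    fix k
    have "(\<integral>\<^sup>+z. ennreal (c k) * indicator (A k) z \<partial>lebesgue) = ennreal (c k) * emeasure lebesgue (A k)"
      using Am by (intro nn_integral_cmult_indicator) auto
    also have "\<dots> = ennreal (c k * measure lebesgue (A k))"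
      unfolding emeasure_eq_measure2[OF A[of k]] by (rule ennreal_mult[symmetric]) (simp_all add: c)
    finally show "(\<integral>\<^sup>+z. ennreal (c k) * indicator (A k) z \<partial>lebesgue) = ennreal (c k * measure lebesgue (A k))" .
  qed
  also have "\<dots> = ennreal (\<Sum>k. c k * measure lebesgue (A k))"
    by (intro suminf_ennreal2 sm) (simp add: c)
  also have "\<dots> < \<infinity>" by simp
  finally show "(\<integral>\<^sup>+z. ennreal (f z) \<partial>lebesgue) < \<infinity>" .
qed

lemma dyadic_outer: "\<exists>k::nat. 2 ^ k \<le> r \<and> r < 2 ^ (k+1)" if "1 \<le> r" for r :: real
proof -
  define k where "k = nat \<lfloor>log 2 r\<rfloor>"
  have l0: "0 \<le> log 2 r" using that by (simp add: )
  have "real k \<le> log 2 r" "log 2 r < real k + 1" using l0 unfolding k_def by linarith+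
  then have "2 powr real k \<le> r" "r < 2 powr (real k + 1)"
    using that by (auto simp: le_log_iff log_less_iff)
  then show ?thesis by (intro exI[of _ k]) (simp add: powr_add powr_realpow)
qed

lemma dyadic_inner: "\<exists>k::nat. (1/2) ^ (k+1) \<le> r \<and> r < (1/2) ^ k" if r: "0 < r" "r < 1" for r :: real
proof -
  \<comment> \<open>Ceiling minus one is the largest integer strictly below the negative logarithm;
    strictness places the point in the open ball of radius (1/2)^k.\<close>
  define k where "k = nat (\<lceil>- log 2 r\<rceil> - 1)"
  have l0: "0 < - log 2 r" using that by (simp add: )
  have "real k < - log 2 r" "- log 2 r \<le> real k + 1" using l0 unfolding k_def by linarith+
  then have "log 2 r < - real k" "- (real k + 1) \<le> log 2 r" by auto
  then have 1: "r < 2 powr (- real k)" "2 powr (- (real k + 1)) \<le> r"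
    using that le_log_iff[of 2 r "- (real k + 1)"] log_less_iff[of 2 r "- real k"] by auto
  have h: "(1/2) ^ j = 2 powr (- real j)" for j :: nat
    by (simp add: powr_minus powr_realpow power_one_over inverse_eq_divide)
  show ?thesis unfolding h using 1 by (intro exI[of _ k]) (simp add: add.commute)
qed

text \<open>Outside the unit ball the weight is |z| and the k-th dyadic ball contributes a multiple
  of 2^(k(1-\<sigma>)), summable because \<sigma> > 1. Inside, it is |z|^2 and the contribution is
  of order 2^(k(\<sigma>-2)), summable because \<sigma> < 2.\<close>

lemma wt_power_integrable:
  assumes s: "1 < \<sigma>" "\<sigma> < 2"
  shows "integrable lebesgue (\<lambda>z :: real ^ 'n. wt z / norm z powr (real CARD('n) + \<sigma>))" (is "integrable _ ?f")
proof -
  define N where "N = real CARD('n)"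
  have N1: "N \<ge> 1" unfolding N_def by simp
  define V where "V = measure lebesgue (ball (0::real^'n) 1)"
  have vol: "measure lebesgue (ball (0::real^'n) r) = r powr N * V" if "0 < r" for r
    using that by (simp add: V_def content_ball N_def powr_realpow)
  have 1: "integrable lebesgue (\<lambda>z::real^'n. if 1 \<le> norm z then ?f z else 0)"
  proof (rule integrable_dyadic[where A="\<lambda>k. ball 0 (2 ^ (k+1))" and c="\<lambda>k. (2 ^ k) powr (1 - N - \<sigma>)"])
    show "(\<lambda>z::real^'n. if 1 \<le> norm z then ?f z else 0) \<in> borel_measurable lebesgue"
      by (rule lebesgue_measurable_borel) measurable
    have eq: "(2 ^ k) powr (1 - N - \<sigma>) * measure lebesgue (ball (0::real^'n) (2 ^ (k + 1)))
        = 2 powr N * V * (2 powr (1 - \<sigma>)) ^ k" for k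
    proof -
      have "(2 ^ k) powr (1 - N - \<sigma>) * (2 ^ (k + 1)) powr N = 2 powr (real k * (1 - N - \<sigma>)) * 2 powr ((real k + 1) * N)"
        unfolding powr_realpow[symmetric, of 2, simplified] powr_powr by (simp add: algebra_simps)
      also have "\<dots> = 2 powr N * 2 powr (real k * (1 - \<sigma>))"
        by (simp add: powr_add[symmetric] algebra_simps)
      finally have e: "(2 ^ k) powr (1 - N - \<sigma>) * (2 ^ (k + 1)) powr N = 2 powr N * 2 powr (real k * (1 - \<sigma>))" .
      have "(2 powr (1 - \<sigma>)) ^ k = 2 powr (real k * (1 - \<sigma>))"
        by (simp add: powr_realpow[symmetric] powr_powr mult.commute)
      then show ?thesis using e by (subst vol) (auto simp: algebra_simps)
    qed
    have lt: "2 powr (1 - \<sigma>) < (1::real)" using s powr_less_mono[of "1-\<sigma>" 0 2] by simp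
    show "summable (\<lambda>k. (2 ^ k) powr (1 - N - \<sigma>) * measure lebesgue (ball (0::real^'n) (2 ^ (k + 1))))"
      unfolding eq by (intro summable_mult summable_geometric) (use lt in simp)
    fix z :: "real^'n" assume "(if 1 \<le> norm z then ?f z else 0) \<noteq> 0"
    then have z: "1 \<le> norm z" by (auto split: if_splits)
    obtain k :: nat where k: "2 ^ k \<le> norm z" "norm z < 2 ^ (k+1)" using dyadic_outer[OF z] by blast
    have "?f z = norm z powr (1 - N - \<sigma>)"
      using z by (simp add: wt_ge_1 N_def diff_diff_eq powr_diff)
    also have "\<dots> \<le> (2 ^ k) powr (1 - N - \<sigma>)"
      using k N1 s by (intro powr_mono2') auto
    finally show "\<exists>k. z \<in> ball 0 (2 ^ (k + 1)) \<and> (if 1 \<le> norm z then ?f z else 0) \<le> (2 ^ k) powr (1 - N - \<sigma>)"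
      using k z by auto
  qed auto
  have 2: "integrable lebesgue (\<lambda>z::real^'n. if norm z < 1 then ?f z else 0)"
  proof (rule integrable_dyadic[where A="\<lambda>k. ball 0 ((1/2) ^ k)" and c="\<lambda>k. ((1/2) ^ (k+1)) powr (2 - N - \<sigma>)"])
    show "(\<lambda>z::real^'n. if norm z < 1 then ?f z else 0) \<in> borel_measurable lebesgue"
      by (rule lebesgue_measurable_borel) measurable
    have h: "(1/2)^k = 2 powr (- real k)" for k
      by (simp add: powr_minus powr_realpow power_one_over inverse_eq_divide)
    have eq: "((1/2) ^ (k+1)) powr (2 - N - \<sigma>) * measure lebesgue (ball (0::real^'n) ((1/2) ^ k))
        = 2 powr (N + \<sigma> - 2) * V * (2 powr (\<sigma> - 2)) ^ k" for k
    proof -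
      have "((1/2) ^ (k+1)) powr (2 - N - \<sigma>) * ((1/2) ^ k) powr N
          = 2 powr (- real (k+1) * (2 - N - \<sigma>)) * 2 powr (- real k * N)"
        unfolding h by (simp only: powr_powr)
      also have "\<dots> = 2 powr (N + \<sigma> - 2) * 2 powr (real k * (\<sigma> - 2))"
        by (simp add: powr_add[symmetric] algebra_simps)
      finally have e: "((1/2) ^ (k+1)) powr (2 - N - \<sigma>) * ((1/2) ^ k) powr N = 2 powr (N + \<sigma> - 2) * 2 powr (real k * (\<sigma> - 2))" .
      have "(2 powr (\<sigma> - 2)) ^ k = 2 powr (real k * (\<sigma> - 2))"
        by (simp add: powr_realpow[symmetric] powr_powr mult.commute)
      then show ?thesis using e by (subst vol) (auto simp: algebra_simps)
    qed
    have lt: "2 powr (\<sigma> - 2) < (1::real)" using s powr_less_mono[of "\<sigma>-2" 0 2] by simp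
    show "summable (\<lambda>k. ((1/2) ^ (k+1)) powr (2 - N - \<sigma>) * measure lebesgue (ball (0::real^'n) ((1/2) ^ k)))"
      unfolding eq by (intro summable_mult summable_geometric) (use lt in simp)
    fix z :: "real^'n" assume "(if norm z < 1 then ?f z else 0) \<noteq> 0"
    then have z: "norm z < 1" "0 < norm z" by (auto split: if_splits)
    obtain k :: nat where k: "(1/2) ^ (k+1) \<le> norm z" "norm z < (1/2) ^ k" using dyadic_inner[of "norm z"] z by blast
    have "?f z = norm z powr (2 - N - \<sigma>)"
      using z by (simp add: wt_less_1 N_def diff_diff_eq powr_diff)
    also have "\<dots> \<le> ((1/2) ^ (k+1)) powr (2 - N - \<sigma>)"
      using k N1 s by (intro powr_mono2') auto
    finally show "\<exists>k. z \<in> ball 0 ((1/2) ^ k) \<and> (if norm z < 1 then ?f z else 0) \<le> ((1/2) ^ (k+1)) powr (2 - N - \<sigma>)"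
      using k z by (intro exI[of _ k]) auto
  qed auto
  have "?f = (\<lambda>z. (if 1 \<le> norm z then ?f z else 0) + (if norm z < 1 then ?f z else 0))"
    by (rule ext) auto
  then show ?thesis using Bochner_Integration.integrable_add[OF 1 2] by simp
qed

section \<open>Kernels integrating the weight, and their compensated integrals\<close>

locale levy_kernel =
  fixes K :: "real ^ 'n \<Rightarrow> real"
  assumes K_nonneg [simp]: "0 \<le> K z"
    and K_measurable [measurable]: "K \<in> borel_measurable lebesgue"
    and wt_K_integrable: "integrable lebesgue (\<lambda>z. wt z * K z)"

text \<open>The vector p and the increment d are independent arguments. One functional then covers
  increments of smooth functions, increments that change from a test function to u at radius
  \<delta>, and linear combinations of increments taken at two different points.\<close>

definition lev :: "(real ^ 'n \<Rightarrow> real) \<Rightarrow> real ^ 'n \<Rightarrow> (real ^ 'n \<Rightarrow> real) \<Rightarrow> real" where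
  "lev K p d = (LINT z|lebesgue. (d z - indicator (ball 0 1) z * (p \<bullet> z)) * K z)"

definition comp_incr :: "real ^ 'n \<Rightarrow> (real ^ 'n \<Rightarrow> real) \<Rightarrow> real ^ 'n \<Rightarrow> real" where
  "comp_incr p d z = d z - indicator (ball 0 1) z * (p \<bullet> z)"

definition lev_adm :: "real ^ 'n \<Rightarrow> (real ^ 'n \<Rightarrow> real) \<Rightarrow> bool" where
  "lev_adm p d \<longleftrightarrow> d \<in> borel_measurable lebesgue \<and> (\<exists>C. \<forall>z. \<bar>comp_incr p d z\<bar> \<le> C * wt z)"

lemma comp_incr_measurable:
  assumes "d \<in> borel_measurable lebesgue"
  shows "comp_incr p d \<in> borel_measurable lebesgue"
proof -
  have "(\<lambda>z. indicator (ball 0 1) z * (p \<bullet> z) :: real) \<in> borel_measurable lebesgue"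
    by (intro lebesgue_measurable_borel borel_measurable_times borel_measurable_indicator borel_measurable_inner) auto
  then show ?thesis using assms unfolding comp_incr_def[abs_def] by (intro borel_measurable_diff)
qed

lemma lev_adm_scale: "lev_adm p d \<Longrightarrow> lev_adm (c *\<^sub>R p) (\<lambda>z. c * d z)"
proof -
  assume a: "lev_adm p d"
  then obtain C where C: "\<And>z. \<bar>comp_incr p d z\<bar> \<le> C * wt z" unfolding lev_adm_def by blast
  have "\<bar>comp_incr (c *\<^sub>R p) (\<lambda>z. c * d z) z\<bar> \<le> (\<bar>c\<bar> * C) * wt z" for z
  proof -
    have "comp_incr (c *\<^sub>R p) (\<lambda>z. c * d z) z = c * comp_incr p d z"
      by (simp add: comp_incr_def algebra_simps)
    then show ?thesis using mult_left_mono[OF C[of z], of "\<bar>c\<bar>"] by (simp add: abs_mult algebra_simps)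
  qed
  then show ?thesis using a unfolding lev_adm_def by auto
qed

lemma lev_scale: "lev K (c *\<^sub>R p) (\<lambda>z. c * d z) = c * lev K p d"
  unfolding lev_def by (subst integral_mult_right_zero[symmetric]) (auto intro!: Bochner_Integration.integral_cong simp: algebra_simps)

lemma lev_uminus: "lev K (-p) (\<lambda>z. - d z) = - lev K p d"
  using lev_scale[of K "-1" p d] by simp

context levy_kernel
begin

definition mass :: real where "mass = (LINT z|lebesgue. wt z * K z)"

lemma mass_nonneg: "0 \<le> mass"
  unfolding mass_def by (intro Bochner_Integration.integral_nonneg) simp

lemma integrable_le_wt:
  assumes "f \<in> borel_measurable lebesgue" "\<And>z. \<bar>f z\<bar> \<le> C * wt z"
  shows "integrable lebesgue (\<lambda>z. f z * K z)"
proof (rule Bochner_Integration.integrable_bound)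
  show "integrable lebesgue (\<lambda>z. C * (wt z * K z))" by (intro integrable_mult_right wt_K_integrable)
  show "(\<lambda>z. f z * K z) \<in> borel_measurable lebesgue" using assms by measurable
  have "norm (f z * K z) \<le> norm (C * (wt z * K z))" for z
  proof -
    have "norm (f z * K z) = \<bar>f z\<bar> * K z" by (simp add: abs_mult)
    also have "\<dots> \<le> C * wt z * K z" by (intro mult_right_mono assms) simp
    also have "\<dots> \<le> norm (C * (wt z * K z))" by (simp add: mult.assoc)
    finally show ?thesis .
  qed
  then show "AE z in lebesgue. norm (f z * K z) \<le> norm (C * (wt z * K z))" by simp
qed

lemma lev_integrable:
  assumes "lev_adm p d"
  shows "integrable lebesgue (\<lambda>z. comp_incr p d z * K z)"
proof -
  obtain C where "\<And>z. \<bar>comp_incr p d z\<bar> \<le> C * wt z" using assms unfolding lev_adm_def by blast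
  moreover have "comp_incr p d \<in> borel_measurable lebesgue"
    using assms unfolding lev_adm_def by (simp add: comp_incr_measurable)
  ultimately show ?thesis using integrable_le_wt by blast
qed

text \<open>The slack r enters only through its integral against K. It is used with a multiple of
  \<open>wt\<close>, with a multiple of \<open>wt\<close> cut off to a small ball, and with a
  positive part that tends to 0.\<close>

lemma lev_mono_gen:
  assumes "lev_adm p d" "lev_adm p' d'" "integrable lebesgue (\<lambda>z. r z * K z)"
    and "\<And>z. comp_incr p d z \<le> comp_incr p' d' z + r z"
  shows "lev K p d \<le> lev K p' d' + (LINT z|lebesgue. r z * K z)"
proof -
  have "lev K p d = (LINT z|lebesgue. comp_incr p d z * K z)" by (simp add: lev_def comp_incr_def)
  also have "\<dots> \<le> (LINT z|lebesgue. comp_incr p' d' z * K z + r z * K z)"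
  proof (intro integral_mono Bochner_Integration.integrable_add lev_integrable assms)
    fix z show "comp_incr p d z * K z \<le> comp_incr p' d' z * K z + r z * K z"
      using mult_right_mono[OF assms(4)[of z] K_nonneg[of z]] by (simp add: algebra_simps)
  qed
  also have "\<dots> = (LINT z|lebesgue. comp_incr p' d' z * K z) + (LINT z|lebesgue. r z * K z)"
    by (intro Bochner_Integration.integral_add lev_integrable assms)
  finally show ?thesis by (simp add: lev_def comp_incr_def)
qed

lemma lev_mono_wt:
  assumes "lev_adm p d" "lev_adm p' d'"
    and "\<And>z. comp_incr p d z \<le> comp_incr p' d' z + e * wt z"
  shows "lev K p d \<le> lev K p' d' + e * mass"
proof -
  have "integrable lebesgue (\<lambda>z. e * wt z * K z)"
    using integrable_mult_right[OF wt_K_integrable, of e] by (simp add: mult.assoc)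
  then have "lev K p d \<le> lev K p' d' + (LINT z|lebesgue. e * wt z * K z)"
    by (intro lev_mono_gen assms)
  then show ?thesis by (simp add: mass_def mult.assoc)
qed

lemma lev_mono:
  assumes "lev_adm p d" "lev_adm p' d'"
    and "\<And>z. comp_incr p d z \<le> comp_incr p' d' z"
  shows "lev K p d \<le> lev K p' d'"
proof -
  have "lev K p d \<le> lev K p' d' + 0 * mass"
    by (rule lev_mono_wt[OF assms(1,2)]) (simp only: mult_zero_left add_0_right assms(3))
  then show ?thesis by simp
qed

lemma lev_adm_zero: "lev_adm 0 (\<lambda>_. 0)"
  unfolding lev_adm_def comp_incr_def by (intro conjI exI[of _ 0]) auto

lemma lev_zero [simp]: "lev K 0 (\<lambda>_. 0) = 0"
  by (simp add: lev_def)

lemma lev_abs_le: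
  assumes "d \<in> borel_measurable lebesgue" "\<And>z. \<bar>comp_incr p d z\<bar> \<le> C * wt z"
  shows "\<bar>lev K p d\<bar> \<le> C * mass"
proof -
  have adm: "lev_adm p d" using assms unfolding lev_adm_def by auto
  have z: "comp_incr 0 (\<lambda>_. 0) z = 0" for z :: "real^'n" by (simp add: comp_incr_def)
  have "lev K p d \<le> lev K 0 (\<lambda>_. 0) + C * mass"
  proof (intro lev_mono_wt adm lev_adm_zero)
    fix z show "comp_incr p d z \<le> comp_incr 0 (\<lambda>_. 0) z + C * wt z"
      using assms(2)[of z] unfolding z by linarith
  qed
  moreover have "lev K 0 (\<lambda>_. 0) \<le> lev K p d + C * mass"
  proof (intro lev_mono_wt adm lev_adm_zero)
    fix z show "comp_incr 0 (\<lambda>_. 0) z \<le> comp_incr p d z + C * wt z"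
      using assms(2)[of z] unfolding z by linarith
  qed
  ultimately show ?thesis by simp
qed

lemma lev_adm_add:
  assumes "lev_adm p d" "lev_adm p' d'"
  shows "lev_adm (p + p') (\<lambda>z. d z + d' z)"
proof -
  obtain C where C1: "\<And>z. \<bar>comp_incr p d z\<bar> \<le> C * wt z"
    using assms(1) unfolding lev_adm_def by blast
  obtain C' where C2: "\<And>z. \<bar>comp_incr p' d' z\<bar> \<le> C' * wt z"
    using assms(2) unfolding lev_adm_def by blast
  note C = C1 C2
  have "\<bar>comp_incr (p + p') (\<lambda>z. d z + d' z) z\<bar> \<le> (C + C') * wt z" for z
  proof -
    have "comp_incr (p + p') (\<lambda>z. d z + d' z) z = comp_incr p d z + comp_incr p' d' z"
      by (simp add: comp_incr_def algebra_simps)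
    then show ?thesis using C(1)[of z] C(2)[of z] by (simp add: algebra_simps)
  qed
  then show ?thesis using assms unfolding lev_adm_def by auto
qed

lemma lev_add:
  assumes "lev_adm p d" "lev_adm p' d'"
  shows "lev K (p + p') (\<lambda>z. d z + d' z) = lev K p d + lev K p' d'"
proof -
  have "lev K (p + p') (\<lambda>z. d z + d' z) = (LINT z|lebesgue. comp_incr p d z * K z + comp_incr p' d' z * K z)"
    unfolding lev_def comp_incr_def by (intro Bochner_Integration.integral_cong) (auto simp: algebra_simps)
  also have "\<dots> = lev K p d + lev K p' d'"
    unfolding Bochner_Integration.integral_add[OF lev_integrable[OF assms(1)] lev_integrable[OF assms(2)]]
    by (simp add: lev_def comp_incr_def)
  finally show ?thesis .
qed

text \<open>A reverse Fatou lemma: the positive part of the excess tends to 0 pointwise and is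
  dominated by a multiple of \<open>wt\<close>. Only an upper bound is asked of the increments,
  which is all that a half-relaxed limit provides.\<close>

lemma lev_limsup:
  assumes adm: "\<And>n. lev_adm (p n) (d n)" "lev_adm p0 d0"
    and bd: "\<And>n z. \<bar>comp_incr (p n) (d n) z\<bar> \<le> C * wt z"
    and lim: "\<And>z e. 0 < e \<Longrightarrow> \<forall>\<^sub>F n in sequentially. comp_incr (p n) (d n) z \<le> comp_incr p0 d0 z + e"
    and e: "0 < e"
  shows "\<forall>\<^sub>F n in sequentially. lev K (p n) (d n) \<le> lev K p0 d0 + e"
proof -
  define r where "r n z = max 0 (comp_incr (p n) (d n) z - comp_incr p0 d0 z)" for n z
  obtain C0 where C0: "\<And>z. \<bar>comp_incr p0 d0 z\<bar> \<le> C0 * wt z" using adm(2) unfolding lev_adm_def by blast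
  have mr: "r n \<in> borel_measurable lebesgue" for n
    unfolding r_def[abs_def] using adm unfolding lev_adm_def
    by (intro borel_measurable_max borel_measurable_diff comp_incr_measurable) auto
  have rb: "\<bar>r n z\<bar> \<le> (C + C0) * wt z" for n z
    using bd[of n z] C0[of z] by (auto simp: r_def algebra_simps abs_le_iff max_def)
  have ri: "integrable lebesgue (\<lambda>z. r n z * K z)" for n by (rule integrable_le_wt[OF mr rb])
  have "(\<lambda>n. LINT z|lebesgue. r n z * K z) \<longlonglongrightarrow> (LINT z|(lebesgue::(real^'n) measure). 0)"
  proof (rule integral_dominated_convergence)
    show "(\<lambda>z. 0) \<in> borel_measurable (lebesgue::(real^'n) measure)" by simp
    show "(\<lambda>z. r n z * K z) \<in> borel_measurable lebesgue" for n using ri[of n] by (rule borel_measurable_integrable)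
    show "integrable lebesgue (\<lambda>z. (C + C0) * (wt z * K z))" by (intro integrable_mult_right wt_K_integrable)
    have "norm (r n z * K z) \<le> (C + C0) * (wt z * K z)" for n z
      using mult_right_mono[OF rb[of n z] K_nonneg[of z]] by (simp add: abs_mult mult.assoc)
    then show "AE z in lebesgue. norm (r n z * K z) \<le> (C + C0) * (wt z * K z)" for n by simp
    have "(\<lambda>n. r n z) \<longlonglongrightarrow> 0" for z
    proof (rule order_tendstoI)
      fix a :: real assume "a < 0"
      then show "\<forall>\<^sub>F n in sequentially. a < r n z" by (simp add: r_def less_max_iff_disj)
    next
      fix a :: real assume a: "0 < a"
      show "\<forall>\<^sub>F n in sequentially. r n z < a"
        using lim[of "a/2" z] by (rule eventually_mono) (use a in \<open>auto simp: r_def\<close>)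
    qed
    from tendsto_mult_left_zero[OF this] show "AE z in lebesgue. (\<lambda>n. r n z * K z) \<longlonglongrightarrow> 0" by simp
  qed
  then have "(\<lambda>n. LINT z|lebesgue. r n z * K z) \<longlonglongrightarrow> 0" by simp
  from order_tendstoD(2)[OF this e] show ?thesis
  proof (rule eventually_mono)
    fix n assume "(LINT z|lebesgue. r n z * K z) < e"
    moreover have "lev K (p n) (d n) \<le> lev K p0 d0 + (LINT z|lebesgue. r n z * K z)"
      by (intro lev_mono_gen adm ri) (simp add: r_def)
    ultimately show "lev K (p n) (d n) \<le> lev K p0 d0 + e" by linarith
  qed
qed

text \<open>Dominated convergence over shrinking balls; at the origin itself \<open>wt\<close>
  vanishes. It lets the radius \<delta> of a viscosity inequality be chosen after a penalisation
  parameter whose inverse multiplies the second derivatives.\<close>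

lemma small_ball:
  assumes e: "0 < e"
  shows "\<exists>\<delta>. 0 < \<delta> \<and> \<delta> < 1 \<and> integrable lebesgue (\<lambda>z. indicator (ball 0 \<delta>) z * wt z * K z) \<and>
    (LINT z|lebesgue. indicator (ball 0 \<delta>) z * wt z * K z) < e"
proof -
  define \<delta> where "\<delta> n = 1 / real (n + 2)" for n
  have d: "0 < \<delta> n" "\<delta> n < 1" for n unfolding \<delta>_def by auto
  have m: "(\<lambda>z::real^'n. indicator (ball 0 (\<delta> n)) z * wt z :: real) \<in> borel_measurable lebesgue" for n
    by (intro lebesgue_measurable_borel borel_measurable_times borel_measurable_indicator wt_measurable) auto
  have i: "integrable lebesgue (\<lambda>z. indicator (ball 0 (\<delta> n)) z * wt z * K z)" for n
    by (rule integrable_le_wt[where C=1, OF m]) (auto simp: indicator_def)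
  have "(\<lambda>n. LINT z|lebesgue. indicator (ball 0 (\<delta> n)) z * wt z * K z) \<longlonglongrightarrow> (LINT z|(lebesgue::(real^'n) measure). 0)"
  proof (rule integral_dominated_convergence)
    show "integrable lebesgue (\<lambda>z. wt z * K z)" by (rule wt_K_integrable)
    show "(\<lambda>z. indicator (ball 0 (\<delta> n)) z * wt z * K z) \<in> borel_measurable lebesgue" for n
      using i[of n] by (rule borel_measurable_integrable)
    show "AE z in lebesgue. norm (indicator (ball 0 (\<delta> n)) z * wt z * K z) \<le> wt z * K z" for n
      by (auto simp: indicator_def)
    have "(\<lambda>n. indicator (ball 0 (\<delta> n)) z * wt z * K z) \<longlonglongrightarrow> 0" for z
    proof (cases "z = 0")
      case False
      have "\<delta> \<longlonglongrightarrow> 0" unfolding \<delta>_def[abs_def] by real_asymp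
      then have "\<forall>\<^sub>F n in sequentially. \<delta> n < norm z" using False by (intro order_tendstoD) auto
      then have "\<forall>\<^sub>F n in sequentially. indicator (ball 0 (\<delta> n)) z * wt z * K z = 0"
        by (rule eventually_mono) auto
      then show ?thesis by (rule tendsto_eventually)
    qed simp
    then show "AE z in lebesgue. (\<lambda>n. indicator (ball 0 (\<delta> n)) z * wt z * K z) \<longlonglongrightarrow> 0" by simp
  qed simp
  then have "(\<lambda>n. LINT z|lebesgue. indicator (ball 0 (\<delta> n)) z * wt z * K z) \<longlonglongrightarrow> 0" by simp
  from order_tendstoD(2)[OF this e] obtain n where "(LINT z|lebesgue. indicator (ball 0 (\<delta> n)) z * wt z * K z) < e"
    by (auto simp: eventually_sequentially)
  then show ?thesis using d i by blast
qed

end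

section \<open>Two instances: kernels with bounded density, and the fractional kernel\<close>

lemma levy_kernel_kbar:
  fixes K :: "real ^ 'n \<Rightarrow> real"
  assumes "1 < \<sigma>" "\<sigma> < 2" "\<And>z. 0 \<le> K z" "K \<in> borel_measurable lebesgue" "bounded (range (kbar \<sigma> K))"
  shows "levy_kernel K"
proof
  obtain B where B: "\<And>z. \<bar>kbar \<sigma> K z\<bar> \<le> B" using assms(5) unfolding bounded_iff by auto
  have m: "(\<lambda>z::real^'n. wt z) \<in> borel_measurable lebesgue" by (rule lebesgue_measurable_borel) measurable
  show "integrable lebesgue (\<lambda>z. wt z * K z)"
  proof (rule Bochner_Integration.integrable_bound)
    show "integrable lebesgue (\<lambda>z::real^'n. B * (wt z / norm z powr (real CARD('n) + \<sigma>)))"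
      by (intro integrable_mult_right wt_power_integrable assms)
    show "(\<lambda>z. wt z * K z) \<in> borel_measurable lebesgue" using assms(4) m by measurable
    have "norm (wt z * K z) \<le> norm (B * (wt z / norm z powr (real CARD('n) + \<sigma>)))" for z
    proof (cases "z = 0")
      case False
      then have pos: "0 < norm z powr (real CARD('n) + \<sigma>)" by simp
      have "K z * norm z powr (real CARD('n) + \<sigma>) \<le> B" using B[of z] unfolding kbar_def by linarith
      then have "K z \<le> B / norm z powr (real CARD('n) + \<sigma>)" using pos by (simp add: pos_le_divide_eq)
      then have "wt z * K z \<le> wt z * (B / norm z powr (real CARD('n) + \<sigma>))" by (intro mult_left_mono) auto
      then show ?thesis using assms(3)[of z] B[of z] by (simp add: abs_mult mult.commute)
    qed simp
    then show "AE z in lebesgue. norm (wt z * K z) \<le> norm (B * (wt z / norm z powr (real CARD('n) + \<sigma>)))" by simp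
  qed
qed (use assms in auto)

lemma levy_kernel_frac:
  assumes "1 < \<sigma>" "\<sigma> < 2" "0 < frac_const TYPE('n::finite) \<sigma>"
  shows "levy_kernel (frac_kernel \<sigma> :: real ^ 'n \<Rightarrow> real)"
proof
  show "0 \<le> frac_kernel \<sigma> z" for z :: "real^'n" using assms(3) by (simp add: frac_kernel_def)
  show "(frac_kernel \<sigma> :: real^'n \<Rightarrow> real) \<in> borel_measurable lebesgue"
    by (rule lebesgue_measurable_borel) (unfold frac_kernel_def[abs_def], measurable)
  show "integrable lebesgue (\<lambda>z::real^'n. wt z * frac_kernel \<sigma> z)"
    using integrable_mult_right[OF wt_power_integrable[OF assms(1,2), where 'n='n], of "frac_const TYPE('n) \<sigma>"]
    by (simp add: frac_kernel_def algebra_simps)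
qed

section \<open>Test functions\<close>

lemma C2_on_const: "C2_on S (\<lambda>_. c)"
  unfolding C2_on_def
  by (intro exI[of _ "\<lambda>_. 0"] conjI ballI) (auto simp: zero_blinfun.rep_eq)

lemma C2_on_add:
  assumes "C2_on S f" "C2_on S g"
  shows "C2_on S (\<lambda>q. f q + g q)"
proof -
  obtain D D2 where D: "\<forall>q\<in>S. (f has_derivative blinfun_apply (D q)) (at q within S) \<and>
               (D has_derivative blinfun_apply (D2 q)) (at q within S)" "continuous_on S D2"
    using assms(1) unfolding C2_on_def by blast
  obtain E E2 where E: "\<forall>q\<in>S. (g has_derivative blinfun_apply (E q)) (at q within S) \<and>
               (E has_derivative blinfun_apply (E2 q)) (at q within S)" "continuous_on S E2"
    using assms(2) unfolding C2_on_def by blast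
  show ?thesis unfolding C2_on_def
  proof (intro exI[of _ "\<lambda>q. D q + E q"] exI[of _ "\<lambda>q. D2 q + E2 q"] conjI ballI)
    fix q assume q: "q \<in> S"
    show "((\<lambda>q. f q + g q) has_derivative blinfun_apply (D q + E q)) (at q within S)"
      using has_derivative_add[of f "blinfun_apply (D q)" "at q within S" g "blinfun_apply (E q)"] D E q
      by (simp add: plus_blinfun.rep_eq)
    show "((\<lambda>q. D q + E q) has_derivative blinfun_apply (D2 q + E2 q)) (at q within S)"
      using has_derivative_add[of D "blinfun_apply (D2 q)" "at q within S" E "blinfun_apply (E2 q)"] D E q
      by (simp add: plus_blinfun.rep_eq)
  qed (intro continuous_intros D E)
qed

lemma C2_on_cmult:
  assumes "C2_on S f"
  shows "C2_on S (\<lambda>q. c * f q)"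
proof -
  obtain D D2 where D: "\<forall>q\<in>S. (f has_derivative blinfun_apply (D q)) (at q within S) \<and>
               (D has_derivative blinfun_apply (D2 q)) (at q within S)" "continuous_on S D2"
    using assms(1) unfolding C2_on_def by blast
  show ?thesis unfolding C2_on_def
  proof (intro exI[of _ "\<lambda>q. c *\<^sub>R D q"] exI[of _ "\<lambda>q. c *\<^sub>R D2 q"] conjI ballI)
    fix q assume q: "q \<in> S"
    show "((\<lambda>q. c * f q) has_derivative blinfun_apply (c *\<^sub>R D q)) (at q within S)"
      using has_derivative_scaleR_right[of f "blinfun_apply (D q)" "at q within S" c] D q
      by (simp add: scaleR_blinfun.rep_eq)
    show "((\<lambda>q. c *\<^sub>R D q) has_derivative blinfun_apply (c *\<^sub>R D2 q)) (at q within S)"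
      using has_derivative_scaleR_right[of D "blinfun_apply (D2 q)" "at q within S" c] D q
      by (simp add: scaleR_blinfun.rep_eq)
  qed (intro continuous_intros D)
qed

lemma C2_on_uminus: "C2_on S f \<Longrightarrow> C2_on S (\<lambda>q. - f q)"
  using C2_on_cmult[of S f "-1"] by simp

lemma C2_on_sum: "finite I \<Longrightarrow> (\<And>i. i \<in> I \<Longrightarrow> C2_on S (f i)) \<Longrightarrow> C2_on S (\<lambda>q. \<Sum>i\<in>I. f i q)"
proof (induction I rule: finite_induct)
  case empty
  then show ?case by (simp add: C2_on_const)
next
  case (insert i I)
  then show ?case using C2_on_add[of S "f i" "\<lambda>q. \<Sum>i\<in>I. f i q"] by simp
qed

text \<open>By the chain rule the derivatives of a function of c \<bullet> q + b are multiples of c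
  and of its tensor square. The squares, the trigonometric functions and the localising function
  used later are sums of such ridge functions, so explicit second derivatives are computed in one
  real variable only.\<close>

lemma C2_on_ridge:
  fixes c :: "'e::real_inner"
  assumes h: "\<And>s. (h has_real_derivative h' s) (at s)" "\<And>s. (h' has_real_derivative h'' s) (at s)"
    and cont: "continuous_on UNIV h''"
  shows "C2_on S (\<lambda>q. h (c \<bullet> q + b))"
proof -
  define ic where "ic = blinfun_inner_right c"
  have ic: "blinfun_apply ic v = c \<bullet> v" for v by (simp add: ic_def)
  define M where "M = blinfun_scaleR_left ic o\<^sub>L ic"
  have M: "blinfun_apply M v = (c \<bullet> v) *\<^sub>R ic" for v by (simp add: M_def ic)
  have lin: "((\<lambda>q. c \<bullet> q + b) has_derivative (\<lambda>v. c \<bullet> v)) (at q within S)" for q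
    by (auto intro!: derivative_eq_intros)
  show ?thesis unfolding C2_on_def
  proof (intro exI[of _ "\<lambda>q. h' (c \<bullet> q + b) *\<^sub>R ic"] exI[of _ "\<lambda>q. h'' (c \<bullet> q + b) *\<^sub>R M"] conjI ballI)
    fix q assume q: "q \<in> S"
    have "((\<lambda>q. h (c \<bullet> q + b)) has_derivative (\<lambda>v. h' (c \<bullet> q + b) * (c \<bullet> v))) (at q within S)"
      using has_derivative_compose[OF lin[of q], of h] h(1)[of "c \<bullet> q + b", unfolded has_field_derivative_def] by blast
    then show "((\<lambda>q. h (c \<bullet> q + b)) has_derivative blinfun_apply (h' (c \<bullet> q + b) *\<^sub>R ic)) (at q within S)"
      by (simp add: scaleR_blinfun.rep_eq ic)
    have "((\<lambda>q. h' (c \<bullet> q + b)) has_derivative (\<lambda>v. h'' (c \<bullet> q + b) * (c \<bullet> v))) (at q within S)"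
      using has_derivative_compose[OF lin[of q], of h'] h(2)[of "c \<bullet> q + b", unfolded has_field_derivative_def] by blast
    from has_derivative_scaleR_left[OF this, of ic]
    show "((\<lambda>q. h' (c \<bullet> q + b) *\<^sub>R ic) has_derivative blinfun_apply (h'' (c \<bullet> q + b) *\<^sub>R M)) (at q within S)"
      by (simp add: scaleR_blinfun.rep_eq M)
  next
    have "continuous_on S (\<lambda>q. h'' (c \<bullet> q + b))"
      by (rule continuous_on_compose2[OF cont]) (auto intro!: continuous_intros)
    then show "continuous_on S (\<lambda>q. h'' (c \<bullet> q + b) *\<^sub>R M)" by (intro continuous_intros)
  qed
qed

lemma C2_on_affine:
  fixes A :: "'e::real_normed_vector \<Rightarrow> 'f::real_normed_vector"
  assumes f: "C2_on S' f" and A: "bounded_linear A" and sub: "\<And>q. q \<in> S \<Longrightarrow> A q + b \<in> S'"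
  shows "C2_on S (\<lambda>q. f (A q + b))"
proof -
  obtain D D2 where D: "\<And>q. q\<in>S' \<Longrightarrow> (f has_derivative blinfun_apply (D q)) (at q within S')"
       "\<And>q. q\<in>S' \<Longrightarrow> (D has_derivative blinfun_apply (D2 q)) (at q within S')" "continuous_on S' D2"
    using f unfolding C2_on_def by blast
  define L where "L = Blinfun A"
  have L: "blinfun_apply L = A" unfolding L_def by (rule bounded_linear_Blinfun_apply[OF A])
  have Lc: "bounded_linear (\<lambda>M :: 'f \<Rightarrow>\<^sub>L real. M o\<^sub>L L)"
    by (rule bounded_bilinear.bounded_linear_left[OF bounded_bilinear_blinfun_compose])
  \<comment> \<open>Precomposition with the linear part is itself a bounded linear map on operators,
    so the second derivative of the composite is \<open>R\<close> after \<open>D2\<close> after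
    \<open>L\<close>.\<close>
  define R where "R = Blinfun (\<lambda>M :: 'f \<Rightarrow>\<^sub>L real. M o\<^sub>L L)"
  have R: "blinfun_apply R = (\<lambda>M. M o\<^sub>L L)" unfolding R_def by (rule bounded_linear_Blinfun_apply[OF Lc])
  have lin: "((\<lambda>q. A q + b) has_derivative A) (at q within S)" for q
    using has_derivative_add_const[OF bounded_linear_imp_has_derivative[OF A]] by blast
  have sub': "(\<lambda>q. A q + b) ` S \<subseteq> S'" using sub by auto
  show ?thesis unfolding C2_on_def
  proof (intro exI[of _ "\<lambda>q. D (A q + b) o\<^sub>L L"] exI[of _ "\<lambda>q. R o\<^sub>L D2 (A q + b) o\<^sub>L L"] conjI ballI)
    fix q assume q: "q \<in> S"
    show "((\<lambda>q. f (A q + b)) has_derivative blinfun_apply (D (A q + b) o\<^sub>L L)) (at q within S)"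
      using has_derivative_in_compose2[OF D(1) sub' q lin] by (simp add: blinfun_compose.rep_eq L o_def)
    have "((\<lambda>q. D (A q + b)) has_derivative (\<lambda>v. D2 (A q + b) (A v))) (at q within S)"
      using has_derivative_in_compose2[OF D(2) sub' q lin] by simp
    from bounded_linear.has_derivative[OF Lc this]
    show "((\<lambda>q. D (A q + b) o\<^sub>L L) has_derivative blinfun_apply (R o\<^sub>L D2 (A q + b) o\<^sub>L L)) (at q within S)"
      by (simp add: blinfun_compose.rep_eq L R o_def)
  next
    have "continuous_on S (\<lambda>q. D2 (A q + b))"
      by (rule continuous_on_compose2[OF D(3)]) (use sub in \<open>auto intro!: continuous_intros bounded_linear.continuous_on[OF A]\<close>)
    then show "continuous_on S (\<lambda>q. R o\<^sub>L D2 (A q + b) o\<^sub>L L)"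
      by (intro bounded_bilinear.continuous_on[OF bounded_bilinear_blinfun_compose] continuous_on_const)
  qed
qed

section \<open>Gradients\<close>

lemma GDERIV_unique: "GDERIV f x :> p \<Longrightarrow> GDERIV f x :> q \<Longrightarrow> p = q" for f :: "'a::euclidean_space \<Rightarrow> real"
  unfolding gderiv_def using has_derivative_unique[of f "\<lambda>h. h \<bullet> p" x "\<lambda>h. h \<bullet> q"]
  by (metis inner_commute vector_eq_ldot)

lemma grad_eqI: "GDERIV f x :> p \<Longrightarrow> grad f x = p"
  unfolding grad_def by (rule the_equality) (auto intro: GDERIV_unique)

lemma GDERIV_cmult: "GDERIV f x :> p \<Longrightarrow> GDERIV (\<lambda>y. c * f y) x :> c *\<^sub>R p"
  unfolding gderiv_def inner_scaleR_right by (rule has_derivative_mult_right)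

lemma GDERIV_ridge:
  assumes "(h has_real_derivative h') (at (c \<bullet> x + b))"
  shows "GDERIV (\<lambda>y. h (c \<bullet> y + b)) x :> h' *\<^sub>R c"
proof -
  have "((\<lambda>q. c \<bullet> q + b) has_derivative (\<lambda>v. c \<bullet> v)) (at x)"
    by (auto intro!: derivative_eq_intros)
  from has_derivative_compose[OF this, of h "\<lambda>v. h' * v"] assms
  show ?thesis by (simp add: gderiv_def has_field_derivative_def inner_commute)
qed

lemma GDERIV_affine:
  assumes "GDERIV f (c *\<^sub>R x + b) :> p"
  shows "GDERIV (\<lambda>y. f (c *\<^sub>R y + b)) x :> c *\<^sub>R p"
proof -
  have "((\<lambda>q. c *\<^sub>R q + b) has_derivative (\<lambda>v. c *\<^sub>R v)) (at x)"
    by (auto intro!: derivative_eq_intros)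
  from has_derivative_compose[OF this assms[unfolded gderiv_def]]
  show ?thesis by (simp add: gderiv_def)
qed

text \<open>What the arguments use of a C2 function on \<open>QT T\<close>: P is the spatial
  gradient, Q the time derivative, one-sided at t = T, and the second derivatives survive only as a
  Taylor bound in space, uniform over base points in a compact set.\<close>

definition test_fn :: "real \<Rightarrow> ((real ^ 'n) \<times> real \<Rightarrow> real) \<Rightarrow> ((real ^ 'n) \<times> real \<Rightarrow> real ^ 'n) \<Rightarrow>
    ((real ^ 'n) \<times> real \<Rightarrow> real) \<Rightarrow> bool" where
  "test_fn T \<phi> P Q \<longleftrightarrow>
     C2_on (QT T) \<phi> \<and> continuous_on (QT T) \<phi> \<and> continuous_on (QT T) P \<and> continuous_on (QT T) Q \<and>
     (\<forall>x. \<forall>t\<in>{0<..T}. GDERIV (\<lambda>y. \<phi> (y, t)) x :> P (x, t) \<and>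
        ((\<lambda>s. \<phi> (x, s)) has_vector_derivative Q (x, t)) (at t within {0<..T})) \<and>
     (\<forall>C. compact C \<and> C \<subseteq> QT T \<longrightarrow>
        (\<exists>B\<ge>0. \<forall>(x, t)\<in>C. \<forall>z. norm z \<le> 1 \<longrightarrow> \<bar>\<phi> (x + z, t) - \<phi> (x, t) - P (x, t) \<bullet> z\<bar> \<le> B * (norm z)\<^sup>2))"

lemma C2_test_fn:
  fixes \<phi> :: "(real ^ 'n) \<times> real \<Rightarrow> real"
  assumes "C2_on (QT T) \<phi>"
  shows "\<exists>P Q. test_fn T \<phi> P Q"
proof -
  obtain D D2 where D: "\<And>q. q\<in>QT T \<Longrightarrow> (\<phi> has_derivative blinfun_apply (D q)) (at q within QT T)"
       "\<And>q. q\<in>QT T \<Longrightarrow> (D has_derivative blinfun_apply (D2 q)) (at q within QT T)" "continuous_on (QT T) D2"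
    using assms unfolding C2_on_def by blast
  define P where "P q = (\<Sum>b\<in>Basis. D q (b, 0) *\<^sub>R b)" for q
  define Q where "Q q = D q (0, 1)" for q
  have P: "P q \<bullet> h = D q (h, 0)" for q h
  proof -
    have l: "linear (\<lambda>h. D q (h, 0))"
      by (intro bounded_linear.linear blinfun.bounded_linear_right[THEN bounded_linear_compose] bounded_linear_Pair bounded_linear_ident bounded_linear_zero)
    have "P q \<bullet> h = (\<Sum>b\<in>Basis. (h \<bullet> b) * D q (b, 0))"
      unfolding P_def inner_sum_left inner_scaleR_left by (simp add: inner_commute mult.commute)
    also have "\<dots> = D q (\<Sum>b\<in>Basis. (h \<bullet> b) *\<^sub>R b, 0)"
      using linear_sum[OF l, of "\<lambda>b. (h \<bullet> b) *\<^sub>R b" Basis] linear_cmul[OF l] by simp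
    finally show ?thesis by (simp add: euclidean_representation)
  qed
  have contD: "continuous_on (QT T) D"
    by (rule has_derivative_continuous_on[OF D(2)])
  have contphi: "continuous_on (QT T) \<phi>"
    by (rule has_derivative_continuous_on[OF D(1)])
  have slice: "(f has_derivative F) (at (x, t) within QT T) \<Longrightarrow> t \<in> {0<..T} \<Longrightarrow>
      ((\<lambda>y. f (y, t)) has_derivative (\<lambda>h. F (h, 0))) (at x within S)"
    for f :: "(real ^ 'n) \<times> real \<Rightarrow> 'c::real_normed_vector" and F x t S
  proof -
    assume f: "(f has_derivative F) (at (x, t) within QT T)" and t: "t \<in> {0<..T}"
    have 1: "((\<lambda>y. (y, t)) has_derivative (\<lambda>h. (h, 0))) (at x within S)"
      by (auto intro!: derivative_eq_intros)
    have 2: "(f has_derivative F) (at (x, t) within (\<lambda>y. (y, t)) ` S)"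
      by (rule has_derivative_subset[OF f]) (use t in \<open>auto simp: QT_def\<close>)
    from has_derivative_in_compose[OF 1 2] show ?thesis .
  qed
  have "test_fn T \<phi> P Q"
    unfolding test_fn_def
  proof (intro conjI allI ballI impI)
    show "continuous_on (QT T) P" "continuous_on (QT T) Q"
      unfolding P_def[abs_def] Q_def[abs_def] by (intro continuous_intros contD)+
    fix x :: "real^'n" and t assume t: "t \<in> {0<..T}"
    then have q: "(x, t) \<in> QT T" by (simp add: QT_def)
    show "GDERIV (\<lambda>y. \<phi> (y, t)) x :> P (x, t)"
      unfolding gderiv_def using slice[OF D(1)[OF q] t, of UNIV] by (simp add: P[symmetric] inner_commute)
    have 1: "((\<lambda>s. (x, s)) has_derivative (\<lambda>h. (0, h))) (at t within {0<..T})"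
      by (auto intro!: derivative_eq_intros)
    have 2: "(\<phi> has_derivative D (x, t)) (at (x, t) within (\<lambda>s. (x, s)) ` {0<..T})"
      by (rule has_derivative_subset[OF D(1)[OF q]]) (auto simp: QT_def)
    have "D (x, t) (0, h) = h *\<^sub>R Q (x, t)" for h unfolding Q_def
      using blinfun.scaleR_right[of "D (x, t)" h "(0, 1)"] by simp
    then show "((\<lambda>s. \<phi> (x, s)) has_vector_derivative Q (x, t)) (at t within {0<..T})"
      using has_derivative_in_compose[OF 1 2] by (simp add: has_vector_derivative_def)
  next
    fix C :: "((real ^ 'n) \<times> real) set" assume C: "compact C \<and> C \<subseteq> QT T"
    \<comment> \<open>Translations in space stay in \<open>QT T\<close>, so the second derivative is
      bounded on this larger compact set, which contains all the spatial balls used below.\<close>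
    define C' where "C' = (\<lambda>(q, z). (fst q + z, snd q)) ` (C \<times> cball 0 1)"
    have "compact C'" unfolding C'_def case_prod_beta
      using C by (intro compact_continuous_image compact_Times continuous_intros) auto
    moreover have "C' \<subseteq> QT T" using C by (auto simp: C'_def QT_def)
    ultimately have "compact (D2 ` C')"
      by (intro compact_continuous_image continuous_on_subset[OF D(3)])
    then obtain B where B: "B > 0" "\<And>q. q \<in> C' \<Longrightarrow> norm (D2 q) \<le> B"
      using compact_imp_bounded bounded_pos by (metis imageI)
    have "\<bar>\<phi> (x + z, t) - \<phi> (x, t) - P (x, t) \<bullet> z\<bar> \<le> B * (norm z)\<^sup>2"
      if xt: "(x, t) \<in> C" and z: "norm z \<le> 1" for x t z
    proof -
      have t: "t \<in> {0<..T}" using xt C by (auto simp: QT_def)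
      define S where "S = cball x (norm z)"
      have inC: "(w, t) \<in> C'" if "w \<in> S" for w
      proof -
        have "norm (w - x) \<le> 1" using that z by (simp add: S_def dist_norm norm_minus_commute)
        then show ?thesis unfolding C'_def using xt
          by (intro image_eqI[of _ _ "((x, t), w - x)"]) auto
      qed
      have inQ: "(w, t) \<in> QT T" for w using t by (simp add: QT_def)
      have x: "x \<in> S" "x + z \<in> S" by (auto simp: S_def dist_norm)
      \<comment> \<open>The mean value inequality is applied twice: here to the derivative, and then
        to \<open>g\<close>, the function minus its linear part, whose derivative is the difference
        estimated here.\<close>
      have b1: "norm (D (w, t) - D (x, t)) \<le> B * norm z" if w: "w \<in> S" for w
      proof -
        have "norm (D (w, t) - D (x, t)) \<le> B * norm (w - x)"
        proof (rule differentiable_bound[where S=S and f'="\<lambda>w h. D2 (w, t) (h, 0)"])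
          show "convex S" by (simp add: S_def)
          show "((\<lambda>y. D (y, t)) has_derivative (\<lambda>h. D2 (v, t) (h, 0))) (at v within S)" for v
            by (rule slice[OF D(2)[OF inQ] t])
          fix v assume "v \<in> S"
          show "onorm (\<lambda>h. D2 (v, t) (h, 0)) \<le> B"
          proof (rule onorm_le)
            fix h :: "real^'n"
            have "norm (D2 (v, t) (h, 0)) \<le> norm (D2 (v, t)) * norm (h, 0::real)" by (rule norm_blinfun)
            also have "\<dots> \<le> B * norm h"
              using less_imp_le[OF B(1)] B(2)[OF inC[OF \<open>v \<in> S\<close>]] by (intro mult_mono) (auto simp: norm_Pair)
            finally show "norm (D2 (v, t) (h, 0)) \<le> B * norm h" .
          qed
        qed (use w x in auto)
        also have "\<dots> \<le> B * norm z" using w B(1) by (intro mult_left_mono) (auto simp: S_def dist_norm norm_minus_commute)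
        finally show ?thesis .
      qed
      define g where "g w = \<phi> (w, t) - D (x, t) (w, 0)" for w
      have "norm (g (x + z) - g x) \<le> (B * norm z) * norm (x + z - x)"
      proof (rule differentiable_bound[where S=S and f'="\<lambda>w h. (D (w, t) - D (x, t)) (h, 0)"])
        show "convex S" by (simp add: S_def)
        show "(g has_derivative (\<lambda>h. (D (v, t) - D (x, t)) (h, 0))) (at v within S)" for v
          unfolding g_def[abs_def]
          by (auto intro!: derivative_eq_intros slice[OF D(1)[OF inQ] t] simp: minus_blinfun.rep_eq)
        fix v assume "v \<in> S"
        show "onorm (\<lambda>h. (D (v, t) - D (x, t)) (h, 0)) \<le> B * norm z"
        proof (rule onorm_le)
          fix h :: "real^'n"
          have "norm ((D (v, t) - D (x, t)) (h, 0)) \<le> norm (D (v, t) - D (x, t)) * norm (h, 0::real)" by (rule norm_blinfun)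
          also have "\<dots> \<le> (B * norm z) * norm h"
            using less_imp_le[OF B(1)] b1[OF \<open>v \<in> S\<close>] by (intro mult_mono) (auto simp: norm_Pair)
          finally show "norm ((D (v, t) - D (x, t)) (h, 0)) \<le> B * norm z * norm h" .
        qed
      qed (use x in auto)
      moreover have "g (x + z) - g x = \<phi> (x + z, t) - \<phi> (x, t) - P (x, t) \<bullet> z"
        using blinfun.add_right[of "D (x, t)" "(x, 0)" "(z, 0)"] by (simp add: g_def P)
      ultimately show ?thesis by (simp add: power2_eq_square mult.assoc)
    qed
    then show "\<exists>B\<ge>0. \<forall>(x, t)\<in>C. \<forall>z. norm z \<le> 1 \<longrightarrow> \<bar>\<phi> (x + z, t) - \<phi> (x, t) - P (x, t) \<bullet> z\<bar> \<le> B * (norm z)\<^sup>2"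
      using B(1) by (intro exI[of _ B]) auto
  qed (use assms contphi in auto)
  then show ?thesis by blast
qed

text \<open>Global smoothness with a single constant L for values, gradient and Taylor remainder.
  The remainder is measured by \<open>wt\<close> with the gradient subtracted on all of space, so it
  can be integrated against a Levy kernel without a cutoff.\<close>

definition nice :: "(real ^ 'n \<Rightarrow> real) \<Rightarrow> (real ^ 'n \<Rightarrow> real ^ 'n) \<Rightarrow> real \<Rightarrow> bool" where
  "nice \<psi> P L \<longleftrightarrow> 0 \<le> L \<and> C2_on UNIV \<psi> \<and> continuous_on UNIV \<psi> \<and> continuous_on UNIV P \<and>
     (\<forall>y. GDERIV \<psi> y :> P y \<and> \<bar>\<psi> y\<bar> \<le> L \<and> norm (P y) \<le> L \<and>
       (\<forall>z. \<bar>\<psi> (y + z) - \<psi> y - P y \<bullet> z\<bar> \<le> L * wt z))"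

lemma nice_const: "nice (\<lambda>_. c) (\<lambda>_. 0) \<bar>c\<bar>"
  unfolding nice_def by (auto intro: C2_on_const GDERIV_const)

lemma nice_add:
  assumes "nice \<psi> P L" "nice \<psi>' P' L'"
  shows "nice (\<lambda>y. \<psi> y + \<psi>' y) (\<lambda>y. P y + P' y) (L + L')"
  unfolding nice_def
proof (intro conjI allI)
  fix y z
  have "\<bar>\<psi> (y + z) - \<psi> y - P y \<bullet> z\<bar> \<le> L * wt z" "\<bar>\<psi>' (y + z) - \<psi>' y - P' y \<bullet> z\<bar> \<le> L' * wt z"
    using assms unfolding nice_def by auto
  then show "\<bar>\<psi> (y + z) + \<psi>' (y + z) - (\<psi> y + \<psi>' y) - (P y + P' y) \<bullet> z\<bar> \<le> (L + L') * wt z"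
    by (simp add: inner_add_left distrib_right abs_le_iff)
  show "norm (P y + P' y) \<le> L + L'" using assms unfolding nice_def by (intro norm_triangle_mono) auto
  have "\<bar>\<psi> y\<bar> \<le> L" "\<bar>\<psi>' y\<bar> \<le> L'" using assms unfolding nice_def by auto
  then show "\<bar>\<psi> y + \<psi>' y\<bar> \<le> L + L'" by linarith
qed (use assms in \<open>auto simp: nice_def intro!: C2_on_add GDERIV_add continuous_intros\<close>)

lemma nice_cmult:
  assumes "nice \<psi> P L"
  shows "nice (\<lambda>y. c * \<psi> y) (\<lambda>y. c *\<^sub>R P y) (\<bar>c\<bar> * L)"
  unfolding nice_def
proof (intro conjI allI)
  fix y z
  have "\<bar>\<psi> (y + z) - \<psi> y - P y \<bullet> z\<bar> \<le> L * wt z"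
    using assms unfolding nice_def by auto
  from mult_left_mono[OF this, of "\<bar>c\<bar>"]
  show "\<bar>c * \<psi> (y + z) - c * \<psi> y - (c *\<^sub>R P y) \<bullet> z\<bar> \<le> \<bar>c\<bar> * L * wt z"
    by (simp add: abs_mult[symmetric] algebra_simps)
qed (use assms in \<open>auto simp: nice_def abs_mult intro!: C2_on_cmult GDERIV_cmult continuous_intros mult_left_mono\<close>)

lemma nice_sum:
  assumes "finite I" "\<And>i. i \<in> I \<Longrightarrow> nice (f i) (P i) (L i)"
  shows "nice (\<lambda>y. \<Sum>i\<in>I. f i y) (\<lambda>y. \<Sum>i\<in>I. P i y) (\<Sum>i\<in>I. L i)"
  using assms
proof (induction I rule: finite_induct)
  case empty
  then show ?case using nice_const[of 0] by simp
next
  case (insert i I)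
  have "nice (\<lambda>y. f i y + (\<Sum>i\<in>I. f i y)) (\<lambda>y. P i y + (\<Sum>i\<in>I. P i y)) (L i + (\<Sum>i\<in>I. L i))"
    using insert by (intro nice_add) auto
  then show ?case using insert by simp
qed

lemma taylor2_real:
  fixes h :: "real \<Rightarrow> real"
  assumes h: "\<And>s. (h has_real_derivative h' s) (at s)" "\<And>s. (h' has_real_derivative h'' s) (at s)"
    and b: "\<And>s. \<bar>h'' s\<bar> \<le> L"
  shows "\<bar>h (s + r) - h s - h' s * r\<bar> \<le> L * r\<^sup>2"
proof -
  have 1: "\<bar>h' v - h' s\<bar> \<le> L * \<bar>v - s\<bar>" for v
    using field_differentiable_bound[of UNIV h' h'' L v s] h(2) b by simp
  have 2: "norm ((h (s + r) - h' s * (s + r)) - (h s - h' s * s)) \<le> (L * \<bar>r\<bar>) * norm (s + r - s)"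
  proof (rule field_differentiable_bound[where S="cball s \<bar>r\<bar>" and f="\<lambda>v. h v - h' s * v" and f'="\<lambda>v. h' v - h' s"])
    show "((\<lambda>v. h v - h' s * v) has_field_derivative h' z - h' s) (at z within cball s \<bar>r\<bar>)" for z
      by (auto intro!: derivative_eq_intros has_field_derivative_at_within[OF h(1)])
    fix z assume "z \<in> cball s \<bar>r\<bar>"
    then have "\<bar>z - s\<bar> \<le> \<bar>r\<bar>" by (simp add: dist_real_def abs_minus_commute)
    moreover have "0 \<le> L" using b[of 0] by linarith
    ultimately have "L * \<bar>z - s\<bar> \<le> L * \<bar>r\<bar>" by (rule mult_left_mono)
    then show "norm (h' z - h' s) \<le> L * \<bar>r\<bar>" using 1[of z] by simp
  qed (auto simp: dist_real_def)
  then show ?thesis by (simp add: algebra_simps power2_eq_square abs_mult)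
qed

lemma nice_ridge:
  fixes c :: "real ^ 'n"
  assumes h: "\<And>s. (h has_real_derivative h' s) (at s)" "\<And>s. (h' has_real_derivative h'' s) (at s)"
    and cont: "continuous_on UNIV h''"
    and b: "\<And>s. \<bar>h s\<bar> \<le> L" "\<And>s. \<bar>h' s\<bar> \<le> L" "\<And>s. \<bar>h'' s\<bar> \<le> L"
  shows "\<exists>L'. nice (\<lambda>y. h (c \<bullet> y + b)) (\<lambda>y. h' (c \<bullet> y + b) *\<^sub>R c) L'"
proof -
  have L: "0 \<le> L" using b(1)[of 0] by linarith
  \<comment> \<open>The summand 1 pays for the values, 2 |c| for the gradient and for the remainder
    at large |z|, and |c|^2 for the second order remainder near 0.\<close>
  define L' where "L' = L * (1 + 2 * norm c + (norm c)\<^sup>2)"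
  have sq: "\<bar>c \<bullet> z\<bar> \<le> norm c * norm z" for z by (rule Cauchy_Schwarz_ineq2)
  have hc: "continuous_on UNIV h" "continuous_on UNIV h'"
    using h by (auto intro!: DERIV_continuous_on intro: has_field_derivative_at_within)
  have "nice (\<lambda>y. h (c \<bullet> y + b)) (\<lambda>y. h' (c \<bullet> y + b) *\<^sub>R c) L'"
    unfolding nice_def
  proof (intro conjI allI)
    show "0 \<le> L'" using L by (simp add: L'_def)
    show "C2_on UNIV (\<lambda>y. h (c \<bullet> y + b))" by (rule C2_on_ridge[OF h cont])
    show "continuous_on UNIV (\<lambda>y. h (c \<bullet> y + b))"
      by (rule continuous_on_compose2[OF hc(1)]) (auto intro!: continuous_intros)
    have "continuous_on UNIV (\<lambda>y. h' (c \<bullet> y + b))"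
      by (rule continuous_on_compose2[OF hc(2)]) (auto intro!: continuous_intros)
    then show "continuous_on UNIV (\<lambda>y. h' (c \<bullet> y + b) *\<^sub>R c)" by (intro continuous_intros)
    fix y :: "real^'n"
    show "GDERIV (\<lambda>y. h (c \<bullet> y + b)) y :> h' (c \<bullet> y + b) *\<^sub>R c" by (rule GDERIV_ridge[OF h(1)])
    have "L * 1 \<le> L'" unfolding L'_def by (rule mult_left_mono[OF _ L]) auto
    then show "\<bar>h (c \<bullet> y + b)\<bar> \<le> L'" using b(1)[of "c \<bullet> y + b"] by linarith
    have "\<bar>h' (c \<bullet> y + b)\<bar> * norm c \<le> L * norm c" by (intro mult_right_mono b) auto
    also have "\<dots> \<le> L'" unfolding L'_def by (rule mult_left_mono[OF _ L]) auto
    finally show "norm (h' (c \<bullet> y + b) *\<^sub>R c) \<le> L'" by simp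
    fix z
    define s where "s = c \<bullet> y + b"
    define r where "r = c \<bullet> z"
    have e: "h (c \<bullet> (y + z) + b) - h (c \<bullet> y + b) - h' (c \<bullet> y + b) *\<^sub>R c \<bullet> z = h (s + r) - h s - h' s * r"
      by (simp add: s_def r_def inner_add_right algebra_simps)
    have "\<bar>h (s + r) - h s - h' s * r\<bar> \<le> L * r\<^sup>2" by (rule taylor2_real[OF h b(3)])
    also have "\<dots> \<le> L * (norm c * norm z)\<^sup>2"
      using sq[of z] L by (intro mult_left_mono) (auto simp: r_def abs_le_square_iff[symmetric])
    also have "\<dots> \<le> L' * (norm z)\<^sup>2"
      unfolding L'_def power_mult_distrib mult.assoc
      by (intro mult_left_mono[OF _ L] mult_right_mono) auto
    finally have 1: "\<bar>h (s + r) - h s - h' s * r\<bar> \<le> L' * (norm z)\<^sup>2" .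
    have "\<bar>h (s + r) - h s\<bar> \<le> L * \<bar>r\<bar>"
      using field_differentiable_bound[of UNIV h h' L "s + r" s] h(1) b(2) by simp
    moreover have "\<bar>h' s * r\<bar> \<le> L * \<bar>r\<bar>" using b(2)[of s] by (simp add: abs_mult mult_right_mono)
    ultimately have "\<bar>h (s + r) - h s - h' s * r\<bar> \<le> L * (2 * \<bar>r\<bar>)" by linarith
    also have "\<dots> \<le> L * ((1 + 2 * norm c + (norm c)\<^sup>2) * norm z)"
    proof (intro mult_left_mono L)
      have "2 * \<bar>r\<bar> \<le> (2 * norm c) * norm z" using sq[of z] by (simp add: r_def)
      also have "\<dots> \<le> (1 + 2 * norm c + (norm c)\<^sup>2) * norm z" by (intro mult_right_mono) auto
      finally show "2 * \<bar>r\<bar> \<le> (1 + 2 * norm c + (norm c)\<^sup>2) * norm z" .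
    qed
    finally have 2: "\<bar>h (s + r) - h s - h' s * r\<bar> \<le> L' * norm z" by (simp add: L'_def mult.assoc)
    show "\<bar>h (c \<bullet> (y + z) + b) - h (c \<bullet> y + b) - h' (c \<bullet> y + b) *\<^sub>R c \<bullet> z\<bar> \<le> L' * wt z"
      unfolding e using 1 2 by (simp add: wt_def min_def)
  qed
  then show ?thesis by blast
qed

text \<open>The quadratic branch of the minimum would allow a factor \<beta>^2, the linear branch
  only \<beta>; for \<beta> \<le> 1 the latter serves both.\<close>

lemma wt_scale: "0 \<le> \<beta> \<Longrightarrow> \<beta> \<le> 1 \<Longrightarrow> wt (\<beta> *\<^sub>R z) \<le> \<beta> * wt z"
proof -
  assume b: "0 \<le> \<beta>" "\<beta> \<le> 1"
  have "\<beta>\<^sup>2 * (norm z)\<^sup>2 \<le> \<beta> * (norm z)\<^sup>2"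
    using b mult_left_le[of \<beta> \<beta>] by (intro mult_right_mono) (auto simp: power2_eq_square)
  then show ?thesis using b by (auto simp: wt_def min_def power_mult_distrib)
qed

lemma nice_affine:
  assumes "nice \<psi> P L" "0 \<le> \<beta>" "\<beta> \<le> 1"
  shows "C2_on UNIV (\<lambda>y. \<psi> (\<beta> *\<^sub>R y + b))" "GDERIV (\<lambda>y. \<psi> (\<beta> *\<^sub>R y + b)) y :> \<beta> *\<^sub>R P (\<beta> *\<^sub>R y + b)"
    "norm (\<beta> *\<^sub>R P (\<beta> *\<^sub>R y + b)) \<le> \<beta> * L" "continuous_on UNIV (\<lambda>y. \<psi> (\<beta> *\<^sub>R y + b))"
    "\<bar>\<psi> (\<beta> *\<^sub>R (y + z) + b) - \<psi> (\<beta> *\<^sub>R y + b) - (\<beta> *\<^sub>R P (\<beta> *\<^sub>R y + b)) \<bullet> z\<bar> \<le> \<beta> * L * wt z"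
proof -
  note n = assms(1)[unfolded nice_def]
  show "C2_on UNIV (\<lambda>y. \<psi> (\<beta> *\<^sub>R y + b))"
    using n by (intro C2_on_affine[where S'=UNIV] bounded_linear_scaleR_right) auto
  show "GDERIV (\<lambda>y. \<psi> (\<beta> *\<^sub>R y + b)) y :> \<beta> *\<^sub>R P (\<beta> *\<^sub>R y + b)"
    using n by (intro GDERIV_affine) auto
  show "norm (\<beta> *\<^sub>R P (\<beta> *\<^sub>R y + b)) \<le> \<beta> * L"
    using n assms by (auto intro!: mult_left_mono)
  show "continuous_on UNIV (\<lambda>y. \<psi> (\<beta> *\<^sub>R y + b))"
    by (rule continuous_on_compose2[of UNIV \<psi>]) (use n in \<open>auto intro!: continuous_intros\<close>)
  have "\<bar>\<psi> (\<beta> *\<^sub>R (y + z) + b) - \<psi> (\<beta> *\<^sub>R y + b) - (\<beta> *\<^sub>R P (\<beta> *\<^sub>R y + b)) \<bullet> z\<bar>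
     = \<bar>\<psi> ((\<beta> *\<^sub>R y + b) + \<beta> *\<^sub>R z) - \<psi> (\<beta> *\<^sub>R y + b) - P (\<beta> *\<^sub>R y + b) \<bullet> (\<beta> *\<^sub>R z)\<bar>"
    by (simp add: algebra_simps)
  also have "\<dots> \<le> L * wt (\<beta> *\<^sub>R z)" using n by blast
  also have "\<dots> \<le> L * (\<beta> * wt z)" using n assms by (intro mult_left_mono wt_scale) auto
  finally show "\<bar>\<psi> (\<beta> *\<^sub>R (y + z) + b) - \<psi> (\<beta> *\<^sub>R y + b) - (\<beta> *\<^sub>R P (\<beta> *\<^sub>R y + b)) \<bullet> z\<bar> \<le> \<beta> * L * wt z"
    by (simp add: mult.commute mult.left_commute)
qed

text \<open>Outside the unit ball the compensator is absent from \<open>comp_incr\<close> but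
  present in the Taylor remainder; adding it back costs a second \<beta> L \<open>wt\<close>. The
  factor \<beta> makes the localising functions used later negligible in Levy integrals.\<close>

lemma nice_incr:
  assumes "nice \<psi> P L" "0 \<le> \<beta>" "\<beta> \<le> 1"
  shows "\<bar>comp_incr (\<beta> *\<^sub>R P (\<beta> *\<^sub>R y + b)) (\<lambda>z. \<psi> (\<beta> *\<^sub>R (y + z) + b) - \<psi> (\<beta> *\<^sub>R y + b)) z\<bar> \<le> 2 * \<beta> * L * wt z"
    and "(\<lambda>z. \<psi> (\<beta> *\<^sub>R (y + z) + b) - \<psi> (\<beta> *\<^sub>R y + b)) \<in> borel_measurable lebesgue"
proof -
  note A = nice_affine[OF assms, where b=b]
  have L0: "0 \<le> L" using assms(1) by (simp add: nice_def)
  show "\<bar>comp_incr (\<beta> *\<^sub>R P (\<beta> *\<^sub>R y + b)) (\<lambda>z. \<psi> (\<beta> *\<^sub>R (y + z) + b) - \<psi> (\<beta> *\<^sub>R y + b)) z\<bar> \<le> 2 * \<beta> * L * wt z"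
  proof (cases "norm z < 1")
    case True
    have "0 \<le> \<beta> * L * wt z" using L0 assms by simp
    then show ?thesis using A(5)[of y z] True by (simp add: comp_incr_def)
  next
    case False
    have "\<bar>(\<beta> *\<^sub>R P (\<beta> *\<^sub>R y + b)) \<bullet> z\<bar> \<le> norm (\<beta> *\<^sub>R P (\<beta> *\<^sub>R y + b)) * norm z" by (rule Cauchy_Schwarz_ineq2)
    also have "\<dots> \<le> \<beta> * L * norm z" by (intro mult_right_mono A(3)) auto
    finally show ?thesis using A(5)[of y z] False by (simp add: comp_incr_def wt_ge_1)
  qed
  have "continuous_on UNIV (\<lambda>z. \<psi> (\<beta> *\<^sub>R (y + z) + b) - \<psi> (\<beta> *\<^sub>R y + b))"
    by (intro continuous_intros continuous_on_compose2[OF A(4), of UNIV "\<lambda>z. y + z"]) auto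
  then show "(\<lambda>z. \<psi> (\<beta> *\<^sub>R (y + z) + b) - \<psi> (\<beta> *\<^sub>R y + b)) \<in> borel_measurable lebesgue"
    by (intro lebesgue_measurable_borel borel_measurable_continuous_onI)
qed

lemma C2_on_fst: "C2_on UNIV \<psi> \<Longrightarrow> C2_on S (\<lambda>q :: 'a::real_normed_vector \<times> real. \<psi> (fst q))"
  using C2_on_affine[of UNIV \<psi> fst S 0] bounded_linear_fst by simp

lemma C2_on_snd: "C2_on UNIV \<psi> \<Longrightarrow> C2_on S (\<lambda>q :: 'a::real_normed_vector \<times> real. \<psi> (snd q))"
  using C2_on_affine[of UNIV \<psi> snd S 0] bounded_linear_snd by simp

lemma C2_on_sq: "C2_on S (\<lambda>s::real. c * (s - b)\<^sup>2)"
proof -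
  have "C2_on S (\<lambda>q. (\<lambda>s. c * s\<^sup>2) ((1::real) \<bullet> q + (-b)))"
    by (rule C2_on_ridge[where h'="\<lambda>s. c * (2 * s)" and h''="\<lambda>s. c * 2"]) (auto intro!: derivative_eq_intros)
  then show ?thesis by simp
qed

lemma C2_on_linear: "C2_on S (\<lambda>s::real. c * s)"
proof -
  have "C2_on S (\<lambda>q. (\<lambda>s. c * s) ((1::real) \<bullet> q + 0))"
    by (rule C2_on_ridge[where h'="\<lambda>s. c" and h''="\<lambda>s. 0"]) (auto intro!: derivative_eq_intros)
  then show ?thesis by simp
qed

lemma C2_on_norm_sq: "C2_on S (\<lambda>y::real^'n. c * (norm (y - b))\<^sup>2)"
proof -
  have e: "c * (norm (y - b))\<^sup>2 = (\<Sum>i\<in>UNIV. c * (axis i 1 \<bullet> y + (- b $ i))\<^sup>2)" for y :: "real^'n"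
    unfolding power2_norm_eq_inner inner_axis' by (simp add: inner_vec_def power2_eq_square sum_distrib_left)
  have "C2_on S (\<lambda>q. (\<lambda>s. c * s\<^sup>2) (axis i 1 \<bullet> q + (- b $ i)))" for i
    by (rule C2_on_ridge[where h'="\<lambda>s. c * (2 * s)" and h''="\<lambda>s. c * 2"]) (auto intro!: derivative_eq_intros)
  then show ?thesis unfolding e by (intro C2_on_sum) auto
qed

lemma GDERIV_norm_sq: "GDERIV (\<lambda>y. c * (norm (y - b))\<^sup>2) x :> (2 * c) *\<^sub>R (x - b)"
  unfolding gderiv_def power2_norm_eq_inner
  by (auto intro!: derivative_eq_intros simp: inner_commute algebra_simps)

section \<open>Semicontinuity and viscosity inequalities\<close>

lemma usc_on_iff_openin:
  "usc_on S u \<longleftrightarrow> (\<forall>c. openin (top_of_set S) {q\<in>S. u q < c})" (is "?l \<longleftrightarrow> ?r")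
proof
  assume l: ?l
  show ?r
  proof
    fix c
    have "\<exists>A. openin (top_of_set S) A \<and> q \<in> A \<and> A \<subseteq> {q\<in>S. u q < c}" if "q \<in> {q\<in>S. u q < c}" for q
    proof -
      have "\<forall>\<^sub>F r in at q within S. u r < c" using l that unfolding usc_on_def by blast
      then obtain U where U: "open U" "q \<in> U" "\<And>y. y \<in> U \<Longrightarrow> y \<noteq> q \<Longrightarrow> y \<in> S \<Longrightarrow> u y < c"
        unfolding eventually_at_topological by blast
      then show ?thesis using that by (intro exI[of _ "S \<inter> U"]) auto
    qed
    then show "openin (top_of_set S) {q\<in>S. u q < c}" by (subst openin_subopen) blast
  qed
next
  assume r: ?r
  show ?l unfolding usc_on_def
  proof (intro ballI allI impI)
    fix q c assume q: "q \<in> S" "u q < c"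
    obtain U where U: "open U" "{q\<in>S. u q < c} = S \<inter> U" using r unfolding openin_open by blast
    have "q \<in> U" using q U by blast
    moreover have "\<And>y. y \<in> U \<Longrightarrow> y \<in> S \<Longrightarrow> u y < c" using U by blast
    ultimately show "\<forall>\<^sub>F r in at q within S. u r < c"
      unfolding eventually_at_topological using U(1) by blast
  qed
qed

lemma lsc_on_iff_usc_on: "lsc_on S u \<longleftrightarrow> usc_on S (\<lambda>q. - u q)"
proof -
  have a: "(\<forall>c. P (- c)) \<longleftrightarrow> (\<forall>c. P c)" for P :: "real \<Rightarrow> bool"
    by (metis minus_minus)
  have "(\<forall>c<u q. \<forall>\<^sub>F r in at q within S. c < u r) \<longleftrightarrow> (\<forall>c>- u q. \<forall>\<^sub>F r in at q within S. - u r < c)" for q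
    using a[of "\<lambda>c. c < u q \<longrightarrow> (\<forall>\<^sub>F r in at q within S. c < u r)"] by (simp add: minus_less_iff)
  then show ?thesis unfolding lsc_on_def usc_on_def by simp
qed

lemma usc_on_continuous: "continuous_on S u \<Longrightarrow> usc_on S u"
  unfolding usc_on_def continuous_on_def by (auto dest: order_tendstoD(2))

lemma lsc_on_continuous: "continuous_on S u \<Longrightarrow> lsc_on S u"
  unfolding lsc_on_def continuous_on_def by (auto dest: order_tendstoD(1))

lemma usc_on_add:
  assumes "usc_on S u" "usc_on S v"
  shows "usc_on S (\<lambda>q. u q + v q)"
  unfolding usc_on_def
proof (intro ballI allI impI)
  fix q c assume q: "q \<in> S" "u q + v q < c"
  define e where "e = (c - u q - v q) / 2"
  have e: "0 < e" using q by (simp add: e_def)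
  have "\<forall>\<^sub>F r in at q within S. u r < u q + e" "\<forall>\<^sub>F r in at q within S. v r < v q + e"
    using assms q e unfolding usc_on_def by auto
  then show "\<forall>\<^sub>F r in at q within S. u r + v r < c"
  proof eventually_elim
    case (elim r)
    then show ?case by (simp add: e_def field_simps)
  qed
qed

lemma usc_on_cmult:
  assumes "usc_on S u" "0 < (k::real)"
  shows "usc_on S (\<lambda>q. k * u q)"
proof -
  have "{q\<in>S. k * u q < c} = {q\<in>S. u q < c / k}" for c using assms(2) by (auto simp: field_simps)
  then show ?thesis using assms(1) unfolding usc_on_iff_openin by simp
qed

lemma usc_on_compose:
  assumes "usc_on S u" "continuous_on S' g" "g ` S' \<subseteq> S"
  shows "usc_on S' (\<lambda>q. u (g q))"
  unfolding usc_on_iff_openin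
proof
  fix c
  have "openin (top_of_set S') (S' \<inter> g -` {q\<in>S. u q < c})"
    by (rule continuous_openin_preimage[OF assms(2), of S]) (use assms in \<open>auto simp: usc_on_iff_openin\<close>)
  moreover have "S' \<inter> g -` {q\<in>S. u q < c} = {q \<in> S'. u (g q) < c}" using assms(3) by auto
  ultimately show "openin (top_of_set S') {q \<in> S'. u (g q) < c}" by simp
qed

lemma usc_on_subset: "usc_on S u \<Longrightarrow> S' \<subseteq> S \<Longrightarrow> usc_on S' u"
  using usc_on_compose[of S u S' "\<lambda>q. q"] by auto

text \<open>Without a maximum the relatively open sets {u < u r} would cover S. Among finitely many
  of them the one with the largest u r contains the others, and this r escapes it.\<close>

lemma usc_on_attains_sup:
  assumes "compact S" "S \<noteq> {}" "usc_on S u"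
  shows "\<exists>q\<in>S. \<forall>r\<in>S. u r \<le> u q"
proof (rule ccontr)
  assume n: "\<not> ?thesis"
  define \<C> where "\<C> = (\<lambda>r. {q\<in>S. u q < u r}) ` S"
  have "\<forall>c\<in>\<C>. openin (top_of_set S) c" using assms(3) by (auto simp: \<C>_def usc_on_iff_openin)
  moreover have "S \<subseteq> \<Union>\<C>" using n by (force simp: \<C>_def not_le)
  ultimately obtain D where D: "D \<subseteq> \<C>" "finite D" "S \<subseteq> \<Union>D"
    using assms(1)[unfolded compact_eq_openin_cover] by metis
  obtain R where R: "R \<subseteq> S" "finite R" "D = (\<lambda>r. {q\<in>S. u q < u r}) ` R"
    using finite_subset_image[OF D(2) D(1)[unfolded \<C>_def]] by blast
  have "R \<noteq> {}" using D R assms(2) by auto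
  then have "Max (u ` R) \<in> u ` R" using R(2) by (intro Max_in) auto
  then obtain r where r: "r \<in> R" "Max (u ` R) = u r" by auto
  have "r \<in> \<Union>D" using D(3) R(1) r(1) by blast
  then obtain r' where "r' \<in> R" "u r < u r'" unfolding R(3) by blast
  moreover have "u r' \<le> u r" if "r' \<in> R" for r' using r(2) that R(2) by (metis Max_ge finite_imageI imageI)
  ultimately show False by fastforce
qed

lemma usc_section_measurable:
  assumes "usc_on (QT T) u" "t \<in> {0<..T}"
  shows "(\<lambda>z. u (x + z, t)) \<in> borel_measurable lebesgue"
proof (rule lebesgue_measurable_borel)
  have "usc_on UNIV (\<lambda>z. u (x + z, t))"
    by (rule usc_on_compose[OF assms(1)]) (use assms(2) in \<open>auto simp: QT_def intro!: continuous_intros\<close>)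
  then have "open {z. u (x + z, t) < c}" for c by (simp add: usc_on_iff_openin)
  then show "(\<lambda>z. u (x + z, t)) \<in> borel_measurable borel"
    unfolding borel_measurable_iff_less by (auto intro: borel_open)
qed

text \<open>The increment seen by a viscosity inequality of radius \<delta>: test function near the
  origin, solution away from it. It turns the inner and outer operators into a single
  \<open>lev\<close>.\<close>

definition glue :: "real \<Rightarrow> (real ^ 'n \<Rightarrow> real) \<Rightarrow> (real ^ 'n \<Rightarrow> real) \<Rightarrow> real ^ 'n \<Rightarrow> real" where
  "glue \<delta> f g z = (if norm z < \<delta> then f z else g z)"

lemma glue_measurable:
  assumes "f \<in> borel_measurable lebesgue" "g \<in> borel_measurable lebesgue"
  shows "glue \<delta> f g \<in> borel_measurable lebesgue"
proof -
  have "{z :: real^'n. norm z < \<delta>} = ball 0 \<delta>" by auto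
  then have "{z \<in> space lebesgue. norm (z :: real^'n) < \<delta>} \<in> sets lebesgue" by simp
  then show ?thesis unfolding glue_def[abs_def] using assms by (intro measurable_If) auto
qed

text \<open>For |z| \<ge> \<delta> the compensated increment is at most M + |p|, while
  \<open>wt\<close> is at least \<delta>^2 there; this is the origin of the second summand of the
  constant.\<close>

lemma glue_bound:
  assumes d: "0 < \<delta>" "\<delta> < 1" and B: "0 \<le> B"
    and f: "\<And>z. norm z < \<delta> \<Longrightarrow> \<bar>f z - p \<bullet> z\<bar> \<le> B * (norm z)\<^sup>2"
    and g: "\<And>z. \<bar>g z\<bar> \<le> M"
  shows "\<bar>comp_incr p (glue \<delta> f g) z\<bar> \<le> (B + (M + norm p) / \<delta>\<^sup>2) * wt z"
proof -
  have M: "0 \<le> M" using g[of 0] by linarith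
  have k: "0 \<le> (M + norm p) / \<delta>\<^sup>2 * wt z" "0 \<le> B * wt z" using M B by auto
  show ?thesis
  proof (cases "norm z < \<delta>")
    case True
    then have "comp_incr p (glue \<delta> f g) z = f z - p \<bullet> z" using d by (simp add: comp_incr_def glue_def)
    then show ?thesis using f[OF True] k True d by (simp add: wt_less_1 algebra_simps)
  next
    case False
    have "\<bar>indicator (ball 0 1) z * (p \<bullet> z)\<bar> \<le> norm p"
    proof (cases "norm z < 1")
      case True
      have "\<bar>p \<bullet> z\<bar> \<le> norm p * norm z" by (rule Cauchy_Schwarz_ineq2)
      also have "\<dots> \<le> norm p" using True by (simp add: mult_left_le)
      finally show ?thesis using True by simp
    qed simp
    moreover have "comp_incr p (glue \<delta> f g) z = g z - indicator (ball 0 1) z * (p \<bullet> z)"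
      using False by (simp add: comp_incr_def glue_def)
    ultimately have "\<bar>comp_incr p (glue \<delta> f g) z\<bar> \<le> M + norm p" using g[of z] by linarith
    also have "\<dots> \<le> (M + norm p) / \<delta>\<^sup>2 * wt z"
      using mult_left_mono[OF wt_outside[OF d, of z], of "M + norm p"] False M d by (simp add: field_simps)
    finally show ?thesis using k by (simp add: algebra_simps)
  qed
qed

text \<open>Since \<delta> < 1, the indicator of the unit ball equals 1 on the ball of radius
  \<delta>. The full compensation of the inner operator therefore agrees with the truncated one, and
  the two integrals add up.\<close>

lemma nonlocal_eq:
  fixes K :: "real ^ 'n \<Rightarrow> real"
  assumes K: "levy_kernel K" and d: "0 < \<delta>" "\<delta> < 1" and p: "GDERIV \<phi> x :> p"
    and c: "continuous_on UNIV \<phi>" and B: "0 \<le> B" "\<And>z. norm z \<le> 1 \<Longrightarrow> \<bar>\<phi> (x + z) - \<phi> x - p \<bullet> z\<bar> \<le> B * (norm z)\<^sup>2"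
    and u: "(\<lambda>z. u (x + z)) \<in> borel_measurable lebesgue" "\<And>y. \<bar>u y\<bar> \<le> M"
  defines "g \<equiv> glue \<delta> (\<lambda>z. \<phi> (x + z) - \<phi> x) (\<lambda>z. u (x + z) - u x)"
  shows "lev_adm p g" "nonlocal_inner K \<delta> \<phi> x + nonlocal_outer K \<delta> u p x = lev K p g"
    "\<And>z. \<bar>comp_incr p g z\<bar> \<le> (B + (2 * M + norm p) / \<delta>\<^sup>2) * wt z"
proof -
  interpret levy_kernel K by fact
  have m: "(\<lambda>z. \<phi> (x + z) - \<phi> x) \<in> borel_measurable lebesgue"
    by (intro lebesgue_measurable_borel borel_measurable_continuous_onI continuous_intros continuous_on_compose2[OF c]) auto
  have gm: "g \<in> borel_measurable lebesgue"
    unfolding g_def using u(1) by (intro glue_measurable m borel_measurable_diff) auto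
  show gb: "\<bar>comp_incr p g z\<bar> \<le> (B + (2 * M + norm p) / \<delta>\<^sup>2) * wt z" for z
    unfolding g_def
  proof (rule glue_bound[OF d B(1)])
    show "\<bar>u (x + z) - u x\<bar> \<le> 2 * M" for z using u(2)[of "x + z"] u(2)[of x] by linarith
  qed (use B(2) d in auto)
  then show "lev_adm p g" using gm unfolding lev_adm_def by blast
  define f1 where "f1 z = indicator (ball 0 \<delta>) z * comp_incr p g z" for z
  define f2 where "f2 z = indicator (- ball 0 \<delta>) z * comp_incr p g z" for z
  have cm: "comp_incr p g \<in> borel_measurable lebesgue" by (rule comp_incr_measurable[OF gm])
  have i1: "integrable lebesgue (\<lambda>z. f1 z * K z)"
  proof (rule integrable_le_wt)
    show "f1 \<in> borel_measurable lebesgue" unfolding f1_def[abs_def]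
      by (intro borel_measurable_times borel_measurable_indicator cm) auto
    show "\<bar>f1 z\<bar> \<le> (B + (2 * M + norm p) / \<delta>\<^sup>2) * wt z" for z
      using gb[of z] by (auto simp: f1_def indicator_def intro: order_trans[OF abs_ge_zero])
  qed
  have i2: "integrable lebesgue (\<lambda>z. f2 z * K z)"
  proof (rule integrable_le_wt)
    show "f2 \<in> borel_measurable lebesgue" unfolding f2_def[abs_def]
      by (intro borel_measurable_times borel_measurable_indicator cm) auto
    show "\<bar>f2 z\<bar> \<le> (B + (2 * M + norm p) / \<delta>\<^sup>2) * wt z" for z
      using gb[of z] by (auto simp: f2_def indicator_def intro: order_trans[OF abs_ge_zero])
  qed
  have "nonlocal_inner K \<delta> \<phi> x = (LINT z|lebesgue. f1 z * K z)"
    unfolding nonlocal_inner_def set_lebesgue_integral_def grad_eqI[OF p]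
    by (rule Bochner_Integration.integral_cong) (use d in \<open>auto simp: f1_def comp_incr_def g_def glue_def indicator_def\<close>)
  moreover have "nonlocal_outer K \<delta> u p x = (LINT z|lebesgue. f2 z * K z)"
    unfolding nonlocal_outer_def set_lebesgue_integral_def
    by (rule Bochner_Integration.integral_cong) (auto simp: f2_def comp_incr_def g_def glue_def indicator_def)
  moreover have "lev K p g = (LINT z|lebesgue. f1 z * K z + f2 z * K z)"
    unfolding lev_def
    by (rule Bochner_Integration.integral_cong) (auto simp: f1_def f2_def comp_incr_def indicator_def)
  ultimately show "nonlocal_inner K \<delta> \<phi> x + nonlocal_outer K \<delta> u p x = lev K p g"
    using Bochner_Integration.integral_add[OF i1 i2] by simp
qed

text \<open>Every t in the interval, the endpoint T included, is a limit of points from the left, so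
  the derivative within the interval is unique.\<close>

lemma vector_derivative_Ioc:
  assumes "(f has_vector_derivative y) (at t within {0<..T})" "t \<in> {0<..T}"
  shows "vector_derivative f (at t within {0<..T}) = y"
proof (rule vector_derivative_within[OF _ assms(1)])
  have "t islimpt {0<..<t}" using assms(2) by (intro islimpt_greaterThanLessThan2) auto
  then have "t islimpt {0<..T}" using assms(2) by (elim islimpt_subset) auto
  then show "at t within {0<..T} \<noteq> bot" by (simp add: trivial_limit_within)
qed

section \<open>Viscosity inequalities with explicit gradients and increments\<close>

definition local_max :: "real \<Rightarrow> ((real ^ 'n) \<times> real \<Rightarrow> real) \<Rightarrow> real \<Rightarrow> real ^ 'n \<Rightarrow> real \<Rightarrow> bool" where
  "local_max T w \<delta> x t \<longleftrightarrow> (\<forall>q \<in> (ball x \<delta> \<times> {t - \<delta><..<t + \<delta>}) \<inter> QT T. w q \<le> w (x, t))"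

lemma test_fn_taylor:
  assumes "test_fn T \<phi> P Q" "compact C" "C \<subseteq> QT T"
  shows "\<exists>B\<ge>0. \<forall>(x, t)\<in>C. \<forall>z. norm z \<le> 1 \<longrightarrow> \<bar>\<phi> (x + z, t) - \<phi> (x, t) - P (x, t) \<bullet> z\<bar> \<le> B * (norm z)\<^sup>2"
  using assms(1)[unfolded test_fn_def, THEN conjunct2, THEN conjunct2, THEN conjunct2, THEN conjunct2, THEN conjunct2]
    assms(2,3) by simp

lemma test_fn_slice:
  assumes "test_fn T \<phi> P Q" "t \<in> {0<..T}"
  shows "GDERIV (\<lambda>y. \<phi> (y, t)) x :> P (x, t)" "continuous_on UNIV (\<lambda>y. \<phi> (y, t))"
    "\<exists>B\<ge>0. \<forall>z. norm z \<le> 1 \<longrightarrow> \<bar>\<phi> (x + z, t) - \<phi> (x, t) - P (x, t) \<bullet> z\<bar> \<le> B * (norm z)\<^sup>2"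
proof -
  show "GDERIV (\<lambda>y. \<phi> (y, t)) x :> P (x, t)" using assms unfolding test_fn_def by blast
  have "continuous_on (QT T) \<phi>" using assms unfolding test_fn_def by blast
  then show "continuous_on UNIV (\<lambda>y. \<phi> (y, t))"
    by (rule continuous_on_compose2) (use assms in \<open>auto simp: QT_def intro!: continuous_intros\<close>)
  have "compact {(x, t)}" "{(x, t)} \<subseteq> QT T" using assms(2) by (auto simp: QT_def)
  then show "\<exists>B\<ge>0. \<forall>z. norm z \<le> 1 \<longrightarrow> \<bar>\<phi> (x + z, t) - \<phi> (x, t) - P (x, t) \<bullet> z\<bar> \<le> B * (norm z)\<^sup>2"
    using test_fn_taylor[OF assms(1), of "{(x, t)}"] by simp
qed

text \<open>Derivatives are unique, so any explicitly computed gradient and time derivative may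
  replace the description operators hidden in \<open>visc_lhs\<close>.\<close>

lemma visc_lhs_eq:
  fixes K :: "real ^ 'n \<Rightarrow> real"
  assumes K: "levy_kernel K" and d: "0 < \<delta>" "\<delta> < 1" and t: "t \<in> {0<..T}" and \<phi>: "C2_on (QT T) \<phi>"
    and p: "GDERIV (\<lambda>y. \<phi> (y, t)) x :> p" and q: "((\<lambda>s. \<phi> (x, s)) has_vector_derivative \<tau>) (at t within {0<..T})"
    and u: "usc_on (QT T) u \<or> lsc_on (QT T) u" "bounded (u ` QT T)"
  defines "g \<equiv> glue \<delta> (\<lambda>z. \<phi> (x + z, t) - \<phi> (x, t)) (\<lambda>z. u (x + z, t) - u (x, t))"
  shows "lev_adm p g" "visc_lhs T K F u \<phi> \<delta> x t = \<tau> + F x p (lev K p g)"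
proof -
  obtain P Q where PQ: "test_fn T \<phi> P Q" using C2_test_fn[OF \<phi>] by blast
  note sl = test_fn_slice(1)[OF PQ t, of x] test_fn_slice(2)[OF PQ t] test_fn_slice(3)[OF PQ t, of x]
  have pP: "p = P (x, t)" by (rule GDERIV_unique[OF p sl(1)])
  obtain B where B: "0 \<le> B" "\<And>z. norm z \<le> 1 \<Longrightarrow> \<bar>\<phi> (x + z, t) - \<phi> (x, t) - p \<bullet> z\<bar> \<le> B * (norm z)\<^sup>2"
    using sl(3) unfolding pP by blast
  obtain M where M: "\<And>q. q \<in> QT T \<Longrightarrow> \<bar>u q\<bar> \<le> M" using u(2) unfolding bounded_iff by auto
  have M': "\<bar>u (y, t)\<bar> \<le> M" for y using M t by (auto simp: QT_def)
  have um: "(\<lambda>z. u (x + z, t)) \<in> borel_measurable lebesgue"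
    using u(1)
  proof
    assume "lsc_on (QT T) u"
    then have "(\<lambda>z. - u (x + z, t)) \<in> borel_measurable lebesgue"
      unfolding lsc_on_iff_usc_on by (rule usc_section_measurable[OF _ t])
    then show ?thesis by simp
  qed (rule usc_section_measurable[OF _ t])
  note ne = nonlocal_eq[where u="\<lambda>y. u (y, t)" and M=M and \<phi>="\<lambda>y. \<phi> (y, t)", OF K d p sl(2) B um M']
  show "lev_adm p g" unfolding g_def using ne(1) by simp
  show "visc_lhs T K F u \<phi> \<delta> x t = \<tau> + F x p (lev K p g)"
    unfolding visc_lhs_def Let_def grad_eqI[OF p] vector_derivative_Ioc[OF q t] g_def using ne(2) by simp
qed

lemma subsol_ineq:
  fixes K :: "real ^ 'n \<Rightarrow> real"
  assumes u: "visc_subsol T K F u" and K: "levy_kernel K" and d: "0 < \<delta>" "\<delta> < 1" and t: "t \<in> {0<..T}"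
    and \<phi>: "C2_on (QT T) \<phi>" and mx: "local_max T (\<lambda>q. u q - \<phi> q) \<delta> x t"
    and p: "GDERIV (\<lambda>y. \<phi> (y, t)) x :> p" and q: "((\<lambda>s. \<phi> (x, s)) has_vector_derivative \<tau>) (at t within {0<..T})"
  defines "g \<equiv> glue \<delta> (\<lambda>z. \<phi> (x + z, t) - \<phi> (x, t)) (\<lambda>z. u (x + z, t) - u (x, t))"
  shows "lev_adm p g" "\<tau> + F x p (lev K p g) \<le> 0"
proof -
  have us: "usc_on (QT T) u \<or> lsc_on (QT T) u" "bounded (u ` QT T)" using u unfolding visc_subsol_def by auto
  note e = visc_lhs_eq[OF K d t \<phi> p q us]
  show "lev_adm p g" unfolding g_def by (rule e(1))
  have "visc_lhs T K F u \<phi> \<delta> x t \<le> 0"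
    using u d t \<phi> mx unfolding visc_subsol_def local_max_def by blast
  then show "\<tau> + F x p (lev K p g) \<le> 0" unfolding g_def e(2) .
qed

section \<open>Reflection of sub- and supersolutions\<close>

definition neg_op :: "(real ^ 'n \<Rightarrow> real ^ 'n \<Rightarrow> real \<Rightarrow> real) \<Rightarrow> real ^ 'n \<Rightarrow> real ^ 'n \<Rightarrow> real \<Rightarrow> real" where
  "neg_op F x p l = - F x (- p) (- l)"

lemma neg_op_neg_op [simp]: "neg_op (neg_op F) = F"
  by (simp add: neg_op_def fun_eq_iff)

text \<open>The Levy integral is odd in the pair of gradient and increment, and the derivatives of
  the test function change sign too. For an operator - a l + H(p) the reflection keeps the
  coefficient a and replaces H(p) by - H(- p), so the type of equation is preserved.\<close>

lemma visc_lhs_uminus: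
  fixes K :: "real ^ 'n \<Rightarrow> real"
  assumes K: "levy_kernel K" and d: "0 < \<delta>" "\<delta> < 1" and t: "t \<in> {0<..T}" and \<phi>: "C2_on (QT T) \<phi>"
    and u: "usc_on (QT T) u \<or> lsc_on (QT T) u" "bounded (u ` QT T)"
  shows "visc_lhs T K (neg_op F) (\<lambda>q. - u q) (\<lambda>q. - \<phi> q) \<delta> x t = - visc_lhs T K F u \<phi> \<delta> x t"
proof -
  obtain P Q where PQ: "test_fn T \<phi> P Q" using C2_test_fn[OF \<phi>] by blast
  have p: "GDERIV (\<lambda>y. \<phi> (y, t)) x :> P (x, t)"
    and q: "((\<lambda>s. \<phi> (x, s)) has_vector_derivative Q (x, t)) (at t within {0<..T})"
    using PQ t unfolding test_fn_def by auto
  have u': "usc_on (QT T) (\<lambda>q. - u q) \<or> lsc_on (QT T) (\<lambda>q. - u q)"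
    using u(1) unfolding lsc_on_iff_usc_on by auto
  have "bounded ((\<lambda>q. - u q) ` QT T)" using u(2) unfolding bounded_iff by auto
  note e = visc_lhs_eq(2)[OF K d t \<phi> p q u] visc_lhs_eq(2)[OF K d t C2_on_uminus[OF \<phi>] GDERIV_minus[OF p] has_vector_derivative_minus[OF q] u' this]
  have g: "glue \<delta> (\<lambda>z. - \<phi> (x + z, t) - - \<phi> (x, t)) (\<lambda>z. - u (x + z, t) - - u (x, t))
     = (\<lambda>z. - glue \<delta> (\<lambda>z. \<phi> (x + z, t) - \<phi> (x, t)) (\<lambda>z. u (x + z, t) - u (x, t)) z)"
    by (auto simp: glue_def)
  show ?thesis unfolding e g lev_uminus neg_op_def by simp
qed

lemma visc_subsol_uminus:
  assumes K: "levy_kernel K" and u: "visc_supersol T K F u"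
  shows "visc_subsol T K (neg_op F) (\<lambda>q. - u q)"
  unfolding visc_subsol_def
proof (intro conjI allI ballI impI)
  have us: "lsc_on (QT T) u" "bounded (u ` QT T)" using u unfolding visc_supersol_def by auto
  show "bounded ((\<lambda>q. - u q) ` QT T)" using us(2) unfolding bounded_iff by auto
  show "usc_on (QT T) (\<lambda>q. - u q)" using us(1) unfolding lsc_on_iff_usc_on .
  fix x t \<phi> \<delta>
  assume t: "t \<in> {0<..T}" and a: "C2_on (QT T) \<phi> \<and> 0 < \<delta> \<and> \<delta> < 1 \<and>
      (\<forall>q\<in>(ball x \<delta> \<times> {t - \<delta><..<t + \<delta>}) \<inter> QT T. - u q - \<phi> q \<le> - u (x, t) - \<phi> (x, t))"
  have c: "C2_on (QT T) (\<lambda>q. - \<phi> q)" using a C2_on_uminus by blast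
  have "u (x, t) - - \<phi> (x, t) \<le> u q - - \<phi> q" if "q\<in>(ball x \<delta> \<times> {t - \<delta><..<t + \<delta>}) \<inter> QT T" for q
  proof -
    have "- u q - \<phi> q \<le> - u (x, t) - \<phi> (x, t)" using a that by blast
    then show ?thesis by linarith
  qed
  then have "0 \<le> visc_lhs T K F u (\<lambda>q. - \<phi> q) \<delta> x t"
    using u c a t unfolding visc_supersol_def by blast
  then show "visc_lhs T K (neg_op F) (\<lambda>q. - u q) \<phi> \<delta> x t \<le> 0"
    using visc_lhs_uminus[OF K _ _ t c, of \<delta> u F x] us a by simp
qed

lemma visc_supersol_uminus:
  assumes K: "levy_kernel K" and u: "visc_subsol T K F u"
  shows "visc_supersol T K (neg_op F) (\<lambda>q. - u q)"
  unfolding visc_supersol_def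
proof (intro conjI allI ballI impI)
  have us: "usc_on (QT T) u" "bounded (u ` QT T)" using u unfolding visc_subsol_def by auto
  show "bounded ((\<lambda>q. - u q) ` QT T)" using us(2) unfolding bounded_iff by auto
  show "lsc_on (QT T) (\<lambda>q. - u q)" using us(1) unfolding lsc_on_iff_usc_on by simp
  fix x t \<phi> \<delta>
  assume t: "t \<in> {0<..T}" and a: "C2_on (QT T) \<phi> \<and> 0 < \<delta> \<and> \<delta> < 1 \<and>
      (\<forall>q\<in>(ball x \<delta> \<times> {t - \<delta><..<t + \<delta>}) \<inter> QT T. - u (x, t) - \<phi> (x, t) \<le> - u q - \<phi> q)"
  have c: "C2_on (QT T) (\<lambda>q. - \<phi> q)" using a C2_on_uminus by blast
  have "u q - - \<phi> q \<le> u (x, t) - - \<phi> (x, t)" if "q\<in>(ball x \<delta> \<times> {t - \<delta><..<t + \<delta>}) \<inter> QT T" for q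
  proof -
    have "- u (x, t) - \<phi> (x, t) \<le> - u q - \<phi> q" using a that by blast
    then show ?thesis by linarith
  qed
  then have "visc_lhs T K F u (\<lambda>q. - \<phi> q) \<delta> x t \<le> 0"
    using u c a t unfolding visc_subsol_def by blast
  then show "0 \<le> visc_lhs T K (neg_op F) (\<lambda>q. - u q) \<phi> \<delta> x t"
    using visc_lhs_uminus[OF K _ _ t c, of \<delta> u F x] us a by simp
qed

section \<open>Half-relaxed limits\<close>

text \<open>The upper half-relaxed limit: the limsup of u \<epsilon> q' as \<epsilon> tends to 0
  from above and q' to q within X, written as the infimum of the strict upper bounds valid on a
  joint neighbourhood.\<close>

definition relaxed_sup :: "(real \<Rightarrow> 'a::metric_space \<Rightarrow> real) \<Rightarrow> 'a set \<Rightarrow> 'a \<Rightarrow> real" where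
  "relaxed_sup u X q = Inf {c. \<exists>r>0. \<forall>\<epsilon> q'. 0 < \<epsilon> \<and> \<epsilon> < r \<and> q' \<in> X \<and> dist q' q < r \<longrightarrow> u \<epsilon> q' < c}"

locale bounded_family =
  fixes u :: "real \<Rightarrow> 'a::metric_space \<Rightarrow> real" and X :: "'a set" and M :: real
  assumes bdd: "\<And>\<epsilon> q. 0 < \<epsilon> \<Longrightarrow> q \<in> X \<Longrightarrow> \<bar>u \<epsilon> q\<bar> \<le> M"
begin

definition near :: "'a \<Rightarrow> real \<Rightarrow> real \<Rightarrow> bool" where
  "near q r c \<longleftrightarrow> 0 < r \<and> (\<forall>\<epsilon> q'. 0 < \<epsilon> \<and> \<epsilon> < r \<and> q' \<in> X \<and> dist q' q < r \<longrightarrow> u \<epsilon> q' < c)"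

lemma relaxed_sup_near: "relaxed_sup u X q = Inf {c. \<exists>r. near q r c}"
  unfolding relaxed_sup_def near_def by (rule arg_cong[where f=Inf]) auto

lemma near_lower: "q \<in> X \<Longrightarrow> near q r c \<Longrightarrow> - M < c"
proof -
  assume q: "q \<in> X" and n: "near q r c"
  have "0 < r / 2" "r / 2 < r" using n by (auto simp: near_def)
  then have "u (r/2) q < c" "\<bar>u (r/2) q\<bar> \<le> M" using n q bdd[of "r/2" q] unfolding near_def by auto
  then show ?thesis by linarith
qed

lemma near_upper: "M < c \<Longrightarrow> near q 1 c"
  unfolding near_def using bdd by fastforce

lemma bdd_below_near: "q \<in> X \<Longrightarrow> bdd_below {c. \<exists>r. near q r c}"
  using near_lower unfolding bdd_below_def by (auto intro!: exI[of _ "- M"] less_imp_le)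

lemma relaxed_sup_less:
  assumes "q \<in> X" "relaxed_sup u X q < c"
  shows "\<exists>r. near q r c"
proof -
  have ne: "{c. \<exists>r. near q r c} \<noteq> {}" using near_upper[of "M + 1" q] by auto
  obtain c' r where "near q r c'" "c' < c"
    using assms cInf_lessD[OF ne] unfolding relaxed_sup_near by blast
  then show ?thesis unfolding near_def by (meson less_trans)
qed

lemma relaxed_sup_le: "q \<in> X \<Longrightarrow> near q r c \<Longrightarrow> relaxed_sup u X q \<le> c"
  unfolding relaxed_sup_near by (intro cInf_lower bdd_below_near) auto

lemma relaxed_sup_greater:
  assumes "q \<in> X" "c < relaxed_sup u X q" "0 < r"
  shows "\<exists>\<epsilon> q'. 0 < \<epsilon> \<and> \<epsilon> < r \<and> q' \<in> X \<and> dist q' q < r \<and> c \<le> u \<epsilon> q'"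
proof (rule ccontr)
  assume "\<not> ?thesis"
  then have "near q r c" unfolding near_def using assms(3) by (auto simp: not_le)
  then show False using relaxed_sup_le[OF assms(1)] assms(2) by fastforce
qed

lemma relaxed_sup_bounds: "q \<in> X \<Longrightarrow> \<bar>relaxed_sup u X q\<bar> \<le> M"
proof -
  assume q: "q \<in> X"
  have "relaxed_sup u X q \<le> M + e" if "0 < e" for e
    using relaxed_sup_le[OF q near_upper[of "M + e" q]] that by simp
  then have 1: "relaxed_sup u X q \<le> M" by (rule field_le_epsilon)
  have "- M \<le> relaxed_sup u X q"
    unfolding relaxed_sup_near using near_upper[of "M + 1" q] near_lower[OF q]
    by (intro cInf_greatest) (auto intro: less_imp_le)
  then show ?thesis using 1 by linarith
qed

lemma relaxed_sup_usc: "usc_on X (relaxed_sup u X)"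
  unfolding usc_on_def
proof (intro ballI allI impI)
  fix q c assume q: "q \<in> X" "relaxed_sup u X q < c"
  define c' where "c' = (relaxed_sup u X q + c) / 2"
  have c': "relaxed_sup u X q < c'" "c' < c" using q by (auto simp: c'_def)
  obtain r where r: "near q r c'" using relaxed_sup_less[OF q(1) c'(1)] by blast
  have "relaxed_sup u X q' < c" if "q' \<in> X" "dist q' q < r / 2" for q'
  proof -
    have "near q' (r / 2) c'" unfolding near_def
    proof (intro conjI allI impI)
      show "0 < r / 2" using r by (simp add: near_def)
      fix \<epsilon> q'' assume a: "0 < \<epsilon> \<and> \<epsilon> < r / 2 \<and> q'' \<in> X \<and> dist q'' q' < r / 2"
      have "dist q'' q < r" using a that dist_triangle[of q'' q q'] by simp
      then show "u \<epsilon> q'' < c'" using r a unfolding near_def by auto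
    qed
    then show ?thesis using relaxed_sup_le[OF that(1)] c' by fastforce
  qed
  moreover have "0 < r / 2" using r by (simp add: near_def)
  ultimately show "\<forall>\<^sub>F q' in at q within X. relaxed_sup u X q' < c"
    unfolding eventually_at by blast
qed

lemma relaxed_sup_seq:
  assumes "q \<in> X"
  shows "\<exists>\<epsilon> q'. (\<forall>n. 0 < \<epsilon> n \<and> q' n \<in> X) \<and> \<epsilon> \<longlonglongrightarrow> 0 \<and> q' \<longlonglongrightarrow> q \<and>
    (\<forall>e>0. \<forall>\<^sub>F n in sequentially. relaxed_sup u X q - e \<le> u (\<epsilon> n) (q' n))"
proof -
  have "\<exists>\<epsilon> q'. 0 < \<epsilon> \<and> \<epsilon> < 1 / real (Suc n) \<and> q' \<in> X \<and> dist q' q < 1 / real (Suc n) \<and>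
      relaxed_sup u X q - 1 / real (Suc n) \<le> u \<epsilon> q'" for n
    by (rule relaxed_sup_greater[OF assms]) auto
  then obtain \<epsilon> q' where s: "\<And>n. 0 < \<epsilon> n \<and> \<epsilon> n < 1 / real (Suc n) \<and> q' n \<in> X \<and> dist (q' n) q < 1 / real (Suc n) \<and>
      relaxed_sup u X q - 1 / real (Suc n) \<le> u (\<epsilon> n) (q' n)" by metis
  have z: "(\<lambda>n. 1 / real (Suc n)) \<longlonglongrightarrow> 0" by real_asymp
  have "\<epsilon> \<longlonglongrightarrow> 0"
    by (rule tendsto_sandwich[OF _ _ tendsto_const z]) (use s in \<open>auto intro!: eventuallyI less_imp_le\<close>)
  moreover have "(\<lambda>n. dist (q' n) q) \<longlonglongrightarrow> 0"
    by (rule tendsto_sandwich[OF _ _ tendsto_const z]) (use s in \<open>auto intro!: eventuallyI less_imp_le\<close>)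
  then have "q' \<longlonglongrightarrow> q" by (rule tendsto_dist_iff[THEN iffD2])
  moreover have "\<forall>e>0. \<forall>\<^sub>F n in sequentially. relaxed_sup u X q - e \<le> u (\<epsilon> n) (q' n)"
  proof (intro allI impI)
    fix e :: real assume "0 < e"
    then have "\<forall>\<^sub>F n in sequentially. 1 / real (Suc n) < e" using order_tendstoD(2)[OF z] by blast
    then show "\<forall>\<^sub>F n in sequentially. relaxed_sup u X q - e \<le> u (\<epsilon> n) (q' n)"
    proof (rule eventually_mono)
      fix n assume "1 / real (Suc n) < e"
      then show "relaxed_sup u X q - e \<le> u (\<epsilon> n) (q' n)" using s[of n] by linarith
    qed
  qed
  ultimately show ?thesis using s by blast
qed

end

text \<open>Away from \<open>q0\<close>, compactness leaves finitely many local upper bounds, each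
  given by the midpoint between wb q and wb q0, while the lower bound at q0 forces the maximal
  values up to these midpoints. Hence maximisers cannot stay away. The convergence required of
  \<open>w\<close> is one-sided, so relaxed limits and uniform limits are both covered.\<close>

lemma max_points_converge:
  fixes w :: "nat \<Rightarrow> 'a::metric_space \<Rightarrow> real"
  assumes N: "compact N" "q0 \<in> N" and cont: "\<And>n. continuous_on N (w n)"
    and strict: "\<And>q. q \<in> N \<Longrightarrow> q \<noteq> q0 \<Longrightarrow> wb q < wb q0"
    and up: "\<And>q c. q \<in> N \<Longrightarrow> wb q < c \<Longrightarrow>
      \<exists>r>0. \<forall>\<^sub>F n in sequentially. \<forall>q'\<in>N. dist q' q < r \<longrightarrow> w n q' < c"
    and low: "\<And>e. 0 < e \<Longrightarrow> \<forall>\<^sub>F n in sequentially. \<exists>q'\<in>N. wb q0 - e \<le> w n q'"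
  shows "\<exists>qh. (\<forall>n. qh n \<in> N \<and> (\<forall>q\<in>N. w n q \<le> w n (qh n))) \<and> qh \<longlonglongrightarrow> q0 \<and> (\<lambda>n. w n (qh n)) \<longlonglongrightarrow> wb q0"
proof -
  have "\<exists>qh\<in>N. \<forall>q\<in>N. w n q \<le> w n qh" for n
    using continuous_attains_sup[OF N(1) _ cont[of n]] N(2) by blast
  then obtain qh where qh: "\<And>n. qh n \<in> N" "\<And>n q. q \<in> N \<Longrightarrow> w n q \<le> w n (qh n)" by metis
  have lower: "\<forall>\<^sub>F n in sequentially. wb q0 - e \<le> w n (qh n)" if "0 < e" for e
    using low[OF that] by (rule eventually_mono) (use qh(2) in \<open>blast intro: order_trans\<close>)
  have conv: "qh \<longlonglongrightarrow> q0"
  proof (rule tendstoI)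
    fix \<rho> :: real assume \<rho>: "0 < \<rho>"
    define N' where "N' = N - ball q0 \<rho>"
    have N': "compact N'" unfolding N'_def by (intro compact_diff N) auto
    have "\<exists>r>0. \<forall>\<^sub>F n in sequentially. \<forall>q'\<in>N. dist q' q < r \<longrightarrow> w n q' < (wb q + wb q0) / 2" if "q \<in> N'" for q
    proof -
      have "q \<in> N" "q \<noteq> q0" using that \<rho> by (auto simp: N'_def)
      then have "wb q < (wb q + wb q0) / 2" using strict[of q] by simp
      then show ?thesis using up \<open>q \<in> N\<close> by blast
    qed
    then have "\<forall>q\<in>N'. \<exists>r. 0 < r \<and> (\<forall>\<^sub>F n in sequentially. \<forall>q'\<in>N. dist q' q < r \<longrightarrow> w n q' < (wb q + wb q0) / 2)"
      by blast
    from bchoice[OF this] obtain r where r': "\<forall>q\<in>N'. 0 < r q \<and>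
        (\<forall>\<^sub>F n in sequentially. \<forall>q'\<in>N. dist q' q < r q \<longrightarrow> w n q' < (wb q + wb q0) / 2)" ..
    then have r: "\<And>q. q \<in> N' \<Longrightarrow> 0 < r q"
      "\<And>q. q \<in> N' \<Longrightarrow> \<forall>\<^sub>F n in sequentially. \<forall>q'\<in>N. dist q' q < r q \<longrightarrow> w n q' < (wb q + wb q0) / 2"
      by auto
    obtain C where C: "C \<subseteq> N'" "finite C" "N' \<subseteq> (\<Union>q\<in>C. ball q (r q))"
      by (rule compactE_image[OF N', of N' "\<lambda>q. ball q (r q)"]) (use r in auto)
    have ev1: "\<forall>\<^sub>F n in sequentially. \<forall>q\<in>C. \<forall>q'\<in>N. dist q' q < r q \<longrightarrow> w n q' < (wb q + wb q0) / 2"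
      using C r by (intro eventually_ball_finite) auto
    have ev2: "\<forall>\<^sub>F n in sequentially. \<forall>q\<in>C. wb q0 - (wb q0 - wb q) / 2 \<le> w n (qh n)"
    proof (intro eventually_ball_finite C ballI lower)
      fix q assume "q \<in> C"
      then have "q \<in> N" "q \<noteq> q0" using C \<rho> by (auto simp: N'_def)
      then show "0 < (wb q0 - wb q) / 2" using strict by simp
    qed
    from ev1 ev2 show "\<forall>\<^sub>F n in sequentially. dist (qh n) q0 < \<rho>"
    proof eventually_elim
      case (elim n)
      show ?case
      proof (rule ccontr)
        assume "\<not> dist (qh n) q0 < \<rho>"
        then have "qh n \<in> N'" using qh(1) by (auto simp: N'_def dist_commute)
        then obtain q where q: "q \<in> C" "dist (qh n) q < r q" using C(3) by (auto simp: dist_commute)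
        then have "w n (qh n) < (wb q + wb q0) / 2" "wb q0 - (wb q0 - wb q) / 2 \<le> w n (qh n)"
          using elim qh(1) by auto
        then show False by (simp add: field_simps)
      qed
    qed
  qed
  moreover have "(\<lambda>n. w n (qh n)) \<longlonglongrightarrow> wb q0"
  proof (rule order_tendstoI)
    fix a assume "a < wb q0"
    then have "\<forall>\<^sub>F n in sequentially. wb q0 - (wb q0 - a) / 2 \<le> w n (qh n)" by (intro lower) simp
    then show "\<forall>\<^sub>F n in sequentially. a < w n (qh n)"
      by (rule eventually_mono) (use \<open>a < wb q0\<close> in \<open>simp add: field_simps\<close>)
  next
    fix a assume "wb q0 < a"
    then obtain r where r: "0 < r" "\<forall>\<^sub>F n in sequentially. \<forall>q'\<in>N. dist q' q0 < r \<longrightarrow> w n q' < a"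
      using up[OF N(2)] by blast
    have "\<forall>\<^sub>F n in sequentially. dist (qh n) q0 < r" using conv r(1) by (rule tendstoD)
    with r(2) show "\<forall>\<^sub>F n in sequentially. w n (qh n) < a"
      by eventually_elim (use qh(1) in auto)
  qed
  ultimately show ?thesis using qh by blast
qed

section \<open>Barriers\<close>

text \<open>A bounded smooth substitute for the square: zero at 0, bounded away from zero at a
  distance, with bounded first and second derivatives. Summing over coordinates in
  \<open>chi\<close> keeps it a sum of ridge functions.\<close>

definition chi1 :: "real \<Rightarrow> real" where "chi1 s = s\<^sup>2 / (1 + s\<^sup>2)"

definition chi :: "real ^ 'n \<Rightarrow> real" where "chi y = (\<Sum>i\<in>UNIV. chi1 (y $ i))"

lemma chi1_nonneg: "0 \<le> chi1 s"
  by (simp add: chi1_def)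

lemma chi1_mono: "0 \<le> s \<Longrightarrow> s \<le> \<bar>r\<bar> \<Longrightarrow> chi1 s \<le> chi1 r"
proof -
  assume "0 \<le> s" "s \<le> \<bar>r\<bar>"
  then have "s\<^sup>2 \<le> r\<^sup>2" by (metis abs_le_square_iff abs_of_nonneg)
  moreover have "0 < 1 + s\<^sup>2" "0 < 1 + r\<^sup>2" by (auto intro: add_pos_nonneg)
  ultimately show ?thesis unfolding chi1_def by (simp add: frac_le_eq divide_le_0_iff field_simps)
qed

lemma chi_nonneg: "0 \<le> chi y"
  unfolding chi_def by (intro sum_nonneg chi1_nonneg)

lemma chi_0 [simp]: "chi 0 = 0"
  by (simp add: chi_def chi1_def)

text \<open>The norm is at most the sum of the moduli of the coordinates, so some coordinate is at
  least r / N in modulus; \<open>chi1\<close> is monotone in the modulus.\<close>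

lemma chi_ge:
  fixes y :: "real ^ 'n"
  assumes "0 \<le> r" "r \<le> norm y"
  shows "chi1 (r / real CARD('n)) \<le> chi y"
proof -
  have "\<exists>i. r / real CARD('n) \<le> \<bar>y $ i\<bar>"
  proof (rule ccontr)
    assume "\<not> ?thesis"
    then have "\<And>i. \<bar>y $ i\<bar> < r / real CARD('n)" by (auto simp: not_le)
    then have "(\<Sum>i\<in>UNIV. \<bar>y $ i\<bar>) < (\<Sum>i\<in>(UNIV::'n set). r / real CARD('n))"
      by (intro sum_strict_mono) auto
    then show False using norm_le_l1_cart[of y] assms by simp
  qed
  then obtain i where i: "r / real CARD('n) \<le> \<bar>y $ i\<bar>" by blast
  have "chi1 (r / real CARD('n)) \<le> chi1 (y $ i)" using assms i by (intro chi1_mono) auto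
  also have "\<dots> \<le> chi y" unfolding chi_def by (rule member_le_sum) (auto simp: chi1_nonneg)
  finally show ?thesis .
qed

lemma chi_ge_half: "real CARD('n) \<le> norm y \<Longrightarrow> 1 / 2 \<le> chi (y :: real ^ 'n)"
  using chi_ge[of "real CARD('n)" y] by (simp add: chi1_def)

lemma chi_nice: "\<exists>P L. nice (chi :: real ^ 'n \<Rightarrow> real) P L"
proof -
  define h' :: "real \<Rightarrow> real" where "h' s = 2 * s / (1 + s\<^sup>2)\<^sup>2" for s
  define h'' :: "real \<Rightarrow> real" where "h'' s = (2 - 6 * s\<^sup>2) / (1 + s\<^sup>2) ^ 3" for s
  have pos: "1 + s\<^sup>2 > 0" "1 + s\<^sup>2 \<noteq> 0" for s :: real
    using zero_le_power2[of s] by linarith+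
  have d1: "(chi1 has_real_derivative h' s) (at s)" for s
    unfolding chi1_def[abs_def] h'_def using pos[of s]
    by (auto intro!: derivative_eq_intros simp: field_simps power2_eq_square)
  have d2: "(h' has_real_derivative h'' s) (at s)" for s
  proof -
    have "(h' has_real_derivative (2 * (1 + s\<^sup>2)\<^sup>2 - 2 * s * (2 * (1 + s\<^sup>2) * (2 * s))) / ((1 + s\<^sup>2)\<^sup>2 * (1 + s\<^sup>2)\<^sup>2)) (at s)"
      unfolding h'_def[abs_def] using pos[of s]
      by (auto intro!: derivative_eq_intros)
    also have "(2 * (1 + s\<^sup>2)\<^sup>2 - 2 * s * (2 * (1 + s\<^sup>2) * (2 * s))) / ((1 + s\<^sup>2)\<^sup>2 * (1 + s\<^sup>2)\<^sup>2)
        = ((1 + s\<^sup>2) * (2 - 6 * s\<^sup>2)) / ((1 + s\<^sup>2) * (1 + s\<^sup>2) ^ 3)"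
      by (rule arg_cong2[where f="(/)"]) (simp_all add: algebra_simps power2_eq_square power3_eq_cube)
    also have "\<dots> = h'' s" unfolding h''_def using pos[of s] by simp
    finally show ?thesis .
  qed
  have c: "continuous_on UNIV h''" unfolding h''_def[abs_def] using pos by (intro continuous_intros) auto
  have one: "1 \<le> (1 + s\<^sup>2) ^ k" for s :: real and k by (rule one_le_power) simp
  \<comment> \<open>The common bound 8 = 2 + 6 is read off the numerator 2 - 6 s^2 of the second
    derivative; the bounds on the value and the first derivative fit under it.\<close>
  have b0: "\<bar>chi1 s\<bar> \<le> 8" for s
    using pos[of s] by (simp add: chi1_def divide_le_eq)
  have b1: "\<bar>h' s\<bar> \<le> 8" for s
  proof -
    have "\<bar>2 * s\<bar> \<le> 1 + s\<^sup>2" using sum_squares_bound[of 1 "\<bar>s\<bar>"] by (simp add: power2_eq_square abs_mult)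
    also have "\<dots> \<le> 8 * (1 + s\<^sup>2)\<^sup>2" using pos(1)[of s] one[of s 1] by (simp add: power2_eq_square mult_le_cancel_left1)
    finally show ?thesis using pos[of s] by (simp add: h'_def divide_le_eq abs_mult)
  qed
  have b2: "\<bar>h'' s\<bar> \<le> 8" for s
  proof -
    have "\<bar>2 - 6 * s\<^sup>2\<bar> \<le> 8 * (1 + s\<^sup>2)" using zero_le_power2[of s] by (auto simp: abs_if)
    also have "\<dots> \<le> 8 * (1 + s\<^sup>2) ^ 3"
      using power_increasing[of 1 3 "1 + s\<^sup>2"] by simp
    finally have "\<bar>2 - 6 * s\<^sup>2\<bar> / (1 + s\<^sup>2) ^ 3 \<le> 8" using pos[of s] by (simp add: divide_le_eq)
    then show ?thesis using pos[of s] by (simp add: h''_def)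
  qed
  have "\<forall>i::'n. \<exists>L. nice (\<lambda>y. chi1 (axis i 1 \<bullet> y + 0)) (\<lambda>y. h' (axis i 1 \<bullet> y + 0) *\<^sub>R axis i 1) L"
    using nice_ridge[OF d1 d2 c b0 b1 b2] by blast
  from choice[OF this] obtain L where
    "\<forall>i. nice (\<lambda>y. chi1 (axis i 1 \<bullet> y + 0)) (\<lambda>y. h' (axis i 1 \<bullet> y + 0) *\<^sub>R axis (i::'n) 1) (L i)" ..
  then have "nice (\<lambda>y. \<Sum>i\<in>UNIV. chi1 (axis i 1 \<bullet> y + 0)) (\<lambda>y. \<Sum>i\<in>UNIV. h' (axis i 1 \<bullet> y + 0) *\<^sub>R axis (i::'n) 1) (\<Sum>i\<in>UNIV. L i)"
    by (intro nice_sum) auto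
  moreover have "(\<lambda>y. \<Sum>i\<in>UNIV. chi1 (axis (i::'n) 1 \<bullet> y + 0)) = chi"
    by (simp add: chi_def fun_eq_iff inner_axis')
  ultimately show ?thesis by auto
qed

section \<open>The barrier estimate\<close>

lemma nice_at_0:
  assumes "nice \<psi> P L"
  shows "\<psi> z \<le> \<psi> 0 + 2 * L * norm z"
proof -
  have "\<bar>\<psi> (0 + z) - \<psi> 0 - P 0 \<bullet> z\<bar> \<le> L * wt z" "norm (P 0) \<le> L" "0 \<le> L" using assms unfolding nice_def by blast+
  moreover have "P 0 \<bullet> z \<le> norm (P 0) * norm z" by (rule norm_cauchy_schwarz)
  moreover have "norm (P 0) * norm z \<le> L * norm z" "L * wt z \<le> L * norm z"
    using calculation by (auto intro!: mult_right_mono mult_left_mono wt_le_norm)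
  ultimately show ?thesis by simp
qed

lemma eventually_small: "0 < e \<Longrightarrow> \<forall>\<^sub>F \<beta> in at_right 0. A * \<beta> < (e::real)"
proof -
  assume e: "0 < e"
  have "((\<lambda>\<beta>. A * \<beta>) \<longlongrightarrow> A * 0) (at_right 0)" by (intro tendsto_intros)
  then show ?thesis using e order_tendstoD(2)[of _ "A * 0"] by force
qed

lemma glue_le:
  assumes "\<And>z. g z \<le> f z"
  shows "comp_incr p (glue \<delta> f g) z \<le> comp_incr p f z"
  using assms[of z] by (simp add: comp_incr_def glue_def)

text \<open>At a maximum of u minus \<psi> + (C + \<kappa>) t + M' chi(\<beta> x) over the whole
  strip, the gradient is that of the smooth function and the Levy integral is at most its integral.
  Both lie in the range where F is at least - C, so the time slope C + \<kappa> contradicts the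
  subsolution inequality. The chi term makes the maximum exist, and its effect vanishes with
  \<beta>.\<close>

lemma (in levy_kernel) upper_barrier:
  fixes u :: "(real ^ 'n) \<times> real \<Rightarrow> real"
  assumes T: "0 < T" and u: "visc_subsol T K F u" "usc_on (QT_bar T) u" "\<And>q. q \<in> QT_bar T \<Longrightarrow> \<bar>u q\<bar> \<le> M"
    and \<psi>: "nice \<psi> P L" and init: "\<And>x. u (x, 0) \<le> \<psi> x" and C: "0 \<le> C"
    and F: "\<And>x p l. norm p \<le> L + 1 \<Longrightarrow> l \<le> 2 * L * mass + 1 \<Longrightarrow> - C \<le> F x p l"
    and t1: "0 \<le> t1" "t1 \<le> T"
  shows "u (x1, t1) \<le> \<psi> x1 + C * t1"
proof (rule ccontr)
  define S where "S = u (x1, t1) - \<psi> x1 - C * t1"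
  assume "\<not> ?thesis"
  then have S: "0 < S" by (simp add: S_def)
  obtain P\<chi> Lx where chi: "nice (chi :: real^'n \<Rightarrow> real) P\<chi> Lx" using chi_nice by blast
  have Lx: "0 \<le> Lx" and L: "0 \<le> L" using chi \<psi> by (auto simp: nice_def)
  have M: "0 \<le> M" using u(3)[of "(x1, t1)"] t1 by (auto simp: QT_bar_def)
  \<comment> \<open>Far out chi is at least 1/2, and half of M' exceeds M + L, an upper bound for u
    - \<psi>.\<close>
  define M' where "M' = 2 * (M + L) + 2"
  have M': "0 \<le> M'" using M L by (simp add: M'_def)
  define \<kappa> where "\<kappa> = S / (4 * (T + 1))"
  have \<kappa>: "0 < \<kappa>" using S T by (simp add: \<kappa>_def)
  have kT: "\<kappa> * T \<le> S / 4" using S T by (simp add: \<kappa>_def field_simps)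
  have "\<forall>\<^sub>F \<beta> in at_right 0. (0 < \<beta> \<and> \<beta> < 1) \<and> (M' * Lx) * \<beta> < 1 \<and> (2 * M' * Lx * mass) * \<beta> < 1 \<and>
      (M' * 2 * Lx * norm x1) * \<beta> < S / 4"
    using S by (intro eventually_conj eventually_small eventually_at_right_less eventually_at_rightI[of 0 1]) (auto intro: eventually_at_rightI[of 0 1])
  then obtain \<beta> where \<beta>: "0 < \<beta>" "\<beta> < 1" "(M' * Lx) * \<beta> < 1" "(2 * M' * Lx * mass) * \<beta> < 1"
      "(M' * 2 * Lx * norm x1) * \<beta> < S / 4"
    using eventually_happens'[OF trivial_limit_at_right_real] by blast
  define \<phi> :: "(real^'n) \<times> real \<Rightarrow> real" where "\<phi> q = \<psi> (fst q) + (C + \<kappa>) * snd q + M' * chi (\<beta> *\<^sub>R fst q + 0)" for q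
  have c\<chi>: "C2_on UNIV (\<lambda>y::real^'n. chi (\<beta> *\<^sub>R y + 0))"
    using nice_affine(1)[OF chi, of \<beta> 0] \<beta> by simp
  have C2: "C2_on S' \<phi>" for S'
    unfolding \<phi>_def using \<psi> c\<chi>
    by (intro C2_on_add C2_on_cmult C2_on_fst[of "\<lambda>y. chi (\<beta> *\<^sub>R y + 0)"] C2_on_fst[of \<psi>] C2_on_snd[of "\<lambda>s. s"] C2_on_linear[of _ 1, simplified]) (auto simp: nice_def)
  have cont: "continuous_on S' \<phi>" for S'
  proof -
    have 1: "continuous_on UNIV \<psi>" using \<psi> by (simp add: nice_def)
    have 2: "continuous_on UNIV (\<lambda>y::real^'n. chi (\<beta> *\<^sub>R y + 0))" using nice_affine(4)[OF chi, of \<beta> 0] \<beta> by simp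
    show ?thesis unfolding \<phi>_def
      by (intro continuous_intros continuous_on_compose2[OF 1, of _ fst] continuous_on_compose2[OF 2, of _ fst]) auto
  qed
  define w where "w q = u q - \<phi> q" for q
  have wusc: "usc_on (QT_bar T) w"
    unfolding w_def using usc_on_add[OF u(2), of "\<lambda>q. - \<phi> q"] usc_on_continuous[OF continuous_on_minus[OF cont]] by simp
  \<comment> \<open>Beyond N / \<beta> the point scaled by \<beta> has norm at least N, where
    \<open>chi_ge_half\<close> applies; adding |x1| keeps the base point inside.\<close>
  define R where "R = real CARD('n) / \<beta> + norm x1"
  have R: "norm x1 \<le> R" using \<beta> by (simp add: R_def)
  define N where "N = (cball 0 R :: (real^'n) set) \<times> {0..T}"
  have N: "compact N" "(x1, t1) \<in> N" "N \<subseteq> QT_bar T"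
    using t1 R by (auto simp: N_def QT_bar_def intro: compact_Times)
  obtain q where q: "q \<in> N" "\<And>r. r \<in> N \<Longrightarrow> w r \<le> w q"
    using usc_on_attains_sup[OF N(1) _ usc_on_subset[OF wusc N(3)]] N(2) by blast
  have w1: "S / 2 \<le> w (x1, t1)"
  proof -
    have "chi (\<beta> *\<^sub>R x1) \<le> 2 * Lx * (\<beta> * norm x1)" using nice_at_0[OF chi, of "\<beta> *\<^sub>R x1"] \<beta> by simp
    from mult_left_mono[OF this M'] have "M' * chi (\<beta> *\<^sub>R x1) \<le> S / 4" using \<beta>(5) by (simp add: algebra_simps)
    moreover have "\<kappa> * t1 \<le> \<kappa> * T" using t1 \<kappa> by simp
    moreover have "w (x1, t1) = S - \<kappa> * t1 - M' * chi (\<beta> *\<^sub>R x1)" by (simp add: w_def \<phi>_def S_def algebra_simps)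
    ultimately show ?thesis using kT by linarith
  qed
  have out: "w (y, s) \<le> w q" if "(y, s) \<in> QT_bar T" for y s
  proof (cases "(y, s) \<in> N")
    case False
    then have "R < norm y" using that by (auto simp: N_def QT_bar_def)
    then have "real CARD('n) / \<beta> \<le> norm y" using norm_ge_zero[of x1] unfolding R_def by linarith
    then have "1 / 2 \<le> chi (\<beta> *\<^sub>R y)" using \<beta> by (intro chi_ge_half) (simp add: field_simps)
    from mult_left_mono[OF this M'] have "M / 1 + L + 1 \<le> M' * chi (\<beta> *\<^sub>R y)" by (simp add: M'_def)
    moreover have "u (y, s) \<le> M" using u(3)[OF that] by linarith
    moreover have "- L \<le> \<psi> y" using \<psi> unfolding nice_def by (metis abs_le_D2 minus_le_iff)
    moreover have "0 \<le> (C + \<kappa>) * s" using that C \<kappa> by (auto simp: QT_bar_def)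
    ultimately have "w (y, s) \<le> 0" by (simp add: w_def \<phi>_def)
    then show ?thesis using q(2)[OF N(2)] w1 S by linarith
  qed (rule q(2))
  obtain x t where xt: "q = (x, t)" by force
  have qT: "0 \<le> t" "t \<le> T" using q N xt by (auto simp: QT_bar_def)
  have "t \<noteq> 0"
  proof
    assume "t = 0"
    then have "w q \<le> 0" using init[of x] mult_nonneg_nonneg[OF M' chi_nonneg, of "\<beta> *\<^sub>R x"] by (simp add: w_def \<phi>_def xt)
    then show False using q(2)[OF N(2)] w1 S by linarith
  qed
  then have t: "t \<in> {0<..T}" using qT by simp
  define p where "p = P x + M' *\<^sub>R (\<beta> *\<^sub>R P\<chi> (\<beta> *\<^sub>R x + 0))"
  have Gp: "GDERIV (\<lambda>y. \<phi> (y, t)) x :> p"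
  proof -
    have "GDERIV (\<lambda>y. \<psi> y + (C + \<kappa>) * t + M' * chi (\<beta> *\<^sub>R y + 0)) x :> P x + 0 + M' *\<^sub>R (\<beta> *\<^sub>R P\<chi> (\<beta> *\<^sub>R x + 0))"
      using \<psi> nice_affine(2)[OF chi, of \<beta> 0 x] \<beta> by (intro GDERIV_add GDERIV_cmult GDERIV_const) (auto simp: nice_def)
    then show ?thesis by (simp add: \<phi>_def p_def)
  qed
  have Vt: "((\<lambda>s. \<phi> (x, s)) has_vector_derivative (C + \<kappa>)) (at t within {0<..T})"
    unfolding \<phi>_def by (auto intro!: derivative_eq_intros)
  \<comment> \<open>The maximum is global, so the radius is a free choice in (0, 1).\<close>
  have lm: "local_max T (\<lambda>q. u q - \<phi> q) (1/2) x t"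
    unfolding local_max_def using out xt by (auto simp: w_def QT_def QT_bar_def)
  note ineq = subsol_ineq[OF u(1) levy_kernel_axioms _ _ t C2 lm Gp Vt]
  define dp where "dp = (\<lambda>z. \<phi> (x + z, t) - \<phi> (x, t))"
  define g where "g = glue (1/2) dp (\<lambda>z. u (x + z, t) - u (x, t))"
  have adm: "lev_adm p g" and le: "C + \<kappa> + F x p (lev K p g) \<le> 0"
    using ineq by (auto simp: g_def dp_def)
  have incr: "dp = (\<lambda>z. (\<psi> (1 *\<^sub>R (x + z) + 0) - \<psi> (1 *\<^sub>R x + 0)) + M' * (chi (\<beta> *\<^sub>R (x + z) + 0) - chi (\<beta> *\<^sub>R x + 0)))"
    by (simp add: dp_def \<phi>_def algebra_simps fun_eq_iff)
  note n1 = nice_incr[OF \<psi>, of 1 x 0] nice_incr[OF chi, of \<beta> x 0]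
  have db: "\<bar>comp_incr p dp z\<bar> \<le> (2 * L + M' * (2 * \<beta> * Lx)) * wt z" for z
  proof -
    have "comp_incr p dp z = comp_incr (1 *\<^sub>R P (1 *\<^sub>R x + 0)) (\<lambda>z. \<psi> (1 *\<^sub>R (x + z) + 0) - \<psi> (1 *\<^sub>R x + 0)) z
       + M' * comp_incr (\<beta> *\<^sub>R P\<chi> (\<beta> *\<^sub>R x + 0)) (\<lambda>z. chi (\<beta> *\<^sub>R (x + z) + 0) - chi (\<beta> *\<^sub>R x + 0)) z"
      by (simp add: comp_incr_def p_def incr algebra_simps)
    also have "\<bar>\<dots>\<bar> \<le> 2 * 1 * L * wt z + M' * (2 * \<beta> * Lx * wt z)"
    proof (rule order_trans[OF abs_triangle_ineq add_mono])
      show "\<bar>comp_incr (1 *\<^sub>R P (1 *\<^sub>R x + 0)) (\<lambda>z. \<psi> (1 *\<^sub>R (x + z) + 0) - \<psi> (1 *\<^sub>R x + 0)) z\<bar> \<le> 2 * 1 * L * wt z"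
        by (rule n1(1)) auto
      show "\<bar>M' * comp_incr (\<beta> *\<^sub>R P\<chi> (\<beta> *\<^sub>R x + 0)) (\<lambda>z. chi (\<beta> *\<^sub>R (x + z) + 0) - chi (\<beta> *\<^sub>R x + 0)) z\<bar>
          \<le> M' * (2 * \<beta> * Lx * wt z)"
        unfolding abs_mult abs_of_nonneg[OF M'] by (intro mult_left_mono n1(3) M') (use \<beta> in auto)
    qed
    finally show ?thesis by (simp add: algebra_simps)
  qed
  have dm: "dp \<in> borel_measurable lebesgue"
    unfolding incr using n1(2,4) \<beta> by (intro borel_measurable_add borel_measurable_times borel_measurable_const) auto
  \<comment> \<open>Maximality in space bounds the increment of u by that of the test function at
    every z, so the glued increment may be replaced by the smooth one.\<close>
  have "lev K p g \<le> lev K p dp"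
  proof (rule lev_mono[OF adm])
    show "lev_adm p dp" unfolding lev_adm_def using db dm by blast
    show "comp_incr p g z \<le> comp_incr p dp z" for z
      unfolding g_def
    proof (rule glue_le)
      fix z show "u (x + z, t) - u (x, t) \<le> dp z"
        using out[of "x + z" t] t xt by (simp add: w_def dp_def QT_bar_def)
    qed
  qed
  also have "\<dots> \<le> (2 * L + M' * (2 * \<beta> * Lx)) * mass"
    using lev_abs_le[OF dm db] by linarith
  also have "\<dots> \<le> 2 * L * mass + 1" using \<beta>(4) by (simp add: algebra_simps)
  finally have lb: "lev K p g \<le> 2 * L * mass + 1" .
  have pb: "norm p \<le> L + 1"
  proof -
    have "norm (P x) \<le> L" using \<psi> by (simp add: nice_def)
    moreover have "norm (M' *\<^sub>R (\<beta> *\<^sub>R P\<chi> (\<beta> *\<^sub>R x + 0))) \<le> M' * (\<beta> * Lx)"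
      using mult_left_mono[OF nice_affine(3)[OF chi, of \<beta> x 0] M'] \<beta> M' by (simp add: mult.assoc)
    ultimately show ?thesis using \<beta>(3) norm_triangle_ineq[of "P x" "M' *\<^sub>R (\<beta> *\<^sub>R P\<chi> (\<beta> *\<^sub>R x + 0))"]
      by (simp add: p_def algebra_simps)
  qed
  show False using F[OF pb lb, of x] le \<kappa> by linarith
qed

section \<open>Comparison\<close>

definition coercive_growth :: "(real ^ 'n \<Rightarrow> real ^ 'n \<Rightarrow> real) \<Rightarrow> real \<Rightarrow> real \<Rightarrow> real \<Rightarrow> bool" where
  "coercive_growth g m b1 C1 \<longleftrightarrow> (\<forall>\<mu> x p. 0 < \<mu> \<and> \<mu> < 1 \<longrightarrow>
     (1 - \<mu>) * (b1 * norm p powr m - C1) \<le> \<mu> * g x (inverse \<mu> *\<^sub>R p) - g x p)"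

text \<open>Continuity measured relative to R^m. This form names no particular modulus, is stable
  under averaging over the torus, and allows exactly the error that a coercive gain of order |p|^m
  can absorb.\<close>

definition modulus_growth :: "('a::real_normed_vector \<Rightarrow> 'b::real_normed_vector \<Rightarrow> real) \<Rightarrow> real \<Rightarrow> bool" where
  "modulus_growth g m \<longleftrightarrow> (\<forall>\<theta>>0. \<exists>r>0. \<forall>x x' p p' R. 1 \<le> R \<longrightarrow> norm p \<le> R \<longrightarrow> norm p' \<le> R \<longrightarrow>
     norm (x - x') < r \<longrightarrow> norm (p - p') < r \<longrightarrow> \<bar>g x p - g x' p'\<bar> \<le> \<theta> * R powr m)"

text \<open>The coercive term \<open>(1 - \<mu>) b1 |p|^m\<close> absorbs the oscillation of \<open>g\<close> in \<open>x\<close>, which is only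
  small relative to \<open>|p|^m\<close>.\<close>

lemma coercive_absorb:
  assumes g: "coercive_growth g m b1 C1" "modulus_growth g m" and b1: "0 < b1" and m: "0 < m"
    and \<mu>: "0 < \<mu>" "\<mu> < 1" and e: "0 < e"
  shows "\<exists>r>0. \<forall>x y p q. norm (x - y) < r \<longrightarrow> norm q < r \<longrightarrow>
     - (1 - \<mu>) * C1 - e \<le> \<mu> * g x (inverse \<mu> *\<^sub>R (p + q)) - g y p"
proof -
  define k where "k = (1 - \<mu>) * b1"
  have k: "0 < k" using \<mu> b1 by (simp add: k_def)
  \<comment> \<open>The factor 2^m comes from (P + 1)^m \<le> 2^m (P^m + 1). In the minimum, k
    leaves an error k P^m that the coercive gain cancels, and e bounds the remaining
    constant.\<close>
  define \<theta> where "\<theta> = min k e / 2 powr m"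
  have \<theta>: "0 < \<theta>" using k e by (simp add: \<theta>_def)
  obtain r where r: "0 < r" "\<forall>x x' p p' R. 1 \<le> R \<longrightarrow> norm p \<le> R \<longrightarrow> norm p' \<le> R \<longrightarrow>
     norm (x - x') < r \<longrightarrow> norm (p - p') < r \<longrightarrow> \<bar>g x p - g x' p'\<bar> \<le> \<theta> * R powr m"
    using g(2) \<theta> unfolding modulus_growth_def by blast
  show ?thesis
  proof (intro exI[of _ "min r 1"] conjI allI impI)
    show "0 < min r 1" using r by simp
    fix x y p q :: "real^'a" assume a: "norm (x - y) < min r 1" "norm q < min r 1"
    define P where "P = norm (p + q)"
    have P: "0 \<le> P" by (simp add: P_def)
    have "norm p \<le> P + norm q" using norm_triangle_ineq4[of "p + q" q] by (simp add: P_def)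
    then have p: "norm p \<le> P + 1" using a by simp
    have "(P + 1) powr m \<le> (2 * max P 1) powr m" using P m by (intro powr_mono2) auto
    also have "\<dots> = 2 powr m * max P 1 powr m" using P by (simp add: powr_mult)
    also have "\<dots> \<le> 2 powr m * (P powr m + 1)" by (intro mult_left_mono) (auto simp: max_def)
    finally have R: "(P + 1) powr m \<le> 2 powr m * (P powr m + 1)" .
    have "\<bar>g x (p + q) - g y p\<bar> \<le> \<theta> * (P + 1) powr m"
      using r(2)[rule_format, of "P + 1" "p + q" p x y] P p a by (simp add: P_def)
    also have "\<dots> \<le> \<theta> * (2 powr m * (P powr m + 1))" using \<theta> R by (intro mult_left_mono) auto
    also have "\<dots> = min k e * (P powr m + 1)" by (simp add: \<theta>_def)
    also have "\<dots> \<le> k * P powr m + e"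
      using mult_right_mono[of "min k e" k "P powr m"] by (simp add: distrib_left)
    finally have 1: "\<bar>g x (p + q) - g y p\<bar> \<le> k * P powr m + e" .
    have "(1 - \<mu>) * (b1 * P powr m - C1) \<le> \<mu> * g x (inverse \<mu> *\<^sub>R (p + q)) - g x (p + q)"
      using g(1) \<mu> unfolding coercive_growth_def P_def by blast
    then have "k * P powr m - (1 - \<mu>) * C1 \<le> \<mu> * g x (inverse \<mu> *\<^sub>R (p + q)) - g x (p + q)"
      by (simp add: k_def algebra_simps)
    then show "- (1 - \<mu>) * C1 - e \<le> \<mu> * g x (inverse \<mu> *\<^sub>R (p + q)) - g y p"
      using 1 by (simp add: abs_le_iff algebra_simps)
  qed
qed

text \<open>A compact set inside an open one has a neighbourhood of uniform width that still lies
  inside. It is applied to the diagonal at time 0.\<close>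

lemma usc_below_near_compact:
  fixes X :: "'a::euclidean_space set"
  assumes f: "usc_on X f" and D: "compact D" "D \<subseteq> X" "D \<noteq> {}" and lt: "\<And>d. d \<in> D \<Longrightarrow> f d < c"
  shows "\<exists>r>0. \<forall>d\<in>D. \<forall>q\<in>X. dist d q < r \<longrightarrow> f q < (c::real)"
proof -
  obtain U where U: "open U" "{q\<in>X. f q < c} = X \<inter> U"
    using f unfolding usc_on_iff_openin openin_open by blast
  have "D \<subseteq> U" using U(2) D lt by blast
  then obtain e where e: "e > 0" "{x. infdist x D \<le> e} \<subseteq> U"
    using compact_in_open_separated[OF D(3,1) U(1)] by blast
  have "f q < c" if "d \<in> D" "q \<in> X" "dist d q < e" for d q
  proof -
    have "infdist q D \<le> e" using infdist_le[OF that(1), of q] that(3) by (simp add: dist_commute)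
    then have "q \<in> X \<inter> U" using e that by blast
    then show ?thesis using U(2) by blast
  qed
  then show ?thesis using e(1) by blast
qed

lemma usc_penalised_max:
  fixes f :: "'a::real_normed_vector \<Rightarrow> real"
  assumes "compact N" "N \<subseteq> X" "q0 \<in> N" "usc_on X f" and out: "\<And>q. q \<in> X \<Longrightarrow> q \<notin> N \<Longrightarrow> f q \<le> f q0"
  shows "\<exists>q\<in>N. \<forall>r\<in>X. f r \<le> f q"
proof -
  obtain q where q: "q \<in> N" "\<And>r. r \<in> N \<Longrightarrow> f r \<le> f q"
    using usc_on_attains_sup[OF assms(1) _ usc_on_subset[OF assms(4,2)]] assms(3) by blast
  show ?thesis using q out assms(3) by (meson order_trans)
qed

context levy_kernel
begin

text \<open>The parameters are fixed in the order \<nu> = 1 - \<mu>, \<beta> (localisation), \<eta>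
  (doubling in time), \<epsilon> (doubling in space), \<delta> (radius of the viscosity
  inequalities), each allowed to depend on the earlier ones. In space it is enough that |x - y| is
  below a fixed radius at the maximum: the coercive term absorbs the oscillation whatever the size
  of p = (x - y) / \<epsilon>, so no decay of |x - y|^2 / \<epsilon> is asked for.\<close>

lemma comparison_principle:
  fixes u v :: "(real ^ 'n) \<times> real \<Rightarrow> real" and g :: "real ^ 'n \<Rightarrow> real ^ 'n \<Rightarrow> real"
  assumes T: "0 < T" and m: "0 < m" and b1: "0 < b1"
    and g: "coercive_growth g m b1 C1" "modulus_growth g m"
    and b: "0 < bm" "\<And>x. bm \<le> b x" "uniformly_continuous_on UNIV b"
    and F: "\<And>x p l. F x p l = (- l + g x p) / b x"
    and u: "visc_subsol T K F u" "usc_on (QT_bar T) u" "\<And>q. q \<in> QT_bar T \<Longrightarrow> \<bar>u q\<bar> \<le> M"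
    and v: "visc_supersol T K F v" "lsc_on (QT_bar T) v" "\<And>q. q \<in> QT_bar T \<Longrightarrow> \<bar>v q\<bar> \<le> M"
    and init: "\<And>x. u (x, 0) \<le> v (x, 0)"
    and q1: "(x1, t1) \<in> QT_bar T"
  shows "u (x1, t1) \<le> v (x1, t1)"
proof (rule ccontr)
  define S where "S = u (x1, t1) - v (x1, t1)"
  assume "\<not> ?thesis"
  then have S: "0 < S" by (simp add: S_def)
  have t1: "0 \<le> t1" "t1 \<le> T" using q1 by (auto simp: QT_bar_def)
  have M: "0 \<le> M" using u(3)[OF q1] by linarith
  define w where "w q = - v q" for q
  have w: "visc_subsol T K (neg_op F) w" "usc_on (QT_bar T) w" "\<And>q. q \<in> QT_bar T \<Longrightarrow> \<bar>w q\<bar> \<le> M"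
    using visc_subsol_uminus[OF levy_kernel_axioms v(1)] v(2,3) unfolding w_def[abs_def] lsc_on_iff_usc_on by auto
  obtain P\<chi> Lx where chi: "nice (chi :: real^'n \<Rightarrow> real) P\<chi> Lx" using chi_nice by blast
  have Lx: "0 \<le> Lx" using chi by (auto simp: nice_def)
  \<comment> \<open>Half of M' exceeds 2 M, the bound on \<mu> u - v, so the maximum cannot lie
    where chi is at least 1/2.\<close>
  define M' where "M' = 4 * M + 2"
  have M': "0 \<le> M'" using M by (simp add: M'_def)
  define \<kappa> where "\<kappa> = S / (8 * (T + 1))"
  have \<kappa>: "0 < \<kappa>" using S T by (simp add: \<kappa>_def)
  have kT: "\<kappa> * T \<le> S / 8" using S T by (simp add: \<kappa>_def field_simps)
  \<comment> \<open>The closing balance loses at most 6 e: e from b(x) - b(y), 2 e from the Levy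
    integrals and 3 e from the coercive estimate. The extra time slope \<kappa> contributes b(x)
    \<kappa>, which is at least 8 e.\<close>
  define e where "e = bm * \<kappa> / 8"
  have e: "0 < e" using b(1) \<kappa> by (simp add: e_def)
  have "\<forall>\<^sub>F \<nu> in at_right 0. (0 < \<nu> \<and> \<nu> < (1::real)) \<and> M * \<nu> < S / 8 \<and> C1 * \<nu> < 2 * e"
    using S e by (intro eventually_conj eventually_small) (auto intro: eventually_at_rightI[of 0 1])
  then obtain \<nu> where \<nu>: "0 < \<nu>" "\<nu> < 1" "M * \<nu> < S / 8" "C1 * \<nu> < 2 * e"
    using eventually_happens'[OF trivial_limit_at_right_real] by blast
  define \<mu> where "\<mu> = 1 - \<nu>"
  have \<mu>: "0 < \<mu>" "\<mu> < 1" using \<nu> by (auto simp: \<mu>_def)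
  have \<mu>u: "\<bar>\<mu> * u q - u q\<bar> \<le> S / 8" "\<bar>\<mu> * u q\<bar> \<le> M" if "q \<in> QT_bar T" for q
  proof -
    have "\<bar>\<mu> * u q - u q\<bar> = \<nu> * \<bar>u q\<bar>" using \<nu> by (simp add: \<mu>_def algebra_simps abs_mult)
    also have "\<dots> \<le> \<nu> * M" using \<nu> u(3)[OF that] by (intro mult_left_mono) auto
    finally show "\<bar>\<mu> * u q - u q\<bar> \<le> S / 8" using \<nu>(3) by (simp add: mult.commute)
    have "\<bar>\<mu> * u q\<bar> = \<mu> * \<bar>u q\<bar>" using \<mu> by (simp add: abs_mult)
    also have "\<dots> \<le> 1 * M" using \<mu> u(3)[OF that] by (intro mult_mono) auto
    finally show "\<bar>\<mu> * u q\<bar> \<le> M" by simp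
  qed
  obtain r1 where r1: "0 < r1" "\<And>x y p q. norm (x - y) < r1 \<Longrightarrow> norm q < r1 \<Longrightarrow>
     - (1 - \<mu>) * C1 - e \<le> \<mu> * g x (inverse \<mu> *\<^sub>R (p + q)) - g y p"
    using coercive_absorb[OF g b1 m \<mu> e] by blast
  have "\<forall>\<^sub>F \<beta> in at_right 0. (0 < \<beta> \<and> \<beta> < 1) \<and> (M' * Lx) * \<beta> < r1 \<and> (2 * M' * Lx * mass) * \<beta> < e \<and>
      (M' * 2 * Lx * norm x1) * \<beta> < S / 4"
    using S e r1(1) by (intro eventually_conj eventually_small) (auto intro: eventually_at_rightI[of 0 1])
  then obtain \<beta> where \<beta>: "0 < \<beta>" "\<beta> < 1" "(M' * Lx) * \<beta> < r1" "(2 * M' * Lx * mass) * \<beta> < e"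
      "(M' * 2 * Lx * norm x1) * \<beta> < S / 4"
    using eventually_happens'[OF trivial_limit_at_right_real] by blast
  define R where "R = real CARD('n) / \<beta> + norm x1"
  have R: "norm x1 \<le> R" "0 \<le> R" using \<beta> by (auto simp: R_def)
  define X where "X = (QT_bar T :: ((real^'n) \<times> real) set) \<times> (QT_bar T :: ((real^'n) \<times> real) set)"
  define h where "h = (\<lambda>Q. \<mu> * u (fst Q) + w (snd Q))"
  have husc: "usc_on X h"
    unfolding h_def using \<mu>
    by (intro usc_on_add usc_on_cmult usc_on_compose[OF u(2)] usc_on_compose[OF w(2)]) (auto simp: X_def intro!: continuous_intros)
  have hM: "h Q \<le> 2 * M" if "Q \<in> X" for Q
    using \<mu>u(2)[of "fst Q"] w(3)[of "snd Q"] that by (auto simp: X_def h_def)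
  define D where "D = (\<lambda>x. ((x, 0::real), (x, 0::real))) ` (cball (0::real^'n) R)"
  have "compact D" unfolding D_def by (intro compact_continuous_image continuous_intros) auto
  moreover have "D \<subseteq> X" "D \<noteq> {}" using T R by (auto simp: D_def X_def QT_bar_def)
  \<comment> \<open>On the initial diagonal the ordering of the data leaves at most S / 8, the cost
    of replacing u by \<mu> u. Upper semicontinuity then keeps h below S / 2 on a neighbourhood of
    uniform width, where the maximum cannot lie.\<close>
  moreover have "h d < S / 2" if "d \<in> D" for d
  proof -
    obtain x where d: "d = ((x, 0), (x, 0))" using \<open>d \<in> D\<close> by (auto simp: D_def)
    have "(x, 0) \<in> QT_bar T" using T by (simp add: QT_bar_def)
    from \<mu>u(1)[OF this] have "\<mu> * u (x, 0) \<le> u (x, 0) + S / 8" by linarith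
    then show ?thesis using init[of x] S by (simp add: d h_def w_def)
  qed
  ultimately obtain r2 where r2: "0 < r2" "\<And>d Q. d \<in> D \<Longrightarrow> Q \<in> X \<Longrightarrow> dist d Q < r2 \<Longrightarrow> h Q < S / 2"
    using usc_below_near_compact[OF husc, of D "S / 2"] by blast
  have init0: "h ((x, t), (y, s)) < S / 2"
    if "norm x \<le> R" "norm (x - y) < r2 / 3" "0 \<le> t" "t < r2 / 3" "t \<le> T" "0 \<le> s" "s < r2 / 3" "s \<le> T" for x y t s
  proof (rule r2(2))
    show "((x, 0), (x, 0)) \<in> D" using that by (auto simp: D_def)
    show "((x, t), (y, s)) \<in> X" using that by (simp add: X_def QT_bar_def)
    have "dist ((x, 0), (x, 0)) ((x, t), (y, s)) \<le> dist (x, 0) (x, t) + dist (x, 0) (y, s)"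
      unfolding dist_Pair_Pair[of "(x, 0)"] by (rule sqrt_sum_squares_le_sum) auto
    also have "\<dots> \<le> \<bar>t\<bar> + (dist x y + \<bar>s\<bar>)"
      unfolding dist_Pair_Pair using sqrt_sum_squares_le_sum[of "dist x y" "\<bar>s\<bar>"] by (auto simp: dist_real_def)
    also have "\<dots> < r2" using that by (simp add: dist_norm)
    finally show "dist ((x, 0), (x, 0)) ((x, t), (y, s)) < r2" .
  qed
  \<comment> \<open>As h is at most 2 M, positivity of the penalised function forces (t - s)^2 \<le>
    4 M \<eta>; this choice keeps the two times within r2 / 3 of each other.\<close>
  have "\<forall>\<^sub>F \<eta> in at_right 0. (0 < \<eta> \<and> \<eta> < 1) \<and> (4 * M) * \<eta> < (r2 / 3)\<^sup>2"
    using r2(1) by (intro eventually_conj eventually_small) (auto intro: eventually_at_rightI[of 0 1])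
  then obtain \<eta> where \<eta>: "0 < \<eta>" "\<eta> < 1" "(4 * M) * \<eta> < (r2 / 3)\<^sup>2"
    using eventually_happens'[OF trivial_limit_at_right_real] by blast
  \<comment> \<open>The time slope (t - s) / \<eta> is at most T / \<eta>. The oscillation of b is
    made small against this bound now, before \<epsilon> is chosen.\<close>
  have "0 < e / (T / \<eta> + 1)" using e T \<eta> by (auto intro!: divide_pos_pos add_pos_pos)
  then obtain r3 where r3: "0 < r3" "\<And>x y. dist x y < r3 \<Longrightarrow> dist (b x) (b y) < e / (T / \<eta> + 1)"
    using b(3) unfolding uniformly_continuous_on_def by (metis UNIV_I)
  define r where "r = min r1 (min (r2 / 3) r3)"
  have r: "0 < r" using r1 r2 r3 by (simp add: r_def)
  have "\<forall>\<^sub>F \<epsilon> in at_right 0. (0 < \<epsilon> \<and> \<epsilon> < 1) \<and> (4 * M) * \<epsilon> < r\<^sup>2"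
    using r by (intro eventually_conj eventually_small) (auto intro: eventually_at_rightI[of 0 1])
  then obtain \<epsilon> where \<epsilon>: "0 < \<epsilon>" "\<epsilon> < 1" "(4 * M) * \<epsilon> < r\<^sup>2"
    using eventually_happens'[OF trivial_limit_at_right_real] by blast
  define pen where "pen = (\<lambda>Q :: ((real^'n) \<times> real) \<times> ((real^'n) \<times> real).
     1 / (2 * \<epsilon>) * (norm (fst (fst Q) - fst (snd Q)))\<^sup>2 + 1 / (2 * \<eta>) * (snd (fst Q) - snd (snd Q))\<^sup>2)"
  have pen0: "0 \<le> pen Q" for Q using \<epsilon> \<eta> by (simp add: pen_def)
  define lo where "lo = (\<lambda>q :: (real^'n) \<times> real. M' * chi (\<beta> *\<^sub>R fst q + 0) + \<kappa> * snd q)"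
  have chic: "continuous_on UNIV (\<lambda>y::real^'n. chi (\<beta> *\<^sub>R y + 0))" using nice_affine(4)[OF chi, of \<beta> 0] \<beta> by simp
  have loc: "continuous_on A lo" for A
    unfolding lo_def by (intro continuous_intros continuous_on_compose2[OF chic, of _ fst]) auto
  have lo0: "0 \<le> lo q" if "q \<in> QT_bar T" for q
    using that \<kappa> M' unfolding lo_def by (auto simp: QT_bar_def intro!: add_nonneg_nonneg mult_nonneg_nonneg chi_nonneg)
  define \<Psi> where "\<Psi> = (\<lambda>Q. h Q - pen Q - lo (fst Q))"
  have pusc: "usc_on X \<Psi>"
  proof -
    have "continuous_on X (\<lambda>Q. - pen Q - lo (fst Q))"
      unfolding pen_def by (intro continuous_intros continuous_on_compose2[OF loc[of UNIV], of _ fst]) auto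
    from usc_on_add[OF husc usc_on_continuous[OF this]] show ?thesis by (simp add: \<Psi>_def algebra_simps)
  qed
  define Q1 where "Q1 = ((x1, t1), (x1, t1))"
  have P1: "S / 2 \<le> \<Psi> Q1"
  proof -
    have "chi (\<beta> *\<^sub>R x1) \<le> 2 * Lx * (\<beta> * norm x1)" using nice_at_0[OF chi, of "\<beta> *\<^sub>R x1"] \<beta> by simp
    from mult_left_mono[OF this M'] have "M' * chi (\<beta> *\<^sub>R x1) \<le> S / 4" using \<beta>(5) by (simp add: algebra_simps)
    moreover have "\<kappa> * t1 \<le> \<kappa> * T" using t1 \<kappa> by simp
    moreover have "\<Psi> Q1 = \<mu> * u (x1, t1) - v (x1, t1) - \<kappa> * t1 - M' * chi (\<beta> *\<^sub>R x1)"
      by (simp add: \<Psi>_def Q1_def h_def w_def pen_def lo_def)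
    ultimately show ?thesis using kT \<mu>u(1)[OF q1] S_def by linarith
  qed
  define N where "N = (cball (0::real^'n) R \<times> {0..T}) \<times> (cball (0::real^'n) (R + r) \<times> {0..T})"
  have Ncomp: "compact N" "N \<subseteq> X" "Q1 \<in> N"
    using R t1 r by (auto simp: N_def X_def QT_bar_def Q1_def intro!: compact_Times)
  have penM: "norm (fst (fst Q) - fst (snd Q)) < r" "\<bar>snd (fst Q) - snd (snd Q)\<bar> < r2 / 3" "norm (fst (fst Q)) \<le> R"
    if "Q \<in> X" "0 < \<Psi> Q" for Q
  proof -
    have fQ: "fst Q \<in> QT_bar T" using that by (auto simp: X_def)
    have hle: "pen Q \<le> 2 * M" using that hM[OF that(1)] lo0[OF fQ] unfolding \<Psi>_def by linarith
    have n1: "1 / (2 * \<epsilon>) * (norm (fst (fst Q) - fst (snd Q)))\<^sup>2 \<le> pen Q"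
      "1 / (2 * \<eta>) * (snd (fst Q) - snd (snd Q))\<^sup>2 \<le> pen Q"
      using \<epsilon> \<eta> unfolding pen_def by auto
    have "(norm (fst (fst Q) - fst (snd Q)))\<^sup>2 \<le> 4 * M * \<epsilon>"
      using order_trans[OF n1(1) hle] \<epsilon> by (simp add: field_simps)
    then have "(norm (fst (fst Q) - fst (snd Q)))\<^sup>2 < r\<^sup>2" using \<epsilon>(3) by simp
    then show "norm (fst (fst Q) - fst (snd Q)) < r" using r power_less_imp_less_base less_imp_le by metis
    have "(snd (fst Q) - snd (snd Q))\<^sup>2 \<le> 4 * M * \<eta>"
      using order_trans[OF n1(2) hle] \<eta> by (simp add: field_simps)
    then have "\<bar>snd (fst Q) - snd (snd Q)\<bar>\<^sup>2 < (r2 / 3)\<^sup>2" using \<eta>(3) by simp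
    then show "\<bar>snd (fst Q) - snd (snd Q)\<bar> < r2 / 3"
      using power_less_imp_less_base[of "\<bar>snd (fst Q) - snd (snd Q)\<bar>" 2 "r2 / 3"] r2(1) by simp
    show "norm (fst (fst Q)) \<le> R"
    proof (rule ccontr)
      assume "\<not> ?thesis"
      then have "real CARD('n) / \<beta> \<le> norm (fst (fst Q))" using norm_ge_zero[of x1] unfolding R_def by linarith
      then have "1 / 2 \<le> chi (\<beta> *\<^sub>R fst (fst Q))" using \<beta> by (intro chi_ge_half) (simp add: field_simps)
      from mult_left_mono[OF this M'] have "2 * M + 1 \<le> M' * chi (\<beta> *\<^sub>R fst (fst Q))" by (simp add: M'_def)
      moreover have "0 \<le> \<kappa> * snd (fst Q)" using fQ \<kappa> by (auto simp: QT_bar_def)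
      ultimately have "2 * M + 1 \<le> lo (fst Q)" by (simp add: lo_def)
      then show False using that(2) hM[OF that(1)] pen0[of Q] unfolding \<Psi>_def by linarith
    qed
  qed
  \<comment> \<open>Points of the doubled strip with positive \<open>\<Psi>\<close> lie in the
    compact set N, and \<open>\<Psi>\<close> is positive at Q1, so the supremum over the noncompact
    strip is attained.\<close>
  have "\<exists>Q\<in>N. \<forall>Q'\<in>X. \<Psi> Q' \<le> \<Psi> Q"
  proof (rule usc_penalised_max[OF Ncomp pusc])
    fix Q assume Q: "Q \<in> X" "Q \<notin> N"
    have "\<not> 0 < \<Psi> Q"
    proof
      assume pos: "0 < \<Psi> Q"
      note pm = penM[OF Q(1) pos]
      have "norm (fst (snd Q)) \<le> norm (fst (fst Q)) + norm (fst (fst Q) - fst (snd Q))"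
        using norm_triangle_sub[of "fst (snd Q)" "fst (fst Q)"] by (simp add: norm_minus_commute)
      then have "norm (fst (snd Q)) \<le> R + r" using pm by linarith
      then have "Q \<in> N" using Q(1) pm(3) by (auto simp: N_def X_def QT_bar_def)
      then show False using Q(2) by simp
    qed
    then show "\<Psi> Q \<le> \<Psi> Q1" using P1 S by linarith
  qed
  then obtain Q where Q: "Q \<in> N" "\<And>Q'. Q' \<in> X \<Longrightarrow> \<Psi> Q' \<le> \<Psi> Q" by blast
  obtain x t y s where Qe: "Q = ((x, t), (y, s))" by (metis prod.collapse)
  have QX: "Q \<in> X" using Q(1) Ncomp(2) by blast
  have PQ: "S / 2 \<le> \<Psi> Q" using Q(2)[of Q1] Ncomp P1 by force
  then have Pp: "0 < \<Psi> Q" using S by linarith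
  note pm = penM[OF QX Pp, unfolded Qe fst_conv snd_conv]
  have ts: "0 \<le> t" "t \<le> T" "0 \<le> s" "s \<le> T" using QX by (auto simp: Qe X_def QT_bar_def)
  \<comment> \<open>At least one time is not below r2 / 3, and the times differ by less than that.
    So both are positive and both viscosity inequalities apply.\<close>
  have "\<not> (t < r2 / 3 \<and> s < r2 / 3)"
  proof
    assume "t < r2 / 3 \<and> s < r2 / 3"
    then have "h Q < S / 2" unfolding Qe using pm ts by (intro init0) (auto simp: r_def)
    moreover have "0 \<le> lo (fst Q)" using QX by (intro lo0) (auto simp: X_def)
    ultimately show False using PQ pen0[of Q] by (simp add: \<Psi>_def)
  qed
  moreover have "t - s < r2 / 3" "s - t < r2 / 3" using pm(2) by linarith+
  ultimately have t0: "t \<in> {0<..T}" "s \<in> {0<..T}" using ts r2(1) by auto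
  define p where "p = (1 / \<epsilon>) *\<^sub>R (x - y)"
  define q where "q = M' *\<^sub>R (\<beta> *\<^sub>R P\<chi> (\<beta> *\<^sub>R x + 0))"
  define \<tau> where "\<tau> = (t - s) / \<eta>"
  \<comment> \<open>The factor 1 / \<mu> appears because u, and not \<mu> u, is the subsolution; it
    disappears when the first inequality is multiplied by \<mu> b(x).\<close>
  define \<phi>1 where "\<phi>1 = (\<lambda>q' :: (real^'n) \<times> real. 1 / \<mu> *
    (1 / (2 * \<epsilon>) * (norm (fst q' - y))\<^sup>2 + 1 / (2 * \<eta>) * (snd q' - s)\<^sup>2 + (M' * chi (\<beta> *\<^sub>R fst q' + 0) + \<kappa> * snd q')))"
  define \<phi>2 where "\<phi>2 = (\<lambda>q' :: (real^'n) \<times> real. 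
    1 / (2 * \<epsilon>) * (norm (fst q' - x))\<^sup>2 + 1 / (2 * \<eta>) * (snd q' - t)\<^sup>2)"
  have c\<chi>: "C2_on UNIV (\<lambda>y::real^'n. chi (\<beta> *\<^sub>R y + 0))"
    using nice_affine(1)[OF chi, of \<beta> 0] \<beta> by simp
  have C1': "C2_on (QT T) \<phi>1"
    unfolding \<phi>1_def
    by (intro C2_on_add C2_on_cmult C2_on_fst[OF c\<chi>] C2_on_fst[OF C2_on_norm_sq] C2_on_snd[OF C2_on_sq]
        C2_on_snd[OF C2_on_linear[of _ 1, simplified]])
  have C2': "C2_on (QT T) \<phi>2"
    unfolding \<phi>2_def by (intro C2_on_add C2_on_fst[OF C2_on_norm_sq] C2_on_snd[OF C2_on_sq])
  have G1: "GDERIV (\<lambda>y. \<phi>1 (y, t)) x :> inverse \<mu> *\<^sub>R (p + q)"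
  proof -
    have "GDERIV (\<lambda>v. 1 / \<mu> * (1 / (2 * \<epsilon>) * (norm (v - y))\<^sup>2 + 1 / (2 * \<eta>) * (t - s)\<^sup>2 + (M' * chi (\<beta> *\<^sub>R v + 0) + \<kappa> * t))) x
      :> (1 / \<mu>) *\<^sub>R ((2 * (1 / (2 * \<epsilon>))) *\<^sub>R (x - y) + 0 + (M' *\<^sub>R (\<beta> *\<^sub>R P\<chi> (\<beta> *\<^sub>R x + 0)) + 0))"
      using nice_affine(2)[OF chi, of \<beta> 0 x] \<beta> by (intro GDERIV_cmult GDERIV_add GDERIV_const GDERIV_norm_sq) auto
    then show ?thesis by (simp add: \<phi>1_def p_def q_def inverse_eq_divide)
  qed
  have G2: "GDERIV (\<lambda>y. \<phi>2 (y, s)) y :> - p"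
  proof -
    have "GDERIV (\<lambda>v. 1 / (2 * \<epsilon>) * (norm (v - x))\<^sup>2 + 1 / (2 * \<eta>) * (s - t)\<^sup>2) y :> (2 * (1 / (2 * \<epsilon>))) *\<^sub>R (y - x) + 0"
      by (intro GDERIV_add GDERIV_const GDERIV_norm_sq)
    then show ?thesis by (simp add: \<phi>2_def p_def scaleR_right_diff_distrib)
  qed
  have V1: "((\<lambda>s. \<phi>1 (x, s)) has_vector_derivative (\<tau> + \<kappa>) / \<mu>) (at t within {0<..T})"
    unfolding \<phi>1_def \<tau>_def has_real_derivative_iff_has_vector_derivative[symmetric]
    using \<eta> \<mu> by (auto intro!: derivative_eq_intros simp: field_simps)
  have V2: "((\<lambda>s. \<phi>2 (y, s)) has_vector_derivative - \<tau>) (at s within {0<..T})"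
    unfolding \<phi>2_def \<tau>_def has_real_derivative_iff_has_vector_derivative[symmetric]
    using \<eta> by (auto intro!: derivative_eq_intros simp: field_simps)
  have L1: "local_max T (\<lambda>q. u q - \<phi>1 q) \<delta> x t" for \<delta>
    unfolding local_max_def
  proof
    fix q' assume "q' \<in> ball x \<delta> \<times> {t - \<delta><..<t + \<delta>} \<inter> QT T"
    then have "(q', (y, s)) \<in> X" using ts by (auto simp: X_def QT_def QT_bar_def)
    from Q(2)[OF this] have "\<mu> * u q' - \<mu> * \<phi>1 q' \<le> \<mu> * u (x, t) - \<mu> * \<phi>1 (x, t)"
      using \<mu> by (simp add: \<Psi>_def Qe h_def pen_def lo_def \<phi>1_def)
    then show "u q' - \<phi>1 q' \<le> u (x, t) - \<phi>1 (x, t)"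
      using \<mu>(1) by (simp add: right_diff_distrib[symmetric])
  qed
  have L2: "local_max T (\<lambda>q. w q - \<phi>2 q) \<delta> y s" for \<delta>
    unfolding local_max_def
  proof
    fix q' assume "q' \<in> ball y \<delta> \<times> {s - \<delta><..<s + \<delta>} \<inter> QT T"
    then have "((x, t), q') \<in> X" using ts by (auto simp: X_def QT_def QT_bar_def)
    from Q(2)[OF this] show "w q' - \<phi>2 q' \<le> w (y, s) - \<phi>2 (y, s)"
      by (simp add: \<Psi>_def Qe h_def pen_def lo_def \<phi>2_def norm_minus_commute power2_commute)
  qed
  \<comment> \<open>Inside the ball of radius \<delta> the two quadratic penalties together
    contribute |z|^2 / \<epsilon>, so the mass of \<open>wt\<close> there has to be below e
    \<epsilon>.\<close>
  have "0 < e * \<epsilon>" using e \<epsilon> by simp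
  from small_ball[OF this] obtain \<delta> where \<delta>: "0 < \<delta>" "\<delta> < 1" "integrable lebesgue (\<lambda>z. indicator (ball 0 \<delta>) z * wt z * K z)"
    "(LINT z|lebesgue. indicator (ball 0 \<delta>) z * wt z * K z) < e * \<epsilon>" by blast
  note i1 = subsol_ineq[OF u(1) levy_kernel_axioms \<delta>(1,2) t0(1) C1' L1 G1 V1]
  note i2 = subsol_ineq[OF w(1) levy_kernel_axioms \<delta>(1,2) t0(2) C2' L2 G2 V2]
  define d1 where "d1 = glue \<delta> (\<lambda>z. \<phi>1 (x + z, t) - \<phi>1 (x, t)) (\<lambda>z. u (x + z, t) - u (x, t))"
  define d2 where "d2 = glue \<delta> (\<lambda>z. \<phi>2 (y + z, s) - \<phi>2 (y, s)) (\<lambda>z. w (y + z, s) - w (y, s))"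
  define l1 where "l1 = lev K (inverse \<mu> *\<^sub>R (p + q)) d1"
  define l2 where "l2 = lev K (- p) d2"
  define dq where "dq = (\<lambda>z. M' * (chi (\<beta> *\<^sub>R (x + z) + 0) - chi (\<beta> *\<^sub>R x + 0)))"
  have a1: "lev_adm (inverse \<mu> *\<^sub>R (p + q)) d1" and I1: "(\<tau> + \<kappa>) / \<mu> + (- l1 + g x (inverse \<mu> *\<^sub>R (p + q))) / b x \<le> 0"
    using i1 unfolding d1_def[symmetric] l1_def[symmetric] F by auto
  have a2: "lev_adm (- p) d2" and I2: "- \<tau> - (l2 + g y p) / b y \<le> 0"
    using i2 unfolding d2_def[symmetric] l2_def[symmetric] F neg_op_def by auto
  note n1 = nice_incr[OF chi, of \<beta> x 0]
  have dqb: "\<bar>comp_incr q dq z\<bar> \<le> (M' * (2 * \<beta> * Lx)) * wt z" for z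
  proof -
    have "comp_incr q dq z = M' * comp_incr (\<beta> *\<^sub>R P\<chi> (\<beta> *\<^sub>R x + 0)) (\<lambda>z. chi (\<beta> *\<^sub>R (x + z) + 0) - chi (\<beta> *\<^sub>R x + 0)) z"
      by (simp add: comp_incr_def q_def dq_def algebra_simps)
    also have "\<bar>\<dots>\<bar> \<le> M' * (2 * \<beta> * Lx * wt z)"
      unfolding abs_mult abs_of_nonneg[OF M'] by (intro mult_left_mono n1 M') (use \<beta> in auto)
    finally show ?thesis by (simp add: mult.assoc)
  qed
  have dqm: "dq \<in> borel_measurable lebesgue"
    unfolding dq_def using n1(2) \<beta> by (intro borel_measurable_times borel_measurable_const) auto
  have aq: "lev_adm q dq" unfolding lev_adm_def using dqb dqm by blast
  have lq: "lev K q dq \<le> e" using lev_abs_le[OF dqm dqb] \<beta>(4) by (simp add: algebra_simps)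
  have as: "lev_adm (\<mu> *\<^sub>R (inverse \<mu> *\<^sub>R (p + q)) + - p) (\<lambda>z. \<mu> * d1 z + d2 z)"
    by (intro lev_adm_add lev_adm_scale a1 a2)
  have sum: "\<mu> * l1 + l2 = lev K (\<mu> *\<^sub>R (inverse \<mu> *\<^sub>R (p + q)) + - p) (\<lambda>z. \<mu> * d1 z + d2 z)"
    unfolding l1_def l2_def by (simp only: lev_add[OF lev_adm_scale[OF a1] a2] lev_scale)
  have pq: "\<mu> *\<^sub>R (inverse \<mu> *\<^sub>R (p + q)) + - p = q" using \<mu> by simp
  \<comment> \<open>Near 0 the linear terms of the two squares cancel and |z|^2 / \<epsilon>
    remains. Away from 0 both points are shifted by the same z, which leaves the penalty unchanged,
    so maximality compares the increments directly.\<close>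
  have key: "\<mu> * d1 z + d2 z \<le> dq z + 1 / \<epsilon> * (indicator (ball 0 \<delta>) z * wt z)" for z
  proof (cases "norm z < \<delta>")
    case True
    have e1: "(norm (x + z - y))\<^sup>2 = (norm (x - y))\<^sup>2 + 2 * ((x - y) \<bullet> z) + (norm z)\<^sup>2"
      unfolding power2_norm_eq_inner by (simp add: algebra_simps inner_commute)
    have e2: "(norm (y + z - x))\<^sup>2 = (norm (y - x))\<^sup>2 - 2 * ((x - y) \<bullet> z) + (norm z)\<^sup>2"
      unfolding power2_norm_eq_inner by (simp add: algebra_simps inner_commute)
    define k where "k = 1 / (2 * \<epsilon>)"
    have "\<mu> * d1 z = k * (norm (x + z - y))\<^sup>2 - k * (norm (x - y))\<^sup>2 + dq z"
      using True \<mu> by (simp add: d1_def glue_def \<phi>1_def dq_def right_diff_distrib k_def)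
    moreover have "d2 z = k * (norm (y + z - x))\<^sup>2 - k * (norm (y - x))\<^sup>2"
      using True by (simp add: d2_def glue_def \<phi>2_def k_def)
    ultimately have "\<mu> * d1 z + d2 z = dq z + (2 * k) * (norm z)\<^sup>2"
      unfolding e1 e2 norm_minus_commute[of y x] by (simp add: algebra_simps)
    then show ?thesis using True \<delta> by (simp add: wt_less_1 k_def)
  next
    case False
    have "((x + z, t), (y + z, s)) \<in> X" using ts by (auto simp: X_def QT_bar_def)
    from Q(2)[OF this] have "\<mu> * (u (x + z, t) - u (x, t)) + (w (y + z, s) - w (y, s)) \<le> dq z"
      by (simp add: \<Psi>_def Qe h_def pen_def lo_def dq_def algebra_simps)
    then show ?thesis using False by (simp add: d1_def d2_def glue_def)
  qed
  have ir: "integrable lebesgue (\<lambda>z. 1 / \<epsilon> * (indicator (ball 0 \<delta>) z * wt z) * K z)"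
    using integrable_mult_right[OF \<delta>(3), of "1 / \<epsilon>"] by (simp add: mult.assoc)
  have "\<mu> * l1 + l2 \<le> lev K q dq + (LINT z|lebesgue. 1 / \<epsilon> * (indicator (ball 0 \<delta>) z * wt z) * K z)"
    unfolding sum pq by (rule lev_mono_gen[OF as[unfolded pq] aq ir]) (use key in \<open>simp add: comp_incr_def\<close>)
  also have "(LINT z|lebesgue. 1 / \<epsilon> * (indicator (ball 0 \<delta>) z * wt z) * K z)
      = 1 / \<epsilon> * (LINT z|lebesgue. indicator (ball 0 \<delta>) z * wt z * K z)"
    by (subst integral_mult_right_zero[symmetric]) (simp add: mult.assoc)
  also have "\<dots> \<le> e" using \<delta>(4) \<epsilon> by (simp add: field_simps)
  finally have ll: "\<mu> * l1 + l2 \<le> 2 * e" using lq by linarith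
  have bx: "0 < b x" "0 < b y" using b(1) b(2)[of x] b(2)[of y] by linarith+
  have J1: "b x * (\<tau> + \<kappa>) - \<mu> * l1 + \<mu> * g x (inverse \<mu> *\<^sub>R (p + q)) \<le> 0"
  proof -
    have "(\<mu> * b x) * ((\<tau> + \<kappa>) / \<mu> + (- l1 + g x (inverse \<mu> *\<^sub>R (p + q))) / b x) \<le> 0"
      using I1 \<mu> bx by (intro mult_nonneg_nonpos) auto
    moreover have "(\<mu> * b x) * ((\<tau> + \<kappa>) / \<mu> + (- l1 + g x (inverse \<mu> *\<^sub>R (p + q))) / b x)
        = b x * (\<tau> + \<kappa>) + \<mu> * (- l1 + g x (inverse \<mu> *\<^sub>R (p + q)))"
      using \<mu> bx by (simp add: distrib_left add_divide_distrib)
    ultimately show ?thesis by (simp add: algebra_simps)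
  qed
  have J2: "- (b y * \<tau>) - l2 - g y p \<le> 0"
  proof -
    have "b y * (- \<tau> - (l2 + g y p) / b y) \<le> 0" using I2 bx by (intro mult_nonneg_nonpos) auto
    moreover have "b y * (- \<tau> - (l2 + g y p) / b y) = - (b y * \<tau>) - (l2 + g y p)"
      using bx by (simp add: right_diff_distrib)
    ultimately show ?thesis by linarith
  qed
  have tb: "\<bar>\<tau>\<bar> \<le> T / \<eta>" using ts \<eta> by (auto simp: \<tau>_def abs_le_iff field_simps)
  have "\<bar>(b x - b y) * \<tau>\<bar> \<le> e / (T / \<eta> + 1) * (T / \<eta> + 1)"
    unfolding abs_mult
  proof (rule mult_mono)
    show "\<bar>b x - b y\<bar> \<le> e / (T / \<eta> + 1)"
      using r3(2)[of x y] pm(1) by (simp add: dist_norm r_def)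
    show "\<bar>\<tau>\<bar> \<le> T / \<eta> + 1" using tb by simp
    show "0 \<le> e / (T / \<eta> + 1)" using e T \<eta> by (auto intro!: divide_nonneg_nonneg add_nonneg_nonneg)
  qed simp
  also have "\<dots> = e"
  proof -
    have "0 < T / \<eta> + 1" using T \<eta> by (intro add_pos_pos divide_pos_pos) auto
    then show ?thesis by simp
  qed
  finally have J3: "- e \<le> (b x - b y) * \<tau>" by (simp add: abs_le_iff)
  have qr: "norm q < r1"
  proof -
    have "norm q = M' * norm (\<beta> *\<^sub>R P\<chi> (\<beta> *\<^sub>R x + 0))" using M' by (simp add: q_def abs_mult)
    also have "\<dots> \<le> M' * (\<beta> * Lx)" using nice_affine(3)[OF chi, of \<beta> x 0] \<beta> M' by (intro mult_left_mono) auto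
    finally show ?thesis using \<beta>(3) by (simp add: algebra_simps)
  qed
  have J4: "- (1 - \<mu>) * C1 - e \<le> \<mu> * g x (inverse \<mu> *\<^sub>R (p + q)) - g y p"
    using pm(1) qr by (intro r1(2)) (auto simp: r_def)
  have J5: "(1 - \<mu>) * C1 \<le> 2 * e" using \<nu>(4) by (simp add: \<mu>_def mult.commute)
  have J6: "8 * e \<le> b x * \<kappa>" using mult_right_mono[OF b(2)[of x], of \<kappa>] \<kappa> by (simp add: e_def)
  have J7: "b x * (\<tau> + \<kappa>) - b y * \<tau> = (b x - b y) * \<tau> + b x * \<kappa>" by (simp add: algebra_simps)
  have J8: "- (1 - \<mu>) * C1 = - ((1 - \<mu>) * C1)" by (rule mult_minus_left)
  show False using J1 J2 J3 J4[unfolded J8] J5 J6 J7 ll e by linarith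
qed

end

section \<open>Perturbed test functions\<close>

text \<open>Minus the fractional Laplacian, with the gradient subtracted on all of space. This
  converges at infinity because \<sigma> > 1 and, having no cutoff at radius 1, is exactly
  homogeneous under dilations.\<close>

definition frac_full :: "real \<Rightarrow> (real ^ 'n \<Rightarrow> real) \<Rightarrow> (real ^ 'n \<Rightarrow> real ^ 'n) \<Rightarrow> real ^ 'n \<Rightarrow> real" where
  "frac_full \<sigma> \<psi> P y = (LINT w|lebesgue. (\<psi> (y + w) - \<psi> y - P y \<bullet> w) * frac_kernel \<sigma> w)"

text \<open>Under the substitution z = \<epsilon> w the Jacobian \<epsilon>^N combines with the
  homogeneity \<epsilon>^(-N-\<sigma>) of the kernel.\<close>

lemma integral_power_scale:
  fixes f :: "real ^ 'n \<Rightarrow> real"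
  assumes f: "f \<in> borel_measurable borel" and \<epsilon>: "0 < \<epsilon>"
  shows "(LINT z|lebesgue. f (inverse \<epsilon> *\<^sub>R z) / norm z powr (real CARD('n) + \<sigma>))
    = \<epsilon> powr (- \<sigma>) * (LINT z|lebesgue. f z / norm z powr (real CARD('n) + \<sigma>))"
proof -
  let ?N = "real CARD('n)"
  define g where "g z = f (inverse \<epsilon> *\<^sub>R z) / norm z powr (?N + \<sigma>)" for z :: "real^'n"
  have fs: "(\<lambda>z. f (inverse \<epsilon> *\<^sub>R z)) \<in> borel_measurable borel"
    by (rule measurable_compose[OF _ f]) measurable
  have gm: "g \<in> borel_measurable borel" unfolding g_def using fs by measurable
  have fm: "(\<lambda>z. f z / norm z powr (?N + \<sigma>)) \<in> borel_measurable borel" using f by measurable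
  have c: "g (\<epsilon> *\<^sub>R w) = \<epsilon> powr (- (?N + \<sigma>)) * (f w / norm w powr (?N + \<sigma>))" for w
    unfolding powr_minus g_def using \<epsilon> by (simp add: powr_mult field_simps)
  have "(LINT z|lebesgue. g z) = (LINT z|lborel. g z)"
    using gm by (intro integral_completion) simp
  also have "\<dots> = (LINT z|density (distr lborel borel (\<lambda>x. 0 + \<epsilon> *\<^sub>R x)) (\<lambda>_. \<bar>\<epsilon>\<bar>^DIM(real^'n)). g z)"
    using lborel_affine[of \<epsilon> "0::real^'n"] \<epsilon> by simp
  also have "\<dots> = (LINT z|distr lborel borel (\<lambda>x. 0 + \<epsilon> *\<^sub>R x). \<bar>\<epsilon>\<bar>^DIM(real^'n) *\<^sub>R g z)"
    using gm by (intro integral_density[where g="\<lambda>_. \<bar>\<epsilon>\<bar>^DIM(real^'n)"]) auto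
  also have "\<dots> = (LINT z|lborel. \<bar>\<epsilon>\<bar>^DIM(real^'n) *\<^sub>R g (0 + \<epsilon> *\<^sub>R z))"
    using gm by (intro integral_distr) auto
  also have "\<dots> = (LINT z|lborel. (\<epsilon> ^ CARD('n) * \<epsilon> powr (- (?N + \<sigma>))) * (f z / norm z powr (?N + \<sigma>)))"
    using \<epsilon> by (intro Bochner_Integration.integral_cong) (simp_all add: c mult.assoc)
  also have "\<dots> = (\<epsilon> ^ CARD('n) * \<epsilon> powr (- (?N + \<sigma>))) * (LINT z|lborel. f z / norm z powr (?N + \<sigma>))"
    by (rule integral_mult_right_zero)
  also have "(\<epsilon> ^ CARD('n) * \<epsilon> powr (- (?N + \<sigma>))) = \<epsilon> powr (- \<sigma>)"
    using \<epsilon> by (simp add: powr_realpow[symmetric] powr_add[symmetric])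
  also have "(LINT z|lborel. f z / norm z powr (?N + \<sigma>)) = (LINT z|lebesgue. f z / norm z powr (?N + \<sigma>))"
    using fm by (intro integral_completion[symmetric]) simp
  finally show ?thesis unfolding g_def .
qed

lemma integrable_power_scale:
  fixes f :: "real ^ 'n \<Rightarrow> real"
  assumes f: "f \<in> borel_measurable borel" and \<epsilon>: "0 < \<epsilon>"
    and i: "integrable lebesgue (\<lambda>z. f z / norm z powr (real CARD('n) + \<sigma>))"
  shows "integrable lebesgue (\<lambda>z. f (inverse \<epsilon> *\<^sub>R z) / norm z powr (real CARD('n) + \<sigma>))"
proof -
  let ?N = "real CARD('n)"
  define g where "g z = f (inverse \<epsilon> *\<^sub>R z) / norm z powr (?N + \<sigma>)" for z :: "real^'n"
  have fs: "(\<lambda>z. f (inverse \<epsilon> *\<^sub>R z)) \<in> borel_measurable borel"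
    by (rule measurable_compose[OF _ f]) measurable
  have gm: "g \<in> borel_measurable borel" unfolding g_def using fs by measurable
  have fm: "(\<lambda>z. f z / norm z powr (?N + \<sigma>)) \<in> borel_measurable borel" using f by measurable
  have c: "g (\<epsilon> *\<^sub>R w) = \<epsilon> powr (- (?N + \<sigma>)) * (f w / norm w powr (?N + \<sigma>))" for w
    unfolding powr_minus g_def using \<epsilon> by (simp add: powr_mult field_simps)
  have "integrable lborel (\<lambda>z. f z / norm z powr (?N + \<sigma>))"
    using i integrable_completion[of "\<lambda>z. f z / norm z powr (?N + \<sigma>)" lborel] fm by simp
  then have "integrable lborel (\<lambda>z. \<bar>\<epsilon>\<bar>^DIM(real^'n) *\<^sub>R g (0 + \<epsilon> *\<^sub>R z))"
    unfolding add_0_left c by (intro integrable_scaleR_right integrable_mult_right)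
  then have "integrable (distr lborel borel (\<lambda>x. 0 + \<epsilon> *\<^sub>R x)) (\<lambda>z. \<bar>\<epsilon>\<bar>^DIM(real^'n) *\<^sub>R g z)"
    using gm by (subst integrable_distr_eq) auto
  then have "integrable (density (distr lborel borel (\<lambda>x. 0 + \<epsilon> *\<^sub>R x)) (\<lambda>_. \<bar>\<epsilon>\<bar>^DIM(real^'n))) g"
    using gm by (subst integrable_density[where g="\<lambda>_. \<bar>\<epsilon>\<bar>^DIM(real^'n)"]) auto
  then have "integrable lborel g"
    using lborel_affine[of \<epsilon> "0::real^'n"] \<epsilon> by simp
  then show ?thesis
    using integrable_completion[of g lborel] gm unfolding g_def by simp
qed

section \<open>Scaled correctors and the limit of their Levy integrals\<close>

definition scaled_corr :: "real \<Rightarrow> real \<Rightarrow> (real ^ 'n \<Rightarrow> real) \<Rightarrow> real ^ 'n \<Rightarrow> real" where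
  "scaled_corr \<sigma> \<epsilon> \<psi> x = \<epsilon> powr \<sigma> * \<psi> (inverse \<epsilon> *\<^sub>R x + 0)"

definition scaled_grad :: "real \<Rightarrow> real \<Rightarrow> (real ^ 'n \<Rightarrow> real ^ 'n) \<Rightarrow> real ^ 'n \<Rightarrow> real ^ 'n" where
  "scaled_grad \<sigma> \<epsilon> P x = \<epsilon> powr (\<sigma> - 1) *\<^sub>R P (inverse \<epsilon> *\<^sub>R x)"

lemma scaled_corr_facts:
  assumes n: "nice \<psi> P L" and \<epsilon>: "0 < \<epsilon>"
  shows "C2_on UNIV (scaled_corr \<sigma> \<epsilon> \<psi>)" "GDERIV (scaled_corr \<sigma> \<epsilon> \<psi>) x :> scaled_grad \<sigma> \<epsilon> P x"
    "continuous_on UNIV (scaled_corr \<sigma> \<epsilon> \<psi>)" "\<bar>scaled_corr \<sigma> \<epsilon> \<psi> x\<bar> \<le> \<epsilon> powr \<sigma> * L"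
    "norm (scaled_grad \<sigma> \<epsilon> P x) \<le> \<epsilon> powr (\<sigma> - 1) * L"
    "scaled_corr \<sigma> \<epsilon> \<psi> (x + z) - scaled_corr \<sigma> \<epsilon> \<psi> x - scaled_grad \<sigma> \<epsilon> P x \<bullet> z
      = \<epsilon> powr \<sigma> * (\<psi> (inverse \<epsilon> *\<^sub>R x + inverse \<epsilon> *\<^sub>R z) - \<psi> (inverse \<epsilon> *\<^sub>R x) - P (inverse \<epsilon> *\<^sub>R x) \<bullet> (inverse \<epsilon> *\<^sub>R z))"
proof -
  note nn = n[unfolded nice_def]
  have pe: "\<epsilon> powr (\<sigma> - 1) = \<epsilon> powr \<sigma> * inverse \<epsilon>" using \<epsilon> by (simp add: powr_diff divide_inverse)
  show "C2_on UNIV (scaled_corr \<sigma> \<epsilon> \<psi>)"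
    unfolding scaled_corr_def[abs_def] using nn
    by (intro C2_on_cmult C2_on_affine[where S'=UNIV] bounded_linear_scaleR_right) auto
  have "GDERIV (\<lambda>x. \<epsilon> powr \<sigma> * \<psi> (inverse \<epsilon> *\<^sub>R x + 0)) x :> \<epsilon> powr \<sigma> *\<^sub>R (inverse \<epsilon> *\<^sub>R P (inverse \<epsilon> *\<^sub>R x + 0))"
    using nn by (intro GDERIV_cmult GDERIV_affine) auto
  then show "GDERIV (scaled_corr \<sigma> \<epsilon> \<psi>) x :> scaled_grad \<sigma> \<epsilon> P x"
    unfolding scaled_corr_def[abs_def] scaled_grad_def pe by simp
  show "continuous_on UNIV (scaled_corr \<sigma> \<epsilon> \<psi>)"
  proof -
    have "continuous_on UNIV (\<lambda>x. \<psi> (inverse \<epsilon> *\<^sub>R x + 0))"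
      by (rule continuous_on_compose2[of UNIV \<psi>]) (use nn in \<open>auto intro!: continuous_intros\<close>)
    then show ?thesis unfolding scaled_corr_def[abs_def] by (intro continuous_intros)
  qed
  show "\<bar>scaled_corr \<sigma> \<epsilon> \<psi> x\<bar> \<le> \<epsilon> powr \<sigma> * L"
    unfolding scaled_corr_def abs_mult using nn by (auto intro!: mult_mono)
  show "norm (scaled_grad \<sigma> \<epsilon> P x) \<le> \<epsilon> powr (\<sigma> - 1) * L"
    unfolding scaled_grad_def norm_scaleR using nn by (auto intro!: mult_mono)
  show "scaled_corr \<sigma> \<epsilon> \<psi> (x + z) - scaled_corr \<sigma> \<epsilon> \<psi> x - scaled_grad \<sigma> \<epsilon> P x \<bullet> z
      = \<epsilon> powr \<sigma> * (\<psi> (inverse \<epsilon> *\<^sub>R x + inverse \<epsilon> *\<^sub>R z) - \<psi> (inverse \<epsilon> *\<^sub>R x) - P (inverse \<epsilon> *\<^sub>R x) \<bullet> (inverse \<epsilon> *\<^sub>R z))"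
    unfolding scaled_corr_def scaled_grad_def pe
    by (simp add: scaleR_right_distrib right_diff_distrib mult.assoc)
qed

context levy_kernel
begin

text \<open>The nonlocal operator with kernel \<open>K\<close>, applied to the scaled corrector \<open>\<epsilon>^\<sigma> \<psi>(x/\<epsilon>)\<close>, sees in the
  limit only the behaviour of \<open>K\<close> at the origin.\<close>

lemma corrector_limit:
  fixes \<psi> :: "real ^ 'n \<Rightarrow> real"
  assumes \<sigma>: "1 < \<sigma>" "\<sigma> < 2" and lim: "(kbar \<sigma> K \<longlongrightarrow> frac_const TYPE('n) \<sigma>) (at 0)"
    and fc: "0 < frac_const TYPE('n) \<sigma>" and n: "nice \<psi> P L" and \<delta>: "0 < \<delta>" "\<delta> < 1" and e: "0 < e"
  shows "\<forall>\<^sub>F \<epsilon> in at_right 0. \<forall>x.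
     lev_adm (scaled_grad \<sigma> \<epsilon> P x) (glue \<delta> (\<lambda>z. scaled_corr \<sigma> \<epsilon> \<psi> (x + z) - scaled_corr \<sigma> \<epsilon> \<psi> x) (\<lambda>_. 0)) \<and>
     lev K (scaled_grad \<sigma> \<epsilon> P x) (glue \<delta> (\<lambda>z. scaled_corr \<sigma> \<epsilon> \<psi> (x + z) - scaled_corr \<sigma> \<epsilon> \<psi> x) (\<lambda>_. 0))
       \<le> frac_full \<sigma> \<psi> P (inverse \<epsilon> *\<^sub>R x) + e"
proof -
  define \<nu> where "\<nu> z = 1 / norm z powr (real CARD('n) + \<sigma>)" for z :: "real^'n"
  define fk where "fk = (frac_kernel \<sigma> :: real^'n \<Rightarrow> real)"
  have fk: "fk z = frac_const TYPE('n) \<sigma> * \<nu> z" for z by (simp add: fk_def frac_kernel_def \<nu>_def)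
  interpret F: levy_kernel fk unfolding fk_def by (rule levy_kernel_frac[OF \<sigma> fc])
  define m0 where "m0 = (LINT z|lebesgue. wt z * \<nu> (z::real^'n))"
  have \<nu>0: "0 \<le> \<nu> z" for z by (simp add: \<nu>_def)
  have m0: "0 \<le> m0" unfolding m0_def by (intro Bochner_Integration.integral_nonneg) (simp add: \<nu>0)
  have L: "0 \<le> L" using n by (simp add: nice_def)
  have cpsi: "continuous_on UNIV \<psi>" using n by (simp add: nice_def)
  \<comment> \<open>Replacing K by the fractional kernel near 0 costs e' times the integral of
    \<epsilon>^\<sigma> L wt(z / \<epsilon>) |z|^(-N-\<sigma>), which by scaling equals L m0 for
    every \<epsilon>.\<close>
  define e' where "e' = e / (2 * (L * m0 + 1))"
  have Lm: "0 < L * m0 + 1" using L m0 by (intro add_nonneg_pos) auto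
  have e': "0 < e'" using e Lm by (simp add: e'_def)
  have e'2: "e' * (L * m0) \<le> e / 2"
  proof -
    have "e' * (L * m0) \<le> e' * (L * m0 + 1)" using e' by simp
    also have "\<dots> = e / 2" unfolding e'_def divide_divide_eq_left[symmetric]
      using nonzero_eq_divide_eq[of "L * m0 + 1" "e / 2 / (L * m0 + 1)" "e / 2"] Lm by fastforce
    finally show ?thesis .
  qed
  obtain \<rho>0 where \<rho>0: "0 < \<rho>0" "\<And>z. z \<noteq> 0 \<Longrightarrow> norm z < \<rho>0 \<Longrightarrow> \<bar>kbar \<sigma> K z - frac_const TYPE('n) \<sigma>\<bar> < e'"
    using tendstoD[OF lim e'] unfolding eventually_at by (auto simp: dist_real_def)
  define \<rho> where "\<rho> = min \<rho>0 \<delta>"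
  have \<rho>: "0 < \<rho>" "\<rho> < 1" "\<rho> \<le> \<delta>" using \<rho>0 \<delta> by (auto simp: \<rho>_def)
  have Kfk: "\<bar>K z - fk z\<bar> \<le> e' * \<nu> z" if "z \<noteq> 0" "norm z < \<rho>" for z
  proof -
    have "K z = kbar \<sigma> K z * \<nu> z" using that by (simp add: kbar_def \<nu>_def)
    then have "\<bar>K z - fk z\<bar> = \<bar>kbar \<sigma> K z - frac_const TYPE('n) \<sigma>\<bar> * \<nu> z"
      by (simp add: fk left_diff_distrib[symmetric] abs_mult \<nu>0)
    also have "\<dots> \<le> e' * \<nu> z" using \<rho>0(2)[of z] that by (intro mult_right_mono \<nu>0) (auto simp: \<rho>_def)
    finally show ?thesis .
  qed
  \<comment> \<open>A \<epsilon>^(\<sigma>-1) is the total contribution of |z| \<ge> \<rho>, for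
    both kernels; it vanishes with \<epsilon> because \<sigma> > 1.\<close>
  define A where "A = (L / \<rho>) * (mass + F.mass)"
  have "((\<lambda>\<epsilon>::real. A * \<epsilon> powr (\<sigma> - 1)) \<longlongrightarrow> A * 0) (at_right 0)"
    using \<sigma> by (intro tendsto_mult tendsto_const) real_asymp
  then have "\<forall>\<^sub>F \<epsilon> in at_right 0. A * \<epsilon> powr (\<sigma> - 1) < e / 2" using e by (intro order_tendstoD(2)) auto
  moreover have "\<forall>\<^sub>F \<epsilon> in at_right 0. 0 < (\<epsilon>::real)" by (rule eventually_at_right_less)
  ultimately show ?thesis
  proof eventually_elim
    case (elim \<epsilon>)
    show ?case
    proof
      fix x :: "real^'n"
      define y where "y = inverse \<epsilon> *\<^sub>R x"
      define g where "g = glue \<delta> (\<lambda>z. scaled_corr \<sigma> \<epsilon> \<psi> (x + z) - scaled_corr \<sigma> \<epsilon> \<psi> x) (\<lambda>_. 0)"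
      define p where "p = scaled_grad \<sigma> \<epsilon> P x"
      define R where "R z = scaled_corr \<sigma> \<epsilon> \<psi> (x + z) - scaled_corr \<sigma> \<epsilon> \<psi> x - p \<bullet> z" for z
      define r where "r w = \<psi> (y + w) - \<psi> y - P y \<bullet> w" for w
      note sc = scaled_corr_facts[OF n \<open>0 < \<epsilon>\<close>, of \<sigma>]
      have R: "R z = \<epsilon> powr \<sigma> * r (inverse \<epsilon> *\<^sub>R z)" for z
        unfolding R_def p_def r_def y_def by (rule sc(6))
      have rb: "\<bar>r w\<bar> \<le> L * wt w" for w using n unfolding r_def nice_def by blast
      have rm: "r \<in> borel_measurable borel"
        unfolding r_def[abs_def]
        by (intro borel_measurable_continuous_onI continuous_intros continuous_on_compose2[OF cpsi, of UNIV "\<lambda>w. y + w"]) auto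
      have Rb1: "\<bar>R z\<bar> \<le> \<epsilon> powr \<sigma> * L * wt (inverse \<epsilon> *\<^sub>R z)" for z
        unfolding R abs_mult using mult_left_mono[OF rb[of "inverse \<epsilon> *\<^sub>R z"], of "\<epsilon> powr \<sigma>"] by simp
      have pe: "\<epsilon> powr \<sigma> * inverse \<epsilon> = \<epsilon> powr (\<sigma> - 1)" using \<open>0 < \<epsilon>\<close> by (simp add: powr_diff divide_inverse)
      have Rb2: "\<bar>R z\<bar> \<le> \<epsilon> powr (\<sigma> - 1) * L * norm z" for z
      proof -
        have "\<epsilon> powr \<sigma> * L * wt (inverse \<epsilon> *\<^sub>R z) \<le> \<epsilon> powr \<sigma> * L * norm (inverse \<epsilon> *\<^sub>R z)"
          using L by (intro mult_left_mono wt_le_norm) auto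
        also have "\<dots> = (\<epsilon> powr \<sigma> * inverse \<epsilon>) * L * norm z" using \<open>0 < \<epsilon>\<close> by simp
        finally show ?thesis using Rb1[of z] unfolding pe by linarith
      qed
      have pb: "\<bar>p \<bullet> z\<bar> \<le> \<epsilon> powr (\<sigma> - 1) * L * norm z" for z
      proof -
        have "\<bar>p \<bullet> z\<bar> \<le> norm p * norm z" by (rule Cauchy_Schwarz_ineq2)
        also have "\<dots> \<le> \<epsilon> powr (\<sigma> - 1) * L * norm z" unfolding p_def by (intro mult_right_mono sc(5)) auto
        finally show ?thesis .
      qed
      have wo: "norm z \<le> wt z / \<rho>" if "\<rho> \<le> norm z" for z :: "real^'n"
      proof (cases "norm z \<le> 1")
        case True
        have "\<rho> * norm z \<le> norm z * norm z" using that by (intro mult_right_mono) auto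
        then show ?thesis using True \<rho> by (simp add: wt_less_1 power2_eq_square field_simps)
      next
        case False
        then show ?thesis using \<rho> by (simp add: wt_ge_1 field_simps mult_left_le_one_le)
      qed
      define E where "E = \<epsilon> powr (\<sigma> - 1) * (L / \<rho>)"
      have E: "0 \<le> E" using L \<rho> by (simp add: E_def)
      have outer: "\<bar>R z\<bar> \<le> E * wt z" "\<bar>p \<bullet> z\<bar> \<le> E * wt z" if "\<rho> \<le> norm z" for z
      proof -
        have "\<epsilon> powr (\<sigma> - 1) * L * norm z \<le> \<epsilon> powr (\<sigma> - 1) * L * (wt z / \<rho>)"
          using L wo[OF that] by (intro mult_left_mono) auto
        then have "\<epsilon> powr (\<sigma> - 1) * L * norm z \<le> E * wt z" by (simp add: E_def)
        then show "\<bar>R z\<bar> \<le> E * wt z" "\<bar>p \<bullet> z\<bar> \<le> E * wt z" using Rb2[of z] pb[of z] by linarith+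
      qed
      have ci: "comp_incr p g z = (if norm z < \<delta> then R z else - indicator (ball 0 1) z * (p \<bullet> z))" for z
        using \<delta> by (auto simp: comp_incr_def g_def glue_def R_def)
      \<comment> \<open>Inside radius \<rho> the kernel K is exchanged for \<open>fk\<close> with
        relative error of order e'. Outside, the increment against K and the remainder R against
        \<open>fk\<close> are estimated separately, each by E \<open>wt\<close> with E of order
        \<epsilon>^(\<sigma>-1).\<close>
      have ptw: "comp_incr p g z * K z \<le> R z * fk z + (e' * (\<epsilon> powr \<sigma> * L)) * (wt (inverse \<epsilon> *\<^sub>R z) * \<nu> z) + E * (wt z * K z) + E * (wt z * fk z)" for z
      proof (cases "norm z < \<rho>")
        case True
        have pos: "0 \<le> E * (wt z * K z)" "0 \<le> E * (wt z * fk z)" using E by auto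
        show ?thesis
        proof (cases "z = 0")
          case True
          then show ?thesis using \<delta> by (simp add: ci R_def)
        next
          case False
          have "R z * K z - R z * fk z \<le> \<bar>R z\<bar> * \<bar>K z - fk z\<bar>" unfolding abs_mult[symmetric] right_diff_distrib[symmetric] by simp
          also have "\<dots> \<le> (\<epsilon> powr \<sigma> * L * wt (inverse \<epsilon> *\<^sub>R z)) * (e' * \<nu> z)"
            using L by (intro mult_mono Rb1 Kfk[OF False True]) auto
          finally show ?thesis using pos True \<rho> by (simp add: ci algebra_simps)
        qed
      next
        case False
        then have z: "\<rho> \<le> norm z" by simp
        have "\<bar>comp_incr p g z\<bar> \<le> E * wt z" using outer[OF z] E by (auto simp: ci indicator_def)
        then have "comp_incr p g z * K z \<le> (E * wt z) * K z" by (intro mult_right_mono) auto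
        moreover have "- (R z * fk z) \<le> (E * wt z) * fk z"
          using mult_right_mono[of "- R z" "E * wt z" "fk z"] outer(1)[OF z] by (simp add: abs_le_iff)
        moreover have "0 \<le> (e' * (\<epsilon> powr \<sigma> * L)) * (wt (inverse \<epsilon> *\<^sub>R z) * \<nu> z)"
          using e' L by (intro mult_nonneg_nonneg) (auto simp: \<nu>0)
        ultimately show ?thesis by (simp add: mult.assoc)
      qed
      have gm: "g \<in> borel_measurable lebesgue"
        unfolding g_def
        by (intro glue_measurable borel_measurable_const lebesgue_measurable_borel borel_measurable_continuous_onI
            continuous_intros continuous_on_compose2[OF sc(3), of UNIV "\<lambda>z. x + z"]) auto
      have cib: "\<bar>comp_incr p g z\<bar> \<le> (\<epsilon> powr \<sigma> * L * (inverse \<epsilon>)\<^sup>2 + E) * wt z" for z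
      proof (cases "norm z < \<rho>")
        case True
        have "\<epsilon> powr \<sigma> * L * wt (inverse \<epsilon> *\<^sub>R z) \<le> \<epsilon> powr \<sigma> * L * (norm (inverse \<epsilon> *\<^sub>R z))\<^sup>2"
          using L by (intro mult_left_mono wt_le_norm2) auto
        also have "\<dots> = \<epsilon> powr \<sigma> * L * (inverse \<epsilon>)\<^sup>2 * wt z" using True \<rho> by (simp add: wt_less_1 power_mult_distrib power_divide divide_inverse power_inverse)
        finally have "\<bar>R z\<bar> \<le> \<epsilon> powr \<sigma> * L * (inverse \<epsilon>)\<^sup>2 * wt z" using Rb1[of z] by linarith
        moreover have "0 \<le> E * wt z" using E by simp
        ultimately show ?thesis using True \<rho> by (simp add: ci distrib_right)
      next
        case False
        then have z: "\<rho> \<le> norm z" by simp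
        have "\<bar>comp_incr p g z\<bar> \<le> E * wt z" using outer[OF z] E by (auto simp: ci indicator_def)
        moreover have "0 \<le> \<epsilon> powr \<sigma> * L * (inverse \<epsilon>)\<^sup>2 * wt z" using L by simp
        ultimately show ?thesis by (simp add: distrib_right)
      qed
      have adm: "lev_adm p g" unfolding lev_adm_def using gm cib by blast
      have ri: "integrable lebesgue (\<lambda>z. r z * fk z)"
        by (rule F.integrable_le_wt[OF lebesgue_measurable_borel[OF rm] rb])
      have rfull: "(LINT z|lebesgue. r z * fk z) = frac_full \<sigma> \<psi> P y"
        unfolding frac_full_def r_def fk_def ..
      have rc: "r z * fk z = frac_const TYPE('n) \<sigma> * r z / norm z powr (real CARD('n) + \<sigma>)" for z
        by (simp add: fk \<nu>_def)
      have Rc: "R z * fk z = \<epsilon> powr \<sigma> * (frac_const TYPE('n) \<sigma> * r (inverse \<epsilon> *\<^sub>R z) / norm z powr (real CARD('n) + \<sigma>))" for z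
        by (simp add: R fk \<nu>_def)
      have crm: "(\<lambda>z. frac_const TYPE('n) \<sigma> * r z) \<in> borel_measurable borel" using rm by measurable
      have Ri: "integrable lebesgue (\<lambda>z. R z * fk z)"
        unfolding Rc by (intro integrable_mult_right integrable_power_scale[OF crm \<open>0 < \<epsilon>\<close>]) (use ri in \<open>simp add: rc\<close>)
      have pe1: "\<epsilon> powr \<sigma> * \<epsilon> powr - \<sigma> = 1" using \<open>0 < \<epsilon>\<close> by (simp add: powr_minus)
      have Rfull: "(LINT z|lebesgue. R z * fk z) = frac_full \<sigma> \<psi> P y"
        unfolding Rc integral_mult_right_zero integral_power_scale[OF crm \<open>0 < \<epsilon>\<close>] mult.assoc[symmetric] pe1
        by (simp add: rc[symmetric] rfull)
      have w\<nu>: "wt (inverse \<epsilon> *\<^sub>R z) * \<nu> z = wt (inverse \<epsilon> *\<^sub>R z) / norm z powr (real CARD('n) + \<sigma>)" for z :: "real^'n"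
        by (simp add: \<nu>_def)
      have wi: "integrable lebesgue (\<lambda>z::real^'n. wt (inverse \<epsilon> *\<^sub>R z) * \<nu> z)"
        unfolding w\<nu> by (intro integrable_power_scale wt_measurable \<open>0 < \<epsilon>\<close> wt_power_integrable \<sigma>)
      have wm: "(LINT z|lebesgue. wt (inverse \<epsilon> *\<^sub>R z) * \<nu> (z::real^'n)) = \<epsilon> powr - \<sigma> * m0"
      proof -
        have "m0 = (LINT z|lebesgue. wt z / norm (z::real^'n) powr (real CARD('n) + \<sigma>))" by (simp add: m0_def \<nu>_def)
        then show ?thesis unfolding w\<nu> using integral_power_scale[OF wt_measurable \<open>0 < \<epsilon>\<close>, where 'n='n, of \<sigma>] by simp
      qed
      have i3: "integrable lebesgue (\<lambda>z. E * (wt z * K z))" and i4: "integrable lebesgue (\<lambda>z. E * (wt z * fk z))"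
        by (intro integrable_mult_right wt_K_integrable F.wt_K_integrable)+
      have i2: "integrable lebesgue (\<lambda>z. (e' * (\<epsilon> powr \<sigma> * L)) * (wt (inverse \<epsilon> *\<^sub>R z) * \<nu> z))"
        by (intro integrable_mult_right wi)
      have "lev K p g = (LINT z|lebesgue. comp_incr p g z * K z)" by (simp add: lev_def comp_incr_def)
      also have "\<dots> \<le> (LINT z|lebesgue. R z * fk z + (e' * (\<epsilon> powr \<sigma> * L)) * (wt (inverse \<epsilon> *\<^sub>R z) * \<nu> z) + E * (wt z * K z) + E * (wt z * fk z))"
        by (intro integral_mono lev_integrable[OF adm] Bochner_Integration.integrable_add Ri i2 i3 i4 ptw)
      also have "\<dots> = frac_full \<sigma> \<psi> P y + (e' * (\<epsilon> powr \<sigma> * L)) * (\<epsilon> powr - \<sigma> * m0) + E * mass + E * F.mass"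
        using Ri i2 i3 i4 by (simp add: Bochner_Integration.integral_add Bochner_Integration.integrable_add Rfull wm mass_def F.mass_def)
      also have "(e' * (\<epsilon> powr \<sigma> * L)) * (\<epsilon> powr - \<sigma> * m0) = (\<epsilon> powr \<sigma> * \<epsilon> powr - \<sigma>) * (e' * (L * m0))"
        by (simp add: algebra_simps)
      also have "\<dots> \<le> e / 2" unfolding pe1 using e'2 by simp
      finally have "lev K p g \<le> frac_full \<sigma> \<psi> P y + e / 2 + (E * mass + E * F.mass)" by simp
      moreover have "E * mass + E * F.mass = A * \<epsilon> powr (\<sigma> - 1)" by (simp add: E_def A_def algebra_simps)
      ultimately have "lev K p g \<le> frac_full \<sigma> \<psi> P y + e" using elim by simp
      with adm show "lev_adm (scaled_grad \<sigma> \<epsilon> P x) (glue \<delta> (\<lambda>z. scaled_corr \<sigma> \<epsilon> \<psi> (x + z) - scaled_corr \<sigma> \<epsilon> \<psi> x) (\<lambda>_. 0)) \<and>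
         lev K (scaled_grad \<sigma> \<epsilon> P x) (glue \<delta> (\<lambda>z. scaled_corr \<sigma> \<epsilon> \<psi> (x + z) - scaled_corr \<sigma> \<epsilon> \<psi> x) (\<lambda>_. 0))
           \<le> frac_full \<sigma> \<psi> P (inverse \<epsilon> *\<^sub>R x) + e"
        unfolding g_def p_def y_def by blast
    qed
  qed
qed

end

text \<open>Smoothness is what lets a corrector enter a test function. The price is an error e,
  uniform in the fast variable and sent to 0 only after \<epsilon>.\<close>

definition cell_corrector :: "real \<Rightarrow> (real ^ 'n \<Rightarrow> real ^ 'n \<Rightarrow> real) \<Rightarrow> (real ^ 'n \<Rightarrow> real ^ 'n \<Rightarrow> real ^ 'n \<Rightarrow> real) \<Rightarrow>
    (real ^ 'n \<Rightarrow> real ^ 'n \<Rightarrow> real \<Rightarrow> real) \<Rightarrow> bool" where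
  "cell_corrector \<sigma> a H G \<longleftrightarrow> (\<forall>x p l. \<forall>e>0. \<exists>\<psi> P L. nice \<psi> P L \<and>
     (\<forall>y. \<bar>- a x y * (l + frac_full \<sigma> \<psi> P y) + H x y p - G x p l\<bar> \<le> e))"

lemma (in levy_kernel) lev_adm_test:
  fixes u :: "(real ^ 'n) \<times> real \<Rightarrow> real"
  assumes "test_fn T \<phi> P Q" "t \<in> {0<..T}" "0 < \<delta>" "\<delta> < 1" "usc_on (QT T) u" "\<And>q. q \<in> QT T \<Longrightarrow> \<bar>u q\<bar> \<le> M"
    "0 \<le> B" "\<And>z. norm z \<le> 1 \<Longrightarrow> \<bar>\<phi> (x + z, t) - \<phi> (x, t) - P (x, t) \<bullet> z\<bar> \<le> B * (norm z)\<^sup>2"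
  defines "g \<equiv> glue \<delta> (\<lambda>z. \<phi> (x + z, t) - \<phi> (x, t)) (\<lambda>z. u (x + z, t) - u (x, t))"
  shows "lev_adm (P (x, t)) g" "\<And>z. \<bar>comp_incr (P (x, t)) g z\<bar> \<le> (B + (2 * M + norm (P (x, t))) / \<delta>\<^sup>2) * wt z"
proof -
  have M': "\<bar>u (y, t)\<bar> \<le> M" for y using assms(2,6) by (auto simp: QT_def)
  note ne = nonlocal_eq[where u="\<lambda>y. u (y, t)" and M=M and \<phi>="\<lambda>y. \<phi> (y, t)", OF levy_kernel_axioms assms(3,4)
      test_fn_slice(1)[OF assms(1,2)] test_fn_slice(2)[OF assms(1,2)] assms(7,8) usc_section_measurable[OF assms(5,2)] M']
  show "lev_adm (P (x, t)) g" "\<And>z. \<bar>comp_incr (P (x, t)) g z\<bar> \<le> (B + (2 * M + norm (P (x, t))) / \<delta>\<^sup>2) * wt z"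
    using ne(1,3) unfolding g_def by auto
qed

theorem (in levy_kernel) homogenised_subsolution:
  fixes u :: "real \<Rightarrow> (real ^ 'n) \<times> real \<Rightarrow> real" and a :: "real ^ 'n \<Rightarrow> real ^ 'n \<Rightarrow> real"
    and H :: "real ^ 'n \<Rightarrow> real ^ 'n \<Rightarrow> real ^ 'n \<Rightarrow> real"
  assumes T: "0 < T" and \<sigma>: "1 < \<sigma>" "\<sigma> < 2" and lim: "(kbar \<sigma> K \<longlongrightarrow> frac_const TYPE('n) \<sigma>) (at 0)"
    and fc: "0 < frac_const TYPE('n) \<sigma>"
    and a: "\<And>x y. 0 \<le> a x y \<and> a x y \<le> A"
    and a_cont: "\<And>e. 0 < e \<Longrightarrow> \<exists>r>0. \<forall>x x' y. norm (x - x') < r \<longrightarrow> \<bar>a x y - a x' y\<bar> < e"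
    and H_cont: "\<And>e R. 0 < e \<Longrightarrow> \<exists>r>0. \<forall>x x' y p p'. norm p \<le> R \<longrightarrow> norm p' \<le> R \<longrightarrow>
       norm (x - x') < r \<longrightarrow> norm (p - p') < r \<longrightarrow> \<bar>H x y p - H x' y p'\<bar> < e"
    and corr: "cell_corrector \<sigma> a H G"
    and sub: "\<And>\<epsilon>. 0 < \<epsilon> \<Longrightarrow> visc_subsol T K (\<lambda>x p l. - a x (inverse \<epsilon> *\<^sub>R x) * l + H x (inverse \<epsilon> *\<^sub>R x) p) (u \<epsilon>)"
    and ucont: "\<And>\<epsilon>. 0 < \<epsilon> \<Longrightarrow> continuous_on (QT_bar T) (u \<epsilon>)"
    and ubd: "\<And>\<epsilon> q. 0 < \<epsilon> \<Longrightarrow> q \<in> QT_bar T \<Longrightarrow> \<bar>u \<epsilon> q\<bar> \<le> M"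
  shows "visc_subsol T K G (relaxed_sup u (QT_bar T))"
proof -
  interpret bf: bounded_family u "QT_bar T" M by unfold_locales (rule ubd)
  interpret F: levy_kernel "frac_kernel \<sigma> :: real^'n \<Rightarrow> real" by (rule levy_kernel_frac[OF \<sigma> fc])
  define ub where "ub = relaxed_sup u (QT_bar T)"
  have QQ: "QT T \<subseteq> (QT_bar T :: ((real^'n) \<times> real) set)" by (auto simp: QT_def QT_bar_def)
  have ubM: "\<bar>ub q\<bar> \<le> M" if "q \<in> QT_bar T" for q unfolding ub_def by (rule bf.relaxed_sup_bounds[OF that])
  have ubusc: "usc_on (QT_bar T) ub" unfolding ub_def by (rule bf.relaxed_sup_usc)
  have ubusc': "usc_on (QT T) ub" by (rule usc_on_subset[OF ubusc QQ])
  have A0: "0 \<le> A" using a[of 0 0] by linarith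
  have ubb: "bounded (ub ` QT T)" unfolding bounded_iff using ubM QQ by (intro exI[of _ M]) auto
  show ?thesis
    unfolding visc_subsol_def ub_def[symmetric]
  proof (intro conjI allI ballI impI)
    show "bounded (ub ` QT T)" by (rule ubb)
    show "usc_on (QT T) ub" by (rule ubusc')
    fix x0 :: "real^'n" and t0 \<phi> \<delta>
    assume t0: "t0 \<in> {0<..T}" and as: "C2_on (QT T) \<phi> \<and> 0 < \<delta> \<and> \<delta> < 1 \<and>
        (\<forall>q\<in>(ball x0 \<delta> \<times> {t0 - \<delta><..<t0 + \<delta>}) \<inter> QT T. ub q - \<phi> q \<le> ub (x0, t0) - \<phi> (x0, t0))"
    then have C2: "C2_on (QT T) \<phi>" and \<delta>: "0 < \<delta>" "\<delta> < 1"
      and mx: "\<And>q. q\<in>(ball x0 \<delta> \<times> {t0 - \<delta><..<t0 + \<delta>}) \<inter> QT T \<Longrightarrow> ub q - \<phi> q \<le> ub (x0, t0) - \<phi> (x0, t0)" by blast+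
    obtain P0 Q0 where PQ0: "test_fn T \<phi> P0 Q0" using C2_test_fn[OF C2] by blast
    define q0 where "q0 = (x0, t0)"
    define p0 where "p0 = P0 q0"
    have q0Q: "q0 \<in> QT T" "q0 \<in> QT_bar T" using t0 by (auto simp: q0_def QT_def QT_bar_def)
    have Gp: "GDERIV (\<lambda>y. \<phi> (y, t0)) x0 :> p0"
      and Vq: "((\<lambda>s. \<phi> (x0, s)) has_vector_derivative Q0 q0) (at t0 within {0<..T})"
      using PQ0 t0 unfolding test_fn_def p0_def q0_def by auto
    define g0 where "g0 = glue \<delta> (\<lambda>z. \<phi> (x0 + z, t0) - \<phi> (x0, t0)) (\<lambda>z. ub (x0 + z, t0) - ub (x0, t0))"
    define l where "l = lev K p0 g0"
    note ve = visc_lhs_eq[OF levy_kernel_axioms \<delta> t0 C2 Gp Vq disjI1[OF ubusc'] ubb]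
    have g0adm: "lev_adm p0 g0" unfolding g0_def by (rule ve(1))
    have "Q0 q0 + G x0 p0 l \<le> 0 + e2" if e2: "0 < e2" for e2
    proof -
      \<comment> \<open>Three errors e in the Levy term are multiplied by a \<le> A; four more come
        from freezing a, freezing H, the corrector and the time derivative.\<close>
      define e where "e = e2 / (3 * A + 4)"
      have A4: "0 < 3 * A + 4" using A0 by linarith
      have e: "0 < e" using e2 A4 by (simp add: e_def)
      have ee: "(3 * A + 4) * e = e2" using A4 by (simp add: e_def)
      obtain \<psi> P\<psi> L where \<psi>: "nice \<psi> P\<psi> L"
        and cor: "\<And>y. \<bar>- a x0 y * (l + frac_full \<sigma> \<psi> P\<psi> y) + H x0 y p0 - G x0 p0 l\<bar> \<le> e"
        using corr e unfolding cell_corrector_def by meson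
      have L: "0 \<le> L" using \<psi> by (simp add: nice_def)
      define Lm where "Lm y = frac_full \<sigma> \<psi> P\<psi> y" for y
      have LmB: "\<bar>Lm y\<bar> \<le> L * F.mass" for y
      proof -
        have "\<bar>Lm y\<bar> \<le> (LINT w|lebesgue. \<bar>(\<psi> (y + w) - \<psi> y - P\<psi> y \<bullet> w) * frac_kernel \<sigma> w\<bar>)"
          unfolding Lm_def frac_full_def by (rule integral_abs_bound)
        also have "\<dots> \<le> (LINT w|lebesgue. L * (wt w * frac_kernel \<sigma> (w::real^'n)))"
        proof (rule integral_mono)
          have cpsi: "continuous_on UNIV \<psi>" using \<psi> by (simp add: nice_def)
          have m: "(\<lambda>w. \<psi> (y + w) - \<psi> y - P\<psi> y \<bullet> w) \<in> borel_measurable lebesgue"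
            by (intro lebesgue_measurable_borel borel_measurable_continuous_onI continuous_intros continuous_on_compose2[OF cpsi, of UNIV "\<lambda>w. y + w"]) auto
          have bd: "\<bar>\<psi> (y + w) - \<psi> y - P\<psi> y \<bullet> w\<bar> \<le> L * wt w" for w using \<psi> by (simp add: nice_def)
          from F.integrable_le_wt[OF m bd] show "integrable lebesgue (\<lambda>w. \<bar>(\<psi> (y + w) - \<psi> y - P\<psi> y \<bullet> w) * frac_kernel \<sigma> w\<bar>)"
            by (rule integrable_abs)
          show "integrable lebesgue (\<lambda>w. L * (wt w * frac_kernel \<sigma> (w::real^'n)))"
            by (intro integrable_mult_right F.wt_K_integrable)
          fix w show "\<bar>(\<psi> (y + w) - \<psi> y - P\<psi> y \<bullet> w) * frac_kernel \<sigma> w\<bar> \<le> L * (wt w * frac_kernel \<sigma> w)"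
            using mult_right_mono[OF bd[of w] F.K_nonneg[of w]] by (simp add: abs_mult mult.assoc)
        qed
        also have "\<dots> = L * F.mass" by (simp add: F.mass_def)
        finally show ?thesis .
      qed
      \<comment> \<open>This weight makes the maximum strict. It adds at most \<kappa>
        \<open>wt\<close> to the increment, hence at most e to the Levy integral.\<close>
      define \<kappa> where "\<kappa> = e / (mass + 1)"
      have mass1: "0 < mass + 1" using mass_nonneg by linarith
      have \<kappa>: "0 < \<kappa>" using e mass1 by (simp add: \<kappa>_def)
      have \<kappa>m: "\<kappa> * mass \<le> e"
      proof -
        have "\<kappa> * mass \<le> \<kappa> * (mass + 1)" using \<kappa> by simp
        also have "\<dots> = e" unfolding \<kappa>_def using mass1 by (intro nonzero_eq_divide_eq[THEN iffD1]) auto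
        finally show ?thesis .
      qed
      define \<phi>' where "\<phi>' q = \<phi> q + (\<kappa> * (norm (fst q - x0))\<^sup>2 + \<kappa> * (snd q - t0)\<^sup>2)" for q
      have C2': "C2_on (QT T) \<phi>'"
        unfolding \<phi>'_def by (intro C2_on_add C2 C2_on_fst[OF C2_on_norm_sq] C2_on_snd[OF C2_on_sq])
      obtain P' Q' where PQ': "test_fn T \<phi>' P' Q'" using C2_test_fn[OF C2'] by blast
      have \<phi>'c: "continuous_on (QT T) \<phi>'" and P'c: "continuous_on (QT T) P'" and Q'c: "continuous_on (QT T) Q'"
        using PQ' unfolding test_fn_def by auto
      have P'0: "P' q0 = p0"
      proof (rule GDERIV_unique)
        show "GDERIV (\<lambda>y. \<phi>' (y, t0)) x0 :> P' q0" unfolding q0_def by (rule test_fn_slice(1)[OF PQ' t0])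
        have "GDERIV (\<lambda>y. \<phi> (y, t0) + (\<kappa> * (norm (y - x0))\<^sup>2 + \<kappa> * (t0 - t0)\<^sup>2)) x0 :> p0 + ((2 * \<kappa>) *\<^sub>R (x0 - x0) + 0)"
          by (intro GDERIV_add Gp GDERIV_norm_sq GDERIV_const)
        then show "GDERIV (\<lambda>y. \<phi>' (y, t0)) x0 :> p0" by (simp add: \<phi>'_def)
      qed
      have Q'0: "Q' q0 = Q0 q0"
      proof -
        have "((\<lambda>s. \<phi>' (x0, s)) has_vector_derivative Q' q0) (at t0 within {0<..T})"
          using PQ' t0 unfolding test_fn_def q0_def by auto
        moreover have "((\<lambda>s. \<phi> (x0, s) + (\<kappa> * (norm (x0 - x0))\<^sup>2 + \<kappa> * (s - t0)\<^sup>2)) has_vector_derivative Q0 q0 + (0 + 0)) (at t0 within {0<..T})"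
        proof (intro has_vector_derivative_add Vq)
          show "((\<lambda>s. \<kappa> * (norm (x0 - x0))\<^sup>2) has_vector_derivative 0) (at t0 within {0<..T})" by simp
          show "((\<lambda>s. \<kappa> * (s - t0)\<^sup>2) has_vector_derivative 0) (at t0 within {0<..T})"
            unfolding has_real_derivative_iff_has_vector_derivative[symmetric] by (auto intro!: derivative_eq_intros)
        qed
        then have "((\<lambda>s. \<phi>' (x0, s)) has_vector_derivative Q0 q0) (at t0 within {0<..T})"
          by (simp add: \<phi>'_def)
        ultimately show ?thesis using vector_derivative_Ioc t0 by metis
      qed
      \<comment> \<open>Half of the minimum keeps the compact cylinder N inside the region of local
        maximality and away from t = 0.\<close>
      define \<rho> where "\<rho> = min \<delta> t0 / 2"
      have \<rho>: "0 < \<rho>" "\<rho> < \<delta>" "\<rho> < t0" "\<rho> < 1" using \<delta> t0 by (auto simp: \<rho>_def)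
      define N where "N = cball x0 \<rho> \<times> {t0 - \<rho> .. min (t0 + \<rho>) T}"
      have Nc: "compact N" unfolding N_def by (intro compact_Times) auto
      have NQ: "N \<subseteq> QT T" using \<rho> by (auto simp: N_def QT_def)
      have q0N: "q0 \<in> N" using \<rho> t0 by (auto simp: N_def q0_def)
      define wb where "wb q = ub q - \<phi>' q" for q
      have strict: "wb q < wb q0" if "q \<in> N" "q \<noteq> q0" for q
      proof -
        have "q \<in> (ball x0 \<delta> \<times> {t0 - \<delta><..<t0 + \<delta>}) \<inter> QT T" using that(1) NQ \<rho> by (auto simp: N_def)
        from mx[OF this] have 1: "ub q - \<phi> q \<le> ub q0 - \<phi> q0" by (simp add: q0_def)
        have "0 < \<kappa> * (norm (fst q - x0))\<^sup>2 + \<kappa> * (snd q - t0)\<^sup>2"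
        proof (cases "fst q = x0")
          case True
          then have "snd q \<noteq> t0" using that(2) by (metis prod.collapse q0_def)
          then show ?thesis using \<kappa> True by simp
        next
          case False
          then show ?thesis using \<kappa> by (intro add_pos_nonneg) auto
        qed
        then show ?thesis using 1 by (simp add: wb_def \<phi>'_def q0_def)
      qed
      obtain \<epsilon> qs where s: "\<And>n. 0 < \<epsilon> n" "\<And>n. qs n \<in> QT_bar T" and \<epsilon>0: "\<epsilon> \<longlonglongrightarrow> 0" and qs: "qs \<longlonglongrightarrow> q0"
        and ulow: "\<And>e. 0 < e \<Longrightarrow> \<forall>\<^sub>F n in sequentially. ub q0 - e \<le> u (\<epsilon> n) (qs n)"
        using bf.relaxed_sup_seq[OF q0Q(2)] unfolding ub_def by blast
      have \<epsilon>at: "filterlim \<epsilon> (at_right 0) sequentially"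
        using \<epsilon>0 s(1) by (simp add: filterlim_at less_imp_neq[OF s(1), THEN not_sym])
      define \<psi>n where "\<psi>n n q = scaled_corr \<sigma> (\<epsilon> n) \<psi> (fst q)" for n and q :: "(real^'n) \<times> real"
      have \<psi>n0: "\<forall>\<^sub>F n in sequentially. \<forall>q. \<bar>\<psi>n n q\<bar> < d" if "0 < d" for d
      proof -
        have "((\<lambda>\<epsilon>::real. \<epsilon> powr \<sigma> * L) \<longlongrightarrow> 0 * L) (at_right 0)"
          using \<sigma> by (intro tendsto_mult tendsto_const) real_asymp
        then have "(\<lambda>n. \<epsilon> n powr \<sigma> * L) \<longlonglongrightarrow> 0" using filterlim_compose[OF _ \<epsilon>at] by simp
        from order_tendstoD(2)[OF this that] show ?thesis
        proof (rule eventually_mono)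
          fix n assume "\<epsilon> n powr \<sigma> * L < d"
          then show "\<forall>q. \<bar>\<psi>n n q\<bar> < d" using scaled_corr_facts(4)[OF \<psi> s(1)[of n]] unfolding \<psi>n_def by (meson le_less_trans)
        qed
      qed
      define w where "w n q = u (\<epsilon> n) q - \<phi>' q - \<psi>n n q" for n q
      have \<psi>nc: "continuous_on A' (\<psi>n n)" for A' n
        unfolding \<psi>n_def[abs_def] by (rule continuous_on_compose2[OF scaled_corr_facts(3)[OF \<psi> s(1)[of n]]]) (auto intro!: continuous_intros)
      have wc: "continuous_on N (w n)" for n
        unfolding w_def[abs_def]
        by (intro continuous_intros continuous_on_subset[OF ucont[OF s(1)]] continuous_on_subset[OF \<phi>'c] \<psi>nc) (use NQ QQ in auto)
      have unear: "\<exists>r>0. \<forall>\<^sub>F n in sequentially. \<forall>q'\<in>QT_bar T. dist q' q < r \<longrightarrow> u (\<epsilon> n) q' < c"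
        if uq: "q \<in> QT_bar T" "ub q < c" for q c
      proof -
        obtain r where r: "bf.near q r c" using bf.relaxed_sup_less[OF uq(1)] uq(2) unfolding ub_def by blast
        then have r0: "0 < r" and rr: "\<And>\<epsilon> q'. 0 < \<epsilon> \<Longrightarrow> \<epsilon> < r \<Longrightarrow> q' \<in> QT_bar T \<Longrightarrow> dist q' q < r \<Longrightarrow> u \<epsilon> q' < c"
          unfolding bf.near_def by auto
        have "\<forall>\<^sub>F n in sequentially. \<epsilon> n < r" using \<epsilon>0 r0 by (rule order_tendstoD(2))
        then have "\<forall>\<^sub>F n in sequentially. \<forall>q'\<in>QT_bar T. dist q' q < r \<longrightarrow> u (\<epsilon> n) q' < c"
          by (rule eventually_mono) (use rr s(1) in blast)
        then show ?thesis using r0 by blast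
      qed
      have wup: "\<exists>r>0. \<forall>\<^sub>F n in sequentially. \<forall>q'\<in>N. dist q' q < r \<longrightarrow> w n q' < c"
        if q: "q \<in> N" "wb q < c" for q c
      proof -
        define d where "d = (c - wb q) / 3"
        have d: "0 < d" using q by (simp add: d_def)
        have qQ: "q \<in> QT T" "q \<in> QT_bar T" using q NQ QQ by auto
        obtain r1 where r1: "0 < r1" "\<forall>\<^sub>F n in sequentially. \<forall>q'\<in>QT_bar T. dist q' q < r1 \<longrightarrow> u (\<epsilon> n) q' < ub q + d"
          using unear[OF qQ(2), of "ub q + d"] d by auto
        obtain r2 where r2: "0 < r2" "\<And>q'. q' \<in> QT T \<Longrightarrow> dist q' q < r2 \<Longrightarrow> dist (\<phi>' q') (\<phi>' q) < d"
          using \<phi>'c qQ(1) d unfolding continuous_on_iff by blast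
        have "\<forall>\<^sub>F n in sequentially. \<forall>q'\<in>N. dist q' q < min r1 r2 \<longrightarrow> w n q' < c"
          using r1(2) \<psi>n0[OF d]
        proof eventually_elim
          case (elim n)
          show ?case
          proof (intro ballI impI)
            fix q' assume q': "q' \<in> N" "dist q' q < min r1 r2"
            have "u (\<epsilon> n) q' < ub q + d" using elim(1) q' NQ QQ by auto
            moreover have "\<bar>\<phi>' q' - \<phi>' q\<bar> < d" using r2(2)[of q'] q' NQ by (auto simp: dist_real_def)
            moreover have "\<bar>\<psi>n n q'\<bar> < d" using elim(2) by blast
            moreover have "ub q - \<phi>' q + 3 * d = c" by (simp add: d_def wb_def diff_divide_distrib)
            ultimately show "w n q' < c" unfolding w_def by linarith
          qed
        qed
        then show ?thesis using r1(1) r2(1) by (intro exI[of _ "min r1 r2"]) auto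
      qed
      have evN: "\<forall>\<^sub>F n in sequentially. qs n \<in> N"
      proof -
        have "\<forall>\<^sub>F n in sequentially. dist (qs n) q0 < \<rho>" using qs \<rho>(1) by (rule tendstoD)
        then show ?thesis
        proof (rule eventually_mono)
          fix n assume d: "dist (qs n) q0 < \<rho>"
          obtain x t where xt: "qs n = (x, t)" by force
          have "dist x x0 < \<rho>" "dist t t0 < \<rho>"
            using d dist_fst_le[of "qs n" q0] dist_snd_le[of "qs n" q0] by (auto simp: xt q0_def)
          then show "qs n \<in> N" using s(2)[of n] by (auto simp: N_def xt QT_bar_def dist_real_def dist_commute)
        qed
      qed
      have wlow: "\<forall>\<^sub>F n in sequentially. \<exists>q'\<in>N. wb q0 - d \<le> w n q'" if "0 < d" for d
      proof -
        have d3: "0 < d / 3" using that by simp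
        obtain r2 where r2: "0 < r2" "\<And>q'. q' \<in> QT T \<Longrightarrow> dist q' q0 < r2 \<Longrightarrow> dist (\<phi>' q') (\<phi>' q0) < d / 3"
          using \<phi>'c q0Q(1) d3 unfolding continuous_on_iff by blast
        have "\<forall>\<^sub>F n in sequentially. dist (qs n) q0 < r2" using qs r2(1) by (rule tendstoD)
        from this evN ulow[OF d3] \<psi>n0[OF d3] show ?thesis
        proof eventually_elim
          case (elim n)
          have "\<bar>\<phi>' (qs n) - \<phi>' q0\<bar> < d / 3" using r2(2)[of "qs n"] elim NQ by (auto simp: dist_real_def)
          moreover have "\<bar>\<psi>n n (qs n)\<bar> < d / 3" using elim by blast
          ultimately have "wb q0 - d \<le> w n (qs n)" using elim(3) unfolding w_def wb_def by linarith
          then show ?case using elim(2) by blast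
        qed
      qed
      obtain qh where qh: "\<And>n. qh n \<in> N" "\<And>n q. q \<in> N \<Longrightarrow> w n q \<le> w n (qh n)" and qhl: "qh \<longlonglongrightarrow> q0"
        and wl: "(\<lambda>n. w n (qh n)) \<longlonglongrightarrow> wb q0"
        using max_points_converge[where N=N and ?q0.0=q0 and w=w and wb=wb, OF Nc q0N wc strict wup wlow] by blast
      define x where "x n = fst (qh n)" for n
      define t where "t n = snd (qh n)" for n
      have xt: "qh n = (x n, t n)" for n by (simp add: x_def t_def)
      have qhQ: "qh n \<in> QT T" "(x n, t n) \<in> QT T" for n using qh(1)[of n] NQ xt by auto
      have tn: "t n \<in> {0<..T}" for n using qhQ(2)[of n] by (auto simp: QT_def)
      have xl: "x \<longlonglongrightarrow> x0" and tl: "t \<longlonglongrightarrow> t0"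
        using tendsto_fst[OF qhl] tendsto_snd[OF qhl] by (auto simp: x_def[abs_def] t_def[abs_def] q0_def)
      have seqc: "(\<lambda>n. f (qq n)) \<longlonglongrightarrow> f q" if "continuous_on (QT T) f" "\<And>n. qq n \<in> QT T" "q \<in> QT T" "qq \<longlonglongrightarrow> q"
        for f :: "(real^'n) \<times> real \<Rightarrow> 'c::topological_space" and qq q
        using continuous_on_tendsto_compose[OF that(1,4,3)] that(2) by simp
      have \<phi>l: "(\<lambda>n. \<phi>' (qh n)) \<longlonglongrightarrow> \<phi>' q0" and Pl: "(\<lambda>n. P' (qh n)) \<longlonglongrightarrow> p0" and Ql: "(\<lambda>n. Q' (qh n)) \<longlonglongrightarrow> Q0 q0"
        using seqc[OF \<phi>'c qhQ(1) q0Q(1) qhl] seqc[OF P'c qhQ(1) q0Q(1) qhl] seqc[OF Q'c qhQ(1) q0Q(1) qhl]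
        unfolding P'0 Q'0 by auto
      have ul: "(\<lambda>n. u (\<epsilon> n) (qh n)) \<longlonglongrightarrow> ub q0"
      proof -
        have "(\<lambda>n. \<psi>n n (qh n)) \<longlonglongrightarrow> 0"
        proof (rule tendstoI)
          fix d :: real assume "0 < d"
          from \<psi>n0[OF this] show "\<forall>\<^sub>F n in sequentially. dist (\<psi>n n (qh n)) 0 < d"
            unfolding dist_real_def diff_0_right by (rule eventually_mono) blast
        qed
        from tendsto_add[OF tendsto_add[OF wl \<phi>l] this] show ?thesis by (simp add: w_def wb_def)
      qed
      \<comment> \<open>Maximum points within \<delta>' of q0 have their \<delta>'-neighbourhood,
        cut at time T, inside N. Maximality over N is then local maximality with a radius
        independent of n.\<close>
      define \<delta>' where "\<delta>' = \<rho> / 2"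
      have \<delta>': "0 < \<delta>'" "\<delta>' < 1" "\<delta>' < \<delta>" "\<delta>' < \<rho>" using \<rho> by (auto simp: \<delta>'_def)
      define y where "y n = inverse (\<epsilon> n) *\<^sub>R x n" for n
      define sg where "sg n = scaled_grad \<sigma> (\<epsilon> n) P\<psi> (x n)" for n
      obtain B where B: "0 \<le> B" and B': "\<And>x t z. (x, t) \<in> N \<Longrightarrow> norm z \<le> 1 \<Longrightarrow> \<bar>\<phi>' (x + z, t) - \<phi>' (x, t) - P' (x, t) \<bullet> z\<bar> \<le> B * (norm z)\<^sup>2"
        using test_fn_taylor[OF PQ' Nc NQ] by blast
      obtain Pb where Pb: "\<And>n. norm (P' (x n, t n)) \<le> Pb"
        using convergent_imp_Bseq[OF convergentI[OF Pl]] unfolding Bseq_def xt by blast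
      have uusc: "usc_on (QT T) (u (\<epsilon> n))" for n
        by (rule usc_on_subset[OF usc_on_continuous[OF ucont[OF s(1)]] QQ])
      have ubd': "\<And>q. q \<in> QT T \<Longrightarrow> \<bar>u (\<epsilon> n) q\<bar> \<le> M" for n using ubd[OF s(1)] QQ by blast
      define g1 where "g1 n = glue \<delta>' (\<lambda>z. \<phi>' (x n + z, t n) - \<phi>' (x n, t n)) (\<lambda>z. u (\<epsilon> n) (x n + z, t n) - u (\<epsilon> n) (x n, t n))" for n
      define g2 where "g2 n = glue \<delta>' (\<lambda>z. scaled_corr \<sigma> (\<epsilon> n) \<psi> (x n + z) - scaled_corr \<sigma> (\<epsilon> n) \<psi> (x n)) (\<lambda>_. 0)" for n
      define g0' where "g0' = glue \<delta>' (\<lambda>z. \<phi>' (x0 + z, t0) - \<phi>' (x0, t0)) (\<lambda>z. ub (x0 + z, t0) - ub (x0, t0))"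
      have xtN: "(x n, t n) \<in> N" for n using qh(1)[of n] xt by simp
      have adm1: "lev_adm (P' (x n, t n)) (g1 n)" for n
        unfolding g1_def by (rule lev_adm_test[OF PQ' tn \<delta>'(1,2) uusc ubd' B B'[OF xtN]])
      have bd1: "\<bar>comp_incr (P' (x n, t n)) (g1 n) z\<bar> \<le> (B + (2 * M + Pb) / \<delta>'\<^sup>2) * wt z" for n z
      proof -
        have "\<bar>comp_incr (P' (x n, t n)) (g1 n) z\<bar> \<le> (B + (2 * M + norm (P' (x n, t n))) / \<delta>'\<^sup>2) * wt z"
          unfolding g1_def by (rule lev_adm_test(2)[OF PQ' tn \<delta>'(1,2) uusc ubd' B B'[OF xtN]])
        also have "\<dots> \<le> (B + (2 * M + Pb) / \<delta>'\<^sup>2) * wt z"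
          using Pb[of n] by (intro mult_right_mono add_left_mono divide_right_mono) auto
        finally show ?thesis .
      qed
      have ubM': "\<And>q. q \<in> QT T \<Longrightarrow> \<bar>ub q\<bar> \<le> M" using ubM QQ by blast
      have adm0: "lev_adm p0 g0'"
        using lev_adm_test(1)[OF PQ' t0 \<delta>'(1,2) ubusc' ubM' B B'[OF q0N[unfolded q0_def]]]
        unfolding g0'_def P'0[unfolded q0_def] .
      \<comment> \<open>For |z| < \<delta>' the increments converge by continuity of the test
        function. For larger z only the limsup of u at the shifted point is controlled, but at the
        maximum points u converges, which gives the one-sided limit.\<close>
      have E1: "\<forall>\<^sub>F n in sequentially. lev K (P' (x n, t n)) (g1 n) \<le> lev K p0 g0' + e"
      proof (rule lev_limsup[OF adm1 adm0 bd1 _ e])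
        fix z :: "real^'n" and d :: real assume d: "0 < d"
        have Plz: "(\<lambda>n. P' (x n, t n) \<bullet> z) \<longlonglongrightarrow> p0 \<bullet> z" using tendsto_inner[OF Pl tendsto_const] unfolding xt .
        show "\<forall>\<^sub>F n in sequentially. comp_incr (P' (x n, t n)) (g1 n) z \<le> comp_incr p0 g0' z + d"
        proof (cases "norm z < \<delta>'")
          case True
          have zQ: "(x n + z, t n) \<in> QT T" "(x0 + z, t0) \<in> QT T" for n using tn t0 by (auto simp: QT_def)
          have zl: "(\<lambda>n. (x n + z, t n)) \<longlonglongrightarrow> (x0 + z, t0)" by (intro tendsto_Pair tendsto_add xl tl tendsto_const)
          have "(\<lambda>n. (\<phi>' (x n + z, t n) - \<phi>' (x n, t n)) - indicator (ball 0 1) z * (P' (x n, t n) \<bullet> z))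
             \<longlonglongrightarrow> (\<phi>' (x0 + z, t0) - \<phi>' (x0, t0)) - indicator (ball 0 1) z * (p0 \<bullet> z)"
            using \<phi>l by (intro tendsto_diff tendsto_mult tendsto_const Plz seqc[OF \<phi>'c zQ zl]) (simp add: xt q0_def)
          then have "(\<lambda>n. comp_incr (P' (x n, t n)) (g1 n) z) \<longlonglongrightarrow> comp_incr p0 g0' z"
            using True by (simp add: comp_incr_def g1_def g0'_def glue_def)
          from order_tendstoD(2)[OF this, of "comp_incr p0 g0' z + d"] show ?thesis
            using d by (auto elim!: eventually_mono)
        next
          case False
          have zQ: "(x0 + z, t0) \<in> QT_bar T" "(x n + z, t n) \<in> QT_bar T" for n using t0 tn[of n] by (auto simp: QT_bar_def)
          have d3: "0 < d / 3" using d by simp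
          obtain r where r: "0 < r" "\<forall>\<^sub>F n in sequentially. \<forall>q'\<in>QT_bar T. dist q' (x0 + z, t0) < r \<longrightarrow> u (\<epsilon> n) q' < ub (x0 + z, t0) + d / 3"
            using unear[OF zQ(1), of "ub (x0 + z, t0) + d / 3"] d3 by auto
          have zl: "(\<lambda>n. (x n + z, t n)) \<longlonglongrightarrow> (x0 + z, t0)" by (intro tendsto_Pair tendsto_add xl tl tendsto_const)
          have c1: "\<forall>\<^sub>F n in sequentially. ub q0 - d / 3 < u (\<epsilon> n) (qh n)"
            using order_tendstoD(1)[OF ul] d3 by simp
          have il: "(\<lambda>n. indicator (ball 0 1) z * (P' (x n, t n) \<bullet> z)) \<longlonglongrightarrow> indicator (ball 0 1) z * (p0 \<bullet> z)"
            by (intro tendsto_mult tendsto_const Plz)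
          have c2: "\<forall>\<^sub>F n in sequentially. indicator (ball 0 1) z * (p0 \<bullet> z) - d / 3 < indicator (ball 0 1) z * (P' (x n, t n) \<bullet> z)"
            using order_tendstoD(1)[OF il] d3 by simp
          from r(2) tendstoD[OF zl r(1)] c1 c2 show ?thesis
          proof eventually_elim
            case (elim n)
            have "u (\<epsilon> n) (x n + z, t n) < ub (x0 + z, t0) + d / 3" using elim(1,2) zQ(2) by blast
            then show ?case using elim(3,4) False
              by (simp add: comp_incr_def g1_def g0'_def glue_def xt q0_def)
          qed
        qed
      qed
      \<comment> \<open>The gluing radii differ. On the shell between \<delta>' and \<delta>, local
        maximality bounds the increment of the relaxed limit by that of the original test
        function.\<close>
      have "lev K p0 g0' \<le> l + \<kappa> * mass"
        unfolding l_def
      proof (rule lev_mono_wt[OF adm0 g0adm])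
        fix z :: "real^'n"
        have pos: "0 \<le> \<kappa> * wt z" using \<kappa> by simp
        consider "norm z < \<delta>'" | "\<delta>' \<le> norm z" "norm z < \<delta>" | "\<delta> \<le> norm z" by linarith
        then show "comp_incr p0 g0' z \<le> comp_incr p0 g0 z + \<kappa> * wt z"
        proof cases
          case 1
          then show ?thesis using \<delta>' by (simp add: comp_incr_def g0_def g0'_def glue_def \<phi>'_def wt_less_1)
        next
          case 2
          have "(x0 + z, t0) \<in> (ball x0 \<delta> \<times> {t0 - \<delta><..<t0 + \<delta>}) \<inter> QT T"
            using 2 t0 \<delta> by (auto simp: QT_def dist_norm)
          from mx[OF this] show ?thesis using 2 pos by (simp add: comp_incr_def g0_def g0'_def glue_def)
        next
          case 3
          then show ?thesis using \<delta>' pos by (simp add: comp_incr_def g0_def g0'_def glue_def)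
        qed
      qed
      then have l0: "lev K p0 g0' \<le> l + e" using \<kappa>m by linarith
      have E2: "\<forall>\<^sub>F n in sequentially. lev_adm (sg n) (g2 n) \<and> lev K (sg n) (g2 n) \<le> Lm (y n) + e"
        using eventually_compose_filterlim[OF corrector_limit[OF \<sigma> lim fc \<psi> \<delta>'(1,2) e] \<epsilon>at]
        by (rule eventually_mono) (auto simp: sg_def g2_def Lm_def y_def)
      have E3: "\<forall>\<^sub>F n in sequentially. dist (qh n) q0 < \<delta>'" using qhl \<delta>'(1) by (rule tendstoD)
      \<comment> \<open>A bound for |l + Lm y| over all y; freezing a at x0 is done with accuracy e
        / k, so it costs at most e.\<close>
      define k where "k = \<bar>l\<bar> + L * F.mass + 1"
      have k: "0 < k" unfolding k_def using L F.mass_nonneg by (simp add: add_nonneg_pos)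
      obtain ra where ra: "0 < ra" "\<And>x x' y. norm (x - x') < ra \<Longrightarrow> \<bar>a x y - a x' y\<bar> < e / k"
        using a_cont[of "e / k"] e k by auto
      have E4: "\<forall>\<^sub>F n in sequentially. dist (x n) x0 < ra" using xl ra(1) by (rule tendstoD)
      have sgl: "sg \<longlonglongrightarrow> 0"
      proof (rule Lim_null_comparison)
        show "\<forall>\<^sub>F n in sequentially. norm (sg n) \<le> \<epsilon> n powr (\<sigma> - 1) * L"
          unfolding sg_def by (intro always_eventually allI scaled_corr_facts(5)[OF \<psi> s(1)])
        have "((\<lambda>\<epsilon>::real. \<epsilon> powr (\<sigma> - 1) * L) \<longlongrightarrow> 0 * L) (at_right 0)"
          using \<sigma> by (intro tendsto_mult tendsto_const) real_asymp
        then show "(\<lambda>n. \<epsilon> n powr (\<sigma> - 1) * L) \<longlonglongrightarrow> 0" using filterlim_compose[OF _ \<epsilon>at] by simp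
      qed
      define Pn where "Pn n = P' (x n, t n) + sg n" for n
      have Pnl: "Pn \<longlonglongrightarrow> p0" unfolding Pn_def[abs_def] using tendsto_add[OF Pl sgl] by (simp add: xt)
      obtain rh where rh: "0 < rh" "\<And>x x' y p p'. norm p \<le> norm p0 + 1 \<Longrightarrow> norm p' \<le> norm p0 + 1 \<Longrightarrow>
          norm (x - x') < rh \<Longrightarrow> norm (p - p') < rh \<Longrightarrow> \<bar>H x y p - H x' y p'\<bar> < e"
        using H_cont[OF e, of "norm p0 + 1"] by blast
      have E5: "\<forall>\<^sub>F n in sequentially. dist (x n) x0 < rh" using xl rh(1) by (rule tendstoD)
      have E6: "\<forall>\<^sub>F n in sequentially. dist (Pn n) p0 < min rh 1" using Pnl rh(1) by (intro tendstoD) auto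
      have E7: "\<forall>\<^sub>F n in sequentially. Q0 q0 - e < Q' (qh n)" using order_tendstoD(1)[OF Ql] e by simp
      have "\<forall>\<^sub>F n in sequentially. Q0 q0 + G x0 p0 l \<le> 0 + e2"
        using E1 E2 E3 E4 E5 E6 E7
      proof eventually_elim
        case (elim n)
        define \<phi>n where "\<phi>n q = \<phi>' q + \<psi>n n q" for q
        have C2n: "C2_on (QT T) \<phi>n"
          unfolding \<phi>n_def[abs_def] \<psi>n_def by (intro C2_on_add C2' C2_on_fst scaled_corr_facts(1)[OF \<psi> s(1)])
        have lm: "local_max T (\<lambda>q. u (\<epsilon> n) q - \<phi>n q) \<delta>' (x n) (t n)"
          unfolding local_max_def
        proof
          fix q assume q: "q \<in> ball (x n) \<delta>' \<times> {t n - \<delta>'<..<t n + \<delta>'} \<inter> QT T"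
          obtain v r where vr: "q = (v, r)" by force
          have "dist (x n) x0 < \<delta>'" "dist (t n) t0 < \<delta>'"
            using elim(3) dist_fst_le[of "qh n" q0] dist_snd_le[of "qh n" q0] by (auto simp: xt q0_def)
          moreover have "dist v x0 \<le> dist (x n) v + dist (x n) x0" by (rule dist_triangle3)
          moreover have "dist (x n) v < \<delta>'" "t n - \<delta>' < r" "r < t n + \<delta>'" "r \<le> T" using q by (auto simp: vr QT_def)
          moreover have "\<rho> = \<delta>' + \<delta>'" by (simp add: \<delta>'_def)
          ultimately have "dist x0 v \<le> \<rho>" "t0 - \<rho> \<le> r" "r \<le> t0 + \<rho>" "r \<le> T"
            unfolding dist_real_def dist_commute[of x0 v] by linarith+
          then have "q \<in> N" unfolding N_def vr by simp
          from qh(2)[OF this, of n] show "u (\<epsilon> n) q - \<phi>n q \<le> u (\<epsilon> n) (x n, t n) - \<phi>n (x n, t n)"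
            by (simp add: w_def \<phi>n_def xt)
        qed
        have Gn: "GDERIV (\<lambda>y. \<phi>n (y, t n)) (x n) :> Pn n"
          unfolding \<phi>n_def \<psi>n_def Pn_def sg_def fst_conv
          using test_fn_slice(1)[OF PQ' tn, of n "x n"] scaled_corr_facts(2)[OF \<psi> s(1)] by (intro GDERIV_add) auto
        have Vn: "((\<lambda>r. \<phi>n (x n, r)) has_vector_derivative Q' (x n, t n) + 0) (at (t n) within {0<..T})"
          unfolding \<phi>n_def \<psi>n_def fst_conv
          using PQ' tn[of n] unfolding test_fn_def by (intro has_vector_derivative_add has_vector_derivative_const) auto
        note ie = subsol_ineq(2)[OF sub[OF s(1)] levy_kernel_axioms \<delta>'(1,2) tn C2n lm Gn Vn]
        have ge: "glue \<delta>' (\<lambda>z. \<phi>n (x n + z, t n) - \<phi>n (x n, t n)) (\<lambda>z. u (\<epsilon> n) (x n + z, t n) - u (\<epsilon> n) (x n, t n))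
           = (\<lambda>z. g1 n z + g2 n z)"
          by (auto simp: glue_def g1_def g2_def \<phi>n_def \<psi>n_def fun_eq_iff)
        define J where "J = lev K (Pn n) (\<lambda>z. g1 n z + g2 n z)"
        have J: "J \<le> l + Lm (y n) + 3 * e"
          unfolding J_def Pn_def using lev_add[OF adm1[of n] elim(2)[THEN conjunct1]] elim(1) elim(2) l0 by linarith
        have ineq: "Q' (x n, t n) + (- a (x n) (y n) * J + H (x n) (y n) (Pn n)) \<le> 0"
          using ie unfolding ge J_def[symmetric] y_def by simp
        have "a (x n) (y n) * J \<le> a (x n) (y n) * (l + Lm (y n) + 3 * e)"
          using J a by (intro mult_left_mono) auto
        also have "\<dots> = a (x n) (y n) * (l + Lm (y n)) + a (x n) (y n) * (3 * e)" by (rule distrib_left)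
        also have "a (x n) (y n) * (3 * e) \<le> A * (3 * e)" using a e by (intro mult_right_mono) auto
        finally have j1: "a (x n) (y n) * J \<le> a (x n) (y n) * (l + Lm (y n)) + A * (3 * e)" by simp
        have "\<bar>(a (x n) (y n) - a x0 (y n)) * (l + Lm (y n))\<bar> \<le> (e / k) * k"
          unfolding abs_mult
        proof (rule mult_mono)
          show "\<bar>a (x n) (y n) - a x0 (y n)\<bar> \<le> e / k" using ra(2)[of "x n" x0 "y n"] elim(4) by (simp add: dist_norm)
          show "\<bar>l + Lm (y n)\<bar> \<le> k" using LmB[of "y n"] abs_triangle_ineq[of l "Lm (y n)"] by (simp add: k_def)
        qed (use e k in auto)
        then have j2: "a (x n) (y n) * (l + Lm (y n)) \<le> a x0 (y n) * (l + Lm (y n)) + e"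
          using k by (simp add: left_diff_distrib abs_le_iff)
        have "norm (Pn n) \<le> norm p0 + 1" using elim(6) norm_triangle_sub[of "Pn n" p0] by (simp add: dist_norm)
        then have "\<bar>H (x n) (y n) (Pn n) - H x0 (y n) p0\<bar> < e"
          using elim(5,6) by (intro rh(2)) (auto simp: dist_norm)
        then have j3: "H x0 (y n) p0 - e \<le> H (x n) (y n) (Pn n)" by (simp add: abs_less_iff)
        have j4: "G x0 p0 l - e \<le> - (a x0 (y n) * (l + Lm (y n))) + H x0 (y n) p0"
          using cor[of "y n"] unfolding Lm_def by (simp add: abs_le_iff)
        have j5: "Q0 q0 - e \<le> Q' (x n, t n)" using elim(7) by (simp add: xt)
        have "Q0 q0 + G x0 p0 l \<le> (3 * A + 4) * e"
          using ineq j1 j2 j3 j4 j5 by (simp add: algebra_simps)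
        then show ?case unfolding ee by simp
      qed
      then show ?thesis by (simp add: eventually_False)
    qed
    then have "Q0 q0 + G x0 p0 l \<le> 0" by (rule field_le_epsilon)
    then show "visc_lhs T K G ub \<phi> \<delta> x0 t0 \<le> 0" unfolding ve(2) l_def g0_def by simp
  qed
qed

section \<open>Trigonometric polynomials on the torus\<close>

lemma lebesgue_integral_affine:
  fixes f :: "'a::euclidean_space \<Rightarrow> real"
  assumes f: "f \<in> borel_measurable borel" and c: "\<bar>c\<bar> = 1"
  shows "(LINT z|lebesgue. f (t + c *\<^sub>R z)) = (LINT z|lebesgue. f z)"
proof -
  have fs: "(\<lambda>z. f (t + c *\<^sub>R z)) \<in> borel_measurable borel"
    by (rule measurable_compose[OF _ f]) measurable
  have "(LINT z|lebesgue. f z) = (LINT z|lborel. f z)"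
    using f by (intro integral_completion) simp
  also have "\<dots> = (LINT z|density (distr lborel borel (\<lambda>x. t + c *\<^sub>R x)) (\<lambda>_. \<bar>c\<bar>^DIM('a)). f z)"
    using lborel_affine[of c t] c by force
  also have "\<dots> = (LINT z|distr lborel borel (\<lambda>x. t + c *\<^sub>R x). \<bar>c\<bar>^DIM('a) *\<^sub>R f z)"
    using f by (intro integral_density[where g="\<lambda>_. \<bar>c\<bar>^DIM('a)"]) auto
  also have "\<dots> = (LINT z|lborel. \<bar>c\<bar>^DIM('a) *\<^sub>R f (t + c *\<^sub>R z))"
    using f by (intro integral_distr) auto
  also have "\<dots> = (LINT z|lborel. f (t + c *\<^sub>R z))" by (simp add: c)
  also have "\<dots> = (LINT z|lebesgue. f (t + c *\<^sub>R z))"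
    using fs by (intro integral_completion[symmetric]) simp
  finally show ?thesis by simp
qed

text \<open>The reflection z to - z shows that the integral equals its own negative. This includes a
  non-integrable f, whose integral is 0 by convention.\<close>

lemma lebesgue_integral_odd:
  fixes f :: "'a::euclidean_space \<Rightarrow> real"
  assumes "f \<in> borel_measurable borel" "\<And>z. f (- z) = - f z"
  shows "(LINT z|lebesgue. f z) = 0"
  using lebesgue_integral_affine[OF assms(1), of "-1" 0] assms(2) by simp

definition lattice :: "(real ^ 'n) set" where "lattice = {k. \<forall>i. k $ i \<in> \<int>}"

text \<open>Real trigonometric polynomials with integer frequencies, generated from single modes:
  periodicity, smoothness and solvability are then checked on one mode and passed through sums and
  multiples.\<close>

inductive trig_poly :: "(real ^ 'n \<Rightarrow> real) \<Rightarrow> bool" where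
  trig_cos: "k \<in> lattice \<Longrightarrow> trig_poly (\<lambda>y. cos ((2 * pi) *\<^sub>R k \<bullet> y))"
| trig_sin: "k \<in> lattice \<Longrightarrow> trig_poly (\<lambda>y. sin ((2 * pi) *\<^sub>R k \<bullet> y))"
| trig_add: "trig_poly f \<Longrightarrow> trig_poly g \<Longrightarrow> trig_poly (\<lambda>y. f y + g y)"
| trig_scale: "trig_poly f \<Longrightarrow> trig_poly (\<lambda>y. c * f y)"

lemma lattice_add: "k \<in> lattice \<Longrightarrow> k' \<in> lattice \<Longrightarrow> k + k' \<in> lattice"
  and lattice_diff: "k \<in> lattice \<Longrightarrow> k' \<in> lattice \<Longrightarrow> k - k' \<in> lattice"
  and lattice_0: "0 \<in> lattice"
  by (auto simp: lattice_def)

lemma lattice_inner_int: "k \<in> lattice \<Longrightarrow> k' \<in> lattice \<Longrightarrow> k \<bullet> k' \<in> \<int>"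
  by (auto simp: lattice_def inner_vec_def intro!: Ints_sum Ints_mult)

lemma trig_const: "trig_poly (\<lambda>_. c)"
  using trig_scale[OF trig_cos[OF lattice_0], of c] by simp

lemma trig_diff: "trig_poly f \<Longrightarrow> trig_poly g \<Longrightarrow> trig_poly (\<lambda>y. f y - g y)"
  using trig_add[of f "\<lambda>y. -1 * g y"] trig_scale[of g "-1"] by simp

text \<open>The product-to-sum formulas stay within integer frequencies. Closure under products is
  what the Stone-Weierstrass theorem asks of the algebra.\<close>

lemma trig_cos_mult:
  assumes k: "k \<in> lattice" and f: "trig_poly f"
  shows "trig_poly (\<lambda>y. cos ((2 * pi) *\<^sub>R k \<bullet> y) * f y)"
  using f
proof induction
  case (trig_cos k')
  have "trig_poly (\<lambda>y. (1/2) * (cos ((2 * pi) *\<^sub>R (k - k') \<bullet> y) + cos ((2 * pi) *\<^sub>R (k + k') \<bullet> y)))"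
    by (intro trig_poly.intros lattice_add lattice_diff k trig_cos)
  moreover have "(1/2) * (cos ((2 * pi) *\<^sub>R (k - k') \<bullet> y) + cos ((2 * pi) *\<^sub>R (k + k') \<bullet> y)) = cos ((2 * pi) *\<^sub>R k \<bullet> y) * cos ((2 * pi) *\<^sub>R k' \<bullet> y)" for y
    by (simp only: cos_times_cos scaleR_right_diff_distrib scaleR_right_distrib inner_diff_left inner_add_left)
  ultimately show ?case by (simp only:)
next
  case (trig_sin k')
  have "trig_poly (\<lambda>y. (1/2) * (sin ((2 * pi) *\<^sub>R (k + k') \<bullet> y) - sin ((2 * pi) *\<^sub>R (k - k') \<bullet> y)))"
    by (intro trig_poly.trig_scale trig_diff trig_poly.trig_sin lattice_add lattice_diff k trig_sin)
  moreover have "(1/2) * (sin ((2 * pi) *\<^sub>R (k + k') \<bullet> y) - sin ((2 * pi) *\<^sub>R (k - k') \<bullet> y)) = cos ((2 * pi) *\<^sub>R k \<bullet> y) * sin ((2 * pi) *\<^sub>R k' \<bullet> y)" for y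
    by (simp only: cos_times_sin scaleR_right_diff_distrib scaleR_right_distrib inner_diff_left inner_add_left)
  ultimately show ?case by (simp only:)
next
  case (trig_add f g)
  then show ?case using trig_poly.trig_add[OF trig_add.IH] by (simp add: distrib_left)
next
  case (trig_scale f c)
  then show ?case using trig_poly.trig_scale[OF trig_scale.IH, of c] by (simp add: mult.left_commute)
qed

lemma trig_sin_mult:
  assumes k: "k \<in> lattice" and f: "trig_poly f"
  shows "trig_poly (\<lambda>y. sin ((2 * pi) *\<^sub>R k \<bullet> y) * f y)"
  using f
proof induction
  case (trig_cos k')
  have "trig_poly (\<lambda>y. (1/2) * (sin ((2 * pi) *\<^sub>R (k + k') \<bullet> y) + sin ((2 * pi) *\<^sub>R (k - k') \<bullet> y)))"
    by (intro trig_poly.intros lattice_add lattice_diff k trig_cos)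
  moreover have "(1/2) * (sin ((2 * pi) *\<^sub>R (k + k') \<bullet> y) + sin ((2 * pi) *\<^sub>R (k - k') \<bullet> y)) = sin ((2 * pi) *\<^sub>R k \<bullet> y) * cos ((2 * pi) *\<^sub>R k' \<bullet> y)" for y
    by (simp only: sin_times_cos scaleR_right_diff_distrib scaleR_right_distrib inner_diff_left inner_add_left)
  ultimately show ?case by (simp only:)
next
  case (trig_sin k')
  have "trig_poly (\<lambda>y. (1/2) * (cos ((2 * pi) *\<^sub>R (k - k') \<bullet> y) - cos ((2 * pi) *\<^sub>R (k + k') \<bullet> y)))"
    by (intro trig_poly.trig_scale trig_diff trig_poly.trig_cos lattice_add lattice_diff k trig_sin)
  moreover have "(1/2) * (cos ((2 * pi) *\<^sub>R (k - k') \<bullet> y) - cos ((2 * pi) *\<^sub>R (k + k') \<bullet> y)) = sin ((2 * pi) *\<^sub>R k \<bullet> y) * sin ((2 * pi) *\<^sub>R k' \<bullet> y)" for y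
    by (simp only: sin_times_sin scaleR_right_diff_distrib scaleR_right_distrib inner_diff_left inner_add_left)
  ultimately show ?case by (simp only:)
next
  case (trig_add f g)
  then show ?case using trig_poly.trig_add[OF trig_add.IH] by (simp add: distrib_left)
next
  case (trig_scale f c)
  then show ?case using trig_poly.trig_scale[OF trig_scale.IH, of c] by (simp add: mult.left_commute)
qed

lemma trig_mult: "trig_poly f \<Longrightarrow> trig_poly g \<Longrightarrow> trig_poly (\<lambda>y. f y * g y)"
proof (induction rule: trig_poly.induct)
  case (trig_add f f')
  then show ?case using trig_poly.trig_add[OF trig_add.IH] by (simp add: distrib_right)
next
  case (trig_scale f c)
  then show ?case using trig_poly.trig_scale[OF trig_scale.IH, of c] by (simp add: mult.assoc)
next
  case (trig_cos k)
  then show ?case by (intro trig_cos_mult)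
next
  case (trig_sin k)
  then show ?case by (intro trig_sin_mult)
qed

lemma trig_periodic:
  fixes f :: "real ^ 'n \<Rightarrow> real"
  assumes "trig_poly f" shows "ZN_periodic f"
  using assms
proof induction
  case (trig_cos k)
  show ?case unfolding ZN_periodic_def
  proof (intro allI impI)
    fix y k' :: "real^'n" assume "\<forall>i. k' $ i \<in> \<int>"
    then have "k \<bullet> k' \<in> \<int>" using trig_cos lattice_inner_int by (auto simp: lattice_def)
    then show "cos ((2 * pi) *\<^sub>R k \<bullet> (y + k')) = cos ((2 * pi) *\<^sub>R k \<bullet> y)"
      by (auto simp: inner_add_right distrib_left cos_add elim!: Ints_cases)
  qed
next
  case (trig_sin k)
  show ?case unfolding ZN_periodic_def
  proof (intro allI impI)
    fix y k' :: "real^'n" assume "\<forall>i. k' $ i \<in> \<int>"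
    then have "k \<bullet> k' \<in> \<int>" using trig_sin lattice_inner_int by (auto simp: lattice_def)
    then show "sin ((2 * pi) *\<^sub>R k \<bullet> (y + k')) = sin ((2 * pi) *\<^sub>R k \<bullet> y)"
      by (auto simp: inner_add_right distrib_left sin_add elim!: Ints_cases)
  qed
qed (auto simp: ZN_periodic_def)

lemma nice_cos: "\<exists>L. nice (\<lambda>y :: real ^ 'n. cos (c \<bullet> y)) (\<lambda>y. - sin (c \<bullet> y) *\<^sub>R c) L"
proof -
  have "\<exists>L'. nice (\<lambda>y. cos (c \<bullet> y + 0)) (\<lambda>y. (- sin (c \<bullet> y + 0)) *\<^sub>R c) L'"
    by (rule nice_ridge[where h'="\<lambda>s. - sin s" and h''="\<lambda>s. - cos s" and L=1]) (auto intro!: derivative_eq_intros continuous_intros)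
  then show ?thesis by simp
qed

lemma nice_sin: "\<exists>L. nice (\<lambda>y :: real ^ 'n. sin (c \<bullet> y)) (\<lambda>y. cos (c \<bullet> y) *\<^sub>R c) L"
proof -
  have "\<exists>L'. nice (\<lambda>y. sin (c \<bullet> y + 0)) (\<lambda>y. cos (c \<bullet> y + 0) *\<^sub>R c) L'"
    by (rule nice_ridge[where h'=cos and h''="\<lambda>s. - sin s" and L=1]) (auto intro!: derivative_eq_intros continuous_intros)
  then show ?thesis by simp
qed

section \<open>Density of trigonometric polynomials among periodic functions\<close>

lemma ZN_periodicD: "ZN_periodic f \<Longrightarrow> k \<in> lattice \<Longrightarrow> f (y + k) = f y"
  by (auto simp: ZN_periodic_def lattice_def)

lemma exists_in_cell: "\<exists>y'\<in>cbox 0 1. \<exists>k\<in>lattice. y = y' + (k :: real ^ 'n)"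
proof
  show "(\<chi> i. frac (y $ i)) \<in> cbox 0 (1 :: real^'n)"
    by (auto simp: mem_box_cart less_imp_le[OF frac_lt_1])
  show "\<exists>k\<in>lattice. y = (\<chi> i. frac (y $ i)) + k"
    by (rule bexI[of _ "\<chi> i. of_int \<lfloor>y $ i\<rfloor>"]) (auto simp: vec_eq_iff frac_def lattice_def)
qed

text \<open>The fibres of this map are exactly the cosets of the lattice and its image is compact,
  so it realises the torus inside Euclidean space and turns periodic functions into functions on a
  compact set.\<close>

definition torus_map :: "real ^ 'n \<Rightarrow> (real ^ 'n) \<times> (real ^ 'n)" where
  "torus_map y = ((\<chi> i. cos (2 * pi * y $ i)), (\<chi> i. sin (2 * pi * y $ i)))"

lemma torus_map_eq:
  assumes "torus_map y = torus_map y'"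
  shows "y - y' \<in> lattice"
proof -
  have "(y - y') $ i \<in> \<int>" for i
  proof -
    have "sin (2 * pi * y $ i) = sin (2 * pi * y' $ i) \<and> cos (2 * pi * y $ i) = cos (2 * pi * y' $ i)"
      using assms by (auto simp: torus_map_def vec_eq_iff)
    then obtain n :: int where "2 * pi * y $ i = 2 * pi * y' $ i + 2 * pi * of_int n"
      using sin_cos_eq_iff by auto
    then have "2 * pi * (y $ i - y' $ i) = 2 * pi * of_int n" by (simp add: right_diff_distrib)
    then have "y $ i - y' $ i = of_int n" by simp
    then show ?thesis by simp
  qed
  then show ?thesis by (simp add: lattice_def)
qed

lemma torus_map_cong: "k \<in> lattice \<Longrightarrow> torus_map (y + k) = torus_map y"
proof -
  assume k: "k \<in> lattice"
  have "cos (2 * pi * (y $ i + k $ i)) = cos (2 * pi * y $ i) \<and> sin (2 * pi * (y $ i + k $ i)) = sin (2 * pi * y $ i)" for i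
  proof -
    obtain n :: int where "k $ i = of_int n" using k by (auto simp: lattice_def elim: Ints_cases)
    then show ?thesis by (simp add: distrib_left cos_add sin_add cos_int_2pin sin_int_2pin)
  qed
  then show ?thesis by (simp add: torus_map_def vec_eq_iff)
qed

lemma continuous_torus_map: "continuous_on A torus_map"
  unfolding torus_map_def by (intro continuous_intros)

lemma trig_dense:
  fixes g :: "real ^ 'n \<Rightarrow> real"
  assumes g: "continuous_on UNIV g" "ZN_periodic g" and e: "0 < e"
  shows "\<exists>f. trig_poly f \<and> (\<forall>y. \<bar>f y - g y\<bar> < e)"
proof -
  define S where "S = range (torus_map :: real^'n \<Rightarrow> _)"
  have S: "S = torus_map ` cbox 0 1"
  proof -
    have "torus_map y \<in> torus_map ` cbox 0 (1::real^'n)" for y :: "real^'n"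
      using exists_in_cell[of y] torus_map_cong by (metis imageI)
    then show ?thesis by (auto simp: S_def)
  qed
  have Sc: "compact S" unfolding S by (intro compact_continuous_image continuous_torus_map) simp
  define R where "R = {h. continuous_on S h \<and> trig_poly (h \<circ> torus_map)}"
  interpret function_ring_on R S
  proof
    show "compact S" by fact
    fix x y assume xy: "x \<in> S" "y \<in> S" "x \<noteq> y"
    then have "fst x \<noteq> fst y \<or> snd x \<noteq> snd y" by (metis prod.collapse)
    then obtain i where "fst x $ i \<noteq> fst y $ i \<or> snd x $ i \<noteq> snd y $ i" by (auto simp: vec_eq_iff)
    moreover have "(\<lambda>v. fst v $ i) \<in> R"
    proof -
      have "axis i 1 \<in> (lattice :: (real^'n) set)" by (auto simp: lattice_def axis_def)
      from trig_cos[OF this] show ?thesis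
        by (auto simp: R_def torus_map_def o_def inner_axis' intro!: continuous_intros)
    qed
    moreover have "(\<lambda>v. snd v $ i) \<in> R"
    proof -
      have "axis i 1 \<in> (lattice :: (real^'n) set)" by (auto simp: lattice_def axis_def)
      from trig_sin[OF this] show ?thesis
        by (auto simp: R_def torus_map_def o_def inner_axis' intro!: continuous_intros)
    qed
    ultimately show "\<exists>f\<in>R. f x \<noteq> f y" by (elim disjE) (rule bexI, assumption, assumption)+
  next
    fix f g assume "f \<in> R" "g \<in> R"
    then have fg: "continuous_on S f" "continuous_on S g" "trig_poly (\<lambda>y. f (torus_map y))" "trig_poly (\<lambda>y. g (torus_map y))"
      by (simp_all add: R_def o_def)
    show "continuous_on S f" by (rule fg)
    show "(\<lambda>x. f x + g x) \<in> R"
      using continuous_on_add[OF fg(1,2)] trig_add[OF fg(3,4)] by (simp add: R_def o_def)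
    show "(\<lambda>x. f x * g x) \<in> R"
      using continuous_on_mult[OF fg(1,2)] trig_mult[OF fg(3,4)] by (simp add: R_def o_def)
  next
    show "(\<lambda>_. c) \<in> R" for c using trig_const[of c] by (simp add: R_def o_def)
  qed
  \<comment> \<open>Any choice in a fibre gives the same value, since two points of a fibre differ
    by a lattice vector.\<close>
  define G where "G v = g (SOME y. torus_map y = v)" for v
  have G: "G (torus_map y) = g y" for y
  proof -
    have "torus_map (SOME y'. torus_map y' = torus_map y) = torus_map y" by (rule someI) simp
    from torus_map_eq[OF this] show ?thesis
      unfolding G_def using ZN_periodicD[OF g(2), of "(SOME y'. torus_map y' = torus_map y) - y" y] by simp
  qed
  have Gc: "continuous_on S G"
    unfolding continuous_on_closed_invariant
  proof (intro allI impI)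
    fix B :: "real set" assume B: "closed B"
    \<comment> \<open>Continuity of G is the quotient property of the compact cell: the preimage of
      a closed set is the image of a compact part of the cell.\<close>
    define A where "A = torus_map ` (cbox 0 1 \<inter> g -` B)"
    have "closed (g -` B)"
      by (rule continuous_closed_vimage[OF B]) (use g(1) in \<open>simp add: continuous_on_eq_continuous_at\<close>)
    then have "compact A" unfolding A_def
      by (intro compact_continuous_image continuous_torus_map compact_Int_closed) auto
    moreover have "A \<inter> S = G -` B \<inter> S"
    proof
      show "A \<inter> S \<subseteq> G -` B \<inter> S" by (auto simp: A_def G)
      show "G -` B \<inter> S \<subseteq> A \<inter> S" unfolding S by (auto simp: A_def G)
    qed
    ultimately show "\<exists>A. closed A \<and> A \<inter> S = G -` B \<inter> S" using compact_imp_closed by blast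
  qed
  obtain h where h: "h \<in> R" "\<And>x. x \<in> S \<Longrightarrow> \<bar>G x - h x\<bar> < e"
    using Stone_Weierstrass_basic[OF Gc e] by blast
  have "trig_poly (h \<circ> torus_map)" using h(1) by (simp add: R_def)
  moreover have "\<bar>(h \<circ> torus_map) y - g y\<bar> < e" for y
    using h(2)[of "torus_map y"] by (simp add: S_def G abs_minus_commute)
  ultimately show ?thesis by blast
qed

section \<open>Integrals over the torus\<close>

lemma torus_integral_lebesgue: "torus_integral f = (LINT y|lebesgue. indicator (cbox 0 1) y * f y)"
  by (simp add: torus_integral_def set_lebesgue_integral_def)

lemma torus_integrable:
  fixes f :: "real ^ 'n \<Rightarrow> real"
  assumes "continuous_on UNIV f"
  shows "integrable lebesgue (\<lambda>y. indicator (cbox 0 1) y * f y)"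
proof -
  have "f absolutely_integrable_on cbox 0 1"
    by (rule absolutely_integrable_continuous) (rule continuous_on_subset[OF assms], simp)
  then show ?thesis by (simp add: set_integrable_def)
qed

lemma torus_integral_add:
  "continuous_on UNIV f \<Longrightarrow> continuous_on UNIV g \<Longrightarrow> torus_integral (\<lambda>y. f y + g y) = torus_integral f + torus_integral g"
  unfolding torus_integral_lebesgue distrib_left by (intro Bochner_Integration.integral_add torus_integrable)

lemma torus_integral_cmult: "torus_integral (\<lambda>y. c * f y) = c * torus_integral f"
  unfolding torus_integral_lebesgue by (subst integral_mult_right_zero[symmetric]) (simp add: mult.left_commute)

lemma measure_cell: "measure lebesgue (cbox 0 (1 :: real ^ 'n)) = 1"
proof -
  have "0 \<in> cbox 0 (1 :: real ^ 'n)" by (simp add: mem_box_cart)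
  then have "cbox 0 (1 :: real ^ 'n) \<noteq> {}" by blast
  from content_cbox_cart[OF this] show ?thesis by simp
qed

lemma torus_integral_const: "torus_integral (\<lambda>_ :: real ^ 'n. c) = c"
proof -
  have "torus_integral (\<lambda>_ :: real ^ 'n. c) = (LINT y|lebesgue. indicator (cbox 0 (1::real^'n)) y * c)"
    by (rule torus_integral_lebesgue)
  also have "\<dots> = measure lebesgue (cbox 0 (1::real^'n)) * c" by simp
  finally show ?thesis by (simp only: measure_cell mult_1)
qed

lemma torus_integral_mono:
  "continuous_on UNIV f \<Longrightarrow> continuous_on UNIV g \<Longrightarrow> (\<And>y. f y \<le> g y) \<Longrightarrow> torus_integral f \<le> torus_integral g"
  unfolding torus_integral_lebesgue by (intro integral_mono torus_integrable) (auto simp: indicator_def)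

text \<open>The cell shifted in one coordinate consists of the part A that stays inside and the slab
  B that leaves. Translating B back by the i-th unit vector gives B', and A with B' fills the cell
  up to hyperplanes of measure zero.\<close>

lemma torus_integral_shift:
  fixes f :: "real ^ 'n \<Rightarrow> real"
  assumes f: "continuous_on UNIV f" "ZN_periodic f" and s: "0 \<le> s" "s \<le> 1"
  shows "torus_integral (\<lambda>y. f (y + s *\<^sub>R axis i 1)) = torus_integral f"
proof -
  have fm: "f \<in> borel_measurable borel" by (rule borel_measurable_continuous_onI[OF f(1)])
  define J where "J y \<longleftrightarrow> (\<forall>j. j \<noteq> i \<longrightarrow> 0 \<le> y $ j \<and> y $ j \<le> 1)" for y :: "real^'n"
  define A where "A = {y. J y \<and> s \<le> y $ i \<and> y $ i \<le> 1}"
  define B where "B = {y. J y \<and> 1 < y $ i \<and> y $ i \<le> 1 + s}"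
  define B' where "B' = {y. J y \<and> 0 < y $ i \<and> y $ i \<le> s}"
  have Jm: "Measurable.pred borel J" unfolding J_def by measurable
  have Am: "A \<in> sets borel" "B \<in> sets borel" "B' \<in> sets borel"
    unfolding A_def B_def B'_def using Jm by measurable
  define h where "h = s *\<^sub>R axis i (1::real)"
  have fh: "(\<lambda>y. f (y + h)) \<in> borel_measurable borel" by (rule measurable_compose[OF _ fm]) measurable
  have hj: "h $ j = (if j = i then s else 0)" for j by (simp add: h_def axis_def)
  have cell: "y \<in> cbox 0 1 \<longleftrightarrow> J y \<and> 0 \<le> y $ i \<and> y $ i \<le> 1" for y :: "real^'n"
    by (auto simp: mem_box_cart J_def)
  have Jh: "J (y - h) \<longleftrightarrow> J y" for y by (auto simp: J_def hj)
  have i1: "integrable lebesgue (\<lambda>y. indicator A y * f y)" "integrable lebesgue (\<lambda>y. indicator B y * f y)"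
    "integrable lebesgue (\<lambda>y. indicator B' y * f y)"
  proof -
    have I: "integrable lebesgue (\<lambda>y. indicator D y * f y)" if "D \<in> sets borel" "D \<subseteq> cbox 0 (1 + 1)" for D :: "(real^'n) set"
    proof -
      have "f absolutely_integrable_on cbox 0 (1 + 1)"
        by (rule absolutely_integrable_continuous) (rule continuous_on_subset[OF f(1)], simp)
      then have "f absolutely_integrable_on D"
        by (rule set_integrable_subset) (use that in auto)
      then show ?thesis by (simp add: set_integrable_def)
    qed
    have c2: "y \<in> cbox 0 (1 + 1)" if "J y" "0 \<le> y $ i" "y $ i \<le> 2" for y
      unfolding mem_box_cart
    proof
      fix j
      have "j \<noteq> i \<Longrightarrow> 0 \<le> y $ j \<and> y $ j \<le> 1" using that(1) by (simp add: J_def)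
      then show "0 $ j \<le> y $ j \<and> y $ j \<le> (1 + 1) $ j" using that(2,3) by (cases "j = i") auto
    qed
    have sub: "A \<subseteq> cbox 0 (1 + 1)" "B \<subseteq> cbox 0 (1 + 1)" "B' \<subseteq> cbox 0 (1 + 1)"
      using s c2 by (auto simp: A_def B_def B'_def)
    show "integrable lebesgue (\<lambda>y. indicator A y * f y)" "integrable lebesgue (\<lambda>y. indicator B y * f y)"
      "integrable lebesgue (\<lambda>y. indicator B' y * f y)" using I Am sub by auto
  qed
  have "torus_integral (\<lambda>y. f (y + h)) = (LINT y|lebesgue. indicator (cbox 0 1) y * f (y + h))"
    by (rule torus_integral_lebesgue)
  also have "\<dots> = (LINT y|lebesgue. indicator (cbox 0 1) (- h + 1 *\<^sub>R y) * f (- h + 1 *\<^sub>R y + h))"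
    using fh by (intro lebesgue_integral_affine[symmetric]) (auto intro!: borel_measurable_times borel_measurable_indicator)
  also have "\<dots> = (LINT y|lebesgue. indicator A y * f y + indicator B y * f y)"
  proof (rule Bochner_Integration.integral_cong)
    fix y :: "real^'n"
    have e: "- h + 1 *\<^sub>R y = y - h" "y - h + h = y" by simp_all
    have "y - h \<in> cbox 0 1 \<longleftrightarrow> J y \<and> s \<le> y $ i \<and> y $ i \<le> 1 + s"
      unfolding cell Jh by (auto simp: hj)
    then have "y - h \<in> cbox 0 1 \<longleftrightarrow> y \<in> A \<or> y \<in> B" using s unfolding A_def B_def by auto
    moreover have "\<not> (y \<in> A \<and> y \<in> B)" unfolding A_def B_def by auto
    ultimately show "indicator (cbox 0 1) (- h + 1 *\<^sub>R y) * f (- h + 1 *\<^sub>R y + h) = indicator A y * f y + indicator B y * f y"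
      unfolding e by (auto simp: indicator_def simp del: mem_box)
  qed simp
  also have "\<dots> = (LINT y|lebesgue. indicator A y * f y) + (LINT y|lebesgue. indicator B y * f y)"
    by (intro Bochner_Integration.integral_add i1)
  also have "(LINT y|lebesgue. indicator B y * f y) = (LINT y|lebesgue. indicator B (axis i 1 + 1 *\<^sub>R y) * f (axis i 1 + 1 *\<^sub>R y))"
    using fm Am by (intro lebesgue_integral_affine[symmetric]) (auto intro!: borel_measurable_times borel_measurable_indicator)
  also have "\<dots> = (LINT y|lebesgue. indicator B' y * f y)"
  proof (rule Bochner_Integration.integral_cong)
    fix y :: "real^'n"
    have "axis i 1 \<in> (lattice :: (real^'n) set)" by (auto simp: lattice_def axis_def)
    then have "f (axis i 1 + 1 *\<^sub>R y) = f y" using ZN_periodicD[OF f(2), of "axis i 1" y] by (simp add: add.commute)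
    moreover have "axis i 1 + y \<in> B \<longleftrightarrow> y \<in> B'" by (auto simp: B_def B'_def J_def axis_def)
    ultimately show "indicator B (axis i 1 + 1 *\<^sub>R y) * f (axis i 1 + 1 *\<^sub>R y) = indicator B' y * f y"
      by (simp add: indicator_def)
  qed simp
  also have "(LINT y|lebesgue. indicator A y * f y) + \<dots> = (LINT y|lebesgue. indicator A y * f y + indicator B' y * f y)"
    by (intro Bochner_Integration.integral_add[symmetric] i1)
  also have "\<dots> = (LINT y|lebesgue. indicator (cbox 0 1) y * f y)"
  proof (rule integral_cong_AE)
    show "(\<lambda>y. indicator A y * f y + indicator B' y * f y) \<in> borel_measurable lebesgue"
      using i1 by auto
    show "(\<lambda>y. indicator (cbox 0 1) y * f y) \<in> borel_measurable lebesgue"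
      using torus_integrable[OF f(1)] by auto
    have n: "negligible ({y. y $ i = 0} \<union> {y. y $ i = s})"
    proof (rule negligible_Un)
      have "negligible {y :: real^'n. y \<bullet> axis i 1 = c}" for c
        by (rule negligible_standard_hyperplane) (auto simp: Basis_vec_def)
      then show "negligible {y :: real^'n. y $ i = 0}" "negligible {y :: real^'n. y $ i = s}"
        by (simp_all add: inner_axis)
    qed
    show "AE y in lebesgue. indicator A y * f y + indicator B' y * f y = indicator (cbox 0 1) y * f y"
    proof (rule AE_I')
      show "{y. y $ i = 0} \<union> {y. y $ i = s} \<in> null_sets lebesgue" using n by (simp add: negligible_iff_null_sets)
      show "{y \<in> space lebesgue. indicator A y * f y + indicator B' y * f y \<noteq> indicator (cbox 0 1) y * f y}
         \<subseteq> {y. y $ i = 0} \<union> {y. y $ i = s}"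
        using s by (auto simp: A_def B'_def cell indicator_def split: if_splits)
    qed
  qed
  finally show ?thesis by (simp add: torus_integral_lebesgue h_def)
qed

text \<open>A shift by half a period, in a coordinate where k is nonzero, changes the sign of the
  mode and leaves the integral unchanged.\<close>

lemma torus_integral_trig:
  fixes k :: "real ^ 'n"
  assumes k: "k \<in> lattice" "k \<noteq> 0"
  shows "torus_integral (\<lambda>y. cos ((2 * pi) *\<^sub>R k \<bullet> y)) = 0" "torus_integral (\<lambda>y. sin ((2 * pi) *\<^sub>R k \<bullet> y)) = 0"
proof -
  obtain i where i: "k $ i \<noteq> 0" using k by (auto simp: vec_eq_iff)
  obtain n :: int where n: "k $ i = of_int n" using k by (auto simp: lattice_def elim: Ints_cases)
  \<comment> \<open>Half a period in direction i. A nonzero integer has modulus at least 1, so s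
    \<le> 1 as the shift lemma asks.\<close>
  define s where "s = 1 / (2 * \<bar>k $ i\<bar>)"
  have "1 \<le> \<bar>n\<bar>" using i n by auto
  then have "1 \<le> \<bar>k $ i\<bar>" unfolding n by linarith
  then have s: "0 \<le> s" "s \<le> 1" by (auto simp: s_def field_simps)
  have a: "(2 * pi) *\<^sub>R k \<bullet> (y + s *\<^sub>R axis i 1) = (2 * pi) *\<^sub>R k \<bullet> y + pi \<or>
      (2 * pi) *\<^sub>R k \<bullet> (y + s *\<^sub>R axis i 1) = (2 * pi) *\<^sub>R k \<bullet> y - pi" for y
  proof -
    have "(2 * pi) *\<^sub>R k \<bullet> (y + s *\<^sub>R axis i 1) = (2 * pi) *\<^sub>R k \<bullet> y + pi * (2 * s * k $ i)"
      by (simp add: inner_add_right inner_axis)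
    moreover have "2 * s * k $ i = 1 \<or> 2 * s * k $ i = -1" using i by (auto simp: s_def abs_if)
    ultimately show ?thesis by auto
  qed
  have c: "cos ((2 * pi) *\<^sub>R k \<bullet> (y + s *\<^sub>R axis i 1)) = -1 * cos ((2 * pi) *\<^sub>R k \<bullet> y)"
    "sin ((2 * pi) *\<^sub>R k \<bullet> (y + s *\<^sub>R axis i 1)) = -1 * sin ((2 * pi) *\<^sub>R k \<bullet> y)" for y
    using a[of y] by (auto simp del: inner_scaleR_left simp: sin_diff cos_diff)
  have cc: "continuous_on UNIV (\<lambda>y. cos ((2 * pi) *\<^sub>R k \<bullet> y))" "continuous_on UNIV (\<lambda>y. sin ((2 * pi) *\<^sub>R k \<bullet> y))"
    by (intro continuous_intros)+
  show "torus_integral (\<lambda>y. cos ((2 * pi) *\<^sub>R k \<bullet> y)) = 0"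
    using torus_integral_shift[OF cc(1) trig_periodic[OF trig_cos[OF k(1)]] s, of i] unfolding c torus_integral_cmult by simp
  show "torus_integral (\<lambda>y. sin ((2 * pi) *\<^sub>R k \<bullet> y)) = 0"
    using torus_integral_shift[OF cc(2) trig_periodic[OF trig_sin[OF k(1)]] s, of i] unfolding c torus_integral_cmult by simp
qed

section \<open>The fractional Laplacian of periodic functions\<close>

text \<open>The type token carries the dimension, on which the normalising constant and the kernel
  depend.\<close>

locale frac_setup =
  fixes \<sigma> :: real and dummy :: "'n::finite itself"
  assumes \<sigma>: "1 < \<sigma>" "\<sigma> < 2" and fc: "0 < frac_const TYPE('n) \<sigma>"
begin

abbreviation fk :: "real ^ 'n \<Rightarrow> real" where "fk \<equiv> frac_kernel \<sigma>"

sublocale levy_kernel fk by (rule levy_kernel_frac[OF \<sigma> fc])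

lemma fk_measurable: "fk \<in> borel_measurable borel"
  unfolding frac_kernel_def[abs_def] by measurable

lemma fk_uminus: "fk (- z) = fk z"
  by (simp add: frac_kernel_def)

lemma nice_measurable:
  assumes "nice \<psi> P L"
  shows "(\<lambda>w. \<psi> (y + w) - \<psi> y - P y \<bullet> w) \<in> borel_measurable borel"
proof -
  have c: "continuous_on UNIV \<psi>" using assms by (simp add: nice_def)
  show ?thesis
    by (intro borel_measurable_continuous_onI continuous_intros continuous_on_compose2[OF c, of UNIV "\<lambda>w. y + w"]) auto
qed

lemma nice_full_integrable:
  assumes "nice \<psi> P L"
  shows "integrable lebesgue (\<lambda>w. (\<psi> (y + w) - \<psi> y - P y \<bullet> w) * fk w)"
  by (rule integrable_le_wt[where C=L, OF lebesgue_measurable_borel[OF nice_measurable[OF assms]]])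
    (use assms in \<open>simp add: nice_def\<close>)

lemma frac_full_add:
  fixes \<psi> \<psi>' :: "real ^ 'n \<Rightarrow> real"
  assumes "nice \<psi> P L" "nice \<psi>' P' L'"
  shows "frac_full \<sigma> (\<lambda>y. \<psi> y + \<psi>' y) (\<lambda>y. P y + P' y) y = frac_full \<sigma> \<psi> P y + frac_full \<sigma> \<psi>' P' y"
proof -
  have "frac_full \<sigma> (\<lambda>y. \<psi> y + \<psi>' y) (\<lambda>y. P y + P' y) y =
     (LINT w|lebesgue. (\<psi> (y + w) - \<psi> y - P y \<bullet> w) * fk w + (\<psi>' (y + w) - \<psi>' y - P' y \<bullet> w) * fk w)"
    unfolding frac_full_def by (rule Bochner_Integration.integral_cong) (auto simp: inner_add_left algebra_simps)
  also have "\<dots> = frac_full \<sigma> \<psi> P y + frac_full \<sigma> \<psi>' P' y"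
    unfolding frac_full_def
    by (rule Bochner_Integration.integral_add[OF nice_full_integrable[OF assms(1)] nice_full_integrable[OF assms(2)]])
  finally show ?thesis .
qed

lemma frac_full_cmult:
  "frac_full \<sigma> (\<lambda>y. c * \<psi> y) (\<lambda>y. c *\<^sub>R P y) y = c * frac_full \<sigma> \<psi> P y"
  unfolding frac_full_def
  by (subst integral_mult_right_zero[symmetric]) (auto intro!: Bochner_Integration.integral_cong simp: algebra_simps)

text \<open>The two compensations differ by P y \<bullet> w times the kernel outside the unit ball,
  an odd function, whose integral is 0.\<close>

lemma frac_full_eq_lev:
  assumes n: "nice \<psi> P L"
  shows "lev_adm (P y) (\<lambda>w. \<psi> (y + w) - \<psi> y)" "frac_full \<sigma> \<psi> P y = lev fk (P y) (\<lambda>w. \<psi> (y + w) - \<psi> y)"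
proof -
  have m: "(\<lambda>w. \<psi> (y + w) - \<psi> y) \<in> borel_measurable lebesgue"
    and b: "\<And>w. \<bar>comp_incr (P y) (\<lambda>w. \<psi> (y + w) - \<psi> y) w\<bar> \<le> 2 * L * wt w"
    using nice_incr[OF n, of 1 y 0] by auto
  show adm: "lev_adm (P y) (\<lambda>w. \<psi> (y + w) - \<psi> y)" unfolding lev_adm_def using m b by blast
  define r where "r w = (1 - indicator (ball 0 1) w) * (P y \<bullet> w) * fk w" for w
  have re: "comp_incr (P y) (\<lambda>w. \<psi> (y + w) - \<psi> y) w * fk w - (\<psi> (y + w) - \<psi> y - P y \<bullet> w) * fk w = r w" for w
    by (simp add: comp_incr_def r_def algebra_simps)
  have "lev fk (P y) (\<lambda>w. \<psi> (y + w) - \<psi> y) - frac_full \<sigma> \<psi> P y = (LINT w|lebesgue. r w)"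
    unfolding lev_def frac_full_def re[symmetric] comp_incr_def
    using Bochner_Integration.integral_diff[OF lev_integrable[OF adm] nice_full_integrable[OF n], of y] by (simp add: comp_incr_def)
  also have "\<dots> = 0"
  proof (rule lebesgue_integral_odd)
    show "r \<in> borel_measurable borel"
      unfolding r_def[abs_def]
      by (intro borel_measurable_times borel_measurable_diff borel_measurable_indicator fk_measurable borel_measurable_const borel_measurable_inner measurable_ident) auto
    show "r (- z) = - r z" for z by (simp add: r_def fk_uminus indicator_def)
  qed
  finally show "frac_full \<sigma> \<psi> P y = lev fk (P y) (\<lambda>w. \<psi> (y + w) - \<psi> y)" by simp
qed

text \<open>The Fourier multiplier of the fractional Laplacian at frequency c. Its value
  |c|^\<sigma> is never computed, since dividing by it asks only that it be nonzero.\<close>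

definition symb :: "real ^ 'n \<Rightarrow> real" where
  "symb c = (LINT w|lebesgue. (1 - cos (c \<bullet> w)) * fk w)"

lemma cos_incr_integrable: "integrable lebesgue (\<lambda>w. (cos (c \<bullet> w) - 1) * fk w)"
proof -
  obtain L where n: "nice (\<lambda>y :: real ^ 'n. cos (c \<bullet> y)) (\<lambda>y. - sin (c \<bullet> y) *\<^sub>R c) L" using nice_cos by blast
  show ?thesis using nice_full_integrable[OF n, of 0] by simp
qed

lemma sin_incr_integrable: "integrable lebesgue (\<lambda>w. (sin (c \<bullet> w) - c \<bullet> w) * fk w)"
proof -
  obtain L where n: "nice (\<lambda>y :: real ^ 'n. sin (c \<bullet> y)) (\<lambda>y. cos (c \<bullet> y) *\<^sub>R c) L" using nice_sin by blast
  show ?thesis using nice_full_integrable[OF n, of 0] by simp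
qed

lemma sin_incr_zero: "(LINT w|lebesgue. (sin (c \<bullet> w) - c \<bullet> w) * fk w) = 0"
proof (rule lebesgue_integral_odd)
  show "(\<lambda>w. (sin (c \<bullet> w) - c \<bullet> w) * fk w) \<in> borel_measurable borel"
    by (intro borel_measurable_times borel_measurable_diff fk_measurable borel_measurable_continuous_onI continuous_intros)
qed (simp add: fk_uminus algebra_simps)

text \<open>By the addition theorem the increment splits into an even part, which produces the
  symbol, and the odd part sin(c \<bullet> w) - c \<bullet> w, which integrates to 0.\<close>

lemma frac_full_cos: "frac_full \<sigma> (\<lambda>y. cos (c \<bullet> y)) (\<lambda>y. - sin (c \<bullet> y) *\<^sub>R c) y = - symb c * cos (c \<bullet> y)"
proof -
  have "frac_full \<sigma> (\<lambda>y. cos (c \<bullet> y)) (\<lambda>y. - sin (c \<bullet> y) *\<^sub>R c) y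
    = (LINT w|lebesgue. cos (c \<bullet> y) * ((cos (c \<bullet> w) - 1) * fk w) - sin (c \<bullet> y) * ((sin (c \<bullet> w) - c \<bullet> w) * fk w))"
    unfolding frac_full_def by (rule Bochner_Integration.integral_cong) (auto simp: inner_add_right cos_add algebra_simps)
  also have "\<dots> = cos (c \<bullet> y) * (LINT w|lebesgue. (cos (c \<bullet> w) - 1) * fk w)"
    by (simp add: Bochner_Integration.integral_diff integrable_mult_right cos_incr_integrable sin_incr_integrable sin_incr_zero)
  also have "(LINT w|lebesgue. (cos (c \<bullet> w) - 1) * fk w) = - symb c"
    unfolding symb_def Bochner_Integration.integral_minus[symmetric] by (rule Bochner_Integration.integral_cong) (auto simp: algebra_simps)
  finally show ?thesis by simp
qed

lemma frac_full_sin: "frac_full \<sigma> (\<lambda>y. sin (c \<bullet> y)) (\<lambda>y. cos (c \<bullet> y) *\<^sub>R c) y = - symb c * sin (c \<bullet> y)"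
proof -
  have "frac_full \<sigma> (\<lambda>y. sin (c \<bullet> y)) (\<lambda>y. cos (c \<bullet> y) *\<^sub>R c) y
    = (LINT w|lebesgue. sin (c \<bullet> y) * ((cos (c \<bullet> w) - 1) * fk w) + cos (c \<bullet> y) * ((sin (c \<bullet> w) - c \<bullet> w) * fk w))"
    unfolding frac_full_def by (rule Bochner_Integration.integral_cong) (auto simp: inner_add_right sin_add algebra_simps)
  also have "\<dots> = sin (c \<bullet> y) * (LINT w|lebesgue. (cos (c \<bullet> w) - 1) * fk w)"
    by (simp add: Bochner_Integration.integral_add integrable_mult_right cos_incr_integrable sin_incr_integrable sin_incr_zero)
  also have "(LINT w|lebesgue. (cos (c \<bullet> w) - 1) * fk w) = - symb c"
    unfolding symb_def Bochner_Integration.integral_minus[symmetric] by (rule Bochner_Integration.integral_cong) (auto simp: algebra_simps)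
  finally show ?thesis by simp
qed

lemma fk_pos: "z \<noteq> 0 \<Longrightarrow> 0 < fk z"
  using fc by (simp add: frac_kernel_def)

text \<open>The integrand is nonnegative, so a vanishing integral makes it zero almost everywhere;
  but it is positive on the nonempty open slab 0 < c \<bullet> w < pi, which is not
  negligible.\<close>

lemma symb_nonzero:
  assumes c: "c \<noteq> 0"
  shows "symb c \<noteq> 0"
proof
  assume s: "symb c = 0"
  have i: "integrable lebesgue (\<lambda>w. (1 - cos (c \<bullet> w)) * fk w)"
    using Bochner_Integration.integrable_minus[OF cos_incr_integrable[of c]] by (simp add: algebra_simps)
  have "AE w in lebesgue. (1 - cos (c \<bullet> w)) * fk w = 0"
    using s integral_nonneg_eq_0_iff_AE[OF i] unfolding symb_def by simp
  then obtain N where N: "{w \<in> space lebesgue. \<not> (1 - cos (c \<bullet> w)) * fk w = 0} \<subseteq> N" "emeasure lebesgue N = 0" "N \<in> sets lebesgue"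
    by (rule AE_E)
  then have "N \<in> null_sets lebesgue" by (simp add: null_sets_def)
  then have "negligible N" by (simp add: negligible_iff_null_sets)
  then have "negligible {w. (1 - cos (c \<bullet> w)) * fk w \<noteq> 0}" by (rule negligible_subset) (use N(1) in auto)
  moreover have "{w. 0 < c \<bullet> w \<and> c \<bullet> w < pi} \<subseteq> {w. (1 - cos (c \<bullet> w)) * fk w \<noteq> 0}"
  proof
    fix w assume "w \<in> {w. 0 < c \<bullet> w \<and> c \<bullet> w < pi}"
    then have w: "0 < c \<bullet> w" "c \<bullet> w < pi" by auto
    then have "w \<noteq> 0" by auto
    moreover have "cos (c \<bullet> w) < cos 0" using w by (intro cos_monotone_0_pi) auto
    ultimately show "w \<in> {w. (1 - cos (c \<bullet> w)) * fk w \<noteq> 0}" using fk_pos[of w] by simp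
  qed
  ultimately have "negligible {w. 0 < c \<bullet> w \<and> c \<bullet> w < pi}" by (rule negligible_subset)
  moreover have "open {w. 0 < c \<bullet> w \<and> c \<bullet> w < pi}"
    by (intro open_Collect_conj open_Collect_less continuous_intros)
  moreover have "(1 / (c \<bullet> c)) *\<^sub>R c \<in> {w. 0 < c \<bullet> w \<and> c \<bullet> w < pi}" using c pi_gt3 by simp
  then have "{w. 0 < c \<bullet> w \<and> c \<bullet> w < pi} \<noteq> {}" by blast
  ultimately show False using open_not_negligible by blast
qed

lemma trig_nice:
  fixes f :: "real ^ 'n \<Rightarrow> real"
  assumes "trig_poly f" shows "\<exists>P L. nice f P L"
  using assms
proof induction
  case (trig_cos k) show ?case using nice_cos by blast
next
  case (trig_sin k) show ?case using nice_sin by blast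
next
  case (trig_add f g)
  then obtain P L P' L' where "nice f P L" "nice g P' L'" by blast
  from nice_add[OF this] show ?case by blast
next
  case (trig_scale f c)
  then obtain P L where "nice f P L" by blast
  from nice_cmult[OF this] show ?case by blast
qed

lemma trig_continuous:
  fixes f :: "real ^ 'n \<Rightarrow> real"
  assumes "trig_poly f" shows "continuous_on UNIV f"
  using trig_nice[OF assms] by (auto simp: nice_def)

text \<open>Modes with k \<noteq> 0 have mean zero and are eigenfunctions with nonzero eigenvalue.
  The mode k = 0 is a constant, removed by subtracting the mean, and is solved by 0.\<close>

lemma trig_solve:
  fixes f :: "real ^ 'n \<Rightarrow> real"
  assumes "trig_poly f"
  shows "\<exists>\<psi> P L. trig_poly \<psi> \<and> nice \<psi> P L \<and> torus_integral \<psi> = 0 \<and> (\<forall>y. frac_full \<sigma> \<psi> P y = f y - torus_integral f)"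
  using assms
proof induction
  case (trig_cos k)
  show ?case
  proof (cases "k = 0")
    case True
    have "frac_full \<sigma> (\<lambda>_. 0) (\<lambda>_. 0) y = 0" for y :: "real^'n" by (simp add: frac_full_def)
    then show ?thesis using True trig_const[of 0] nice_const[of 0]
      by (intro exI[of _ "\<lambda>_. 0"] exI[of _ 0]) (simp add: torus_integral_const)
  next
    case False
    define c where "c = (2 * pi) *\<^sub>R k"
    have s: "symb c \<noteq> 0" using False by (intro symb_nonzero) (simp add: c_def)
    obtain L where n: "nice (\<lambda>y :: real ^ 'n. cos (c \<bullet> y)) (\<lambda>y. - sin (c \<bullet> y) *\<^sub>R c) L" using nice_cos by blast
    note T = torus_integral_trig(1)[OF trig_cos False, folded c_def]
    have "frac_full \<sigma> (\<lambda>y. (- 1 / symb c) * cos (c \<bullet> y)) (\<lambda>y. (- 1 / symb c) *\<^sub>R (- sin (c \<bullet> y) *\<^sub>R c)) y = cos (c \<bullet> y) - torus_integral (\<lambda>y. cos (c \<bullet> y))" for y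
      unfolding frac_full_cmult frac_full_cos T using s by simp
    moreover have "trig_poly (\<lambda>y. (- 1 / symb c) * cos (c \<bullet> y))"
      unfolding c_def by (intro trig_poly.trig_scale trig_poly.trig_cos trig_cos)
    moreover have "torus_integral (\<lambda>y. (- 1 / symb c) * cos (c \<bullet> y)) = 0" unfolding torus_integral_cmult T by simp
    ultimately show ?thesis using nice_cmult[OF n, of "- 1 / symb c"] unfolding c_def[symmetric] by blast
  qed
next
  case (trig_sin k)
  show ?case
  proof (cases "k = 0")
    case True
    have "frac_full \<sigma> (\<lambda>_. 0) (\<lambda>_. 0) y = 0" for y :: "real^'n" by (simp add: frac_full_def)
    then show ?thesis using True trig_const[of 0] nice_const[of 0]
      by (intro exI[of _ "\<lambda>_. 0"] exI[of _ 0]) (simp add: torus_integral_const)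
  next
    case False
    define c where "c = (2 * pi) *\<^sub>R k"
    have s: "symb c \<noteq> 0" using False by (intro symb_nonzero) (simp add: c_def)
    obtain L where n: "nice (\<lambda>y :: real ^ 'n. sin (c \<bullet> y)) (\<lambda>y. cos (c \<bullet> y) *\<^sub>R c) L" using nice_sin by blast
    note T = torus_integral_trig(2)[OF trig_sin False, folded c_def]
    have "frac_full \<sigma> (\<lambda>y. (- 1 / symb c) * sin (c \<bullet> y)) (\<lambda>y. (- 1 / symb c) *\<^sub>R (cos (c \<bullet> y) *\<^sub>R c)) y = sin (c \<bullet> y) - torus_integral (\<lambda>y. sin (c \<bullet> y))" for y
      unfolding frac_full_cmult frac_full_sin T using s by simp
    moreover have "trig_poly (\<lambda>y. (- 1 / symb c) * sin (c \<bullet> y))"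
      unfolding c_def by (intro trig_poly.trig_scale trig_poly.trig_sin trig_sin)
    moreover have "torus_integral (\<lambda>y. (- 1 / symb c) * sin (c \<bullet> y)) = 0" unfolding torus_integral_cmult T by simp
    ultimately show ?thesis using nice_cmult[OF n, of "- 1 / symb c"] unfolding c_def[symmetric] by blast
  qed
next
  case (trig_add f g)
  obtain \<psi> P L where 1: "trig_poly \<psi>" "nice \<psi> P L" "torus_integral \<psi> = 0" "\<And>y. frac_full \<sigma> \<psi> P y = f y - torus_integral f"
    using trig_add.IH(1) by blast
  obtain \<psi>' P' L' where 2: "trig_poly \<psi>'" "nice \<psi>' P' L'" "torus_integral \<psi>' = 0" "\<And>y. frac_full \<sigma> \<psi>' P' y = g y - torus_integral g"
    using trig_add.IH(2) by blast
  have "frac_full \<sigma> (\<lambda>y. \<psi> y + \<psi>' y) (\<lambda>y. P y + P' y) y = f y + g y - torus_integral (\<lambda>y. f y + g y)" for y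
    unfolding frac_full_add[OF 1(2) 2(2)] 1(4) 2(4)
      torus_integral_add[OF trig_continuous[OF trig_add.hyps(1)] trig_continuous[OF trig_add.hyps(2)]] by simp
  moreover have "torus_integral (\<lambda>y. \<psi> y + \<psi>' y) = 0"
    using torus_integral_add[OF trig_continuous[OF 1(1)] trig_continuous[OF 2(1)]] 1 2 by simp
  ultimately show ?case using nice_add[OF 1(2) 2(2)] trig_poly.trig_add[OF 1(1) 2(1)] by blast
next
  case (trig_scale f c)
  obtain \<psi> P L where 1: "trig_poly \<psi>" "nice \<psi> P L" "torus_integral \<psi> = 0" "\<And>y. frac_full \<sigma> \<psi> P y = f y - torus_integral f"
    using trig_scale.IH by blast
  have "frac_full \<sigma> (\<lambda>y. c * \<psi> y) (\<lambda>y. c *\<^sub>R P y) y = c * f y - torus_integral (\<lambda>y. c * f y)" for y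
    unfolding frac_full_cmult 1(4) torus_integral_cmult by (simp add: right_diff_distrib)
  moreover have "torus_integral (\<lambda>y. c * \<psi> y) = 0" using 1 by (simp add: torus_integral_cmult)
  ultimately show ?case using nice_cmult[OF 1(2)] trig_poly.trig_scale[OF 1(1)] by blast
qed

lemma periodic_attains_sup:
  fixes f :: "real ^ 'n \<Rightarrow> real"
  assumes "continuous_on UNIV f" "ZN_periodic f"
  shows "\<exists>y0\<in>cbox 0 1. \<forall>y. f y \<le> f y0"
proof -
  have "cbox 0 (1::real^'n) \<noteq> {}" using exists_in_cell by blast
  then obtain y0 where y0: "y0 \<in> cbox 0 1" "\<And>y. y \<in> cbox 0 1 \<Longrightarrow> f y \<le> f y0"
    using continuous_attains_sup[OF compact_cbox _ continuous_on_subset[OF assms(1) subset_UNIV]] by blast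
  have "f y \<le> f y0" for y
  proof -
    obtain y' k where "y' \<in> cbox 0 1" "k \<in> lattice" "y = y' + k" using exists_in_cell[of y] by blast
    then show ?thesis using y0(2) ZN_periodicD[OF assms(2)] by simp
  qed
  then show ?thesis using y0(1) by blast
qed

text \<open>At a maximum point the kernel is bounded below on a translate of the cell, which controls the
  distance of the maximum from the mean.\<close>

lemma periodic_sup_bound:
  "\<exists>c0>0. \<forall>(\<psi> :: real ^ 'n \<Rightarrow> real) P L B. nice \<psi> P L \<and> ZN_periodic \<psi> \<and> torus_integral \<psi> = 0 \<and>
     (\<forall>y. - B \<le> frac_full \<sigma> \<psi> P y) \<longrightarrow> (\<forall>y. c0 * \<psi> y \<le> B)"
proof -
  \<comment> \<open>The value of the kernel at distance N: two points of the unit cell differ by at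
    most 1 in each coordinate, hence by at most N in norm.\<close>
  define c0 where "c0 = frac_const TYPE('n) \<sigma> / real CARD('n) powr (real CARD('n) + \<sigma>)"
  have c0: "0 < c0" using fc by (simp add: c0_def)
  have "c0 * \<psi> y \<le> B"
    if n: "nice \<psi> P L" and per: "ZN_periodic \<psi>" and mz: "torus_integral \<psi> = 0" and B: "\<And>y. - B \<le> frac_full \<sigma> \<psi> P y"
    for \<psi> :: "real ^ 'n \<Rightarrow> real" and P L B y
  proof -
    have cont: "continuous_on UNIV \<psi>" using n by (simp add: nice_def)
    obtain y0 where y0: "y0 \<in> cbox 0 1" "\<And>y. \<psi> y \<le> \<psi> y0"
      using periodic_attains_sup[OF cont per] by blast
    have G: "(\<psi> has_derivative (\<lambda>h. h \<bullet> P y0)) (at y0)" using n unfolding nice_def gderiv_def by blast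
    \<comment> \<open>The gradient vanishes at the maximum, which removes the compensator and leaves
      a nonpositive integrand.\<close>
    have "(\<lambda>h. h \<bullet> P y0) = (\<lambda>h. 0)"
      by (rule differential_zero_maxmin[OF _ open_UNIV G]) (use y0 in auto)
    then have "P y0 \<bullet> P y0 = 0" by meson
    then have P0: "P y0 = 0" by simp
    define I where "I w = indicator (cbox 0 1) (y0 + w) * (\<psi> (y0 + w) - \<psi> y0)" for w
    have Im: "(\<lambda>v. indicator (cbox 0 1) v * (\<psi> v - \<psi> y0)) \<in> borel_measurable borel"
      by (intro borel_measurable_times borel_measurable_indicator borel_measurable_continuous_onI continuous_intros cont) auto
    have fkI: "c0 \<le> fk w" if "w \<noteq> 0" "y0 + w \<in> cbox 0 1" for w
    proof -
      have "\<bar>w $ i\<bar> \<le> 1" for i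
      proof -
        have "0 $ i \<le> y0 $ i \<and> y0 $ i \<le> 1 $ i" "0 $ i \<le> (y0 + w) $ i \<and> (y0 + w) $ i \<le> 1 $ i"
          using y0(1) that(2) unfolding mem_box_cart by blast+
        then show ?thesis by (auto simp: abs_le_iff)
      qed
      then have "(\<Sum>i\<in>UNIV. \<bar>w $ i\<bar>) \<le> (\<Sum>i\<in>(UNIV::'n set). 1)" by (intro sum_mono) auto
      then have "norm w \<le> real CARD('n)" using norm_le_l1_cart[of w] by simp
      then have "norm w powr (real CARD('n) + \<sigma>) \<le> real CARD('n) powr (real CARD('n) + \<sigma>)"
        using \<sigma> by (intro powr_mono2) auto
      then show ?thesis unfolding c0_def frac_kernel_def using fc that(1) by (intro divide_left_mono) auto
    qed
    have "- B \<le> frac_full \<sigma> \<psi> P y0" by (rule B)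
    also have "\<dots> = (LINT w|lebesgue. (\<psi> (y0 + w) - \<psi> y0) * fk w)" unfolding frac_full_def P0 by simp
    also have "\<dots> \<le> (LINT w|lebesgue. c0 * I w)"
    proof (rule integral_mono)
      show "integrable lebesgue (\<lambda>w. (\<psi> (y0 + w) - \<psi> y0) * fk w)"
        using nice_full_integrable[OF n, of y0] by (simp add: P0)
      have "continuous_on (cbox (- y0) (1 - y0)) (\<lambda>w. \<psi> (y0 + w) - \<psi> y0)"
        by (intro continuous_intros continuous_on_compose2[OF cont, of _ "\<lambda>w. y0 + w"]) auto
      then have "(\<lambda>w. \<psi> (y0 + w) - \<psi> y0) absolutely_integrable_on cbox (- y0) (1 - y0)"
        by (rule absolutely_integrable_continuous)
      moreover have "y0 + w \<in> cbox 0 1 \<longleftrightarrow> w \<in> cbox (- y0) (1 - y0)" for w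
        unfolding mem_box_cart by (intro arg_cong[where f=All] ext) (auto simp: algebra_simps)
      then have "I = (\<lambda>w. indicator (cbox (- y0) (1 - y0)) w * (\<psi> (y0 + w) - \<psi> y0))"
        by (simp add: I_def[abs_def] indicator_def)
      ultimately have "integrable lebesgue I" by (simp add: set_integrable_def)
      then show "integrable lebesgue (\<lambda>w. c0 * I w)" by (rule integrable_mult_right)
      fix w
      have le: "\<psi> (y0 + w) - \<psi> y0 \<le> 0" using y0(2) by simp
      \<comment> \<open>Outside the cell the nonpositive integrand is replaced by 0; inside,
        lowering the kernel to c0 increases the product.\<close>
      show "(\<psi> (y0 + w) - \<psi> y0) * fk w \<le> c0 * I w"
      proof (cases "w \<noteq> 0 \<and> y0 + w \<in> cbox 0 1")
        case True
        then show ?thesis using mult_left_mono_neg[OF fkI le] by (simp add: I_def mult.commute)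
      next
        case False
        then have "c0 * I w = 0" by (cases "w = 0") (simp_all add: I_def)
        then show ?thesis using le K_nonneg[of w] by (simp only:) (rule mult_nonpos_nonneg)
      qed
    qed
    also have "\<dots> = c0 * (LINT w|lebesgue. indicator (cbox 0 1) (y0 + 1 *\<^sub>R w) * (\<psi> (y0 + 1 *\<^sub>R w) - \<psi> y0))" by (simp add: I_def)
    also have "(LINT w|lebesgue. indicator (cbox 0 1) (y0 + 1 *\<^sub>R w) * (\<psi> (y0 + 1 *\<^sub>R w) - \<psi> y0))
        = (LINT v|lebesgue. indicator (cbox 0 1) v * (\<psi> v - \<psi> y0))"
      by (rule lebesgue_integral_affine[OF Im]) simp
    also have "\<dots> = torus_integral (\<lambda>v. \<psi> v + - \<psi> y0)" by (simp add: torus_integral_lebesgue)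
    also have "\<dots> = - \<psi> y0" by (subst torus_integral_add) (auto intro: cont simp: mz torus_integral_const)
    finally have "c0 * \<psi> y0 \<le> B" by simp
    then show ?thesis using mult_left_mono[OF y0(2)[of y], of c0] c0 by linarith
  qed
  then show ?thesis using c0 by blast
qed

end

text \<open>A function of x alone is read as a time-independent test function on \<open>QT 1\<close>
  and evaluated at t = 1.\<close>

lemma C2_stationary:
  fixes \<phi> :: "real ^ 'n \<Rightarrow> real"
  assumes "C2_on UNIV \<phi>"
  shows "\<exists>P. continuous_on UNIV \<phi> \<and> continuous_on UNIV P \<and> (\<forall>x. GDERIV \<phi> x :> P x) \<and>
    (\<forall>C. compact C \<longrightarrow> (\<exists>B\<ge>0. \<forall>x\<in>C. \<forall>z. norm z \<le> 1 \<longrightarrow> \<bar>\<phi> (x + z) - \<phi> x - P x \<bullet> z\<bar> \<le> B * (norm z)\<^sup>2))"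
proof -
  obtain P Q where PQ: "test_fn 1 (\<lambda>q :: (real^'n) \<times> real. \<phi> (fst q)) P Q"
    using C2_test_fn[OF C2_on_fst[OF assms]] by blast
  have 1: "(1::real) \<in> {0<..1}" by simp
  have cP: "continuous_on (QT 1) P" using PQ unfolding test_fn_def by blast
  show ?thesis
  proof (intro exI[of _ "\<lambda>x. P (x, 1)"] conjI allI impI)
    show "continuous_on UNIV \<phi>" using test_fn_slice(2)[OF PQ 1] by simp
    show "continuous_on UNIV (\<lambda>x. P (x, 1))"
      by (rule continuous_on_compose2[OF cP]) (auto simp: QT_def intro!: continuous_intros)
    show "GDERIV \<phi> x :> P (x, 1)" for x using test_fn_slice(1)[OF PQ 1] by simp
    fix C :: "(real^'n) set" assume C: "compact C"
    have "compact (C \<times> {1::real})" using C by (intro compact_Times) auto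
    moreover have "C \<times> {1::real} \<subseteq> QT 1" by (auto simp: QT_def)
    ultimately obtain B where "B \<ge> 0" "\<forall>(x, t)\<in>C \<times> {1::real}. \<forall>z. norm z \<le> 1 \<longrightarrow> \<bar>\<phi> (fst (x + z, t)) - \<phi> (fst (x, t)) - P (x, t) \<bullet> z\<bar> \<le> B * (norm z)\<^sup>2"
      using test_fn_taylor[OF PQ] by blast
    then show "\<exists>B\<ge>0. \<forall>x\<in>C. \<forall>z. norm z \<le> 1 \<longrightarrow> \<bar>\<phi> (x + z) - \<phi> x - P (x, 1) \<bullet> z\<bar> \<le> B * (norm z)\<^sup>2"
      by (intro exI[of _ B]) auto
  qed
qed

lemma nonlocal_inner_uminus:
  assumes "C2_on UNIV \<phi>"
  shows "grad (\<lambda>z. - \<phi> z) y = - grad \<phi> y" "nonlocal_inner K \<delta> (\<lambda>z. - \<phi> z) y = - nonlocal_inner K \<delta> \<phi> y"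
proof -
  obtain P where "\<forall>x. GDERIV \<phi> x :> P x" using C2_stationary[OF assms] by blast
  then have "GDERIV \<phi> y :> P y" by blast
  then show g: "grad (\<lambda>z. - \<phi> z) y = - grad \<phi> y"
    using grad_eqI[OF GDERIV_minus] grad_eqI by metis
  show "nonlocal_inner K \<delta> (\<lambda>z. - \<phi> z) y = - nonlocal_inner K \<delta> \<phi> y"
    unfolding nonlocal_inner_def g set_lebesgue_integral_def Bochner_Integration.integral_minus[symmetric]
    by (rule Bochner_Integration.integral_cong) (auto simp: algebra_simps)
qed

lemma nonlocal_outer_uminus: "nonlocal_outer K \<delta> (\<lambda>z. - u z) (- p) y = - nonlocal_outer K \<delta> u p y"
  unfolding nonlocal_outer_def set_lebesgue_integral_def Bochner_Integration.integral_minus[symmetric]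
  by (rule Bochner_Integration.integral_cong) (auto simp: algebra_simps)

lemma glue_ge:
  assumes "\<And>z. norm z < \<delta> \<Longrightarrow> g z \<le> f z"
  shows "comp_incr p g z \<le> comp_incr p (glue \<delta> f g) z"
  using assms[of z] by (simp add: comp_incr_def glue_def)

section \<open>Viscosity inequalities for the periodic fractional Poisson equation\<close>

context frac_setup
begin

text \<open>Viscosity form of g \<le> - (-\<Delta>)^(\<sigma>/2) \<psi>. The cell equation divided
  by a has this shape, and its supersolution half is the same condition for - \<psi> and -
  g.\<close>

definition stat_sub :: "(real ^ 'n \<Rightarrow> real) \<Rightarrow> (real ^ 'n \<Rightarrow> real) \<Rightarrow> bool" where
  "stat_sub \<psi> g \<longleftrightarrow> (\<forall>y \<phi> \<delta>. C2_on UNIV \<phi> \<and> 0 < \<delta> \<and> \<delta> < 1 \<and> (\<forall>z\<in>ball y \<delta>. \<psi> z - \<phi> z \<le> \<psi> y - \<phi> y) \<longrightarrow>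
     g y \<le> nonlocal_inner fk \<delta> \<phi> y + nonlocal_outer fk \<delta> \<psi> (grad \<phi> y) y)"

lemma section_measurable:
  fixes u :: "real ^ 'n \<Rightarrow> real"
  assumes "continuous_on UNIV u" shows "(\<lambda>z. u (y + z)) \<in> borel_measurable lebesgue"
  by (intro lebesgue_measurable_borel borel_measurable_continuous_onI continuous_on_compose2[OF assms, of UNIV "\<lambda>z. y + z"])
    (auto intro!: continuous_intros)

text \<open>By periodicity \<psi> - \<eta> has a global maximum; there \<eta> is an admissible test
  function and its increments dominate those of \<psi> everywhere.\<close>

lemma stat_sub_touch:
  assumes s: "stat_sub \<psi> g" and \<psi>: "continuous_on UNIV \<psi>" "ZN_periodic \<psi>" "\<And>y. \<bar>\<psi> y\<bar> \<le> M"
    and n: "nice \<eta> P L" and \<eta>: "ZN_periodic \<eta>"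
  shows "\<exists>y. g y \<le> frac_full \<sigma> \<eta> P y"
proof -
  have cc: "continuous_on UNIV \<eta>" "C2_on UNIV \<eta>" using n by (auto simp: nice_def)
  have "continuous_on UNIV (\<lambda>y. \<psi> y - \<eta> y)" by (intro continuous_intros \<psi> cc)
  moreover have "ZN_periodic (\<lambda>y. \<psi> y - \<eta> y)" using \<psi>(2) \<eta> by (simp add: ZN_periodic_def)
  ultimately obtain y where y: "\<And>z. \<psi> z - \<eta> z \<le> \<psi> y - \<eta> y"
    using periodic_attains_sup[of "\<lambda>y. \<psi> y - \<eta> y"] by blast
  have G: "GDERIV \<eta> y :> P y" using n by (simp add: nice_def)
  obtain P' where P': "\<forall>x. GDERIV \<eta> x :> P' x" "\<forall>C. compact C \<longrightarrow> (\<exists>B\<ge>0. \<forall>x\<in>C. \<forall>z. norm z \<le> 1 \<longrightarrow> \<bar>\<eta> (x + z) - \<eta> x - P' x \<bullet> z\<bar> \<le> B * (norm z)\<^sup>2)"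
    using C2_stationary[OF cc(2)] by blast
  have "P' y = P y" using P'(1) G GDERIV_unique by blast
  then obtain B where B: "0 \<le> B" "\<And>z. norm z \<le> 1 \<Longrightarrow> \<bar>\<eta> (y + z) - \<eta> y - P y \<bullet> z\<bar> \<le> B * (norm z)\<^sup>2"
    using P'(2)[rule_format, of "{y}"] by auto
  define h where "h = glue (1/2) (\<lambda>z. \<eta> (y + z) - \<eta> y) (\<lambda>z. \<psi> (y + z) - \<psi> y)"
  have half: "0 < (1/2::real)" "(1/2::real) < 1" by auto
  note ne = nonlocal_eq[where u=\<psi> and M=M, OF levy_kernel_axioms half G cc(1) B section_measurable[OF \<psi>(1)] \<psi>(3)]
  have "g y \<le> nonlocal_inner fk (1/2) \<eta> y + nonlocal_outer fk (1/2) \<psi> (grad \<eta> y) y"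
    using s cc(2) half y unfolding stat_sub_def by blast
  also have "\<dots> = lev fk (P y) h" unfolding grad_eqI[OF G] h_def by (rule ne(2))
  also have "\<dots> \<le> lev fk (P y) (\<lambda>z. \<eta> (y + z) - \<eta> y)"
    unfolding h_def
  proof (rule lev_mono[OF ne(1) frac_full_eq_lev(1)[OF n]])
    fix z show "comp_incr (P y) (glue (1/2) (\<lambda>z. \<eta> (y + z) - \<eta> y) (\<lambda>z. \<psi> (y + z) - \<psi> y)) z \<le> comp_incr (P y) (\<lambda>z. \<eta> (y + z) - \<eta> y) z"
    proof (rule glue_le)
      fix z show "\<psi> (y + z) - \<psi> y \<le> \<eta> (y + z) - \<eta> y" using y[of "y + z"] by linarith
    qed
  qed
  also have "\<dots> = frac_full \<sigma> \<eta> P y" by (rule frac_full_eq_lev(2)[OF n, symmetric])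
  finally show ?thesis by blast
qed

text \<open>In place of integrating the viscosity inequality, \<eta> is chosen to solve the equation
  with right-hand side f minus its mean, for a trigonometric polynomial f close to g. Touching gives
  g(y) \<le> f(y) minus the mean of f at one point y, so the mean of f is at most the distance of f
  from g.\<close>

lemma stat_sub_mean:
  assumes s: "stat_sub \<psi> g" and \<psi>: "continuous_on UNIV \<psi>" "ZN_periodic \<psi>" "\<And>y. \<bar>\<psi> y\<bar> \<le> M"
    and g: "continuous_on UNIV g" "ZN_periodic g"
  shows "torus_integral g \<le> 0"
proof (rule field_le_epsilon)
  fix e :: real assume e: "0 < e"
  then have "0 < e / 2" by simp
  from trig_dense[OF g this] obtain f where f: "trig_poly f" "\<And>y. \<bar>f y - g y\<bar> < e / 2" by blast
  obtain \<eta> P L where \<eta>: "trig_poly \<eta>" "nice \<eta> P L" "\<And>y. frac_full \<sigma> \<eta> P y = f y - torus_integral f"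
    using trig_solve[OF f(1)] by blast
  obtain y where "g y \<le> frac_full \<sigma> \<eta> P y"
    using stat_sub_touch[OF s \<psi> \<eta>(2) trig_periodic[OF \<eta>(1)]] by blast
  then have 1: "torus_integral f \<le> e / 2" using f(2)[of y] unfolding \<eta>(3) by linarith
  have "torus_integral g \<le> torus_integral (\<lambda>y. f y + e / 2)"
  proof (rule torus_integral_mono[OF g(1)])
    show "continuous_on UNIV (\<lambda>y. f y + e / 2)" by (intro continuous_intros trig_continuous f)
    show "g y \<le> f y + e / 2" for y using f(2)[of y] by linarith
  qed
  also have "\<dots> = torus_integral f + e / 2"
    by (subst torus_integral_add[OF trig_continuous[OF f(1)]]) (auto simp: torus_integral_const)
  finally show "torus_integral g \<le> 0 + e" using 1 by simp
qed

text \<open>Stability under uniform limits. The approximants satisfy the inequality classically, and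
  at an interior maximum of \<Psi> n - \<phi>' the gradients agree, so the classical integral is
  below the one glued with the test function.\<close>

lemma stat_sub_limit:
  fixes \<Psi> :: "nat \<Rightarrow> real ^ 'n \<Rightarrow> real"
  assumes n: "\<And>n. nice (\<Psi> n) (Pn n) (Lc n)" and g: "continuous_on UNIV g"
    and M: "\<And>n y. \<bar>\<Psi> n y\<bar> \<le> M" "\<And>y. \<bar>\<psi> y\<bar> \<le> M" and \<psi>: "continuous_on UNIV \<psi>"
    and unif: "\<And>d. 0 < d \<Longrightarrow> \<forall>\<^sub>F n in sequentially. \<forall>y. \<bar>\<Psi> n y - \<psi> y\<bar> < d"
    and eq: "\<And>d. 0 < d \<Longrightarrow> \<forall>\<^sub>F n in sequentially. \<forall>y. g y - d \<le> frac_full \<sigma> (\<Psi> n) (Pn n) y"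
  shows "stat_sub \<psi> g"
  unfolding stat_sub_def
proof (intro allI impI)
  fix y \<phi> \<delta>
  assume as: "C2_on UNIV \<phi> \<and> 0 < \<delta> \<and> \<delta> < 1 \<and> (\<forall>z\<in>ball y \<delta>. \<psi> z - \<phi> z \<le> \<psi> y - \<phi> y)"
  then have C2: "C2_on UNIV \<phi>" and \<delta>: "0 < \<delta>" "\<delta> < 1" and mx: "\<And>z. z \<in> ball y \<delta> \<Longrightarrow> \<psi> z - \<phi> z \<le> \<psi> y - \<phi> y" by blast+
  obtain P0 where P0: "continuous_on UNIV \<phi>" "\<forall>x. GDERIV \<phi> x :> P0 x"
    "\<forall>C. compact C \<longrightarrow> (\<exists>B\<ge>0. \<forall>x\<in>C. \<forall>z. norm z \<le> 1 \<longrightarrow> \<bar>\<phi> (x + z) - \<phi> x - P0 x \<bullet> z\<bar> \<le> B * (norm z)\<^sup>2)"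
    using C2_stationary[OF C2] by blast
  define p0 where "p0 = P0 y"
  have Gp: "GDERIV \<phi> y :> p0" using P0(2) by (simp add: p0_def)
  obtain B0 where B0: "0 \<le> B0" "\<And>z. norm z \<le> 1 \<Longrightarrow> \<bar>\<phi> (y + z) - \<phi> y - p0 \<bullet> z\<bar> \<le> B0 * (norm z)\<^sup>2"
    using P0(3)[rule_format, of "{y}"] by (auto simp: p0_def)
  define g0 where "g0 = glue \<delta> (\<lambda>z. \<phi> (y + z) - \<phi> y) (\<lambda>z. \<psi> (y + z) - \<psi> y)"
  note ne0 = nonlocal_eq[where u=\<psi> and M=M, OF levy_kernel_axioms \<delta> Gp P0(1) B0 section_measurable[OF \<psi>] M(2)]
  have g0adm: "lev_adm p0 g0" unfolding g0_def by (rule ne0(1))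
  define l where "l = lev fk p0 g0"
  have "g y \<le> l + e2" if e2: "0 < e2" for e2
  proof -
    \<comment> \<open>One share each for the continuity of g, the approximate equation, the limit of
      the Levy integrals and the term that makes the maximum strict.\<close>
    define e where "e = e2 / 4"
    have e: "0 < e" using e2 by (simp add: e_def)
    define \<kappa> where "\<kappa> = e / (mass + 1)"
    have mass1: "0 < mass + 1" using mass_nonneg by linarith
    have \<kappa>: "0 < \<kappa>" using e mass1 by (simp add: \<kappa>_def)
    have \<kappa>m: "\<kappa> * mass \<le> e"
    proof -
      have "\<kappa> * mass \<le> \<kappa> * (mass + 1)" using \<kappa> by simp
      also have "\<dots> = e" unfolding \<kappa>_def using mass1 by (intro nonzero_eq_divide_eq[THEN iffD1]) auto
      finally show ?thesis .
    qed
    define \<phi>' where "\<phi>' z = \<phi> z + \<kappa> * (norm (z - y))\<^sup>2" for z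
    have C2': "C2_on UNIV \<phi>'" unfolding \<phi>'_def by (intro C2_on_add C2 C2_on_norm_sq)
    obtain P' where P': "continuous_on UNIV \<phi>'" "continuous_on UNIV P'" "\<And>x. GDERIV \<phi>' x :> P' x"
      "\<forall>C. compact C \<longrightarrow> (\<exists>B\<ge>0. \<forall>x\<in>C. \<forall>z. norm z \<le> 1 \<longrightarrow> \<bar>\<phi>' (x + z) - \<phi>' x - P' x \<bullet> z\<bar> \<le> B * (norm z)\<^sup>2)"
      using C2_stationary[OF C2'] by blast
    have P'0: "P' y = p0"
    proof (rule GDERIV_unique[OF P'(3)])
      have "GDERIV (\<lambda>z. \<phi> z + \<kappa> * (norm (z - y))\<^sup>2) y :> p0 + (2 * \<kappa>) *\<^sub>R (y - y)"
        by (intro GDERIV_add Gp GDERIV_norm_sq)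
      then show "GDERIV \<phi>' y :> p0" by (simp add: \<phi>'_def[abs_def])
    qed
    define \<rho> where "\<rho> = \<delta> / 2"
    have \<rho>: "0 < \<rho>" "\<rho> < \<delta>" using \<delta> by (auto simp: \<rho>_def)
    define N where "N = cball y \<rho>"
    have Nc: "compact N" and yN: "y \<in> N" using \<rho> by (auto simp: N_def)
    define wb where "wb z = \<psi> z - \<phi>' z" for z
    define w where "w n z = \<Psi> n z - \<phi>' z" for n z
    have strict: "wb z < wb y" if "z \<in> N" "z \<noteq> y" for z
    proof -
      have "z \<in> ball y \<delta>" using that \<rho> by (auto simp: N_def)
      moreover have "0 < \<kappa> * (norm (z - y))\<^sup>2" using \<kappa> that by simp
      ultimately show ?thesis using mx[of z] by (simp add: wb_def \<phi>'_def)
    qed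
    have \<Psi>c: "continuous_on UNIV (\<Psi> n)" for n using n[of n] by (simp add: nice_def)
    have wc: "continuous_on N (w n)" for n
      unfolding w_def[abs_def] by (intro continuous_intros continuous_on_subset[OF \<Psi>c] continuous_on_subset[OF P'(1)]) auto
    have wup: "\<exists>r>0. \<forall>\<^sub>F n in sequentially. \<forall>z'\<in>N. dist z' z < r \<longrightarrow> w n z' < c" if z: "z \<in> N" "wb z < c" for z c
    proof -
      define d where "d = (c - wb z) / 2"
      have d: "0 < d" using z by (simp add: d_def)
      have "continuous_on UNIV wb" unfolding wb_def[abs_def] by (intro continuous_intros \<psi> P'(1))
      then obtain r where r: "0 < r" "\<And>z'. dist z' z < r \<Longrightarrow> dist (wb z') (wb z) < d"
        using d unfolding continuous_on_iff by (metis UNIV_I)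
      have "\<forall>\<^sub>F n in sequentially. \<forall>z'\<in>N. dist z' z < r \<longrightarrow> w n z' < c"
        using unif[OF d]
      proof (rule eventually_mono)
        fix n assume a: "\<forall>y. \<bar>\<Psi> n y - \<psi> y\<bar> < d"
        show "\<forall>z'\<in>N. dist z' z < r \<longrightarrow> w n z' < c"
        proof (intro ballI impI)
          fix z' assume "dist z' z < r"
          then have "\<bar>wb z' - wb z\<bar> < d" using r(2) by (simp add: dist_real_def)
          moreover have "\<bar>w n z' - wb z'\<bar> < d" using a by (simp add: w_def wb_def)
          moreover have "wb z + d + d = c" by (simp add: d_def field_simps)
          ultimately show "w n z' < c" by linarith
        qed
      qed
      then show ?thesis using r(1) by blast
    qed
    have wlow: "\<forall>\<^sub>F n in sequentially. \<exists>z'\<in>N. wb y - d \<le> w n z'" if "0 < d" for d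
      using unif[OF that]
    proof (rule eventually_mono)
      fix n assume "\<forall>y. \<bar>\<Psi> n y - \<psi> y\<bar> < d"
      then have "\<bar>\<Psi> n y - \<psi> y\<bar> < d" by blast
      then have "wb y - d \<le> w n y" unfolding wb_def w_def by linarith
      then show "\<exists>z'\<in>N. wb y - d \<le> w n z'" using yN by blast
    qed
    obtain yn where yn: "\<And>n. yn n \<in> N" "\<And>n q. q \<in> N \<Longrightarrow> w n q \<le> w n (yn n)" and ynl: "yn \<longlonglongrightarrow> y"
      using max_points_converge[where N=N and ?q0.0=y and w=w and wb=wb, OF Nc yN wc strict wup wlow] by blast
    define \<delta>' where "\<delta>' = \<rho> / 2"
    have \<delta>': "0 < \<delta>'" "\<delta>' < 1" "\<delta>' < \<delta>" using \<rho> \<delta> by (auto simp: \<delta>'_def)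
    obtain B where B: "0 \<le> B" and B': "\<And>x z. x \<in> N \<Longrightarrow> norm z \<le> 1 \<Longrightarrow> \<bar>\<phi>' (x + z) - \<phi>' x - P' x \<bullet> z\<bar> \<le> B * (norm z)\<^sup>2"
      using P'(4)[rule_format, OF Nc] by blast
    have Pl: "(\<lambda>n. P' (yn n)) \<longlonglongrightarrow> p0"
      using continuous_on_tendsto_compose[OF P'(2) ynl] P'0 by simp
    obtain Pb where Pb: "\<And>n. norm (P' (yn n)) \<le> Pb"
      using convergent_imp_Bseq[OF convergentI[OF Pl]] unfolding Bseq_def by blast
    define g1 where "g1 n = glue \<delta>' (\<lambda>z. \<phi>' (yn n + z) - \<phi>' (yn n)) (\<lambda>z. \<Psi> n (yn n + z) - \<Psi> n (yn n))" for n
    define g0' where "g0' = glue \<delta>' (\<lambda>z. \<phi>' (y + z) - \<phi>' y) (\<lambda>z. \<psi> (y + z) - \<psi> y)"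
    note ne1 = nonlocal_eq[OF levy_kernel_axioms \<delta>'(1,2) P'(3) P'(1) B B'[OF yn(1)] section_measurable[OF \<Psi>c] M(1)]
    have adm1: "lev_adm (P' (yn n)) (g1 n)" for n unfolding g1_def by (rule ne1(1))
    have bd1: "\<bar>comp_incr (P' (yn n)) (g1 n) z\<bar> \<le> (B + (2 * M + Pb) / \<delta>'\<^sup>2) * wt z" for n z
    proof -
      have "\<bar>comp_incr (P' (yn n)) (g1 n) z\<bar> \<le> (B + (2 * M + norm (P' (yn n))) / \<delta>'\<^sup>2) * wt z"
        unfolding g1_def by (rule ne1(3))
      also have "\<dots> \<le> (B + (2 * M + Pb) / \<delta>'\<^sup>2) * wt z"
        using Pb[of n] by (intro mult_right_mono add_left_mono divide_right_mono) auto
      finally show ?thesis .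
    qed
    have adm0: "lev_adm p0 g0'"
      unfolding g0'_def
      using nonlocal_eq(1)[OF levy_kernel_axioms \<delta>'(1,2) P'(3) P'(1) B B'[OF yN] section_measurable[OF \<psi>] M(2)] P'0 by simp
    have E1: "\<forall>\<^sub>F n in sequentially. lev fk (P' (yn n)) (g1 n) \<le> lev fk p0 g0' + e"
    proof (rule lev_limsup[OF adm1 adm0 bd1 _ e])
      fix z :: "real^'n" and d :: real assume d: "0 < d"
      have zl: "(\<lambda>n. yn n + z) \<longlonglongrightarrow> y + z" by (intro tendsto_add ynl tendsto_const)
      have c1: "(\<lambda>n. f (yn n + z) - f (yn n)) \<longlonglongrightarrow> f (y + z) - f y" if "continuous_on UNIV f" for f :: "real^'n \<Rightarrow> real"
        using continuous_on_tendsto_compose[OF that zl] continuous_on_tendsto_compose[OF that ynl]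
        by (intro tendsto_diff) auto
      have u0: "(\<lambda>n. \<Psi> n (v n) - \<psi> (v n)) \<longlonglongrightarrow> 0" for v
      proof (rule tendstoI)
        fix r :: real assume "0 < r"
        from unif[OF this] show "\<forall>\<^sub>F n in sequentially. dist (\<Psi> n (v n) - \<psi> (v n)) 0 < r"
          unfolding dist_real_def diff_0_right by (rule eventually_mono) blast
      qed
      have "(\<lambda>n. (\<Psi> n (yn n + z) - \<psi> (yn n + z)) - (\<Psi> n (yn n) - \<psi> (yn n))) \<longlonglongrightarrow> 0 - 0"
        by (intro tendsto_diff u0)
      from tendsto_add[OF this c1[OF \<psi>]] have c2: "(\<lambda>n. \<Psi> n (yn n + z) - \<Psi> n (yn n)) \<longlonglongrightarrow> \<psi> (y + z) - \<psi> y"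
        by (simp add: algebra_simps)
      have "(\<lambda>n. g1 n z) \<longlonglongrightarrow> g0' z"
        using c2 c1[OF P'(1)] by (simp add: g1_def g0'_def glue_def)
      then have "(\<lambda>n. comp_incr (P' (yn n)) (g1 n) z) \<longlonglongrightarrow> comp_incr p0 g0' z"
        unfolding comp_incr_def by (intro tendsto_intros Pl)
      from order_tendstoD(2)[OF this, of "comp_incr p0 g0' z + d"]
      show "\<forall>\<^sub>F n in sequentially. comp_incr (P' (yn n)) (g1 n) z \<le> comp_incr p0 g0' z + d"
        using d by (auto elim!: eventually_mono)
    qed
    have "lev fk p0 g0' \<le> l + \<kappa> * mass"
      unfolding l_def
    proof (rule lev_mono_wt[OF adm0 g0adm])
      fix z :: "real^'n"
      have pos: "0 \<le> \<kappa> * wt z" using \<kappa> by simp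
      consider "norm z < \<delta>'" | "\<delta>' \<le> norm z" "norm z < \<delta>" | "\<delta> \<le> norm z" by linarith
      then show "comp_incr p0 g0' z \<le> comp_incr p0 g0 z + \<kappa> * wt z"
      proof cases
        case 1
        then show ?thesis using \<delta>' by (simp add: comp_incr_def g0_def g0'_def glue_def \<phi>'_def wt_less_1)
      next
        case 2
        have "y + z \<in> ball y \<delta>" using 2 by (simp add: dist_norm)
        from mx[OF this] show ?thesis using 2 pos by (simp add: comp_incr_def g0_def g0'_def glue_def)
      next
        case 3
        then show ?thesis using \<delta>' pos by (simp add: comp_incr_def g0_def g0'_def glue_def)
      qed
    qed
    then have l0: "lev fk p0 g0' \<le> l + e" using \<kappa>m by linarith
    have E2: "\<forall>\<^sub>F n in sequentially. dist (yn n) y < \<delta>'" using ynl \<delta>'(1) by (rule tendstoD)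
    have "(\<lambda>n. g (yn n)) \<longlonglongrightarrow> g y" using continuous_on_tendsto_compose[OF g ynl] by simp
    from order_tendstoD(1)[OF this, of "g y - e"] have E3: "\<forall>\<^sub>F n in sequentially. g y - e < g (yn n)" using e by simp
    have "\<forall>\<^sub>F n in sequentially. g y \<le> l + e2"
      using E1 E2 E3 eq[OF e]
    proof eventually_elim
      case (elim n)
      have loc: "\<Psi> n z - \<phi>' z \<le> \<Psi> n (yn n) - \<phi>' (yn n)" if "z \<in> ball (yn n) \<delta>'" for z
      proof -
        have "dist y z \<le> dist (yn n) y + dist (yn n) z" by (rule dist_triangle3)
        then have "z \<in> N" using that elim(2) \<rho>(1) by (simp add: N_def \<delta>'_def)
        from yn(2)[OF this, of n] show ?thesis by (simp add: w_def)
      qed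
      have "GDERIV (\<lambda>z. \<Psi> n z - \<phi>' z) (yn n) :> Pn n (yn n) - P' (yn n)"
        using n[of n] P'(3) by (intro GDERIV_diff) (auto simp: nice_def)
      then have D: "((\<lambda>z. \<Psi> n z - \<phi>' z) has_derivative (\<lambda>h. h \<bullet> (Pn n (yn n) - P' (yn n)))) (at (yn n))"
        by (simp add: gderiv_def)
      have "(\<lambda>h. h \<bullet> (Pn n (yn n) - P' (yn n))) = (\<lambda>h. 0)"
        by (rule differential_zero_maxmin[OF centre_in_ball[THEN iffD2, OF \<delta>'(1)] open_ball D]) (use loc in blast)
      then have "(Pn n (yn n) - P' (yn n)) \<bullet> (Pn n (yn n) - P' (yn n)) = 0" by meson
      then have PP: "Pn n (yn n) = P' (yn n)" by simp
      have "g (yn n) - e \<le> frac_full \<sigma> (\<Psi> n) (Pn n) (yn n)" using elim(4) by blast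
      also have "\<dots> = lev fk (P' (yn n)) (\<lambda>z. \<Psi> n (yn n + z) - \<Psi> n (yn n))"
        unfolding frac_full_eq_lev(2)[OF n] PP ..
      also have "\<dots> \<le> lev fk (P' (yn n)) (g1 n)"
      proof (rule lev_mono[OF _ adm1])
        show "lev_adm (P' (yn n)) (\<lambda>z. \<Psi> n (yn n + z) - \<Psi> n (yn n))"
          using frac_full_eq_lev(1)[OF n, of n "yn n"] unfolding PP .
        fix z show "comp_incr (P' (yn n)) (\<lambda>z. \<Psi> n (yn n + z) - \<Psi> n (yn n)) z \<le> comp_incr (P' (yn n)) (g1 n) z"
          unfolding g1_def
        proof (rule glue_ge)
          fix z :: "real^'n" assume "norm z < \<delta>'"
          then show "\<Psi> n (yn n + z) - \<Psi> n (yn n) \<le> \<phi>' (yn n + z) - \<phi>' (yn n)"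
            using loc[of "yn n + z"] by (simp add: dist_norm)
        qed
      qed
      finally show ?case using elim(1,3) l0 by (simp add: e_def)
    qed
    then show ?thesis by simp
  qed
  then have "g y \<le> l" by (rule field_le_epsilon)
  moreover have "nonlocal_inner fk \<delta> \<phi> y + nonlocal_outer fk \<delta> \<psi> (grad \<phi> y) y = l"
    unfolding grad_eqI[OF Gp] l_def g0_def by (rule ne0(2))
  ultimately show "g y \<le> nonlocal_inner fk \<delta> \<phi> y + nonlocal_outer fk \<delta> \<psi> (grad \<phi> y) y" by simp
qed

end

section \<open>Solvability of the periodic fractional Poisson equation\<close>

context frac_setup
begin

text \<open>Differences of approximate solutions have mean zero and small fractional Laplacian, so
  \<open>periodic_sup_bound\<close>, applied to both signs, makes the sequence uniformly Cauchy. The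
  limit is taken separately for \<psi> and for - \<psi>.\<close>

lemma stationary_solution_exists:
  fixes g :: "real ^ 'n \<Rightarrow> real"
  assumes g: "continuous_on UNIV g" "ZN_periodic g" "torus_integral g = 0"
  shows "\<exists>\<psi>. ZN_periodic \<psi> \<and> continuous_on UNIV \<psi> \<and> bounded (range \<psi>) \<and> stat_sub \<psi> g \<and> stat_sub (\<lambda>y. - \<psi> y) (\<lambda>y. - g y)"
proof -
  have "\<forall>n. \<exists>f. trig_poly f \<and> (\<forall>y. \<bar>f y - g y\<bar> < 1 / real (Suc n))"
    using trig_dense[OF g(1,2)] by simp
  from choice[OF this] obtain f where f: "\<And>n. trig_poly (f n)" "\<And>n y. \<bar>f n y - g y\<bar> < 1 / real (Suc n)" by blast
  have "\<forall>n. \<exists>\<psi> P L. trig_poly \<psi> \<and> nice \<psi> P L \<and> torus_integral \<psi> = 0 \<and> (\<forall>y. frac_full \<sigma> \<psi> P y = f n y - torus_integral (f n))"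
    using trig_solve[OF f(1)] by blast
  from choice[OF this] obtain \<Psi> where "\<forall>n. \<exists>P L. trig_poly (\<Psi> n) \<and> nice (\<Psi> n) P L \<and> torus_integral (\<Psi> n) = 0 \<and> (\<forall>y. frac_full \<sigma> (\<Psi> n) P y = f n y - torus_integral (f n))" ..
  from choice[OF this] obtain Pn where "\<forall>n. \<exists>L. trig_poly (\<Psi> n) \<and> nice (\<Psi> n) (Pn n) L \<and> torus_integral (\<Psi> n) = 0 \<and> (\<forall>y. frac_full \<sigma> (\<Psi> n) (Pn n) y = f n y - torus_integral (f n))" ..
  from choice[OF this] obtain Lc where s: "\<And>n. trig_poly (\<Psi> n)" "\<And>n. nice (\<Psi> n) (Pn n) (Lc n)" "\<And>n. torus_integral (\<Psi> n) = 0"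
    "\<And>n y. frac_full \<sigma> (\<Psi> n) (Pn n) y = f n y - torus_integral (f n)" by blast
  \<comment> \<open>One share 1 / (n + 1) is the distance of f n from g; the other bounds the mean
    of f n, which \<open>trig_solve\<close> subtracts.\<close>
  define d where "d n = 2 / real (Suc n)" for n
  have tf: "\<bar>torus_integral (f n)\<bar> \<le> 1 / real (Suc n)" for n
  proof -
    have c: "continuous_on UNIV (f n)" by (rule trig_continuous[OF f(1)])
    have "torus_integral (f n) \<le> torus_integral (\<lambda>y. g y + 1 / real (Suc n))"
    proof (rule torus_integral_mono[OF c])
      show "continuous_on UNIV (\<lambda>y. g y + 1 / real (Suc n))" by (intro continuous_intros g)
      show "f n y \<le> g y + 1 / real (Suc n)" for y using f(2)[of n y] by linarith
    qed
    also have "\<dots> = 1 / real (Suc n)"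
      by (subst torus_integral_add[OF g(1)]) (auto simp: torus_integral_const g(3))
    finally have 1: "torus_integral (f n) \<le> 1 / real (Suc n)" .
    have "torus_integral (\<lambda>y. g y + - (1 / real (Suc n))) \<le> torus_integral (f n)"
    proof (rule torus_integral_mono[OF _ c])
      show "continuous_on UNIV (\<lambda>y. g y + - (1 / real (Suc n)))" by (intro continuous_intros g)
      show "g y + - (1 / real (Suc n)) \<le> f n y" for y using f(2)[of n y] by linarith
    qed
    moreover have "torus_integral (\<lambda>y. g y + - (1 / real (Suc n))) = - (1 / real (Suc n))"
      by (subst torus_integral_add[OF g(1)]) (auto simp: torus_integral_const g(3))
    ultimately show ?thesis using 1 by linarith
  qed
  have h: "\<bar>frac_full \<sigma> (\<Psi> n) (Pn n) y - g y\<bar> \<le> d n" for n y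
  proof -
    have "d n = 1 / real (Suc n) + 1 / real (Suc n)" by (simp add: d_def)
    then show ?thesis using f(2)[of n y] tf[of n] unfolding s(4) by linarith
  qed
  obtain c0 where c0: "0 < c0" and sup: "\<And>(\<psi> :: real^'n \<Rightarrow> real) P L B y. nice \<psi> P L \<Longrightarrow> ZN_periodic \<psi> \<Longrightarrow> torus_integral \<psi> = 0 \<Longrightarrow>
     (\<And>y. - B \<le> frac_full \<sigma> \<psi> P y) \<Longrightarrow> c0 * \<psi> y \<le> B"
    using periodic_sup_bound by blast
  have diff: "c0 * (\<Psi> n y - \<Psi> j y) \<le> d n + d j" for n j y
  proof -
    have "c0 * (\<Psi> n y + -1 * \<Psi> j y) \<le> d n + d j"
    proof (rule sup[where \<psi>="\<lambda>y. \<Psi> n y + -1 * \<Psi> j y" and P="\<lambda>y. Pn n y + -1 *\<^sub>R Pn j y"])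
      show "nice (\<lambda>y. \<Psi> n y + -1 * \<Psi> j y) (\<lambda>y. Pn n y + -1 *\<^sub>R Pn j y) (Lc n + \<bar>-1\<bar> * Lc j)"
        by (intro nice_add nice_cmult s)
      show "ZN_periodic (\<lambda>y. \<Psi> n y + -1 * \<Psi> j y)"
        by (intro trig_periodic trig_add trig_scale s)
      show "torus_integral (\<lambda>y. \<Psi> n y + -1 * \<Psi> j y) = 0"
        unfolding torus_integral_add[OF trig_continuous[OF s(1)] trig_continuous[OF trig_scale[OF s(1)]]] torus_integral_cmult s(3) by simp
      fix y
      have "frac_full \<sigma> (\<lambda>y. \<Psi> n y + -1 * \<Psi> j y) (\<lambda>y. Pn n y + -1 *\<^sub>R Pn j y) y
        = frac_full \<sigma> (\<Psi> n) (Pn n) y + -1 * frac_full \<sigma> (\<Psi> j) (Pn j) y"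
        by (simp only: frac_full_add[OF s(2) nice_cmult[OF s(2)]] frac_full_cmult)
      then show "- (d n + d j) \<le> frac_full \<sigma> (\<lambda>y. \<Psi> n y + -1 * \<Psi> j y) (\<lambda>y. Pn n y + -1 *\<^sub>R Pn j y) y"
        using h[of n y] h[of j y] by linarith
    qed
    then show ?thesis by simp
  qed
  have adiff: "\<bar>\<Psi> n y - \<Psi> j y\<bar> \<le> (d n + d j) / c0" for n j y
    using diff[of n y j] diff[of j y n] c0 by (auto simp: abs_le_iff pos_le_divide_eq mult.commute)
  have dl: "d \<longlonglongrightarrow> 0" unfolding d_def[abs_def] by real_asymp
  have "uniformly_Cauchy_on UNIV \<Psi>"
    unfolding uniformly_Cauchy_on_def
  proof (intro allI impI)
    fix e :: real assume e: "0 < e"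
    then have "0 < e * c0 / 2" using c0 by simp
    from order_tendstoD(2)[OF dl this] obtain N where N: "\<And>n. n \<ge> N \<Longrightarrow> d n < e * c0 / 2"
      by (auto simp: eventually_sequentially)
    have "dist (\<Psi> m y) (\<Psi> n y) < e" if "m \<ge> N" "n \<ge> N" for m n y
    proof -
      have "(d m + d n) / c0 < e" using N[OF that(1)] N[OF that(2)] c0 by (simp add: pos_divide_less_eq)
      then show ?thesis using adiff[of m y n] by (simp add: dist_real_def)
    qed
    then show "\<exists>N. \<forall>x\<in>UNIV. \<forall>m\<ge>N. \<forall>n\<ge>N. dist (\<Psi> m x) (\<Psi> n x) < e" by blast
  qed
  then obtain \<psi> where ul: "uniform_limit UNIV \<Psi> \<psi> sequentially"
    using Cauchy_uniformly_convergent unfolding uniformly_convergent_on_def by blast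
  have unif: "\<forall>\<^sub>F n in sequentially. \<forall>y. \<bar>\<Psi> n y - \<psi> y\<bar> < e" if "0 < e" for e
    using uniform_limitD[OF ul that] by (simp add: dist_real_def)
  have \<psi>c: "continuous_on UNIV \<psi>"
    by (rule uniform_limit_theorem[OF _ ul]) (auto intro: always_eventually trig_continuous s)
  have pt: "(\<lambda>n. \<Psi> n y) \<longlonglongrightarrow> \<psi> y" for y using tendsto_uniform_limitI[OF ul] by simp
  have \<psi>p: "ZN_periodic \<psi>"
    unfolding ZN_periodic_def
  proof (intro allI impI)
    fix y k :: "real^'n" assume "\<forall>i. k $ i \<in> \<int>"
    then have "\<Psi> n (y + k) = \<Psi> n y" for n using trig_periodic[OF s(1)] by (simp add: ZN_periodic_def)
    then show "\<psi> (y + k) = \<psi> y" using pt[of "y + k"] pt[of y] LIMSEQ_unique by auto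
  qed
  \<comment> \<open>The initial approximant plus its distance to the others, with d n at most
    2.\<close>
  define M where "M = Lc 0 + (2 + d 0) / c0"
  have M1: "\<bar>\<Psi> n y\<bar> \<le> M" for n y
  proof -
    have "\<bar>\<Psi> 0 y\<bar> \<le> Lc 0" using s(2)[of 0] by (simp add: nice_def)
    moreover have "(d n + d 0) / c0 \<le> (2 + d 0) / c0"
      using c0 by (intro divide_right_mono) (auto simp: d_def divide_le_eq)
    ultimately show ?thesis using adiff[of n y 0] by (simp add: M_def)
  qed
  have M2: "\<bar>\<psi> y\<bar> \<le> M" for y
    by (rule LIMSEQ_le_const2[OF tendsto_rabs[OF pt]]) (use M1 in auto)
  have eq: "\<forall>\<^sub>F n in sequentially. \<forall>y. g y - e \<le> frac_full \<sigma> (\<Psi> n) (Pn n) y \<and> frac_full \<sigma> (\<Psi> n) (Pn n) y \<le> g y + e" if "0 < e" for e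
    using order_tendstoD(2)[OF dl that]
  proof (rule eventually_mono)
    fix n assume "d n < e"
    show "\<forall>y. g y - e \<le> frac_full \<sigma> (\<Psi> n) (Pn n) y \<and> frac_full \<sigma> (\<Psi> n) (Pn n) y \<le> g y + e"
    proof
      fix y show "g y - e \<le> frac_full \<sigma> (\<Psi> n) (Pn n) y \<and> frac_full \<sigma> (\<Psi> n) (Pn n) y \<le> g y + e"
        using h[of n y] \<open>d n < e\<close> by linarith
    qed
  qed
  have s1: "stat_sub \<psi> g"
  proof (rule stat_sub_limit[OF s(2) g(1) M1 M2 \<psi>c unif])
    fix e :: real assume "0 < e"
    from eq[OF this] show "\<forall>\<^sub>F n in sequentially. \<forall>y. g y - e \<le> frac_full \<sigma> (\<Psi> n) (Pn n) y"
      by (rule eventually_mono) blast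
  qed
  have s2: "stat_sub (\<lambda>y. - \<psi> y) (\<lambda>y. - g y)"
  proof (rule stat_sub_limit[where \<Psi>="\<lambda>n y. -1 * \<Psi> n y" and Pn="\<lambda>n y. -1 *\<^sub>R Pn n y" and M=M])
    show "nice (\<lambda>y. -1 * \<Psi> n y) (\<lambda>y. -1 *\<^sub>R Pn n y) (\<bar>-1\<bar> * Lc n)" for n by (intro nice_cmult s)
    show "continuous_on UNIV (\<lambda>y. - g y)" "continuous_on UNIV (\<lambda>y. - \<psi> y)" by (intro continuous_intros g \<psi>c)+
    show "\<bar>-1 * \<Psi> n y\<bar> \<le> M" "\<bar>- \<psi> y\<bar> \<le> M" for n y using M1 M2 by simp_all
    fix e :: real assume e: "0 < e"
    show "\<forall>\<^sub>F n in sequentially. \<forall>y. \<bar>-1 * \<Psi> n y - - \<psi> y\<bar> < e"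
      using unif[OF e] by (rule eventually_mono) (simp add: abs_minus_commute)
    from eq[OF e] show "\<forall>\<^sub>F n in sequentially. \<forall>y. - g y - e \<le> frac_full \<sigma> (\<lambda>y. -1 * \<Psi> n y) (\<lambda>y. -1 *\<^sub>R Pn n y) y"
      unfolding frac_full_cmult
    proof (rule eventually_mono)
      fix n assume a: "\<forall>y. g y - e \<le> frac_full \<sigma> (\<Psi> n) (Pn n) y \<and> frac_full \<sigma> (\<Psi> n) (Pn n) y \<le> g y + e"
      show "\<forall>y. - g y - e \<le> - 1 * frac_full \<sigma> (\<Psi> n) (Pn n) y"
      proof
        fix y show "- g y - e \<le> - 1 * frac_full \<sigma> (\<Psi> n) (Pn n) y" using a[THEN spec, of y] by linarith
      qed
    qed
  qed
  have "bounded (range \<psi>)" unfolding bounded_iff using M2 by (intro exI[of _ M]) auto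
  then show ?thesis using \<psi>p \<psi>c s1 s2 by blast
qed

text \<open>Division by a > 0 keeps the inequalities and isolates the nonlocal term; test functions
  touching from below are negated.\<close>

lemma stat_visc_sol_iff:
  assumes a: "\<And>y. 0 < a y"
  shows "stat_visc_sol fk (\<lambda>y _ j. - a y * l + a y * (- j) + h y - c) \<psi> \<longleftrightarrow>
    bounded (range \<psi>) \<and> continuous_on UNIV \<psi> \<and>
    stat_sub \<psi> (\<lambda>y. (h y - c) / a y - l) \<and> stat_sub (\<lambda>y. - \<psi> y) (\<lambda>y. - ((h y - c) / a y - l))"
proof -
  define J where "J \<psi> \<phi> \<delta> y = nonlocal_inner fk \<delta> \<phi> y + nonlocal_outer fk \<delta> \<psi> (grad \<phi> y) y" for \<psi> \<phi> \<delta> y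
  have JJ: "J (\<lambda>y. - \<psi> y) (\<lambda>y. - \<phi> y) \<delta> y = - J \<psi> \<phi> \<delta> y" if "C2_on UNIV \<phi>" for \<psi> \<phi> \<delta> y
    unfolding J_def nonlocal_inner_uminus[OF that] nonlocal_outer_uminus by simp
  have 1: "stat_lhs fk (\<lambda>y _ j. - a y * l + a y * (- j) + h y - c) \<psi> \<phi> \<delta> y \<le> 0 \<longleftrightarrow> (h y - c) / a y - l \<le> J \<psi> \<phi> \<delta> y"
   and 2: "0 \<le> stat_lhs fk (\<lambda>y _ j. - a y * l + a y * (- j) + h y - c) \<psi> \<phi> \<delta> y \<longleftrightarrow> J \<psi> \<phi> \<delta> y \<le> (h y - c) / a y - l" for \<phi> \<delta> y
    unfolding stat_lhs_def J_def[symmetric] using a[of y] by (auto simp: field_simps)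
  have 3: "stat_sub \<psi> (\<lambda>y. (h y - c) / a y - l) \<longleftrightarrow>
     (\<forall>y \<phi> \<delta>. C2_on UNIV \<phi> \<and> 0 < \<delta> \<and> \<delta> < 1 \<longrightarrow> (\<forall>z\<in>ball y \<delta>. \<psi> z - \<phi> z \<le> \<psi> y - \<phi> y) \<longrightarrow>
       stat_lhs fk (\<lambda>y _ j. - a y * l + a y * (- j) + h y - c) \<psi> \<phi> \<delta> y \<le> 0)"
    unfolding stat_sub_def 1 J_def by blast
  have 4: "stat_sub (\<lambda>y. - \<psi> y) (\<lambda>y. - ((h y - c) / a y - l)) \<longleftrightarrow>
     (\<forall>y \<phi> \<delta>. C2_on UNIV \<phi> \<and> 0 < \<delta> \<and> \<delta> < 1 \<longrightarrow> (\<forall>z\<in>ball y \<delta>. \<psi> y - \<phi> y \<le> \<psi> z - \<phi> z) \<longrightarrow>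
       0 \<le> stat_lhs fk (\<lambda>y _ j. - a y * l + a y * (- j) + h y - c) \<psi> \<phi> \<delta> y)" (is "?l \<longleftrightarrow> ?r")
  proof
    assume l: ?l
    show ?r
    proof (intro allI impI)
      fix y \<phi> \<delta> assume b: "C2_on UNIV \<phi> \<and> 0 < \<delta> \<and> \<delta> < 1" and m: "\<forall>z\<in>ball y \<delta>. \<psi> y - \<phi> y \<le> \<psi> z - \<phi> z"
      have "\<forall>z\<in>ball y \<delta>. - \<psi> z - - \<phi> z \<le> - \<psi> y - - \<phi> y"
      proof
        fix z assume "z \<in> ball y \<delta>"
        then have "\<psi> y - \<phi> y \<le> \<psi> z - \<phi> z" using m by blast
        then show "- \<psi> z - - \<phi> z \<le> - \<psi> y - - \<phi> y" by linarith
      qed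
      then have "- ((h y - c) / a y - l) \<le> J (\<lambda>y. - \<psi> y) (\<lambda>y. - \<phi> y) \<delta> y"
        using l b C2_on_uminus[of UNIV \<phi>] unfolding stat_sub_def J_def by blast
      then show "0 \<le> stat_lhs fk (\<lambda>y _ j. - a y * l + a y * (- j) + h y - c) \<psi> \<phi> \<delta> y"
        unfolding 2 using JJ b by simp
    qed
  next
    assume r: ?r
    show ?l unfolding stat_sub_def J_def[symmetric]
    proof (intro allI impI)
      fix y \<phi> \<delta> assume b: "C2_on UNIV \<phi> \<and> 0 < \<delta> \<and> \<delta> < 1 \<and> (\<forall>z\<in>ball y \<delta>. - \<psi> z - \<phi> z \<le> - \<psi> y - \<phi> y)"
      have c: "C2_on UNIV (\<lambda>y. - \<phi> y)" using b C2_on_uminus by blast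
      have "\<forall>z\<in>ball y \<delta>. \<psi> y - - \<phi> y \<le> \<psi> z - - \<phi> z"
      proof
        fix z assume "z \<in> ball y \<delta>"
        then have "- \<psi> z - \<phi> z \<le> - \<psi> y - \<phi> y" using b by blast
        then show "\<psi> y - - \<phi> y \<le> \<psi> z - - \<phi> z" by linarith
      qed
      then have "J \<psi> (\<lambda>y. - \<phi> y) \<delta> y \<le> (h y - c) / a y - l"
        using r b c unfolding 2[symmetric] by blast
      then show "- ((h y - c) / a y - l) \<le> J (\<lambda>y. - \<psi> y) \<phi> \<delta> y"
        using JJ[OF c, of \<psi> \<delta> y] by simp
    qed
  qed
  show ?thesis unfolding stat_visc_sol_def 3 4 by blast
qed

end

section \<open>The cell problem\<close>

locale cell_data = frac_setup \<sigma> "TYPE('n::finite)" for \<sigma> :: real +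
  fixes a :: "real ^ 'n \<Rightarrow> real ^ 'n \<Rightarrow> real" and H :: "real ^ 'n \<Rightarrow> real ^ 'n \<Rightarrow> real ^ 'n \<Rightarrow> real" and a0 :: real
  assumes a0: "0 < a0" and a: "\<And>x y. a0 \<le> a x y \<and> a x y \<le> 1 / a0"
    and a_cont: "\<And>x. continuous_on UNIV (a x)" and H_cont: "\<And>x p. continuous_on UNIV (\<lambda>y. H x y p)"
    and a_per: "\<And>x. ZN_periodic (a x)" and H_per: "\<And>x p. ZN_periodic (\<lambda>y. H x y p)"
begin

lemma a_pos: "0 < a x y" using a[of x y] a0 by linarith

lemma inv_a_cont: "continuous_on UNIV (\<lambda>y. 1 / a x y)"
  using a_pos less_imp_neq[THEN not_sym] by (intro continuous_intros a_cont) blast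

lemma H_a_cont: "continuous_on UNIV (\<lambda>y. H x y p / a x y)"
  using a_pos less_imp_neq[THEN not_sym] by (intro continuous_intros a_cont H_cont) blast

lemma inv_a_bounds: "a0 \<le> 1 / a x y" "1 / a x y \<le> 1 / a0"
  using a[of x y] a_pos[of x y] a0 by (auto simp: field_simps)

lemma torus_inv_a: "a0 \<le> torus_integral (\<lambda>y. 1 / a x y)" "torus_integral (\<lambda>y. 1 / a x y) \<le> 1 / a0"
  using torus_integral_mono[OF _ inv_a_cont, of "\<lambda>_. a0" x] torus_integral_mono[OF inv_a_cont, of "\<lambda>_. 1 / a0" x]
    inv_a_bounds by (auto simp: torus_integral_const)

definition cell_rhs :: "real ^ 'n \<Rightarrow> real ^ 'n \<Rightarrow> real \<Rightarrow> real \<Rightarrow> real ^ 'n \<Rightarrow> real" where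
  "cell_rhs x p l c y = (H x y p - c) / a x y - l"

lemma cell_rhs_facts: "continuous_on UNIV (cell_rhs x p l c)" "ZN_periodic (cell_rhs x p l c)"
proof -
  show "continuous_on UNIV (cell_rhs x p l c)" unfolding cell_rhs_def[abs_def]
    using a_pos less_imp_neq[THEN not_sym] by (intro continuous_intros a_cont H_cont) blast
  show "ZN_periodic (cell_rhs x p l c)" using a_per[of x] H_per[of x p] by (simp add: ZN_periodic_def cell_rhs_def)
qed

text \<open>The mean is affine in c, and its slope is minus the mean of 1 / a, which is nonzero. So
  exactly one c makes it vanish, and solving for it gives the formula of
  \<open>eff_H\<close>.\<close>

lemma cell_rhs_mean: "torus_integral (cell_rhs x p l c) = 0 \<longleftrightarrow> c = eff_H a H x p l"
proof -
  have e: "cell_rhs x p l c = (\<lambda>y. (H x y p / a x y + (- c) * (1 / a x y)) + - l)"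
    by (auto simp: cell_rhs_def diff_divide_distrib)
  have "torus_integral (cell_rhs x p l c) = torus_integral (\<lambda>y. H x y p / a x y) - c * torus_integral (\<lambda>y. 1 / a x y) - l"
  proof -
    have c1: "continuous_on UNIV (\<lambda>y. (- c) * (1 / a x y))" by (intro continuous_on_mult_left inv_a_cont)
    have c2: "continuous_on UNIV (\<lambda>y. H x y p / a x y + (- c) * (1 / a x y))" by (intro continuous_on_add c1 H_a_cont)
    show ?thesis
      unfolding e torus_integral_add[OF c2 continuous_on_const] torus_integral_add[OF H_a_cont c1] torus_integral_cmult torus_integral_const
      by simp
  qed
  then show ?thesis using torus_inv_a(1)[of x] a0 by (auto simp: eff_H_def eff_coeff_def field_simps)
qed

text \<open>For necessity, \<open>stat_sub_mean\<close> applied to \<psi> and to - \<psi> forces the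
  right-hand side to have mean zero. Sufficiency is the existence result for such right-hand
  sides.\<close>

lemma cell_solvable_iff: "cell_solvable \<sigma> a H x p l c \<longleftrightarrow> c = eff_H a H x p l"
proof -
  note iff = stat_visc_sol_iff[of "a x" l "\<lambda>y. H x y p" c, OF a_pos, folded cell_rhs_def]
  show ?thesis
  proof
    assume "cell_solvable \<sigma> a H x p l c"
    then obtain \<psi> where \<psi>: "ZN_periodic \<psi>" "bounded (range \<psi>)" "continuous_on UNIV \<psi>" "stat_sub \<psi> (cell_rhs x p l c)"
        "stat_sub (\<lambda>y. - \<psi> y) (\<lambda>y. - cell_rhs x p l c y)"
      unfolding cell_solvable_def iff by blast
    obtain M where M: "\<And>y. \<bar>\<psi> y\<bar> \<le> M" using \<psi>(2) unfolding bounded_iff by auto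
    have "torus_integral (cell_rhs x p l c) \<le> 0"
      by (rule stat_sub_mean[OF \<psi>(4,3,1) M cell_rhs_facts])
    moreover have "torus_integral (\<lambda>y. - cell_rhs x p l c y) \<le> 0"
    proof (rule stat_sub_mean[OF \<psi>(5)])
      show "continuous_on UNIV (\<lambda>y. - \<psi> y)" "continuous_on UNIV (\<lambda>y. - cell_rhs x p l c y)"
        by (intro continuous_intros \<psi> cell_rhs_facts)+
      show "ZN_periodic (\<lambda>y. - \<psi> y)" "ZN_periodic (\<lambda>y. - cell_rhs x p l c y)"
        using \<psi>(1) cell_rhs_facts(2)[of x p l c] by (simp_all add: ZN_periodic_def)
      show "\<bar>- \<psi> y\<bar> \<le> M" for y using M by simp
    qed
    then have "0 \<le> torus_integral (cell_rhs x p l c)"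
      using torus_integral_cmult[of "-1" "cell_rhs x p l c"] by simp
    ultimately show "c = eff_H a H x p l" unfolding cell_rhs_mean[symmetric] by simp
  next
    assume "c = eff_H a H x p l"
    then have "torus_integral (cell_rhs x p l c) = 0" unfolding cell_rhs_mean .
    from stationary_solution_exists[OF cell_rhs_facts this]
    show "cell_solvable \<sigma> a H x p l c" unfolding cell_solvable_def iff by blast
  qed
qed

lemma cell_corrector: "cell_corrector \<sigma> a H (eff_H a H)"
  unfolding cell_corrector_def
proof (intro allI impI)
  fix x p :: "real^'n" and l e :: real assume e: "0 < e"
  define c where "c = eff_H a H x p l"
  define g where "g = cell_rhs x p l c"
  have g: "continuous_on UNIV g" "ZN_periodic g" "torus_integral g = 0"
    using cell_rhs_facts cell_rhs_mean by (auto simp: g_def c_def)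
  \<comment> \<open>One half of e a0 goes to f - g, the other to the mean of f; multiplication by a
    \<le> 1 / a0 brings the total to e.\<close>
  have e': "0 < e * a0 / 2" using e a0 by simp
  obtain f where f: "trig_poly f" "\<And>y. \<bar>f y - g y\<bar> < e * a0 / 2" using trig_dense[OF g(1,2) e'] by blast
  obtain \<psi> P L where \<psi>: "nice \<psi> P L" "\<And>y. frac_full \<sigma> \<psi> P y = f y - torus_integral f" using trig_solve[OF f(1)] by blast
  have fc: "continuous_on UNIV f" by (rule trig_continuous[OF f(1)])
  have "torus_integral f \<le> torus_integral (\<lambda>y. g y + e * a0 / 2)"
  proof (rule torus_integral_mono[OF fc])
    show "continuous_on UNIV (\<lambda>y. g y + e * a0 / 2)" by (intro continuous_intros g)
    show "f y \<le> g y + e * a0 / 2" for y using f(2)[of y] by linarith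
  qed
  also have "\<dots> = e * a0 / 2" by (subst torus_integral_add[OF g(1)]) (auto simp: torus_integral_const g(3))
  finally have t1: "torus_integral f \<le> e * a0 / 2" .
  have "torus_integral (\<lambda>y. g y + - (e * a0 / 2)) \<le> torus_integral f"
  proof (rule torus_integral_mono[OF _ fc])
    show "continuous_on UNIV (\<lambda>y. g y + - (e * a0 / 2))" by (intro continuous_intros g)
    show "g y + - (e * a0 / 2) \<le> f y" for y using f(2)[of y] by linarith
  qed
  moreover have "torus_integral (\<lambda>y. g y + - (e * a0 / 2)) = - (e * a0 / 2)"
    by (subst torus_integral_add[OF g(1)]) (auto simp: torus_integral_const g(3))
  ultimately have t2: "- (e * a0 / 2) \<le> torus_integral f" by simp
  have "\<bar>- a x y * (l + frac_full \<sigma> \<psi> P y) + H x y p - eff_H a H x p l\<bar> \<le> e" for y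
  proof -
    have r: "a x y * g y = H x y p - c - a x y * l"
      using a_pos[of x y] by (simp add: g_def cell_rhs_def right_diff_distrib diff_divide_distrib)
    have "- a x y * (l + frac_full \<sigma> \<psi> P y) + H x y p - eff_H a H x p l = a x y * (g y - frac_full \<sigma> \<psi> P y)"
      using r by (simp add: c_def right_diff_distrib distrib_left)
    also have "\<bar>\<dots>\<bar> \<le> (1 / a0) * (e * a0)"
      unfolding abs_mult
    proof (rule mult_mono)
      show "\<bar>a x y\<bar> \<le> 1 / a0" using a[of x y] a_pos[of x y] by simp
      show "\<bar>g y - frac_full \<sigma> \<psi> P y\<bar> \<le> e * a0" unfolding \<psi>(2) using f(2)[of y] t1 t2 by linarith
    qed (use a0 in auto)
    finally show ?thesis using a0 by simp
  qed
  then show "\<exists>\<psi> P L. nice \<psi> P L \<and> (\<forall>y. \<bar>- a x y * (l + frac_full \<sigma> \<psi> P y) + H x y p - eff_H a H x p l\<bar> \<le> e)"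
    using \<psi>(1) by blast
qed

end

section \<open>The initial layer and the limit\<close>

lemma nice_translate:
  assumes "nice \<psi> P L"
  shows "nice (\<lambda>y. \<psi> (y + b)) (\<lambda>y. P (y + b)) L"
proof -
  have 1: "0 \<le> (1::real)" "(1::real) \<le> 1" by auto
  note a = nice_affine[OF assms 1, where b=b, simplified]
  have Pc: "continuous_on UNIV P" using assms by (simp add: nice_def)
  have "continuous_on UNIV (\<lambda>y. P (y + b))"
    by (rule continuous_on_compose2[OF Pc]) (auto intro!: continuous_intros)
  moreover have "\<bar>\<psi> (y + b)\<bar> \<le> L" "0 \<le> L" for y using assms by (auto simp: nice_def)
  ultimately show ?thesis using a unfolding nice_def by auto
qed

text \<open>The slope C is built from bounds on a and H that are uniform in the fast variable, so
  one barrier serves all \<epsilon>.\<close>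

lemma (in levy_kernel) eps_barrier:
  fixes u :: "real \<Rightarrow> (real ^ 'n) \<times> real \<Rightarrow> real" and a :: "real ^ 'n \<Rightarrow> real ^ 'n \<Rightarrow> real"
  assumes T: "0 < T" and a: "\<And>x y. 0 \<le> a x y \<and> a x y \<le> A"
    and H: "\<And>R. \<exists>C. \<forall>x y p. norm p \<le> R \<longrightarrow> \<bar>H x y p\<bar> \<le> (C::real)"
    and sub: "\<And>\<epsilon>. 0 < \<epsilon> \<Longrightarrow> visc_subsol T K (\<lambda>x p l. - a x (inverse \<epsilon> *\<^sub>R x) * l + H x (inverse \<epsilon> *\<^sub>R x) p) (u \<epsilon>)"
    and ucont: "\<And>\<epsilon>. 0 < \<epsilon> \<Longrightarrow> continuous_on (QT_bar T) (u \<epsilon>)"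
    and ubd: "\<And>\<epsilon>. 0 < \<epsilon> \<Longrightarrow> bounded (u \<epsilon> ` QT_bar T)"
    and init: "\<And>\<epsilon> x. 0 < \<epsilon> \<Longrightarrow> u \<epsilon> (x, 0) = u0 x"
    and \<psi>: "nice \<psi> P L" "\<And>x. u0 x \<le> \<psi> x"
  shows "\<exists>C\<ge>0. \<forall>\<epsilon> x t. 0 < \<epsilon> \<longrightarrow> 0 \<le> t \<longrightarrow> t \<le> T \<longrightarrow> u \<epsilon> (x, t) \<le> \<psi> x + C * t"
proof -
  obtain CH where CH: "\<And>x y p. norm p \<le> L + 1 \<Longrightarrow> \<bar>H x y p\<bar> \<le> CH" using H[of "L + 1"] by blast
  have L: "0 \<le> L" using \<psi>(1) by (simp add: nice_def)
  have A: "0 \<le> A" using a[of 0 0] by linarith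
  define L' where "L' = 2 * L * mass + 1"
  have L': "0 \<le> L'" using L mass_nonneg by (simp add: L'_def)
  define C where "C = A * L' + \<bar>CH\<bar>"
  have C: "0 \<le> C" using A L' by (simp add: C_def)
  have F: "- C \<le> - a x y * l + H x y p" if "norm p \<le> L + 1" "l \<le> 2 * L * mass + 1" for x y p l
  proof -
    have "a x y * l \<le> a x y * L'" using a that(2) by (intro mult_left_mono) (auto simp: L'_def)
    also have "\<dots> \<le> A * L'" using a L' by (intro mult_right_mono) auto
    finally show ?thesis using CH[OF that(1), of x y] by (simp add: C_def abs_le_iff)
  qed
  have "u \<epsilon> (x, t) \<le> \<psi> x + C * t" if \<epsilon>: "0 < \<epsilon>" and t: "0 \<le> t" "t \<le> T" for \<epsilon> x t
  proof -
    obtain M where M: "\<And>q. q \<in> QT_bar T \<Longrightarrow> \<bar>u \<epsilon> q\<bar> \<le> M" using ubd[OF \<epsilon>] unfolding bounded_iff by auto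
    show ?thesis
    proof (rule upper_barrier[OF T sub[OF \<epsilon>] usc_on_continuous[OF ucont[OF \<epsilon>]] M \<psi>(1) _ C _ t])
      show "u \<epsilon> (x, 0) \<le> \<psi> x" for x using init[OF \<epsilon>] \<psi>(2) by simp
      show "- C \<le> - a x (inverse \<epsilon> *\<^sub>R x) * l + H x (inverse \<epsilon> *\<^sub>R x) p" if "norm p \<le> L + 1" "l \<le> 2 * L * mass + 1" for x p l
        by (rule F[OF that])
    qed
  qed
  then show ?thesis using C by blast
qed

text \<open>The function u0 x0 + d + \<Lambda> chi(x - x0) lies above u0: near x0 by uniform
  continuity, elsewhere because \<Lambda> k equals 2 M0, a bound for the oscillation of u0. Its
  slope in time is independent of \<epsilon>, so the bound passes to the relaxed limit.\<close>

lemma relaxed_initial: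
  fixes u :: "real \<Rightarrow> (real ^ 'n) \<times> real \<Rightarrow> real"
  assumes T: "0 < T" and fam: "bounded_family u (QT_bar T) M"
    and u0: "bounded (range u0)" "uniformly_continuous_on UNIV u0"
    and bar: "\<And>\<psi> P L. nice \<psi> P L \<Longrightarrow> (\<And>x. u0 x \<le> \<psi> x) \<Longrightarrow>
      \<exists>C\<ge>0. \<forall>\<epsilon> x t. 0 < \<epsilon> \<longrightarrow> 0 \<le> t \<longrightarrow> t \<le> T \<longrightarrow> u \<epsilon> (x, t) \<le> \<psi> x + C * t"
  shows "relaxed_sup u (QT_bar T) (x0, 0) \<le> u0 x0"
proof (rule field_le_epsilon)
  interpret bounded_family u "QT_bar T" M by fact
  fix e :: real assume e: "0 < e"
  define d where "d = e / 3"
  have d: "0 < d" using e by (simp add: d_def)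
  obtain M0 where M0: "\<And>x. \<bar>u0 x\<bar> \<le> M0" using u0(1) unfolding bounded_iff by auto
  have M00: "0 \<le> M0" using M0[of 0] by linarith
  obtain r where r: "0 < r" "\<And>x y. dist x y < r \<Longrightarrow> dist (u0 x) (u0 y) < d"
    using u0(2) d unfolding uniformly_continuous_on_def by (metis UNIV_I)
  define k where "k = chi1 (r / real CARD('n))"
  have k: "0 < k" unfolding k_def chi1_def using r(1) by (intro divide_pos_pos add_pos_nonneg zero_less_power) auto
  define \<Lambda> where "\<Lambda> = 2 * M0 / k"
  have \<Lambda>: "0 \<le> \<Lambda>" using k M00 by (simp add: \<Lambda>_def)
  obtain P\<chi> Lx where chi: "nice (chi :: real^'n \<Rightarrow> real) P\<chi> Lx" using chi_nice by blast
  define \<psi> where "\<psi> y = (u0 x0 + d) + \<Lambda> * chi (y + - x0)" for y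
  have n: "nice \<psi> (\<lambda>y. 0 + \<Lambda> *\<^sub>R P\<chi> (y + - x0)) (\<bar>u0 x0 + d\<bar> + \<bar>\<Lambda>\<bar> * Lx)"
    unfolding \<psi>_def[abs_def] by (intro nice_add nice_const nice_cmult nice_translate chi)
  have le: "u0 y \<le> \<psi> y" for y
  proof (cases "dist y x0 < r")
    case True
    have "u0 y \<le> u0 x0 + d" using r(2)[OF True] by (simp add: dist_real_def abs_less_iff)
    moreover have "0 \<le> \<Lambda> * chi (y + - x0)" using \<Lambda> by (simp add: chi_nonneg)
    ultimately show ?thesis by (simp add: \<psi>_def)
  next
    case False
    then have "k \<le> chi (y + - x0)" unfolding k_def using r(1) by (intro chi_ge) (auto simp: dist_norm)
    then have "\<Lambda> * k \<le> \<Lambda> * chi (y + - x0)" using \<Lambda> by (rule mult_left_mono)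
    then have "2 * M0 \<le> \<Lambda> * chi (y + - x0)" using k by (simp add: \<Lambda>_def)
    then show ?thesis using M0[of y] M0[of x0] d unfolding \<psi>_def by linarith
  qed
  obtain C where C: "0 \<le> C" "\<And>\<epsilon> x t. 0 < \<epsilon> \<Longrightarrow> 0 \<le> t \<Longrightarrow> t \<le> T \<Longrightarrow> u \<epsilon> (x, t) \<le> \<psi> x + C * t"
    using bar[OF n le] by blast
  have "continuous_on UNIV (\<lambda>q :: (real^'n) \<times> real. \<psi> (fst q) + C * snd q)"
    using n by (intro continuous_intros continuous_on_compose2[of UNIV \<psi> UNIV fst]) (auto simp: nice_def)
  then obtain \<rho> where \<rho>: "0 < \<rho>" "\<And>q. dist q (x0, 0) < \<rho> \<Longrightarrow> dist (\<psi> (fst q) + C * snd q) (\<psi> x0) < d"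
    using d unfolding continuous_on_iff by (metis UNIV_I add_0_right fst_conv mult_zero_right snd_conv)
  have "near (x0, 0) \<rho> (u0 x0 + e)"
    unfolding near_def
  proof (intro conjI allI impI \<rho>(1))
    fix \<epsilon> q assume a: "0 < \<epsilon> \<and> \<epsilon> < \<rho> \<and> q \<in> QT_bar T \<and> dist q (x0, 0) < \<rho>"
    obtain x t where q: "q = (x, t)" by force
    have "u \<epsilon> q \<le> \<psi> x + C * t" unfolding q using a by (intro C(2)) (auto simp: q QT_bar_def)
    moreover have "\<bar>\<psi> x + C * t - \<psi> x0\<bar> < d" using \<rho>(2)[of q] a by (simp add: q dist_real_def)
    moreover have "\<psi> x0 = u0 x0 + d" by (simp add: \<psi>_def)
    moreover have "3 * d = e" by (simp add: d_def)
    ultimately show "u \<epsilon> q < u0 x0 + e" using d by linarith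
  qed
  moreover have "(x0, 0) \<in> QT_bar T" using T by (simp add: QT_bar_def)
  ultimately show "relaxed_sup u (QT_bar T) (x0, 0) \<le> u0 x0 + e" using relaxed_sup_le by blast
qed

text \<open>The relaxed limits are compared only on the closed strip. The supersolution property
  depends on nothing but the values on \<open>QT T\<close>, so it can be moved from one limit to the
  other.\<close>

lemma visc_supersol_cong:
  assumes "\<And>q. q \<in> QT T \<Longrightarrow> u q = v q" "visc_supersol T K F u"
  shows "visc_supersol T K F v"
proof -
  have s: "(\<lambda>y. u (y, t)) = (\<lambda>y. v (y, t))" if "t \<in> {0<..T}" for t using assms(1) that by (auto simp: QT_def)
  have "visc_lhs T K F u \<phi> \<delta> x t = visc_lhs T K F v \<phi> \<delta> x t" if "t \<in> {0<..T}" for \<phi> \<delta> x t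
    unfolding visc_lhs_def s[OF that] ..
  moreover have "u ` QT T = v ` QT T" using assms(1) by auto
  moreover have "lsc_on (QT T) u = lsc_on (QT T) v"
    unfolding lsc_on_iff_usc_on usc_on_iff_openin
  proof -
    have "{q \<in> QT T. - u q < c} = {q \<in> QT T. - v q < c}" for c using assms(1) by auto
    then show "(\<forall>c. openin (top_of_set (QT T)) {q \<in> QT T. - u q < c}) = (\<forall>c. openin (top_of_set (QT T)) {q \<in> QT T. - v q < c})" by simp
  qed
  moreover have "u (x, t) = v (x, t)" if "t \<in> {0<..T}" for x t using assms(1) that by (simp add: QT_def)
  ultimately show ?thesis using assms unfolding visc_supersol_def by auto
qed

lemma usc_lsc_continuous:
  assumes "usc_on S u" "lsc_on S u"
  shows "continuous_on S (u :: 'a::topological_space \<Rightarrow> real)"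
  unfolding continuous_on_def
proof
  fix q assume "q \<in> S"
  then show "(u \<longlongrightarrow> u q) (at q within S)"
    using assms unfolding usc_on_def lsc_on_def by (intro order_tendstoI) auto
qed

text \<open>At each point the two relaxed limits and the continuity of v bound u \<epsilon> - v from
  both sides on a joint neighbourhood in \<epsilon> and q; finitely many such neighbourhoods cover
  C.\<close>

lemma relaxed_limits_uniform:
  fixes u :: "real \<Rightarrow> 'a::metric_space \<Rightarrow> real"
  assumes fam: "bounded_family u X M" and cont: "continuous_on X v"
    and up: "\<And>q. q \<in> X \<Longrightarrow> relaxed_sup u X q = v q" and lo: "\<And>q. q \<in> X \<Longrightarrow> relaxed_sup (\<lambda>\<epsilon> q. - u \<epsilon> q) X q = - v q"
    and C: "compact C" "C \<subseteq> X"
  shows "uniform_limit C u v (at_right 0)"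
proof (rule uniform_limitI)
  fix e :: real assume e: "0 < e"
  interpret U: bounded_family u X M by fact
  interpret L: bounded_family "\<lambda>\<epsilon> q. - u \<epsilon> q" X M by unfold_locales (use U.bdd in auto)
  have "\<exists>r>0. \<forall>\<epsilon> q'. 0 < \<epsilon> \<longrightarrow> \<epsilon> < r \<longrightarrow> q' \<in> X \<longrightarrow> dist q' q < r \<longrightarrow> \<bar>u \<epsilon> q' - v q'\<bar> < e" if q: "q \<in> C" for q
  proof -
    have qX: "q \<in> X" using q C by blast
    obtain r1 where r1: "U.near q r1 (v q + e / 2)" using U.relaxed_sup_less[OF qX, of "v q + e / 2"] up[OF qX] e by auto
    obtain r2 where r2: "L.near q r2 (- v q + e / 2)" using L.relaxed_sup_less[OF qX, of "- v q + e / 2"] lo[OF qX] e by auto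
    have "0 < e / 2" using e by simp
    then obtain r3 where r3: "0 < r3" "\<And>q'. q' \<in> X \<Longrightarrow> dist q' q < r3 \<Longrightarrow> dist (v q') (v q) < e / 2"
      using cont qX unfolding continuous_on_iff by blast
    have "\<bar>u \<epsilon> q' - v q'\<bar> < e" if a: "0 < \<epsilon>" "\<epsilon> < min r1 (min r2 r3)" "q' \<in> X" "dist q' q < min r1 (min r2 r3)" for \<epsilon> q'
    proof -
      have "u \<epsilon> q' < v q + e / 2" using r1 a unfolding U.near_def by auto
      moreover have "- u \<epsilon> q' < - v q + e / 2" using r2 a unfolding L.near_def by auto
      moreover have "\<bar>v q' - v q\<bar> < e / 2" using r3(2)[of q'] a by (simp add: dist_real_def)
      ultimately show ?thesis by linarith
    qed
    moreover have "0 < min r1 (min r2 r3)" using r1 r2 r3(1) unfolding U.near_def L.near_def by auto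
    ultimately show ?thesis by blast
  qed
  then have "\<forall>q\<in>C. \<exists>r. 0 < r \<and> (\<forall>\<epsilon> q'. 0 < \<epsilon> \<longrightarrow> \<epsilon> < r \<longrightarrow> q' \<in> X \<longrightarrow> dist q' q < r \<longrightarrow> \<bar>u \<epsilon> q' - v q'\<bar> < e)" by blast
  from bchoice[OF this] obtain r where r: "\<forall>q\<in>C. 0 < r q \<and> (\<forall>\<epsilon> q'. 0 < \<epsilon> \<longrightarrow> \<epsilon> < r q \<longrightarrow> q' \<in> X \<longrightarrow> dist q' q < r q \<longrightarrow> \<bar>u \<epsilon> q' - v q'\<bar> < e)" ..
  obtain D where D: "D \<subseteq> C" "finite D" "C \<subseteq> (\<Union>q\<in>D. ball q (r q))"
    by (rule compactE_image[OF C(1), of C "\<lambda>q. ball q (r q)"]) (use r in auto)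
  have "\<forall>\<^sub>F \<epsilon> in at_right 0. \<forall>q\<in>D. \<epsilon> < r q"
    using D r by (intro eventually_ball_finite) (auto intro!: order_tendstoD(2)[OF tendsto_ident_at])
  moreover have "\<forall>\<^sub>F \<epsilon> in at_right 0. 0 < (\<epsilon>::real)" by (rule eventually_at_right_less)
  ultimately show "\<forall>\<^sub>F \<epsilon> in at_right 0. \<forall>q\<in>C. dist (u \<epsilon> q) (v q) < e"
  proof eventually_elim
    case (elim \<epsilon>)
    show ?case
    proof
      fix q' assume "q' \<in> C"
      then obtain q where q: "q \<in> D" "dist q' q < r q" using D(3) by (auto simp: dist_commute)
      then have "\<bar>u \<epsilon> q' - v q'\<bar> < e" using r elim D(1) C(2) \<open>q' \<in> C\<close> by blast
      then show "dist (u \<epsilon> q') (v q') < e" by (simp add: dist_real_def)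
    qed
  qed
qed

section \<open>Continuity and growth of the Hamiltonian\<close>

definition hamiltonian_modulus :: "(real ^ 'n \<Rightarrow> real ^ 'n \<Rightarrow> real ^ 'n \<Rightarrow> real) \<Rightarrow> real \<Rightarrow> bool" where
  "hamiltonian_modulus H m \<longleftrightarrow> (\<forall>\<theta>>0. \<exists>r>0. \<forall>x x' y y' p p' R. 1 \<le> R \<longrightarrow> norm p \<le> R \<longrightarrow> norm p' \<le> R \<longrightarrow>
     norm (x - x') < r \<longrightarrow> norm (y - y') < r \<longrightarrow> norm (p - p') < r \<longrightarrow> \<bar>H x y p - H x' y' p'\<bar> \<le> \<theta> * R powr m)"

lemma modulus_small:
  assumes "modulus_of_continuity \<omega>" "0 < \<theta>"
  shows "\<exists>r>0. \<forall>t. 0 \<le> t \<longrightarrow> t < r \<longrightarrow> \<omega> t < \<theta>"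
proof -
  have "(\<omega> \<longlongrightarrow> 0) (at_right 0)" "\<omega> 0 = 0" using assms(1) by (auto simp: modulus_of_continuity_def)
  from order_tendstoD(2)[OF this(1) assms(2)] obtain r where "0 < r" "\<And>t. 0 < t \<Longrightarrow> t < r \<Longrightarrow> \<omega> t < \<theta>"
    unfolding eventually_at_right_field by auto
  then show ?thesis using \<open>\<omega> 0 = 0\<close> assms(2) by (intro exI[of _ r]) (auto simp: order_le_less)
qed

text \<open>For R \<ge> 1 both 1 + R^m and 1 + R^(m-1) are at most 2 R^m, so \<omega> below \<theta>
  / 4 makes each of the two terms at most half of \<theta> R^m.\<close>

lemma hamiltonian_modulus_of_growth:
  assumes \<omega>: "modulus_of_continuity \<omega>" and m: "1 < m"
    and H: "\<And>R x x' y y' p p'. 0 < R \<Longrightarrow> norm p \<le> R \<Longrightarrow> norm p' \<le> R \<Longrightarrow>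
           \<bar>H x y p - H x' y' p'\<bar> \<le> \<omega> (norm (x - x') + norm (y - y')) * (1 + R powr m) + \<omega> (norm (p - p')) * (1 + R powr (m - 1))"
  shows "hamiltonian_modulus H m"
  unfolding hamiltonian_modulus_def
proof (intro allI impI)
  fix \<theta> :: real assume "0 < \<theta>"
  then have "0 < \<theta> / 4" by simp
  from modulus_small[OF \<omega> this] obtain r where r: "0 < r" "\<And>t. 0 \<le> t \<Longrightarrow> t < r \<Longrightarrow> \<omega> t < \<theta> / 4" by blast
  have "\<bar>H x y p - H x' y' p'\<bar> \<le> \<theta> * R powr m"
    if R: "1 \<le> R" "norm p \<le> R" "norm p' \<le> R" "norm (x - x') < r / 2" "norm (y - y') < r / 2" "norm (p - p') < r / 2" for x x' y y' p p' R
  proof -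
    have R1: "1 \<le> R powr m" using R m ge_one_powr_ge_zero[of R m] by simp
    have R2: "R powr (m - 1) \<le> R powr m" using R by (intro powr_mono) auto
    have "\<omega> (norm (x - x') + norm (y - y')) * (1 + R powr m) \<le> \<theta> / 4 * (2 * R powr m)"
      using R R1 \<open>0 < \<theta> / 4\<close> by (intro mult_mono less_imp_le[OF r(2)]) auto
    moreover have "\<omega> (norm (p - p')) * (1 + R powr (m - 1)) \<le> \<theta> / 4 * (2 * R powr m)"
      using R R1 R2 r(1) \<open>0 < \<theta> / 4\<close> by (intro mult_mono less_imp_le[OF r(2)]) auto
    ultimately show ?thesis using H[of R p p' x y x' y'] R by simp
  qed
  then show "\<exists>r>0. \<forall>x x' y y' p p' R. 1 \<le> R \<longrightarrow> norm p \<le> R \<longrightarrow> norm p' \<le> R \<longrightarrow>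
     norm (x - x') < r \<longrightarrow> norm (y - y') < r \<longrightarrow> norm (p - p') < r \<longrightarrow> \<bar>H x y p - H x' y' p'\<bar> \<le> \<theta> * R powr m"
    using r(1) by (intro exI[of _ "r / 2"]) auto
qed

text \<open>The modulus \<open>\<omega>\<close> need not be bounded, so the growth bound is obtained by chaining increments of
  length at most one.\<close>

lemma hamiltonian_growth:
  assumes \<omega>: "modulus_of_continuity \<omega>" and m: "1 < m"
    and H: "\<And>R x x' y y' p p'. 0 < R \<Longrightarrow> norm p \<le> R \<Longrightarrow> norm p' \<le> R \<Longrightarrow>
           \<bar>H x y p - H x' y' p'\<bar> \<le> \<omega> (norm (x - x') + norm (y - y')) * (1 + R powr m) + \<omega> (norm (p - p')) * (1 + R powr (m - 1))"
    and H0: "\<And>x y. \<bar>H x y 0\<bar> \<le> B"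
  shows "\<exists>CH\<ge>0. \<forall>x y p R. 1 \<le> R \<longrightarrow> norm p \<le> R \<longrightarrow> \<bar>H x y (p :: real ^ 'n)\<bar> \<le> CH * R powr m"
proof -
  have \<omega>p: "0 \<le> \<omega> t" if "0 \<le> t" for t using \<omega> that by (simp add: modulus_of_continuity_def)
  have \<omega>0: "\<omega> 0 = 0" using \<omega> by (simp add: modulus_of_continuity_def)
  have B: "0 \<le> B" using H0[of 0 0] by linarith
  have "\<bar>H x y p\<bar> \<le> (B + 4 * \<omega> 1) * R powr m" if R: "1 \<le> R" "norm p \<le> R" for x y and p :: "real^'n" and R
  proof -
    \<comment> \<open>The segment from 0 to p is cut into n pieces of length at most 1, with n at
      most 2 R. Each piece costs \<omega>(1) (1 + R^(m-1)), so the total is of order R^m.\<close>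
    define n where "n = nat \<lceil>R\<rceil>"
    have n: "R \<le> real n" "real n \<le> 2 * R" using R by (auto simp: n_def) linarith+
    have n0: "0 < real n" using n R by linarith
    define D where "D = \<omega> 1 * (1 + R powr (m - 1))"
    define q where "q j = (real j / real n) *\<^sub>R p" for j
    have qR: "norm (q j) \<le> R" if "j \<le> n" for j
    proof -
      have "real j / real n \<le> 1" using that n0 by simp
      then have "real j / real n * norm p \<le> 1 * R" using R n0 by (intro mult_mono) auto
      then show ?thesis by (simp add: q_def)
    qed
    have st: "\<bar>H x y (q (Suc j)) - H x y (q j)\<bar> \<le> D" if "Suc j \<le> n" for j
    proof -
      have "q (Suc j) - q j = (1 / real n) *\<^sub>R p"
        unfolding q_def scaleR_left_diff_distrib[symmetric] by (simp add: diff_divide_distrib[symmetric])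
      then have "norm (q (Suc j) - q j) = norm p / real n" using n0 by simp
      then have le1: "norm (q (Suc j) - q j) \<le> 1" using R n n0 by (simp add: divide_le_eq)
      have "mono_on {0..} \<omega>" using \<omega> by (simp add: modulus_of_continuity_def)
      then have "\<omega> (norm (q (Suc j) - q j)) \<le> \<omega> 1" using le1 by (intro mono_onD[where f=\<omega> and A="{0..}"]) auto
      then have "\<omega> (norm (q (Suc j) - q j)) * (1 + R powr (m - 1)) \<le> D"
        unfolding D_def by (intro mult_right_mono) (auto intro: add_nonneg_nonneg)
      then show ?thesis using H[of R "q (Suc j)" "q j" x y x y] qR[OF that] qR[of j] that R \<omega>0 by simp
    qed
    have "\<bar>H x y (q j) - H x y 0\<bar> \<le> real j * D" if "j \<le> n" for j
      using that
    proof (induction j)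
      case (Suc j)
      have "\<bar>H x y (q j) - H x y 0\<bar> \<le> real j * D" "\<bar>H x y (q (Suc j)) - H x y (q j)\<bar> \<le> D"
        using Suc st by auto
      then show ?case by (simp add: algebra_simps)
    qed (simp add: q_def)
    from this[of n] have 1: "\<bar>H x y p - H x y 0\<bar> \<le> real n * D" using n0 by (simp add: q_def)
    have R1: "1 \<le> R powr (m - 1)" using R m ge_one_powr_ge_zero[of R "m - 1"] by simp
    have Rm: "R * R powr (m - 1) = R powr m" using R powr_add[of R 1 "m - 1"] by simp
    have "real n * D \<le> (2 * R) * (\<omega> 1 * (2 * R powr (m - 1)))"
      unfolding D_def using n R1 R \<omega>p[of 1] by (intro mult_mono mult_left_mono) auto
    also have "\<dots> = 4 * \<omega> 1 * (R * R powr (m - 1))" by simp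
    finally have 2: "real n * D \<le> 4 * \<omega> 1 * R powr m" unfolding Rm .
    have "1 \<le> R powr m" using R m ge_one_powr_ge_zero[of R m] by simp
    then have "B * 1 \<le> B * R powr m" using B by (intro mult_left_mono)
    then show ?thesis using 1 2 H0[of x y] by (simp add: algebra_simps)
  qed
  then show ?thesis using B \<omega>p[of 1] by (intro exI[of _ "B + 4 * \<omega> 1"]) auto
qed

lemma torus_integral_dist:
  fixes f g :: "real ^ 'n \<Rightarrow> real"
  assumes "continuous_on UNIV f" "continuous_on UNIV g" "\<And>y. \<bar>f y - g y\<bar> \<le> c"
  shows "\<bar>torus_integral f - torus_integral g\<bar> \<le> c"
proof -
  have "torus_integral f \<le> torus_integral g + c" if "continuous_on UNIV f" "continuous_on UNIV g" "\<And>y. \<bar>f y - g y\<bar> \<le> c"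
    for f g :: "real ^ 'n \<Rightarrow> real"
  proof -
    have "torus_integral f \<le> torus_integral (\<lambda>y. g y + c)"
    proof (rule torus_integral_mono[OF that(1)])
      show "continuous_on UNIV (\<lambda>y. g y + c)" by (intro continuous_intros that)
      show "f y \<le> g y + c" for y using that(3)[of y] by linarith
    qed
    then show ?thesis by (subst (asm) torus_integral_add[OF that(2)]) (auto simp: torus_integral_const)
  qed
  from this[OF assms] this[OF assms(2,1)] assms(3) show ?thesis by (force simp: abs_le_iff abs_minus_commute)
qed

definition reflect_H :: "(real ^ 'n \<Rightarrow> real ^ 'n \<Rightarrow> real ^ 'n \<Rightarrow> real) \<Rightarrow> real ^ 'n \<Rightarrow> real ^ 'n \<Rightarrow> real ^ 'n \<Rightarrow> real" where
  "reflect_H H x y p = - H x y (- p)"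

section \<open>Regularity and coercivity of the effective coefficients\<close>

context cell_data
begin

definition eff_b :: "real ^ 'n \<Rightarrow> real" where "eff_b x = torus_integral (\<lambda>y. 1 / a x y)"

definition eff_g :: "real ^ 'n \<Rightarrow> real ^ 'n \<Rightarrow> real" where "eff_g x p = torus_integral (\<lambda>y. H x y p / a x y)"

lemma eff_H_eq: "eff_H a H x p l = (- l + eff_g x p) / eff_b x"
  by (simp add: eff_H_def eff_coeff_def eff_g_def eff_b_def add_divide_distrib diff_divide_distrib)

lemma eff_b_ge: "a0 \<le> eff_b x"
  unfolding eff_b_def by (rule torus_inv_a)

lemma inv_a_diff: "\<bar>1 / a x y - 1 / a x' y\<bar> \<le> \<bar>a x y - a x' y\<bar> / (a0 * a0)"
proof -
  have "1 / a x y - 1 / a x' y = (a x' y - a x y) / (a x y * a x' y)"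
    using a_pos[of x y] a_pos[of x' y] by (simp add: field_simps)
  then have "\<bar>1 / a x y - 1 / a x' y\<bar> = \<bar>a x y - a x' y\<bar> / (a x y * a x' y)"
    using a_pos[of x y] a_pos[of x' y] by (simp add: abs_mult abs_minus_commute)
  also have "\<dots> \<le> \<bar>a x y - a x' y\<bar> / (a0 * a0)"
    using a[of x y] a[of x' y] a0 by (intro divide_left_mono mult_mono mult_pos_pos a_pos) auto
  finally show ?thesis .
qed

lemma eff_b_uniformly_continuous:
  assumes uc: "\<And>e. 0 < e \<Longrightarrow> \<exists>r>0. \<forall>x x' y. norm (x - x') < r \<longrightarrow> \<bar>a x y - a x' y\<bar> < e"
  shows "uniformly_continuous_on UNIV eff_b"
  unfolding uniformly_continuous_on_def
proof (intro allI impI)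
  fix e :: real assume e: "0 < e"
  then have "0 < e / 2 * (a0 * a0)" using a0 by simp
  from uc[OF this] obtain r where r: "0 < r" "\<And>x x' y. norm (x - x') < r \<Longrightarrow> \<bar>a x y - a x' y\<bar> < e / 2 * (a0 * a0)" by blast
  have "dist (eff_b x') (eff_b x) < e" if "dist x' x < r" for x x'
  proof -
    have "\<bar>eff_b x' - eff_b x\<bar> \<le> e / 2"
      unfolding eff_b_def
    proof (rule torus_integral_dist[OF inv_a_cont inv_a_cont])
      fix y
      have "\<bar>a x' y - a x y\<bar> / (a0 * a0) \<le> e / 2"
        using r(2)[of x' x y] that a0 by (simp add: dist_norm pos_divide_le_eq less_imp_le)
      then show "\<bar>1 / a x' y - 1 / a x y\<bar> \<le> e / 2" using inv_a_diff[of x' y x] by linarith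
    qed
    then show ?thesis using e by (simp add: dist_real_def)
  qed
  then show "\<exists>d>0. \<forall>x\<in>UNIV. \<forall>x'\<in>UNIV. dist x' x < d \<longrightarrow> dist (eff_b x') (eff_b x) < e" using r(1) by blast
qed

text \<open>The difference of H / a is split as for a product. The variation of 1 / a multiplies H
  itself, and the growth bound CH R^m keeps that term small relative to R^m.\<close>

lemma eff_g_modulus:
  assumes uc: "\<And>e. 0 < e \<Longrightarrow> \<exists>r>0. \<forall>x x' y. norm (x - x') < r \<longrightarrow> \<bar>a x y - a x' y\<bar> < e"
    and Hm: "hamiltonian_modulus H m" and CH: "0 \<le> CH" "\<And>x y p R. 1 \<le> R \<Longrightarrow> norm p \<le> R \<Longrightarrow> \<bar>H x y p\<bar> \<le> CH * R powr m"
  shows "modulus_growth eff_g m"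
  unfolding modulus_growth_def
proof (intro allI impI)
  fix \<theta> :: real assume \<theta>: "0 < \<theta>"
  \<comment> \<open>Chosen so that CH times k / a0^2, the variation of 1 / a, is at most \<theta> /
    2; the 1 in CH + 1 covers CH = 0.\<close>
  define k where "k = \<theta> / 2 / (CH + 1) * (a0 * a0)"
  have k: "0 < k" using \<theta> CH(1) a0 by (simp add: k_def add_nonneg_pos)
  have "0 < \<theta> / 2 * a0" using \<theta> a0 by simp
  then obtain r1 where r1: "0 < r1" "\<And>x x' y y' p p' R. 1 \<le> R \<Longrightarrow> norm p \<le> R \<Longrightarrow> norm p' \<le> R \<Longrightarrow>
     norm (x - x') < r1 \<Longrightarrow> norm (y - y') < r1 \<Longrightarrow> norm (p - p') < r1 \<Longrightarrow> \<bar>H x y p - H x' y' p'\<bar> \<le> \<theta> / 2 * a0 * R powr m"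
    using Hm unfolding hamiltonian_modulus_def by blast
  obtain r2 where r2: "0 < r2" "\<And>x x' y. norm (x - x') < r2 \<Longrightarrow> \<bar>a x y - a x' y\<bar> < k" using uc[OF k] by blast
  have "\<bar>eff_g x p - eff_g x' p'\<bar> \<le> \<theta> * R powr m"
    if R: "1 \<le> R" "norm p \<le> R" "norm p' \<le> R" "norm (x - x') < min r1 r2" "norm (p - p') < min r1 r2" for x x' p p' R
    unfolding eff_g_def
  proof (rule torus_integral_dist[OF H_a_cont H_a_cont])
    fix y
    have "H x y p / a x y - H x' y p' / a x' y = (H x y p - H x' y p') * (1 / a x y) + H x' y p' * (1 / a x y - 1 / a x' y)"
      by (simp add: algebra_simps diff_divide_distrib)
    also have "\<bar>\<dots>\<bar> \<le> \<bar>H x y p - H x' y p'\<bar> * \<bar>1 / a x y\<bar> + \<bar>H x' y p'\<bar> * \<bar>1 / a x y - 1 / a x' y\<bar>"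
      unfolding abs_mult[symmetric] by (rule abs_triangle_ineq)
    also have "\<dots> \<le> (\<theta> / 2 * a0 * R powr m) * (1 / a0) + (CH * R powr m) * (k / (a0 * a0))"
    proof (intro add_mono mult_mono)
      show "\<bar>H x y p - H x' y p'\<bar> \<le> \<theta> / 2 * a0 * R powr m" using R r1(1) by (intro r1(2)) auto
      show "\<bar>1 / a x y\<bar> \<le> 1 / a0" using inv_a_bounds[of x y] a_pos[of x y] by simp
      show "\<bar>H x' y p'\<bar> \<le> CH * R powr m" using R by (intro CH(2)) auto
      have "\<bar>a x y - a x' y\<bar> / (a0 * a0) \<le> k / (a0 * a0)"
        using r2(2)[of x x' y] R a0 by (intro divide_right_mono) auto
      then show "\<bar>1 / a x y - 1 / a x' y\<bar> \<le> k / (a0 * a0)" using inv_a_diff[of x y x'] by linarith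
    qed (use \<theta> a0 CH(1) in auto)
    also have "(\<theta> / 2 * a0 * R powr m) * (1 / a0) = \<theta> / 2 * R powr m" using a0 by simp
    also have "(CH * R powr m) * (k / (a0 * a0)) = (CH / (CH + 1)) * (\<theta> / 2 * R powr m)" using a0 by (simp add: k_def mult.commute mult.left_commute)
    also have "\<dots> \<le> 1 * (\<theta> / 2 * R powr m)" using CH(1) \<theta> by (intro mult_right_mono) auto
    finally show "\<bar>H x y p / a x y - H x' y p' / a x' y\<bar> \<le> \<theta> * R powr m" by simp
  qed
  then show "\<exists>r>0. \<forall>x x' p p' R. 1 \<le> R \<longrightarrow> norm p \<le> R \<longrightarrow> norm p' \<le> R \<longrightarrow>
     norm (x - x') < r \<longrightarrow> norm (p - p') < r \<longrightarrow> \<bar>eff_g x p - eff_g x' p'\<bar> \<le> \<theta> * R powr m"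
    using r1(1) r2(1) by (intro exI[of _ "min r1 r2"]) auto
qed

text \<open>Condition (3) is averaged against 1 / a. The gain is weighted by the lower bound a0 of 1
  / a and the loss by its upper bound 1 / a0, which gives the constants b0 a0 and C0 / a0.\<close>

lemma eff_g_coercive:
  assumes b0: "0 < b0" and C0: "0 < C0"
    and H: "\<And>\<mu> x y p. 0 < \<mu> \<Longrightarrow> \<mu> < 1 \<Longrightarrow> \<mu> * H x y (inverse \<mu> *\<^sub>R p) - H x y p \<ge> (1 - \<mu>) * (b0 * norm p powr m - C0)"
  shows "coercive_growth eff_g m (b0 * a0) (C0 / a0)"
  unfolding coercive_growth_def
proof (intro allI impI)
  fix \<mu> :: real and x p :: "real^'n" assume \<mu>: "0 < \<mu> \<and> \<mu> < 1"
  define c where "c = (1 - \<mu>) * (b0 * a0 * norm p powr m - C0 / a0)"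
  have "torus_integral (\<lambda>y. H x y p / a x y + c) \<le> torus_integral (\<lambda>y. \<mu> * (H x y (inverse \<mu> *\<^sub>R p) / a x y))"
  proof (rule torus_integral_mono)
    show "continuous_on UNIV (\<lambda>y. H x y p / a x y + c)" by (intro continuous_on_add H_a_cont continuous_on_const)
    show "continuous_on UNIV (\<lambda>y. \<mu> * (H x y (inverse \<mu> *\<^sub>R p) / a x y))" by (intro continuous_on_mult_left H_a_cont)
    fix y
    have "(1 - \<mu>) * (b0 * norm p powr m - C0) * (1 / a x y) \<le> (\<mu> * H x y (inverse \<mu> *\<^sub>R p) - H x y p) * (1 / a x y)"
      using H[of \<mu> p x y] \<mu> a_pos[of x y] by (intro mult_right_mono) auto
    moreover have "b0 * norm p powr m * a0 \<le> b0 * norm p powr m * (1 / a x y)"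
      using inv_a_bounds(1) b0 by (intro mult_left_mono) auto
    moreover have "C0 * (1 / a x y) \<le> C0 * (1 / a0)" using inv_a_bounds(2) C0 by (intro mult_left_mono) auto
    ultimately have "c \<le> (\<mu> * H x y (inverse \<mu> *\<^sub>R p) - H x y p) * (1 / a x y)"
    proof -
      assume 1: "(1 - \<mu>) * (b0 * norm p powr m - C0) * (1 / a x y) \<le> (\<mu> * H x y (inverse \<mu> *\<^sub>R p) - H x y p) * (1 / a x y)"
        and 2: "b0 * norm p powr m * a0 \<le> b0 * norm p powr m * (1 / a x y)" and 3: "C0 * (1 / a x y) \<le> C0 * (1 / a0)"
      have "b0 * a0 * norm p powr m - C0 / a0 \<le> (b0 * norm p powr m - C0) * (1 / a x y)"
        using 2 3 by (simp add: algebra_simps diff_divide_distrib)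
      then have "c \<le> (1 - \<mu>) * ((b0 * norm p powr m - C0) * (1 / a x y))" unfolding c_def using \<mu> by (intro mult_left_mono) auto
      then show ?thesis using 1 by (simp add: mult.assoc)
    qed
    then show "H x y p / a x y + c \<le> \<mu> * (H x y (inverse \<mu> *\<^sub>R p) / a x y)" by (simp add: diff_divide_distrib)
  qed
  then show "(1 - \<mu>) * (b0 * a0 * norm p powr m - C0 / a0) \<le> \<mu> * eff_g x (inverse \<mu> *\<^sub>R p) - eff_g x p"
    unfolding torus_integral_cmult torus_integral_add[OF H_a_cont continuous_on_const] torus_integral_const eff_g_def[symmetric] c_def by simp
qed

lemma eff_H_reflect: "eff_H a (reflect_H H) = neg_op (eff_H a H)"
proof -
  have "torus_integral (\<lambda>y. reflect_H H x y p / a x y) = - torus_integral (\<lambda>y. H x y (- p) / a x y)" for x p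
    using torus_integral_cmult[of "-1" "\<lambda>y. H x y (- p) / a x y"] by (simp add: reflect_H_def)
  then show ?thesis by (intro ext) (simp add: eff_H_def neg_op_def)
qed

lemma cell_data_reflect: "cell_data \<sigma> a (reflect_H H) a0"
proof unfold_locales
  show "continuous_on UNIV (\<lambda>y. reflect_H H x y p)" for x p unfolding reflect_H_def by (intro continuous_intros H_cont)
  show "ZN_periodic (\<lambda>y. reflect_H H x y p)" for x p using H_per[of x "- p"] by (simp add: ZN_periodic_def reflect_H_def)
qed (use a0 a a_cont a_per in auto)

end

lemma hamiltonian_local:
  assumes "hamiltonian_modulus H m" "0 < e"
  shows "\<exists>r>0. \<forall>x x' y p p'. norm p \<le> R \<longrightarrow> norm p' \<le> R \<longrightarrow> norm (x - x') < r \<longrightarrow> norm (p - p') < r \<longrightarrow> \<bar>H x y p - H x' y p'\<bar> < e"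
proof -
  define R' where "R' = max R 1"
  have R': "1 \<le> R'" "R \<le> R'" by (auto simp: R'_def)
  have Rp: "0 < R' powr m" using R' by simp
  have "0 < e / 2 / R' powr m" using assms(2) Rp by simp
  then obtain r where r: "0 < r" "\<And>x x' y y' p p' R. 1 \<le> R \<Longrightarrow> norm p \<le> R \<Longrightarrow> norm p' \<le> R \<Longrightarrow>
     norm (x - x') < r \<Longrightarrow> norm (y - y') < r \<Longrightarrow> norm (p - p') < r \<Longrightarrow> \<bar>H x y p - H x' y' p'\<bar> \<le> e / 2 / R' powr m * R powr m"
    using assms(1) unfolding hamiltonian_modulus_def by blast
  have "\<bar>H x y p - H x' y p'\<bar> < e" if "norm p \<le> R" "norm p' \<le> R" "norm (x - x') < r" "norm (p - p') < r" for x x' y p p'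
  proof -
    have "\<bar>H x y p - H x' y p'\<bar> \<le> e / 2 / R' powr m * R' powr m"
      using that R' r(1) by (intro r(2)) auto
    also have "\<dots> = e / 2" using Rp by simp
    finally show ?thesis using assms(2) by simp
  qed
  then show ?thesis using r(1) by blast
qed

lemma hamiltonian_modulus_reflect: "hamiltonian_modulus H m \<Longrightarrow> hamiltonian_modulus (reflect_H H) m"
  unfolding hamiltonian_modulus_def
proof (intro allI impI)
  fix \<theta> :: real
  assume H: "\<forall>\<theta>>0. \<exists>r>0. \<forall>x x' y y' p p' R. 1 \<le> R \<longrightarrow> norm p \<le> R \<longrightarrow> norm p' \<le> R \<longrightarrow>
     norm (x - x') < r \<longrightarrow> norm (y - y') < r \<longrightarrow> norm (p - p') < r \<longrightarrow> \<bar>H x y p - H x' y' p'\<bar> \<le> \<theta> * R powr m" and "0 < \<theta>"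
  then obtain r where r: "0 < r" "\<And>x x' y y' p p' R. 1 \<le> R \<Longrightarrow> norm p \<le> R \<Longrightarrow> norm p' \<le> R \<Longrightarrow>
     norm (x - x') < r \<Longrightarrow> norm (y - y') < r \<Longrightarrow> norm (p - p') < r \<Longrightarrow> \<bar>H x y p - H x' y' p'\<bar> \<le> \<theta> * R powr m"
    by blast
  have "\<bar>reflect_H H x y p - reflect_H H x' y' p'\<bar> \<le> \<theta> * R powr m"
    if "1 \<le> R" "norm p \<le> R" "norm p' \<le> R" "norm (x - x') < r" "norm (y - y') < r" "norm (p - p') < r" for x x' y y' p p' R
    using r(2)[of R "-p" "-p'" x x' y y'] that by (simp add: reflect_H_def abs_minus_commute norm_minus_commute)
  then show "\<exists>r>0. \<forall>x x' y y' p p' R. 1 \<le> R \<longrightarrow> norm p \<le> R \<longrightarrow> norm p' \<le> R \<longrightarrow>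
     norm (x - x') < r \<longrightarrow> norm (y - y') < r \<longrightarrow> norm (p - p') < r \<longrightarrow> \<bar>reflect_H H x y p - reflect_H H x' y' p'\<bar> \<le> \<theta> * R powr m"
    using r(1) by blast
qed

section \<open>Identification of the relaxed limits and convergence\<close>

theorem theorem7p2:
  fixes T \<sigma> a0 b0 C0 m :: real
    and a :: "real ^ 'n \<Rightarrow> real ^ 'n \<Rightarrow> real"
    and H :: "real ^ 'n \<Rightarrow> real ^ 'n \<Rightarrow> real ^ 'n \<Rightarrow> real"
    and K :: "real ^ 'n \<Rightarrow> real"
    and \<omega> :: "real \<Rightarrow> real"
    and u0 :: "real ^ 'n \<Rightarrow> real"
    and u_eps :: "real \<Rightarrow> (real ^ 'n) \<times> real \<Rightarrow> real"
  assumes "0 < T" and "1 < \<sigma>" "\<sigma> < 2"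
    and "uniformly_continuous_on UNIV (\<lambda>(x, y). a x y)"
    and "continuous_on UNIV (\<lambda>(x, y, p). H x y p)"
    and "\<And>z. 0 \<le> K z" and "K \<in> borel_measurable lebesgue"
    \<comment> \<open>(1)\<close>
    and "0 < a0" and "\<And>x y. a0 \<le> a x y \<and> a x y \<le> 1 / a0"
    and "bounded (range (kbar \<sigma> K))"
    and "(kbar \<sigma> K \<longlongrightarrow> frac_const TYPE('n) \<sigma>) (at 0)" and "0 < frac_const TYPE('n) \<sigma>"
    \<comment> \<open>(2)\<close>
    and "bounded (range (\<lambda>(x, y). H x y 0))" and "bounded (range (\<lambda>(x, y). a x y))"
    and "\<And>x. ZN_periodic (a x)" and "\<And>x p. ZN_periodic (\<lambda>y. H x y p)"
    \<comment> \<open>(3)\<close>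
    and "0 < b0" and "0 < C0" and "1 < m"
    and "\<And>\<mu> x y p. 0 < \<mu> \<Longrightarrow> \<mu> < 1 \<Longrightarrow>
           \<mu> * H x y (inverse \<mu> *\<^sub>R p) - H x y p \<ge> (1 - \<mu>) * (b0 * norm p powr m - C0)"
    \<comment> \<open>(4)\<close>
    and "modulus_of_continuity \<omega>"
    and "\<And>R x x' y y' p p'. 0 < R \<Longrightarrow> norm p \<le> R \<Longrightarrow> norm p' \<le> R \<Longrightarrow>
           \<bar>H x y p - H x' y' p'\<bar> \<le>
             \<omega> (norm (x - x') + norm (y - y')) * (1 + R powr m)
             + \<omega> (norm (p - p')) * (1 + R powr (m - 1))"
    and "bounded (range u0)" and "uniformly_continuous_on UNIV u0"
    and "\<And>\<epsilon>. 0 < \<epsilon> \<Longrightarrow>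
           cauchy_visc_sol T K
             (\<lambda>x p l. - a x (inverse \<epsilon> *\<^sub>R x) * l + H x (inverse \<epsilon> *\<^sub>R x) p) u0 (u_eps \<epsilon>)"
  shows "(\<forall>x p l c. cell_solvable \<sigma> a H x p l c \<longleftrightarrow> c = eff_H a H x p l) \<and>
    (\<exists>u. cauchy_visc_sol T K (eff_H a H) u0 u \<and>
         (\<forall>v. cauchy_visc_sol T K (eff_H a H) u0 v \<longrightarrow> (\<forall>q\<in>QT_bar T. v q = u q)) \<and>
         (\<forall>C. compact C \<and> C \<subseteq> QT_bar T \<longrightarrow> uniform_limit C u_eps u (at_right 0)))"
proof -
  note T = assms(1) and \<sigma> = assms(2,3) and fc = assms(12)
  interpret lk: levy_kernel K by (rule levy_kernel_kbar[OF \<sigma> assms(6,7,10)])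
  have a_uc: "\<exists>r>0. \<forall>x x' y. norm (x - x') < r \<longrightarrow> \<bar>a x y - a x' y\<bar> < e" if e: "0 < e" for e
  proof -
    obtain r where r: "0 < r" "\<And>z z'. dist z' z < r \<Longrightarrow> dist ((\<lambda>(x, y). a x y) z') ((\<lambda>(x, y). a x y) z) < e"
      using assms(4) e unfolding uniformly_continuous_on_def by blast
    have "\<bar>a x y - a x' y\<bar> < e" if "norm (x - x') < r" for x x' y
      using r(2)[of "(x, y)" "(x', y)"] that by (simp add: dist_Pair_Pair dist_norm)
    then show ?thesis using r(1) by blast
  qed
  have ac: "continuous_on UNIV (\<lambda>(x, y). a x y)" by (rule uniformly_continuous_imp_continuous[OF assms(4)])
  interpret cd: cell_data \<sigma> a H a0
  proof unfold_locales
    show "1 < \<sigma>" "\<sigma> < 2" "0 < frac_const TYPE('n) \<sigma>" "0 < a0" using assms(2,3,12,8) by auto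
    show "a0 \<le> a x y \<and> a x y \<le> 1 / a0" for x y by (rule assms(9))
    show "continuous_on UNIV (a x)" for x
      using continuous_on_compose2[OF ac, of UNIV "\<lambda>y. (x, y)"] by (simp add: continuous_on_Pair)
    show "continuous_on UNIV (\<lambda>y. H x y p)" for x p
      using continuous_on_compose2[OF assms(5), of UNIV "\<lambda>y. (x, y, p)"] by (simp add: continuous_on_Pair)
    show "ZN_periodic (a x)" "ZN_periodic (\<lambda>y. H x y p)" for x p by (rule assms(15,16))+
  qed
  interpret cr: cell_data \<sigma> a "reflect_H H" a0 by (rule cd.cell_data_reflect)
  have Hm: "hamiltonian_modulus H m" by (rule hamiltonian_modulus_of_growth[OF assms(21,19,22)])
  obtain B where B: "\<And>x y. \<bar>H x y 0\<bar> \<le> B" using assms(13) unfolding bounded_iff by auto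
  obtain CH where CH: "0 \<le> CH" "\<And>x y p R. 1 \<le> R \<Longrightarrow> norm p \<le> R \<Longrightarrow> \<bar>H x y p\<bar> \<le> CH * R powr m"
    using hamiltonian_growth[OF assms(21,19,22) B] by blast
  have Hb: "\<exists>C. \<forall>x y p. norm p \<le> R \<longrightarrow> \<bar>H x y p\<bar> \<le> C" for R
  proof (intro exI allI impI)
    fix x y p :: "real^'n" assume "norm p \<le> R"
    then show "\<bar>H x y p\<bar> \<le> CH * (max R 1) powr m" by (intro CH(2)) auto
  qed
  have Hb': "\<exists>C. \<forall>x y p. norm p \<le> R \<longrightarrow> \<bar>reflect_H H x y p\<bar> \<le> C" for R
  proof -
    obtain C where C: "\<And>x y p. norm p \<le> R \<Longrightarrow> \<bar>H x y p\<bar> \<le> C" using Hb by blast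
    show ?thesis by (intro exI[of _ C] allI impI) (simp add: reflect_H_def C)
  qed
  have aA: "0 \<le> a x y \<and> a x y \<le> 1 / a0" for x y using assms(9)[of x y] cd.a_pos[of x y] by simp
  define Fe where "Fe \<epsilon> x p l = - a x (inverse \<epsilon> *\<^sub>R x) * l + H x (inverse \<epsilon> *\<^sub>R x) p" for \<epsilon> x p l
  have sol: "cauchy_visc_sol T K (Fe \<epsilon>) u0 (u_eps \<epsilon>)" if "0 < \<epsilon>" for \<epsilon>
    unfolding Fe_def[abs_def] by (rule assms(25)[OF that])
  define w where "w = (\<lambda>\<epsilon> q. - u_eps \<epsilon> q)"
  have usub: "visc_subsol T K (\<lambda>x p l. - a x (inverse \<epsilon> *\<^sub>R x) * l + H x (inverse \<epsilon> *\<^sub>R x) p) (u_eps \<epsilon>)" if "0 < \<epsilon>" for \<epsilon>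
    using sol[OF that] unfolding cauchy_visc_sol_def Fe_def by blast
  have wsub: "visc_subsol T K (\<lambda>x p l. - a x (inverse \<epsilon> *\<^sub>R x) * l + reflect_H H x (inverse \<epsilon> *\<^sub>R x) p) (w \<epsilon>)" if "0 < \<epsilon>" for \<epsilon>
  proof -
    have "visc_supersol T K (Fe \<epsilon>) (u_eps \<epsilon>)" using sol[OF that] unfolding cauchy_visc_sol_def by blast
    from visc_subsol_uminus[OF lk.levy_kernel_axioms this] have "visc_subsol T K (neg_op (Fe \<epsilon>)) (w \<epsilon>)" by (simp add: w_def)
    moreover have "neg_op (Fe \<epsilon>) = (\<lambda>x p l. - a x (inverse \<epsilon> *\<^sub>R x) * l + reflect_H H x (inverse \<epsilon> *\<^sub>R x) p)"
      by (intro ext) (simp add: neg_op_def Fe_def reflect_H_def)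
    ultimately show ?thesis by simp
  qed
  have ucont: "continuous_on (QT_bar T) (u_eps \<epsilon>)" "continuous_on (QT_bar T) (w \<epsilon>)" if "0 < \<epsilon>" for \<epsilon>
    using sol[OF that] unfolding cauchy_visc_sol_def w_def by (auto intro: continuous_on_minus)
  have ubdd: "bounded (u_eps \<epsilon> ` QT_bar T)" "bounded (w \<epsilon> ` QT_bar T)" if "0 < \<epsilon>" for \<epsilon>
    using sol[OF that] unfolding cauchy_visc_sol_def w_def bounded_iff by auto
  have uinit: "u_eps \<epsilon> (x, 0) = u0 x" "w \<epsilon> (x, 0) = - u0 x" if "0 < \<epsilon>" for \<epsilon> x
    using sol[OF that] unfolding cauchy_visc_sol_def w_def by auto
  have ubar: "\<exists>C\<ge>0. \<forall>\<epsilon> x t. 0 < \<epsilon> \<longrightarrow> 0 \<le> t \<longrightarrow> t \<le> T \<longrightarrow> u_eps \<epsilon> (x, t) \<le> \<psi> x + C * t"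
    if "nice \<psi> P L" "\<And>x. u0 x \<le> \<psi> x" for \<psi> P L
    by (rule lk.eps_barrier[OF T aA Hb usub ucont(1) ubdd(1) uinit(1) that])
  have wbar: "\<exists>C\<ge>0. \<forall>\<epsilon> x t. 0 < \<epsilon> \<longrightarrow> 0 \<le> t \<longrightarrow> t \<le> T \<longrightarrow> w \<epsilon> (x, t) \<le> \<psi> x + C * t"
    if "nice \<psi> P L" "\<And>x. - u0 x \<le> \<psi> x" for \<psi> P L
    by (rule lk.eps_barrier[OF T aA Hb' wsub ucont(2) ubdd(2) uinit(2) that])
  \<comment> \<open>The constant M0 is a barrier above u0 and above - u0. It yields a bound on the
    family that is uniform in \<epsilon>, which the relaxed limits presuppose.\<close>
  obtain M0 where M0: "\<And>x. \<bar>u0 x\<bar> \<le> M0" using assms(23) unfolding bounded_iff by auto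
  have M0': "u0 x \<le> M0" "- u0 x \<le> M0" for x using M0[of x] by linarith+
  obtain C1 where C1': "0 \<le> C1" "\<forall>\<epsilon> x t. 0 < \<epsilon> \<longrightarrow> 0 \<le> t \<longrightarrow> t \<le> T \<longrightarrow> u_eps \<epsilon> (x, t) \<le> M0 + C1 * t"
    using ubar[OF nice_const M0'(1)] by blast
  obtain C2 where C2': "0 \<le> C2" "\<forall>\<epsilon> x t. 0 < \<epsilon> \<longrightarrow> 0 \<le> t \<longrightarrow> t \<le> T \<longrightarrow> w \<epsilon> (x, t) \<le> M0 + C2 * t"
    using wbar[OF nice_const M0'(2)] by blast
  note C = C1'(1) C2'(1) and C1 = C1'(2)[rule_format] and C2 = C2'(2)[rule_format]
  define M where "M = M0 + (C1 + C2) * T"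
  have uM: "\<bar>u_eps \<epsilon> q\<bar> \<le> M" if "0 < \<epsilon>" "q \<in> QT_bar T" for \<epsilon> q
  proof -
    obtain x t where q: "q = (x, t)" by force
    have t: "0 \<le> t" "t \<le> T" using that(2) by (auto simp: q QT_bar_def)
    have "C1 * t \<le> (C1 + C2) * T" "C2 * t \<le> (C1 + C2) * T" using C t by (auto intro!: mult_mono)
    then show ?thesis using C1[OF that(1) t, of x] C2[OF that(1) t, of x] by (simp add: q M_def w_def abs_le_iff)
  qed
  have wM: "\<bar>w \<epsilon> q\<bar> \<le> M" if "0 < \<epsilon>" "q \<in> QT_bar T" for \<epsilon> q using uM[OF that] by (simp add: w_def)
  interpret U: bounded_family u_eps "QT_bar T" M by unfold_locales (rule uM)
  interpret W: bounded_family w "QT_bar T" M by unfold_locales (rule wM)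
  define ub where "ub = relaxed_sup u_eps (QT_bar T)"
  define lb where "lb = (\<lambda>q. - relaxed_sup w (QT_bar T) q)"
  have ubsub: "visc_subsol T K (eff_H a H) ub"
    unfolding ub_def
    by (rule lk.homogenised_subsolution[OF T \<sigma> assms(11) fc aA a_uc hamiltonian_local[OF Hm] cd.cell_corrector usub ucont(1) uM])
  have "visc_subsol T K (eff_H a (reflect_H H)) (relaxed_sup w (QT_bar T))"
    by (rule lk.homogenised_subsolution[OF T \<sigma> assms(11) fc aA a_uc hamiltonian_local[OF hamiltonian_modulus_reflect[OF Hm]]
          cr.cell_corrector wsub ucont(2) wM])
  from visc_supersol_uminus[OF lk.levy_kernel_axioms this]
  have lbsup: "visc_supersol T K (eff_H a H) lb" by (simp add: cd.eff_H_reflect lb_def)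
  have ubusc: "usc_on (QT_bar T) ub" unfolding ub_def by (rule U.relaxed_sup_usc)
  have lblsc: "lsc_on (QT_bar T) lb" unfolding lb_def lsc_on_iff_usc_on using W.relaxed_sup_usc by simp
  have ubM: "\<bar>ub q\<bar> \<le> M" and lbM: "\<bar>lb q\<bar> \<le> M" if "q \<in> QT_bar T" for q
    unfolding ub_def lb_def using U.relaxed_sup_bounds[OF that] W.relaxed_sup_bounds[OF that] by auto
  have uc0: "uniformly_continuous_on UNIV (\<lambda>x. - u0 x)" "bounded (range (\<lambda>x. - u0 x))"
    using uniformly_continuous_on_minus[OF assms(24)] assms(23) unfolding bounded_iff by auto
  have ub0: "ub (x, 0) \<le> u0 x" for x
    unfolding ub_def by (rule relaxed_initial[OF T U.bounded_family_axioms assms(23,24) ubar])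
  have "relaxed_sup w (QT_bar T) (x, 0) \<le> - u0 x" for x
    by (rule relaxed_initial[OF T W.bounded_family_axioms uc0(2,1) wbar])
  then have lb0: "u0 x \<le> lb (x, 0)" for x unfolding lb_def by (simp add: le_minus_iff)
  \<comment> \<open>The common bound M' is left free: for uniqueness it has to cover the bound of an
    arbitrary second solution.\<close>
  have comparison: "u q \<le> v q"
    if "visc_subsol T K (eff_H a H) u" "usc_on (QT_bar T) u" "\<And>q. q \<in> QT_bar T \<Longrightarrow> \<bar>u q\<bar> \<le> M'"
      "visc_supersol T K (eff_H a H) v" "lsc_on (QT_bar T) v" "\<And>q. q \<in> QT_bar T \<Longrightarrow> \<bar>v q\<bar> \<le> M'"
      "\<And>x. u (x, 0) \<le> v (x, 0)" "q \<in> QT_bar T" for u v q M'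
  proof -
    obtain x t where q: "q = (x, t)" by force
    have m0: "0 < m" "0 < b0 * a0" using assms(19,17,8) by auto
    show ?thesis
      unfolding q
      by (rule lk.comparison_principle[OF T m0 cd.eff_g_coercive[OF assms(17,18,20)] cd.eff_g_modulus[OF a_uc Hm CH]
            assms(8) cd.eff_b_ge cd.eff_b_uniformly_continuous[OF a_uc] cd.eff_H_eq that(1-7) that(8)[unfolded q]])
  qed
  have le: "ub q \<le> lb q" if "q \<in> QT_bar T" for q
    by (rule comparison[OF ubsub ubusc ubM lbsup lblsc lbM order_trans[OF ub0 lb0] that])
  \<comment> \<open>Both strict bounds hold at q itself for one small \<epsilon>. Since
    \<open>w\<close> is the negative of \<open>u_eps\<close>, they would put the same value on both
    sides of c.\<close>
  have ge: "lb q \<le> ub q" if q: "q \<in> QT_bar T" for q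
  proof (rule ccontr)
    assume "\<not> ?thesis"
    then have lt: "ub q < lb q" by simp
    define c where "c = (ub q + lb q) / 2"
    have c: "ub q < c" "- lb q < - c" using lt by (auto simp: c_def)
    obtain r1 where r1: "U.near q r1 c" using U.relaxed_sup_less[OF q] c(1) unfolding ub_def by blast
    obtain r2 where r2: "W.near q r2 (- c)" using W.relaxed_sup_less[OF q, of "- c"] c(2) unfolding lb_def by auto
    define r where "r = min r1 r2 / 2"
    have r: "0 < r" "r < r1" "r < r2" using r1 r2 unfolding U.near_def W.near_def by (auto simp: r_def)
    have "u_eps r q < c" using r1 r q unfolding U.near_def by (cases q) auto
    moreover have "w r q < - c" using r2 r q unfolding W.near_def by (cases q) auto
    ultimately show False by (simp add: w_def)
  qed
  have eq: "ub q = lb q" if "q \<in> QT_bar T" for q using le[OF that] ge[OF that] by simp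
  have QQ: "QT T \<subseteq> (QT_bar T :: ((real^'n) \<times> real) set)" by (auto simp: QT_def QT_bar_def)
  \<comment> \<open>Equality on the closed strip makes the upper limit lower semicontinuous as well,
    hence continuous.\<close>
  have ublsc: "lsc_on (QT_bar T) ub"
  proof -
    have "{q \<in> QT_bar T. - ub q < c} = {q \<in> QT_bar T. - lb q < c}" for c using eq by auto
    then show ?thesis using lblsc unfolding lsc_on_iff_usc_on usc_on_iff_openin by simp
  qed
  have ubc: "continuous_on (QT_bar T) ub" by (rule usc_lsc_continuous[OF ubusc ublsc])
  have ubsup: "visc_supersol T K (eff_H a H) ub"
    by (rule visc_supersol_cong[OF _ lbsup]) (use eq QQ in auto)
  have ubin: "ub (x, 0) = u0 x" for x
    using ub0[of x] lb0[of x] eq[of "(x, 0)"] T by (simp add: QT_bar_def)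
  have cs: "cauchy_visc_sol T K (eff_H a H) u0 ub"
    unfolding cauchy_visc_sol_def bounded_iff ball_simps
    by (intro conjI ballI allI exI[of _ M] ubc ubsub ubsup) (simp_all add: ubin ubM)
  have uniq: "v q = ub q" if v: "cauchy_visc_sol T K (eff_H a H) u0 v" and q: "q \<in> QT_bar T" for v q
  proof -
    obtain Mv where Mv: "\<And>q. q \<in> QT_bar T \<Longrightarrow> \<bar>v q\<bar> \<le> Mv" using v unfolding cauchy_visc_sol_def bounded_iff by auto
    have M1: "\<And>q. q \<in> QT_bar T \<Longrightarrow> \<bar>v q\<bar> \<le> max M Mv" "\<And>q. q \<in> QT_bar T \<Longrightarrow> \<bar>ub q\<bar> \<le> max M Mv"
      using Mv ubM by (auto simp: le_max_iff_disj)
    have vs: "visc_subsol T K (eff_H a H) v" "visc_supersol T K (eff_H a H) v" "usc_on (QT_bar T) v" "lsc_on (QT_bar T) v" "\<And>x. v (x, 0) = u0 x"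
      using v unfolding cauchy_visc_sol_def by (auto intro: usc_on_continuous lsc_on_continuous)
    have "v q \<le> ub q" by (rule comparison[OF vs(1,3) M1(1) ubsup ublsc M1(2) _ q]) (simp_all add: vs ubin)
    moreover have "ub q \<le> v q" by (rule comparison[OF ubsub ubusc M1(2) vs(2,4) M1(1) _ q]) (simp_all add: vs ubin)
    ultimately show ?thesis by simp
  qed
  have unif: "uniform_limit C u_eps ub (at_right 0)" if "compact C" "C \<subseteq> QT_bar T" for C
  proof (rule relaxed_limits_uniform[OF U.bounded_family_axioms ubc _ _ that])
    show "relaxed_sup u_eps (QT_bar T) q = ub q" for q by (simp add: ub_def)
    show "relaxed_sup (\<lambda>\<epsilon> q. - u_eps \<epsilon> q) (QT_bar T) q = - ub q" if "q \<in> QT_bar T" for q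
      using eq[OF that] by (simp add: lb_def w_def)
  qed
  show ?thesis using cd.cell_solvable_iff cs uniq unif by blast
qed

end
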